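(* Let $E$ be a row-countable directed graph, i.e., a directed graph in which every vertex emits a countable (possibly finite or zero) number of edges. If the graph $C^*$-algebra $C^*(E)$ has a unique irreducible representation up to unitary equivalence, then there is a (not necessarily separable) Hilbert space $\mathcal{H}$ such that $C^*(E) \cong K(\mathcal{H})$, the $C^*$-algebra of compact operators on $\mathcal{H}$.
   Context: Graphs. A directed graph $E = (E^0, E^1, r, s)$ consists of a set $E^0$ of vertices, a set $E^1$ of edges, and range and source maps $r, s : E^1 \to E^0$. The sets $E^0$, $E^1$ may have arbitrary cardinality; $E^0$ is nonempty. A vertex $v$ is regular if $s^{-1}(v)$ is finite and nonempty. The graph is row-countable if $s^{-1}(v)$ is countable (possibly finite or empty) for every $v \in E^0$. Graph $C^*$-algebra. A Cuntz-Krieger $E$-family is a collection $\{s_e, p_v : e \in E^1, v \in E^0\}$ in a $C^*$-algebra such that the $p_v$ are mutually orthogonal projections and the $s_e$ are partial isometries with mutually orthogonal ranges satisfying: (CK1) $s_e^* s_e = p_{r(e)}$ for all $e \in E^1$; (CK2) $s_e s_e^* \le p_{s(e)}$ for all $e \in E^1$; (CK3) $p_v = \sum_{s(e) = v} s_e s_e^*$ for every regular vertex $v$. $C^*(E)$ is the universal $C^*$-algebra generated by a Cuntz-Krieger $E$-family. Representations. A representation of a $C^*$-algebra $A$ is a $*$-homomorphism $\pi : A \to B(\mathcal{H})$ for a Hilbert space $\mathcal{H}$; it is irreducible if it is nonzero and its only closed invariant subspaces are $\{0\}$ and $\mathcal{H}$. Representations $\pi : A \to B(\mathcal{H}_\pi)$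 and $\rho : A \to B(\mathcal{H}_\rho)$ are unitarily equivalent if there is a unitary $U : \mathcal{H}_\pi \to \mathcal{H}_\rho$ with $\pi(a) = U^* \rho(a) U$ for all $a \in A$. $A$ has a unique irreducible representation up to unitary equivalence if any two irreducible representations of $A$ are unitarily equivalent. *)

theory Defs
  imports "HOL-Analysis.Analysis" "HOL-Algebra.Module" "Graph_Theory.Digraph"
begin

section \<open>Complex vector spaces with a norm\<close>

definition complex_field :: "complex ring" where
  "complex_field =
    \<lparr>carrier = UNIV, monoid.mult = (*), one = 1, ring.zero = 0, add = (+)\<rparr>"

lemma complex_field_simps [simp]:
  "carrier complex_field = UNIV" "x \<otimes>\<^bsub>complex_field\<^esub> y = x * y"
  "x \<oplus>\<^bsub>complex_field\<^esub> y = x + y"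
  "\<one>\<^bsub>complex_field\<^esub> = 1" "\<zero>\<^bsub>complex_field\<^esub> = 0"
  by (simp_all add: complex_field_def)

lemma cring_complex_field: "cring complex_field"
proof (rule cringI)
  show "abelian_group complex_field"
    by (rule abelian_groupI) (auto simp: add_ac intro: exI[of _ "- x" for x] add.left_inverse)
  show "comm_monoid complex_field"
    by (rule comm_monoidI) auto
qed (auto simp: distrib_right)

definition linear_map ::
    "(complex, 'a, 'm) module_scheme \<Rightarrow> (complex, 'b, 'n) module_scheme \<Rightarrow> ('a \<Rightarrow> 'b) \<Rightarrow> bool" where
  "linear_map V W T \<longleftrightarrow>
     T \<in> carrier V \<rightarrow> carrier W \<and>
     (\<forall>x\<in>carrier V. \<forall>y\<in>carrier V. T (x \<oplus>\<^bsub>V\<^esub> y) = T x \<oplus>\<^bsub>W\<^esub> T y) \<and>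
     (\<forall>c. \<forall>x\<in>carrier V. T (c \<odot>\<^bsub>V\<^esub> x) = c \<odot>\<^bsub>W\<^esub> T x)"

text \<open>The locale \<open>Metric_space\<close> wants a distance that is nonnegative and symmetric on the whole
  type, hence the value 0 off the carrier.\<close>

definition norm_dist :: "('a, 'm) ring_scheme \<Rightarrow> ('a \<Rightarrow> real) \<Rightarrow> 'a \<Rightarrow> 'a \<Rightarrow> real" where
  "norm_dist V N x y = (if x \<in> carrier V \<and> y \<in> carrier V then N (x \<ominus>\<^bsub>V\<^esub> y) else 0)"

abbreviation norm_topology :: "('a, 'm) ring_scheme \<Rightarrow> ('a \<Rightarrow> real) \<Rightarrow> 'a topology" where
  "norm_topology V N \<equiv> Metric_space.mtopology (carrier V) (norm_dist V N)"

abbreviation norm_complete :: "('a, 'm) ring_scheme \<Rightarrow> ('a \<Rightarrow> real) \<Rightarrow> bool" where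
  "norm_complete V N \<equiv> Metric_space.mcomplete (carrier V) (norm_dist V N)"

lemma Metric_space_norm_dist:
  assumes M: "module complex_field V"
    and nonneg: "\<And>x. x \<in> carrier V \<Longrightarrow> 0 \<le> N x"
    and zero: "\<And>x. x \<in> carrier V \<Longrightarrow> N x = 0 \<longleftrightarrow> x = \<zero>\<^bsub>V\<^esub>"
    and scale: "\<And>c x. x \<in> carrier V \<Longrightarrow> N (c \<odot>\<^bsub>V\<^esub> x) = cmod c * N x"
    and add: "\<And>x y. x \<in> carrier V \<Longrightarrow> y \<in> carrier V \<Longrightarrow> N (x \<oplus>\<^bsub>V\<^esub> y) \<le> N x + N y"
  shows "Metric_space (carrier V) (norm_dist V N)"
proof -
  interpret V: module complex_field V by (rule M)
  have neg1: "\<ominus>\<^bsub>complex_field\<^esub> 1 = (-1::complex)"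
    using V.R.minus_equality[of "-1" 1] by simp
  have neg: "N (\<ominus>\<^bsub>V\<^esub> x) = N x" if "x \<in> carrier V" for x
    using V.smult_l_minus[of 1 x] V.smult_one[of x] scale[OF that, of "-1"] that neg1 by simp
  show ?thesis
  proof
    show "0 \<le> norm_dist V N x y" for x y
      by (simp add: norm_dist_def nonneg)
    show "norm_dist V N x y = norm_dist V N y x" for x y
    proof (cases "x \<in> carrier V \<and> y \<in> carrier V")
      case True
      then have "y \<ominus>\<^bsub>V\<^esub> x = \<ominus>\<^bsub>V\<^esub> (x \<ominus>\<^bsub>V\<^esub> y)"
        by (simp add: V.minus_eq V.minus_add V.a_comm)
      then show ?thesis using True neg[of "x \<ominus>\<^bsub>V\<^esub> y"] by (simp add: norm_dist_def)
    qed (auto simp: norm_dist_def)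
    show "norm_dist V N x y = 0 \<longleftrightarrow> x = y" if "x \<in> carrier V" "y \<in> carrier V" for x y
    proof -
      have "x = y" if "x \<ominus>\<^bsub>V\<^esub> y = \<zero>\<^bsub>V\<^esub>"
      proof -
        have "(x \<ominus>\<^bsub>V\<^esub> y) \<oplus>\<^bsub>V\<^esub> y = x"
          using \<open>x \<in> carrier V\<close> \<open>y \<in> carrier V\<close> by (simp add: V.minus_eq V.a_assoc V.l_neg)
        then show ?thesis using that \<open>y \<in> carrier V\<close> by simp
      qed
      then show ?thesis
        using that by (auto simp: norm_dist_def zero V.minus_eq V.r_neg)
    qed
    show "norm_dist V N x z \<le> norm_dist V N x y + norm_dist V N y z"
      if "x \<in> carrier V" "y \<in> carrier V" "z \<in> carrier V" for x y z
    proof -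
      have "x \<ominus>\<^bsub>V\<^esub> z = (x \<ominus>\<^bsub>V\<^esub> y) \<oplus>\<^bsub>V\<^esub> (y \<ominus>\<^bsub>V\<^esub> z)"
        using that by (simp add: V.minus_eq V.a_assoc V.r_neg1)
      then show ?thesis
        using that add[of "x \<ominus>\<^bsub>V\<^esub> y" "y \<ominus>\<^bsub>V\<^esub> z"] by (simp add: norm_dist_def)
    qed
  qed
qed

section \<open>C*-algebras\<close>

text \<open>C*-algebras need not be unital: the inherited field \<open>one\<close> carries no meaning.\<close>

record 'a star_algebra = "(complex, 'a) module" +
  star :: "'a \<Rightarrow> 'a"
  cnorm :: "'a \<Rightarrow> real"

locale cstar_algebra = module complex_field A for A :: "'a star_algebra" (structure) +
  assumes mult_closed: "\<lbrakk>x \<in> carrier A; y \<in> carrier A\<rbrakk> \<Longrightarrow> x \<otimes> y \<in> carrier A"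
    and mult_assoc: "\<lbrakk>x \<in> carrier A; y \<in> carrier A; z \<in> carrier A\<rbrakk>
          \<Longrightarrow> (x \<otimes> y) \<otimes> z = x \<otimes> (y \<otimes> z)"
    and mult_distrib_right: "\<lbrakk>x \<in> carrier A; y \<in> carrier A; z \<in> carrier A\<rbrakk>
          \<Longrightarrow> (x \<oplus> y) \<otimes> z = x \<otimes> z \<oplus> y \<otimes> z"
    and mult_distrib_left: "\<lbrakk>x \<in> carrier A; y \<in> carrier A; z \<in> carrier A\<rbrakk>
          \<Longrightarrow> z \<otimes> (x \<oplus> y) = z \<otimes> x \<oplus> z \<otimes> y"
    and smult_mult_left: "\<lbrakk>x \<in> carrier A; y \<in> carrier A\<rbrakk> \<Longrightarrow> (c \<odot> x) \<otimes> y = c \<odot> (x \<otimes> y)"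
    and smult_mult_right: "\<lbrakk>x \<in> carrier A; y \<in> carrier A\<rbrakk> \<Longrightarrow> x \<otimes> (c \<odot> y) = c \<odot> (x \<otimes> y)"
    and star_closed: "x \<in> carrier A \<Longrightarrow> star A x \<in> carrier A"
    and star_star: "x \<in> carrier A \<Longrightarrow> star A (star A x) = x"
    and star_add: "\<lbrakk>x \<in> carrier A; y \<in> carrier A\<rbrakk> \<Longrightarrow> star A (x \<oplus> y) = star A x \<oplus> star A y"
    and star_smult: "x \<in> carrier A \<Longrightarrow> star A (c \<odot> x) = cnj c \<odot> star A x"
    and star_mult: "\<lbrakk>x \<in> carrier A; y \<in> carrier A\<rbrakk> \<Longrightarrow> star A (x \<otimes> y) = star A y \<otimes> star A x"
    and cnorm_nonneg: "x \<in> carrier A \<Longrightarrow> 0 \<le> cnorm A x"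
    and cnorm_eq_0: "x \<in> carrier A \<Longrightarrow> cnorm A x = 0 \<longleftrightarrow> x = \<zero>"
    and cnorm_smult: "x \<in> carrier A \<Longrightarrow> cnorm A (c \<odot> x) = cmod c * cnorm A x"
    and cnorm_add: "\<lbrakk>x \<in> carrier A; y \<in> carrier A\<rbrakk> \<Longrightarrow> cnorm A (x \<oplus> y) \<le> cnorm A x + cnorm A y"
    and cnorm_mult: "\<lbrakk>x \<in> carrier A; y \<in> carrier A\<rbrakk> \<Longrightarrow> cnorm A (x \<otimes> y) \<le> cnorm A x * cnorm A y"
    and cstar_identity: "x \<in> carrier A \<Longrightarrow> cnorm A (star A x \<otimes> x) = (cnorm A x)\<^sup>2"
    and complete: "norm_complete A (cnorm A)"

lemma (in cstar_algebra) Metric_space_cnorm: "Metric_space (carrier A) (norm_dist A (cnorm A))"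
  by (rule Metric_space_norm_dist)
    (auto simp: cnorm_nonneg cnorm_eq_0 cnorm_smult cnorm_add intro: module_axioms)

definition star_hom :: "'a star_algebra \<Rightarrow> 'b star_algebra \<Rightarrow> ('a \<Rightarrow> 'b) \<Rightarrow> bool" where
  "star_hom A B \<phi> \<longleftrightarrow> linear_map A B \<phi> \<and>
     (\<forall>x\<in>carrier A. \<forall>y\<in>carrier A. \<phi> (x \<otimes>\<^bsub>A\<^esub> y) = \<phi> x \<otimes>\<^bsub>B\<^esub> \<phi> y) \<and>
     (\<forall>x\<in>carrier A. \<phi> (star A x) = star B (\<phi> x))"

definition star_isomorphic :: "'a star_algebra \<Rightarrow> 'b star_algebra \<Rightarrow> bool" where
  "star_isomorphic A B \<longleftrightarrow> (\<exists>\<phi>. star_hom A B \<phi> \<and> bij_betw \<phi> (carrier A) (carrier B))"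

definition star_subalgebra :: "'a star_algebra \<Rightarrow> 'a set \<Rightarrow> bool" where
  "star_subalgebra A C \<longleftrightarrow> submodule C complex_field A \<and>
     (\<forall>x\<in>C. \<forall>y\<in>C. x \<otimes>\<^bsub>A\<^esub> y \<in> C) \<and> (\<forall>x\<in>C. star A x \<in> C)"

definition generates :: "'a star_algebra \<Rightarrow> 'a set \<Rightarrow> bool" where
  "generates A G \<longleftrightarrow> G \<subseteq> carrier A \<and>
     (\<forall>C. star_subalgebra A C \<and> closedin (norm_topology A (cnorm A)) C \<and> G \<subseteq> C
        \<longrightarrow> C = carrier A)"

definition projection :: "'a star_algebra \<Rightarrow> 'a \<Rightarrow> bool" where
  "projection A p \<longleftrightarrow> p \<in> carrier A \<and> star A p = p \<and> p \<otimes>\<^bsub>A\<^esub> p = p"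

definition partial_isometry :: "'a star_algebra \<Rightarrow> 'a \<Rightarrow> bool" where
  "partial_isometry A s \<longleftrightarrow> s \<in> carrier A \<and> s \<otimes>\<^bsub>A\<^esub> star A s \<otimes>\<^bsub>A\<^esub> s = s"

text \<open>The order on self-adjoint elements: the positive elements are those of the form \<open>z\<^sup>* z\<close>.\<close>

definition cstar_le :: "'a star_algebra \<Rightarrow> 'a \<Rightarrow> 'a \<Rightarrow> bool" where
  "cstar_le A x y \<longleftrightarrow> (\<exists>z\<in>carrier A. y \<ominus>\<^bsub>A\<^esub> x = star A z \<otimes>\<^bsub>A\<^esub> z)"

section \<open>Hilbert spaces and their operators\<close>

text \<open>The inherited fields \<open>monoid.mult\<close> and \<open>one\<close> carry no meaning. The inner product is linear in
  its first argument.\<close>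

record 'h inner_space = "(complex, 'h) module" +
  ip :: "'h \<Rightarrow> 'h \<Rightarrow> complex"

definition hnorm :: "'h inner_space \<Rightarrow> 'h \<Rightarrow> real" where
  "hnorm H x = sqrt (Re (ip H x x))"

locale hilbert_space = module complex_field H for H :: "'h inner_space" (structure) +
  assumes ip_add: "\<lbrakk>x \<in> carrier H; y \<in> carrier H; z \<in> carrier H\<rbrakk>
          \<Longrightarrow> ip H (x \<oplus> y) z = ip H x z + ip H y z"
    and ip_smult: "\<lbrakk>x \<in> carrier H; y \<in> carrier H\<rbrakk> \<Longrightarrow> ip H (c \<odot> x) y = c * ip H x y"
    and ip_commute: "\<lbrakk>x \<in> carrier H; y \<in> carrier H\<rbrakk> \<Longrightarrow> ip H y x = cnj (ip H x y)"
    and ip_pos: "\<lbrakk>x \<in> carrier H; x \<noteq> \<zero>\<rbrakk> \<Longrightarrow> 0 < Re (ip H x x)"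
    and complete: "norm_complete H (hnorm H)"
begin

lemma ip_zero_left: "y \<in> carrier H \<Longrightarrow> ip H \<zero> y = 0"
  using ip_smult[of \<zero> y 0] by simp

lemma ip_self_nonneg: "x \<in> carrier H \<Longrightarrow> 0 \<le> Re (ip H x x)"
  using ip_pos[of x] ip_zero_left by (cases "x = \<zero>") auto

lemma ip_self_real: "x \<in> carrier H \<Longrightarrow> ip H x x = complex_of_real (Re (ip H x x))"
  using ip_commute[of x x] by (simp add: complex_eq_iff)

lemma ip_add_right: "\<lbrakk>x \<in> carrier H; y \<in> carrier H; z \<in> carrier H\<rbrakk>
    \<Longrightarrow> ip H z (x \<oplus> y) = ip H z x + ip H z y"
  using ip_add[of x y z] ip_commute[of "x \<oplus> y" z] ip_commute[of x z] ip_commute[of y z] by simp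

lemma ip_smult_right: "\<lbrakk>x \<in> carrier H; y \<in> carrier H\<rbrakk> \<Longrightarrow> ip H y (c \<odot> x) = cnj c * ip H y x"
  using ip_smult[of x y c] ip_commute[of "c \<odot> x" y] ip_commute[of x y] by simp

lemma hnorm_sq: "x \<in> carrier H \<Longrightarrow> (hnorm H x)\<^sup>2 = Re (ip H x x)"
  by (simp add: hnorm_def ip_self_nonneg)

lemma Cauchy_Schwarz:
  assumes x: "x \<in> carrier H" and y: "y \<in> carrier H"
  shows "cmod (ip H x y) \<le> hnorm H x * hnorm H y"
proof (cases "y = \<zero>")
  case True
  then show ?thesis using x ip_commute[of \<zero> x] ip_zero_left[of x] ip_zero_left[of \<zero>]
    by (simp add: hnorm_def)
next
  case False
  define r where "r = Re (ip H y y)"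
  have r: "0 < r" using False y by (simp add: r_def ip_pos)
  define k where "k = ip H x y"
  define c where "c = - (k / complex_of_real r)"
  have yy: "ip H y y = complex_of_real r"
    using ip_self_real[OF y] by (simp add: r_def)
  have yx: "ip H y x = cnj k" using ip_commute[OF x y] by (simp add: k_def)
  have "ip H (x \<oplus> c \<odot> y) (x \<oplus> c \<odot> y)
      = ip H x x + cnj c * k + c * cnj k + c * cnj c * complex_of_real r"
    using x y by (simp add: ip_add ip_add_right ip_smult ip_smult_right yy yx k_def algebra_simps)
  also have "\<dots> = ip H x x - k * cnj k / complex_of_real r"
    using r by (simp add: c_def field_simps)
  also have "k * cnj k = complex_of_real ((cmod k)\<^sup>2)"
    by (simp only: complex_norm_square)
  finally have "Re (ip H (x \<oplus> c \<odot> y) (x \<oplus> c \<odot> y)) = Re (ip H x x) - (cmod k)\<^sup>2 / r"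
    by (simp flip: of_real_divide)
  moreover have "0 \<le> Re (ip H (x \<oplus> c \<odot> y) (x \<oplus> c \<odot> y))"
    using x y by (simp add: ip_self_nonneg)
  ultimately have "(cmod k)\<^sup>2 \<le> Re (ip H x x) * r"
    using r by (simp add: pos_divide_le_eq)
  also have "\<dots> = (hnorm H x * hnorm H y)\<^sup>2"
    using x y by (simp add: power_mult_distrib hnorm_sq r_def)
  finally show ?thesis
    unfolding k_def by (rule power2_le_imp_le) (simp add: hnorm_def x y ip_self_nonneg)
qed

lemma Metric_space_hnorm: "Metric_space (carrier H) (norm_dist H (hnorm H))"
proof (rule Metric_space_norm_dist)
  show "module complex_field H" by (rule module_axioms)
  show "0 \<le> hnorm H x" if "x \<in> carrier H" for x
    using that by (simp add: hnorm_def ip_self_nonneg)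
  show "hnorm H x = 0 \<longleftrightarrow> x = \<zero>" if "x \<in> carrier H" for x
    using that ip_pos[of x] ip_zero_left[of \<zero>] by (cases "x = \<zero>") (auto simp: hnorm_def)
  show "hnorm H (c \<odot> x) = cmod c * hnorm H x" if x: "x \<in> carrier H" for c x
  proof (rule power2_eq_imp_eq)
    have "ip H (c \<odot> x) (c \<odot> x) = (c * cnj c) * ip H x x"
      using x by (simp add: ip_smult ip_smult_right)
    also have "\<dots> = complex_of_real ((cmod c)\<^sup>2) * ip H x x"
      by (simp only: complex_norm_square)
    finally show "(hnorm H (c \<odot> x))\<^sup>2 = (cmod c * hnorm H x)\<^sup>2"
      using x by (simp add: hnorm_sq power_mult_distrib)
  qed (use x in \<open>auto simp: hnorm_def ip_self_nonneg\<close>)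
  show "hnorm H (x \<oplus> y) \<le> hnorm H x + hnorm H y" if x: "x \<in> carrier H" and y: "y \<in> carrier H" for x y
  proof (rule power2_le_imp_le)
    have "Re (ip H x y) \<le> hnorm H x * hnorm H y"
      using Cauchy_Schwarz[OF x y] complex_Re_le_cmod order_trans by blast
    then show "(hnorm H (x \<oplus> y))\<^sup>2 \<le> (hnorm H x + hnorm H y)\<^sup>2"
      using x y ip_commute[OF x y]
      by (simp add: hnorm_sq power2_sum ip_add ip_add_right)
  qed (use x y in \<open>simp add: hnorm_def ip_self_nonneg\<close>)
qed

end

definition bounded_operator :: "'h inner_space \<Rightarrow> ('h \<Rightarrow> 'h) \<Rightarrow> bool" where
  "bounded_operator H T \<longleftrightarrow> linear_map H H T \<and>
     (\<exists>C. \<forall>x\<in>carrier H. hnorm H (T x) \<le> C * hnorm H x)"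

definition compact_operator :: "'h inner_space \<Rightarrow> ('h \<Rightarrow> 'h) \<Rightarrow> bool" where
  "compact_operator H T \<longleftrightarrow> linear_map H H T \<and>
     (let X = norm_topology H (hnorm H)
      in compactin X (X closure_of (T ` {x \<in> carrier H. hnorm H x \<le> 1})))"

definition operator_norm :: "'h inner_space \<Rightarrow> ('h \<Rightarrow> 'h) \<Rightarrow> real" where
  "operator_norm H T = Sup {hnorm H (T x) |x. x \<in> carrier H \<and> hnorm H x \<le> 1}"

text \<open>An operator on \<open>H\<close> is a function taking the value \<open>undefined\<close> off the carrier of \<open>H\<close>, so that
  equality of operators is equality on \<open>H\<close>.\<close>

definition adjoint_op :: "'h inner_space \<Rightarrow> ('h \<Rightarrow> 'h) \<Rightarrow> ('h \<Rightarrow> 'h)" where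
  "adjoint_op H T = (THE S. S \<in> extensional (carrier H) \<and> bounded_operator H S \<and>
     (\<forall>x\<in>carrier H. \<forall>y\<in>carrier H. ip H (T x) y = ip H x (S y)))"

definition bounded_operators :: "'h inner_space \<Rightarrow> ('h \<Rightarrow> 'h) star_algebra" where
  "bounded_operators H =
    \<lparr>carrier = {T \<in> extensional (carrier H). bounded_operator H T},
     monoid.mult = compose (carrier H),
     one = restrict id (carrier H),
     ring.zero = (\<lambda>x\<in>carrier H. \<zero>\<^bsub>H\<^esub>),
     add = (\<lambda>S T. \<lambda>x\<in>carrier H. S x \<oplus>\<^bsub>H\<^esub> T x),
     smult = (\<lambda>c T. \<lambda>x\<in>carrier H. c \<odot>\<^bsub>H\<^esub> T x),
     star = adjoint_op H,
     cnorm = operator_norm H\<rparr>"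

definition compact_operators :: "'h inner_space \<Rightarrow> ('h \<Rightarrow> 'h) star_algebra" where
  "compact_operators H =
    bounded_operators H\<lparr>carrier := {T \<in> extensional (carrier H). compact_operator H T}\<rparr>"

section \<open>Representations\<close>

definition representation :: "'a star_algebra \<Rightarrow> 'h inner_space \<Rightarrow> ('a \<Rightarrow> 'h \<Rightarrow> 'h) \<Rightarrow> bool" where
  "representation A H \<pi> \<longleftrightarrow> hilbert_space H \<and> star_hom A (bounded_operators H) \<pi>"

definition irreducible_representation ::
    "'a star_algebra \<Rightarrow> 'h inner_space \<Rightarrow> ('a \<Rightarrow> 'h \<Rightarrow> 'h) \<Rightarrow> bool" where
  "irreducible_representation A H \<pi> \<longleftrightarrow> representation A H \<pi> \<and>
     (\<exists>a\<in>carrier A. \<pi> a \<noteq> \<zero>\<^bsub>bounded_operators H\<^esub>) \<and>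
     (\<forall>K. submodule K complex_field H \<and> closedin (norm_topology H (hnorm H)) K \<and>
          (\<forall>a\<in>carrier A. \<forall>x\<in>K. \<pi> a x \<in> K)
        \<longrightarrow> K = {\<zero>\<^bsub>H\<^esub>} \<or> K = carrier H)"

definition unitary_map :: "'h inner_space \<Rightarrow> 'k inner_space \<Rightarrow> ('h \<Rightarrow> 'k) \<Rightarrow> bool" where
  "unitary_map H K U \<longleftrightarrow> linear_map H K U \<and> bij_betw U (carrier H) (carrier K) \<and>
     (\<forall>x\<in>carrier H. \<forall>y\<in>carrier H. ip K (U x) (U y) = ip H x y)"

text \<open>The adjoint of a unitary map \<open>U\<close> is its inverse.\<close>

definition unitarily_equivalent ::
    "'a star_algebra \<Rightarrow> 'h inner_space \<Rightarrow> ('a \<Rightarrow> 'h \<Rightarrow> 'h) \<Rightarrow>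
      'k inner_space \<Rightarrow> ('a \<Rightarrow> 'k \<Rightarrow> 'k) \<Rightarrow> bool" where
  "unitarily_equivalent A H \<pi> K \<rho> \<longleftrightarrow> (\<exists>U. unitary_map H K U \<and>
     (\<forall>a\<in>carrier A. \<forall>x\<in>carrier H. \<pi> a x = inv_into (carrier H) U (\<rho> a (U x))))"

text \<open>HOL cannot quantify over the Hilbert spaces on all types, so the Hilbert spaces below have their
  carrier inside the type \<^typ>\<open>'a \<Rightarrow> complex\<close>, where \<^typ>\<open>'a\<close> is the type of the elements of \<open>A\<close>. Up
  to unitary equivalence this omits no irreducible representation: every nonzero vector \<open>\<xi>\<close> of the
  space of an irreducible representation \<open>\<pi>\<close> is cyclic, so a vector \<open>\<eta>\<close> is determined by the function
  taking \<open>a\<close> to the inner product of \<open>\<pi> a \<xi>\<close> and \<open>\<eta>\<close>.\<close>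

definition unique_irreducible_representation :: "'a star_algebra \<Rightarrow> bool" where
  "unique_irreducible_representation A \<longleftrightarrow>
     (\<forall>(H :: ('a \<Rightarrow> complex) inner_space) \<pi> (K :: ('a \<Rightarrow> complex) inner_space) \<rho>.
        irreducible_representation A H \<pi> \<and> irreducible_representation A K \<rho>
        \<longrightarrow> unitarily_equivalent A H \<pi> K \<rho>)"

section \<open>Graph C*-algebras\<close>

type_synonym ('v, 'e) universe =
  "(('v + 'e) list \<Rightarrow> complex) \<Rightarrow> (('v + 'e) list \<Rightarrow> complex)"

text \<open>Directed graphs are the \<open>wf_digraph\<close>s of the library: vertex and arc sets of any cardinality,
  loops and parallel arcs allowed. The source map is \<^const>\<open>tail\<close>, the range map is \<^const>\<open>head\<close>.\<close>

definition row_countable :: "('v, 'e) pre_digraph \<Rightarrow> bool" where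
  "row_countable E \<longleftrightarrow> (\<forall>v\<in>verts E. countable (out_arcs E v))"

definition regular_vertex :: "('v, 'e) pre_digraph \<Rightarrow> 'v \<Rightarrow> bool" where
  "regular_vertex E v \<longleftrightarrow> v \<in> verts E \<and> finite (out_arcs E v) \<and> out_arcs E v \<noteq> {}"

definition cuntz_krieger_family ::
    "('v, 'e) pre_digraph \<Rightarrow> 'a star_algebra \<Rightarrow> ('v \<Rightarrow> 'a) \<Rightarrow> ('e \<Rightarrow> 'a) \<Rightarrow> bool" where
  "cuntz_krieger_family E A p s \<longleftrightarrow>
     (\<forall>v\<in>verts E. projection A (p v)) \<and>
     (\<forall>v\<in>verts E. \<forall>w\<in>verts E. v \<noteq> w \<longrightarrow> p v \<otimes>\<^bsub>A\<^esub> p w = \<zero>\<^bsub>A\<^esub>) \<and>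
     (\<forall>e\<in>arcs E. partial_isometry A (s e)) \<and>
     (\<forall>e\<in>arcs E. \<forall>f\<in>arcs E. e \<noteq> f \<longrightarrow>
        (s e \<otimes>\<^bsub>A\<^esub> star A (s e)) \<otimes>\<^bsub>A\<^esub> (s f \<otimes>\<^bsub>A\<^esub> star A (s f)) = \<zero>\<^bsub>A\<^esub>) \<and>
     (\<forall>e\<in>arcs E. star A (s e) \<otimes>\<^bsub>A\<^esub> s e = p (head E e)) \<and>
     (\<forall>e\<in>arcs E. cstar_le A (s e \<otimes>\<^bsub>A\<^esub> star A (s e)) (p (tail E e))) \<and>
     (\<forall>v. regular_vertex E v \<longrightarrow>
        p v = (\<Oplus>\<^bsub>A\<^esub>e\<in>out_arcs E v. s e \<otimes>\<^bsub>A\<^esub> star A (s e)))"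

text \<open>\<open>A\<close>, together with \<open>p\<close> and \<open>s\<close>, is the universal C*-algebra generated by a Cuntz-Krieger
  \<open>E\<close>-family; the homomorphism \<open>\<phi>\<close> is unique on \<open>A\<close> because the family generates \<open>A\<close>.

  The algebras \<open>B\<close> in the universal property have their carrier inside the fixed type
  \<^typ>\<open>('v, 'e) universe\<close>. This is no restriction, because one may replace \<open>B\<close> by the C*-subalgebra
  generated by the given family: the noncommutative *-polynomials over the rational complex numbers
  form a dense subset of it, of cardinality at most that of the type of words over \<^typ>\<open>'v + 'e\<close>,
  say \<open>\<kappa>\<close> (an infinite cardinal), so it has at most \<open>\<kappa>\<close>-to-the-\<open>\<aleph>\<^sub>0\<close> elements, which is at most
  2-to-the-\<open>\<kappa>\<close>. In particular \<open>A\<close>, whose elements may lie in any type, is determined up to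
  isomorphism by \<open>E\<close>.\<close>

definition graph_cstar_algebra ::
    "('v, 'e) pre_digraph \<Rightarrow> 'a star_algebra \<Rightarrow> ('v \<Rightarrow> 'a) \<Rightarrow> ('e \<Rightarrow> 'a) \<Rightarrow> bool" where
  "graph_cstar_algebra E A p s \<longleftrightarrow>
     cstar_algebra A \<and> cuntz_krieger_family E A p s \<and>
     generates A (p ` verts E \<union> s ` arcs E) \<and>
     (\<forall>(B :: ('v, 'e) universe star_algebra) P S.
        cstar_algebra B \<and> cuntz_krieger_family E B P S \<longrightarrow>
        (\<exists>\<phi>. star_hom A B \<phi> \<and> (\<forall>v\<in>verts E. \<phi> (p v) = P v) \<and> (\<forall>e\<in>arcs E. \<phi> (s e) = S e)))"

end

theory Submission
  imports Defs
begin

text \<open>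
  A boundary path is an infinite path or a finite path ending in a singular vertex. The square-summable
  functions on a tail equivalence class of boundary paths carry an irreducible representation of the
    graph
  C*-algebra \<open>A\<close>, and an intertwiner of two such representations maps each basis vector to a multiple of
  itself. A unique irreducible representation therefore makes all boundary paths tail equivalent, and
  twisting the edges by a scalar of modulus one excludes cycles. There are countably many boundary
    paths in a
  tail equivalence class from a given vertex when emission is countable, so a diagonal argument yields a
  vertex \<open>v\<close> that emits only one boundary path.

  Then \<open>p v A p v\<close> consists of the multiples of \<open>p v\<close>, and every vertex projection is a finite sum
    of elements
  \<open>t t*\<close> with \<open>t* t = p v\<close>. Hence \<open>A\<close> acts on the Hilbert space \<open>A p v\<close>; its matrix units become
    rank one
  operators, and the action is isometric because the C*-identity determines the norm of a self-adjoint
  element by its iterated squares.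
\<close>

section \<open>Normed modules over the complex numbers\<close>

text \<open>Two type restrictions shape the proof. The universal property speaks only of algebras
  inside one fixed type, and uniqueness only of Hilbert spaces inside another, so each space in use
  is injected into the required type and its structure is transported. A single tail class is small
  enough: its members are coded by words together with shifts of one path.

  Row-countability enters where one tail class is intersected with the paths from one vertex.
  Countability lets a diagonal path escape an enumeration, while tail equivalence of all boundary
  paths says that nothing escapes, so branching must stop somewhere.

  The final isomorphism is elementary because the corner at the vertex \<open>v\<close>, with
  projection \<open>q = p v\<close>, is one-dimensional: for \<open>x\<close> and \<open>z\<close>
  in \<open>A q\<close> the product of the adjoint of \<open>z\<close> with \<open>x\<close> is a
  scalar multiple of \<open>q\<close>, and that scalar is an inner product. Hence the C*-norm on
  \<open>A q\<close> is already a Hilbert space norm, and submultiplicativity gives contractivity of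
  the action. The reverse estimate is first obtained only up to a constant, namely the one that a
  finite sum decomposition of a local unit provides; passing to powers removes it.\<close>

context module
begin

lemma minus_self [simp]: "x \<in> carrier M \<Longrightarrow> x \<ominus>\<^bsub>M\<^esub> x = \<zero>\<^bsub>M\<^esub>"
  by (simp add: M.minus_eq M.r_neg)

lemma minus_zero_right [simp]: "x \<in> carrier M \<Longrightarrow> x \<ominus>\<^bsub>M\<^esub> \<zero>\<^bsub>M\<^esub> = x"
  by (simp add: M.minus_eq M.minus_equality)

lemma minus_add_cancel [simp]:
  "\<lbrakk>x \<in> carrier M; y \<in> carrier M\<rbrakk> \<Longrightarrow> (x \<ominus>\<^bsub>M\<^esub> y) \<oplus>\<^bsub>M\<^esub> y = x"
  by (simp add: M.minus_eq M.a_assoc M.l_neg)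

lemma add_minus_cancel [simp]:
  "\<lbrakk>x \<in> carrier M; y \<in> carrier M\<rbrakk> \<Longrightarrow> y \<oplus>\<^bsub>M\<^esub> (x \<ominus>\<^bsub>M\<^esub> y) = x"
  by (metis M.a_comm M.minus_closed minus_add_cancel)

lemma minus_eq_zero_iff [simp]:
  "\<lbrakk>x \<in> carrier M; y \<in> carrier M\<rbrakk> \<Longrightarrow> x \<ominus>\<^bsub>M\<^esub> y = \<zero>\<^bsub>M\<^esub> \<longleftrightarrow> x = y"
  by (metis M.l_zero minus_add_cancel minus_self)

lemma minus_eq_iff:
  "\<lbrakk>x \<in> carrier M; y \<in> carrier M; z \<in> carrier M\<rbrakk> \<Longrightarrow> x \<ominus>\<^bsub>M\<^esub> y = z \<longleftrightarrow> x = z \<oplus>\<^bsub>M\<^esub> y"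
  by (metis M.minus_closed M.add.right_cancel minus_add_cancel)

lemma minus_minus_triangle:
  "\<lbrakk>x \<in> carrier M; y \<in> carrier M; z \<in> carrier M\<rbrakk>
    \<Longrightarrow> (x \<ominus>\<^bsub>M\<^esub> y) \<oplus>\<^bsub>M\<^esub> (y \<ominus>\<^bsub>M\<^esub> z) = x \<ominus>\<^bsub>M\<^esub> z"
  by (simp add: M.minus_eq M.a_assoc M.r_neg1)

lemma minus_add_add:
  "\<lbrakk>x \<in> carrier M; y \<in> carrier M; z \<in> carrier M; w \<in> carrier M\<rbrakk>
    \<Longrightarrow> (x \<oplus>\<^bsub>M\<^esub> y) \<ominus>\<^bsub>M\<^esub> (z \<oplus>\<^bsub>M\<^esub> w) = (x \<ominus>\<^bsub>M\<^esub> z) \<oplus>\<^bsub>M\<^esub> (y \<ominus>\<^bsub>M\<^esub> w)"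
  by (simp add: M.minus_eq M.minus_add M.a_ac)

lemma uminus_minus:
  "\<lbrakk>x \<in> carrier M; y \<in> carrier M\<rbrakk> \<Longrightarrow> \<ominus>\<^bsub>M\<^esub> (x \<ominus>\<^bsub>M\<^esub> y) = y \<ominus>\<^bsub>M\<^esub> x"
  by (simp add: M.minus_eq M.minus_add M.a_comm)

lemma smult_minus_right:
  "\<lbrakk>c \<in> carrier R; x \<in> carrier M; y \<in> carrier M\<rbrakk>
    \<Longrightarrow> c \<odot>\<^bsub>M\<^esub> (x \<ominus>\<^bsub>M\<^esub> y) = c \<odot>\<^bsub>M\<^esub> x \<ominus>\<^bsub>M\<^esub> c \<odot>\<^bsub>M\<^esub> y"
  by (simp add: M.minus_eq smult_r_distr smult_r_minus)

end

lemma complex_field_uminus: "\<ominus>\<^bsub>complex_field\<^esub> c = - c"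
proof -
  interpret cring complex_field by (rule cring_complex_field)
  show ?thesis using minus_equality[of "-c" c] by simp
qed

text \<open>Common ground of C*-algebras, Hilbert spaces, operator spaces and \<open>ell2\<close>,
  so that closure, Cauchy sequences and limits are treated once, in terms of the norm instead of the
  topology.\<close>

locale normed_module = module complex_field V for V (structure) +
  fixes N :: "'a \<Rightarrow> real"
  assumes N_nonneg [simp]: "x \<in> carrier V \<Longrightarrow> 0 \<le> N x"
    and N_eq_0_iff [simp]: "x \<in> carrier V \<Longrightarrow> N x = 0 \<longleftrightarrow> x = \<zero>"
    and N_smult [simp]: "x \<in> carrier V \<Longrightarrow> N (c \<odot> x) = cmod c * N x"
    and N_add: "\<lbrakk>x \<in> carrier V; y \<in> carrier V\<rbrakk> \<Longrightarrow> N (x \<oplus> y) \<le> N x + N y"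
begin

sublocale Metric_space "carrier V" "norm_dist V N"
  by (rule Metric_space_norm_dist) (auto simp: N_add intro: module_axioms)

lemma uminus_eq_smult: "x \<in> carrier V \<Longrightarrow> \<ominus> x = (-1) \<odot> x"
  using smult_l_minus[of 1 x] smult_one[of x] by (simp add: complex_field_uminus)

lemma smult_0_left [simp]: "x \<in> carrier V \<Longrightarrow> 0 \<odot> x = \<zero>"
  using smult_l_null[of x] by simp

lemma smult_1_left [simp]: "x \<in> carrier V \<Longrightarrow> 1 \<odot> x = x"
  using smult_one[of x] by simp

lemma N_zero [simp]: "N \<zero> = 0" by simp

lemma N_le_0_iff [simp]: "x \<in> carrier V \<Longrightarrow> N x \<le> 0 \<longleftrightarrow> x = \<zero>"
  using N_nonneg[of x] N_eq_0_iff[of x] by linarith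

lemma N_uminus [simp]: "x \<in> carrier V \<Longrightarrow> N (\<ominus> x) = N x"
  by (simp add: uminus_eq_smult)

lemma N_minus_commute: "\<lbrakk>x \<in> carrier V; y \<in> carrier V\<rbrakk> \<Longrightarrow> N (x \<ominus> y) = N (y \<ominus> x)"
  by (metis N_uminus M.minus_closed uminus_minus)

lemma N_minus_triangle:
  "\<lbrakk>x \<in> carrier V; y \<in> carrier V; z \<in> carrier V\<rbrakk> \<Longrightarrow> N (x \<ominus> z) \<le> N (x \<ominus> y) + N (y \<ominus> z)"
  using N_add[of "x \<ominus> y" "y \<ominus> z"] by (simp add: minus_minus_triangle)

lemma N_le_add_minus: "\<lbrakk>x \<in> carrier V; y \<in> carrier V\<rbrakk> \<Longrightarrow> N x \<le> N y + N (x \<ominus> y)"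
  using N_add[of y "x \<ominus> y"] by simp

lemma norm_dist_eq [simp]: "\<lbrakk>x \<in> carrier V; y \<in> carrier V\<rbrakk> \<Longrightarrow> norm_dist V N x y = N (x \<ominus> y)"
  by (simp add: norm_dist_def)

lemma closure_of_norm_topology:
  assumes K: "K \<subseteq> carrier V"
  shows "Abstract_Topology.closure_of (norm_topology V N) K
    = {x \<in> carrier V. \<forall>\<epsilon>>0. \<exists>k\<in>K. N (x \<ominus> k) < \<epsilon>}"
proof -
  have "(\<exists>k\<in>K. k \<in> mball x \<epsilon>) \<longleftrightarrow> (\<exists>k\<in>K. N (x \<ominus> k) < \<epsilon>)" if "x \<in> carrier V" for x \<epsilon>
    using that K by (intro bex_cong) (auto simp: in_mball)
  then show ?thesis
    unfolding metric_closure_of by blast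
qed

lemma closedin_norm_topology_iff:
  "closedin (norm_topology V N) K \<longleftrightarrow>
    K \<subseteq> carrier V \<and> (\<forall>x\<in>carrier V. (\<forall>\<epsilon>>0. \<exists>k\<in>K. N (x \<ominus> k) < \<epsilon>) \<longrightarrow> x \<in> K)"
proof (cases "K \<subseteq> carrier V")
  case True
  have "closedin mtopology K \<longleftrightarrow> Abstract_Topology.closure_of mtopology K \<subseteq> K"
    by (metis True closure_of_subset closure_of_eq subset_antisym topspace_mtopology)
  also have "\<dots> \<longleftrightarrow> (\<forall>x\<in>carrier V. (\<forall>\<epsilon>>0. \<exists>k\<in>K. N (x \<ominus> k) < \<epsilon>) \<longrightarrow> x \<in> K)"
    by (simp only: closure_of_norm_topology[OF True]) auto
  finally show ?thesis using True by simp
qed (use closedin_subset in force)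

lemma norm_complete_iff:
  "norm_complete V N \<longleftrightarrow>
    (\<forall>f :: nat \<Rightarrow> 'a. (\<forall>n. f n \<in> carrier V) \<and> (\<forall>\<epsilon>>0. \<exists>M. \<forall>m\<ge>M. \<forall>n\<ge>M. N (f m \<ominus> f n) < \<epsilon>)
      \<longrightarrow> (\<exists>l\<in>carrier V. \<forall>\<epsilon>>0. \<exists>M. \<forall>n\<ge>M. N (f n \<ominus> l) < \<epsilon>))"
proof -
  have "MCauchy f \<longleftrightarrow> (\<forall>n. f n \<in> carrier V) \<and> (\<forall>\<epsilon>>0. \<exists>M. \<forall>m\<ge>M. \<forall>n\<ge>M. N (f m \<ominus> f n) < \<epsilon>)"
    for f :: "nat \<Rightarrow> 'a"
    unfolding MCauchy_def by (simp add: image_subset_iff conj_commute cong: conj_cong)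
  moreover have "(\<exists>x. limitin mtopology f x sequentially) \<longleftrightarrow>
      (\<exists>l\<in>carrier V. \<forall>\<epsilon>>0. \<exists>M. \<forall>n\<ge>M. N (f n \<ominus> l) < \<epsilon>)" if "\<forall>n. f n \<in> carrier V" for f
    using that by (auto simp: limit_metric_sequentially Bex_def cong: conj_cong)
  ultimately have "(MCauchy f \<longrightarrow> (\<exists>x. limitin mtopology f x sequentially)) \<longleftrightarrow>
      ((\<forall>n. f n \<in> carrier V) \<and> (\<forall>\<epsilon>>0. \<exists>M. \<forall>m\<ge>M. \<forall>n\<ge>M. N (f m \<ominus> f n) < \<epsilon>)
      \<longrightarrow> (\<exists>l\<in>carrier V. \<forall>\<epsilon>>0. \<exists>M. \<forall>n\<ge>M. N (f n \<ominus> l) < \<epsilon>))" for f :: "nat \<Rightarrow> 'a"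
    by (cases "\<forall>n. f n \<in> carrier V") simp_all
  then show ?thesis
    unfolding mcomplete_def by simp
qed

lemma norm_complete_convergent:
  fixes f :: "nat \<Rightarrow> 'a"
  assumes complete: "norm_complete V N" and f: "\<And>n. f n \<in> carrier V"
    and cauchy: "\<And>\<epsilon>. 0 < \<epsilon> \<Longrightarrow> \<exists>M. \<forall>m\<ge>M. \<forall>n\<ge>M. N (f m \<ominus> f n) < \<epsilon>"
  shows "\<exists>l\<in>carrier V. \<forall>\<epsilon>>0. \<exists>M. \<forall>n\<ge>M. N (f n \<ominus> l) < \<epsilon>"
proof -
  have "(\<forall>n. f n \<in> carrier V) \<and> (\<forall>\<epsilon>>0. \<exists>M. \<forall>m\<ge>M. \<forall>n\<ge>M. N (f m \<ominus> f n) < \<epsilon>)"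
    using f cauchy by simp
  then show ?thesis
    by (rule complete[unfolded norm_complete_iff, THEN spec, THEN mp])
qed

text \<open>The rate is the one obtained by choosing the n-th approximant within
  \<open>1 / (n + 1)\<close> of a common target. The conclusion supplies a single index at which
  both the rate and the distance to the limit are small, which is the form that the limit arguments
  consume.\<close>

lemma harmonic_Cauchy_convergent:
  fixes a :: "nat \<Rightarrow> 'a"
  assumes complete: "norm_complete V N" and a: "\<And>n. a n \<in> carrier V"
    and dist: "\<And>m n. N (a m \<ominus> a n) \<le> inverse (real (Suc m)) + inverse (real (Suc n))"
  obtains l where "l \<in> carrier V"
    "\<And>\<epsilon>. 0 < \<epsilon> \<Longrightarrow> \<exists>n. inverse (real (Suc n)) < \<epsilon> \<and> N (a n \<ominus> l) < \<epsilon>"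
proof -
  have small: "\<exists>M. \<forall>n\<ge>M. inverse (real (Suc n)) < \<epsilon>" if "0 < \<epsilon>" for \<epsilon>
    using LIMSEQ_D[OF LIMSEQ_inverse_real_of_nat that] by auto
  have "\<exists>l\<in>carrier V. \<forall>\<epsilon>>0. \<exists>M. \<forall>n\<ge>M. N (a n \<ominus> l) < \<epsilon>"
  proof (rule norm_complete_convergent[OF complete a])
    fix \<epsilon> :: real assume "0 < \<epsilon>"
    then obtain M where M: "\<And>n. n \<ge> M \<Longrightarrow> inverse (real (Suc n)) < \<epsilon> / 2"
      using small[of "\<epsilon> / 2"] by auto
    have "N (a m \<ominus> a n) < \<epsilon>" if "m \<ge> M" "n \<ge> M" for m n
      using dist[of m n] M[OF that(1)] M[OF that(2)] by linarith
    then show "\<exists>M. \<forall>m\<ge>M. \<forall>n\<ge>M. N (a m \<ominus> a n) < \<epsilon>" by blast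
  qed
  then obtain l where l: "l \<in> carrier V" "\<And>\<epsilon>. 0 < \<epsilon> \<Longrightarrow> \<exists>M. \<forall>n\<ge>M. N (a n \<ominus> l) < \<epsilon>"
    by blast
  show ?thesis
  proof (rule that[OF l(1)])
    fix \<epsilon> :: real assume \<epsilon>: "0 < \<epsilon>"
    obtain M1 M2 where "\<forall>n\<ge>M1. inverse (real (Suc n)) < \<epsilon>" "\<forall>n\<ge>M2. N (a n \<ominus> l) < \<epsilon>"
      using small[OF \<epsilon>] l(2)[OF \<epsilon>] by blast
    then show "\<exists>n. inverse (real (Suc n)) < \<epsilon> \<and> N (a n \<ominus> l) < \<epsilon>"
      by (intro exI[of _ "max M1 M2"]) simp
  qed
qed

end

text \<open>The free factor \<open>C\<close> allows an estimate to end in any fixed multiple of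
  \<epsilon>. Dividing by \<open>C + 1\<close> instead of \<open>C\<close> covers the case
  \<open>C = 0\<close>.\<close>

lemma real_le_epsilonI: "(\<And>\<epsilon>::real. 0 < \<epsilon> \<Longrightarrow> x \<le> y + C * \<epsilon>) \<Longrightarrow> 0 \<le> C \<Longrightarrow> x \<le> y"
proof (rule field_le_epsilon)
  fix e :: real assume a: "\<And>\<epsilon>::real. 0 < \<epsilon> \<Longrightarrow> x \<le> y + C * \<epsilon>" and C: "0 \<le> C" and e: "0 < e"
  have "C * (e / (C + 1)) \<le> e" using C e by (simp add: field_simps)
  then show "x \<le> y + e" using a[of "e / (C + 1)"] C e by simp
qed

sublocale cstar_algebra \<subseteq> normed_module A "cnorm A"
  by unfold_locales (auto simp: cnorm_nonneg cnorm_eq_0 cnorm_smult cnorm_add)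

sublocale hilbert_space \<subseteq> normed_module H "hnorm H"
proof
  interpret MS: Metric_space "carrier H" "norm_dist H (hnorm H)" by (rule Metric_space_hnorm)
  have dist0: "norm_dist H (hnorm H) x \<zero> = hnorm H x" if "x \<in> carrier H" for x
    using that by (simp add: norm_dist_def)
  show "0 \<le> hnorm H x" if "x \<in> carrier H" for x
    using that by (simp add: hnorm_def ip_self_nonneg)
  show "hnorm H x = 0 \<longleftrightarrow> x = \<zero>" if "x \<in> carrier H" for x
    using that MS.zero[of x \<zero>] dist0 by simp
  show smult: "hnorm H (c \<odot> x) = cmod c * hnorm H x" if x: "x \<in> carrier H" for c x
  proof (rule power2_eq_imp_eq)
    have "ip H (c \<odot> x) (c \<odot> x) = complex_of_real ((cmod c)\<^sup>2) * ip H x x"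
      using x by (simp only: ip_smult ip_smult_right smult_closed complex_norm_square
        complex_field_simps UNIV_I ac_simps)
    then show "(hnorm H (c \<odot> x))\<^sup>2 = (cmod c * hnorm H x)\<^sup>2"
      using x by (simp add: hnorm_sq power_mult_distrib)
  qed (use x in \<open>auto simp: hnorm_def ip_self_nonneg\<close>)
  show "hnorm H (x \<oplus> y) \<le> hnorm H x + hnorm H y" if x: "x \<in> carrier H" and y: "y \<in> carrier H" for x y
  proof -
    have "\<ominus> y = (-1) \<odot> y"
      using smult_l_minus[of 1 y] smult_one[of y] y by (simp add: complex_field_uminus)
    then have "hnorm H (\<ominus> y) = hnorm H y" using y by (simp add: smult)
    then show ?thesis
      using MS.triangle[of x \<zero> "\<ominus> y"] x y dist0[of x] dist0[of "\<ominus> y"]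
      by (simp add: norm_dist_def MS.commute[of \<zero>] M.minus_eq)
  qed
qed

section \<open>Operators on a Hilbert space\<close>

lemma linear_mapD:
  assumes "linear_map V W T"
  shows "x \<in> carrier V \<Longrightarrow> T x \<in> carrier W"
    and "\<lbrakk>x \<in> carrier V; y \<in> carrier V\<rbrakk> \<Longrightarrow> T (x \<oplus>\<^bsub>V\<^esub> y) = T x \<oplus>\<^bsub>W\<^esub> T y"
    and "x \<in> carrier V \<Longrightarrow> T (c \<odot>\<^bsub>V\<^esub> x) = c \<odot>\<^bsub>W\<^esub> T x"
  using assms by (auto simp: linear_map_def)

lemma linear_map_zero_minus:
  assumes V: "module complex_field V" and W: "module complex_field W" and T: "linear_map V W T"
  shows linear_map_zero: "T \<zero>\<^bsub>V\<^esub> = \<zero>\<^bsub>W\<^esub>"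
    and linear_map_minus:
      "\<lbrakk>x \<in> carrier V; y \<in> carrier V\<rbrakk> \<Longrightarrow> T (x \<ominus>\<^bsub>V\<^esub> y) = T x \<ominus>\<^bsub>W\<^esub> T y"
proof -
  interpret V: module complex_field V by (rule V)
  interpret W: module complex_field W by (rule W)
  show "T \<zero>\<^bsub>V\<^esub> = \<zero>\<^bsub>W\<^esub>"
    using linear_mapD(3)[OF T, of "\<zero>\<^bsub>V\<^esub>" 0] linear_mapD(1)[OF T, of "\<zero>\<^bsub>V\<^esub>"]
      V.smult_l_null[of "\<zero>\<^bsub>V\<^esub>"] W.smult_l_null[of "T \<zero>\<^bsub>V\<^esub>"] by simp
  show "T (x \<ominus>\<^bsub>V\<^esub> y) = T x \<ominus>\<^bsub>W\<^esub> T y" if x: "x \<in> carrier V" and y: "y \<in> carrier V" for x y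
  proof -
    have "T (x \<ominus>\<^bsub>V\<^esub> y) \<oplus>\<^bsub>W\<^esub> T y = T x"
      using linear_mapD(2)[OF T, of "x \<ominus>\<^bsub>V\<^esub> y" y] x y by simp
    then show ?thesis
      using W.minus_eq_iff[of "T x" "T y" "T (x \<ominus>\<^bsub>V\<^esub> y)"] linear_mapD(1)[OF T] x y by simp
  qed
qed

context hilbert_space
begin

lemma ip_uminus: "\<lbrakk>x \<in> carrier H; y \<in> carrier H\<rbrakk> \<Longrightarrow> ip H (\<ominus> x) y = - ip H x y"
  by (simp add: uminus_eq_smult ip_smult)

lemma ip_minus: "\<lbrakk>x \<in> carrier H; y \<in> carrier H; z \<in> carrier H\<rbrakk>
    \<Longrightarrow> ip H (x \<ominus> y) z = ip H x z - ip H y z"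
  by (simp add: M.minus_eq ip_add ip_uminus)

lemma ip_minus_right: "\<lbrakk>x \<in> carrier H; y \<in> carrier H; z \<in> carrier H\<rbrakk>
    \<Longrightarrow> ip H z (x \<ominus> y) = ip H z x - ip H z y"
  using ip_minus[of x y z] ip_commute[of "x \<ominus> y" z] ip_commute[of x z] ip_commute[of y z] by simp

lemma ip_self: "x \<in> carrier H \<Longrightarrow> ip H x x = complex_of_real ((hnorm H x)\<^sup>2)"
  using ip_self_real by (simp add: hnorm_sq)

lemma ip_right_cancel:
  assumes x: "x \<in> carrier H" and y: "y \<in> carrier H" and eq: "\<And>z. z \<in> carrier H \<Longrightarrow> ip H z x = ip H z y"
  shows "x = y"
proof -
  have "ip H (x \<ominus> y) (x \<ominus> y) = 0" using x y eq[of "x \<ominus> y"] by (simp add: ip_minus_right)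
  then have "hnorm H (x \<ominus> y) = 0" by (simp add: hnorm_def)
  then show ?thesis using x y by simp
qed

text \<open>The quadratic is evaluated at its minimum point, where it equals the constant term minus
  the square of \<open>b / a\<close>.\<close>

lemma quadratic_nonneg_imp_abs_le:
  fixes a b \<delta> :: real
  assumes "\<And>t. 0 \<le> \<delta>\<^sup>2 + 2 * t * b + t\<^sup>2 * a\<^sup>2" "0 \<le> \<delta>" "0 < a"
  shows "\<bar>b\<bar> \<le> \<delta> * a"
proof -
  have "0 \<le> \<delta>\<^sup>2 - b\<^sup>2 / a\<^sup>2"
    using assms(1)[of "- b / a\<^sup>2"] \<open>0 < a\<close> by (simp add: field_simps power2_eq_square)
  then have "\<bar>b\<bar>\<^sup>2 \<le> (\<delta> * a)\<^sup>2"
    using \<open>0 < a\<close> by (simp add: field_simps)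
  then show ?thesis by (rule power2_le_imp_le) (use assms in simp)
qed

text \<open>The representing vector is the limit of a minimizing sequence of \<open>\<parallel>x\<parallel>\<^sup>2 - 2 Re (f x)\<close>.\<close>

theorem Riesz_representation:
  assumes add: "\<And>x y. \<lbrakk>x \<in> carrier H; y \<in> carrier H\<rbrakk> \<Longrightarrow> f (x \<oplus> y) = f x + f y"
    and smult: "\<And>c x. x \<in> carrier H \<Longrightarrow> f (c \<odot> x) = c * f x"
    and bounded: "\<And>x. x \<in> carrier H \<Longrightarrow> cmod (f x) \<le> C * hnorm H x"
  obtains z where "z \<in> carrier H" "\<And>x. x \<in> carrier H \<Longrightarrow> f x = ip H x z"
proof -
  define \<Phi> where "\<Phi> x = (hnorm H x)\<^sup>2 - 2 * Re (f x)" for x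
  define m where "m = Inf (\<Phi> ` carrier H)"
  have "- C\<^sup>2 \<le> \<Phi> x" if "x \<in> carrier H" for x
  proof -
    have "Re (f x) \<le> C * hnorm H x" using bounded[OF that] complex_Re_le_cmod order_trans by blast
    moreover have "0 \<le> (hnorm H x - C)\<^sup>2" by simp
    ultimately show ?thesis by (simp add: \<Phi>_def power2_diff algebra_simps)
  qed
  then have bdd: "bdd_below (\<Phi> ` carrier H)" by (auto simp: bdd_below_def)
  have m: "m \<le> \<Phi> x" if "x \<in> carrier H" for x
    unfolding m_def using that bdd by (simp add: cInf_lower)
  \<comment> \<open>Approximate Euler equation: testing a near-minimiser \<open>u\<close> against
    all real perturbations along \<open>x\<close> shows that \<open>u\<close> represents the real
    part of \<open>f\<close> up to \<delta>. The defect is written as a square so that its root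
    appears linearly here.\<close>
  have near: "\<bar>Re (ip H x u) - Re (f x)\<bar> \<le> \<delta> * hnorm H x"
    if u: "u \<in> carrier H" "\<Phi> u \<le> m + \<delta>\<^sup>2" "0 \<le> \<delta>" and x: "x \<in> carrier H" for u \<delta> x
  proof (cases "x = \<zero>")
    case True
    then show ?thesis using u smult[of \<zero> 0] by (simp add: ip_zero_left)
  next
    case False
    have "0 \<le> \<delta>\<^sup>2 + 2 * t * (Re (ip H x u) - Re (f x)) + t\<^sup>2 * (hnorm H x)\<^sup>2" for t
    proof -
      have "\<Phi> (u \<oplus> of_real t \<odot> x) = \<Phi> u + 2 * t * (Re (ip H x u) - Re (f x)) + t\<^sup>2 * (hnorm H x)\<^sup>2"
      proof -
        have "(hnorm H (u \<oplus> of_real t \<odot> x))\<^sup>2 = (hnorm H u)\<^sup>2 + 2 * t * Re (ip H x u) + t\<^sup>2 * (hnorm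
          H x)\<^sup>2"
          using u x ip_commute[of x u]
          by (simp add: hnorm_sq ip_add ip_add_right ip_smult ip_smult_right)
            (simp add: power2_eq_square distrib_left)
        then show ?thesis using u x by (simp add: \<Phi>_def add smult algebra_simps)
      qed
      then show ?thesis using u x m[of "u \<oplus> of_real t \<odot> x"] by simp
    qed
    moreover have "0 < hnorm H x" using False x N_eq_0_iff[of x] N_nonneg[of x] by linarith
    ultimately show ?thesis using u(3) by (intro quadratic_nonneg_imp_abs_le) auto
  qed
  define \<delta> where "\<delta> n = inverse (real (Suc n))" for n
  have \<delta>: "0 < \<delta> n" for n by (simp add: \<delta>_def)
  have "\<exists>u\<in>carrier H. \<Phi> u \<le> m + (\<delta> n)\<^sup>2" for n
  proof -
    have lt: "Inf (\<Phi> ` carrier H) < m + (\<delta> n)\<^sup>2" using \<delta>[of n] by (simp add: m_def)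
    have ne: "\<Phi> ` carrier H \<noteq> {}" using M.zero_closed by auto
    obtain v where "v \<in> carrier H" "\<Phi> v < m + (\<delta> n)\<^sup>2"
      using cInf_lessD[OF ne lt] by auto
    then show ?thesis by (intro bexI[of _ v]) auto
  qed
  then obtain u where u: "\<And>n. u n \<in> carrier H" "\<And>n. \<Phi> (u n) \<le> m + (\<delta> n)\<^sup>2" by metis
  \<comment> \<open>Two near-minimisers represent almost the same functional. Inserting their own
    difference as the test vector and cancelling one factor of its norm gives the Cauchy
    estimate.\<close>
  have dist: "hnorm H (u i \<ominus> u j) \<le> \<delta> i + \<delta> j" for i j
  proof -
    let ?x = "u i \<ominus> u j"
    have x: "?x \<in> carrier H" using u by simp
    have "(hnorm H ?x)\<^sup>2 = Re (ip H ?x (u i)) - Re (ip H ?x (u j))"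
      using u x by (simp add: hnorm_sq ip_minus_right)
    also have "\<dots> \<le> (\<delta> i + \<delta> j) * hnorm H ?x"
      using near[OF u(1) u(2) less_imp_le[OF \<delta>] x, of i] near[OF u(1) u(2) less_imp_le[OF \<delta>] x, of j]
      by (simp add: algebra_simps)
    finally have le: "hnorm H ?x * hnorm H ?x \<le> (\<delta> i + \<delta> j) * hnorm H ?x"
      by (simp add: power2_eq_square)
    show ?thesis
    proof (cases "hnorm H ?x = 0")
      case True then show ?thesis using \<delta>[of i] \<delta>[of j] by simp
    next
      case False
      then have "0 < hnorm H ?x" using x N_nonneg[of ?x] by linarith
      then show ?thesis using le by simp
    qed
  qed
  obtain z where z: "z \<in> carrier H"
    and near_z: "\<And>\<epsilon>. 0 < \<epsilon> \<Longrightarrow> \<exists>n. \<delta> n < \<epsilon> \<and> hnorm H (u n \<ominus> z) < \<epsilon>"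
    using harmonic_Cauchy_convergent[OF complete, of u] u(1) dist unfolding \<delta>_def by blast
  have Re_eq: "Re (f x) = Re (ip H x z)" if x: "x \<in> carrier H" for x
  proof -
    have "\<bar>Re (ip H x z) - Re (f x)\<bar> \<le> 0 + 2 * hnorm H x * \<epsilon>" if \<epsilon>: "0 < \<epsilon>" for \<epsilon>
    proof -
      obtain n where n: "\<delta> n < \<epsilon>" "hnorm H (u n \<ominus> z) < \<epsilon>" using near_z[OF \<epsilon>] by blast
      have "\<bar>Re (ip H x (u n \<ominus> z))\<bar> \<le> hnorm H x * hnorm H (u n \<ominus> z)"
        using Cauchy_Schwarz[of x "u n \<ominus> z"] abs_Re_le_cmod[of "ip H x (u n \<ominus> z)"] x u z by simp
      also have "\<dots> \<le> hnorm H x * \<epsilon>" using n x by (intro mult_left_mono) auto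
      finally have 1: "\<bar>Re (ip H x (u n)) - Re (ip H x z)\<bar> \<le> hnorm H x * \<epsilon>"
        using x u z by (simp add: ip_minus_right)
      have "\<bar>Re (ip H x (u n)) - Re (f x)\<bar> \<le> \<delta> n * hnorm H x"
        using near[OF u(1) u(2) less_imp_le[OF \<delta>] x] .
      also have "\<dots> \<le> hnorm H x * \<epsilon>" using n x by (simp add: mult.commute mult_right_mono)
      finally show ?thesis using 1 by linarith
    qed
    then have "\<bar>Re (ip H x z) - Re (f x)\<bar> \<le> 0"
      using x by (intro real_le_epsilonI[of _ 0 "2 * hnorm H x"]) auto
    then show ?thesis by simp
  qed
  have "f x = ip H x z" if x: "x \<in> carrier H" for x
  proof (rule complex_eqI)
    show "Re (f x) = Re (ip H x z)" using Re_eq x by simp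
    \<comment> \<open>The real parts at \<open>\<i> \<odot> x\<close> encode the imaginary parts at
      \<open>x\<close>.\<close>
    show "Im (f x) = Im (ip H x z)"
      using Re_eq[of "\<i> \<odot> x"] x z by (simp add: smult ip_smult)
  qed
  then show ?thesis using that z by blast
qed

section \<open>Bounded operators, the operator norm and adjoints\<close>

lemma bounded_operatorI:
  assumes "\<And>x. x \<in> carrier H \<Longrightarrow> T x \<in> carrier H"
    and "\<And>x y. \<lbrakk>x \<in> carrier H; y \<in> carrier H\<rbrakk> \<Longrightarrow> T (x \<oplus> y) = T x \<oplus> T y"
    and "\<And>c x. x \<in> carrier H \<Longrightarrow> T (c \<odot> x) = c \<odot> T x"
    and "\<And>x. x \<in> carrier H \<Longrightarrow> hnorm H (T x) \<le> C * hnorm H x"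
  shows "bounded_operator H T"
proof -
  have "\<exists>C. \<forall>x\<in>carrier H. hnorm H (T x) \<le> C * hnorm H x"
    by (rule exI[of _ C]) (use assms(4) in simp)
  then show ?thesis using assms(1-3) by (simp add: bounded_operator_def linear_map_def)
qed

lemma bounded_operatorD:
  assumes "bounded_operator H T"
  shows "x \<in> carrier H \<Longrightarrow> T x \<in> carrier H"
    and "\<lbrakk>x \<in> carrier H; y \<in> carrier H\<rbrakk> \<Longrightarrow> T (x \<oplus> y) = T x \<oplus> T y"
    and "x \<in> carrier H \<Longrightarrow> T (c \<odot> x) = c \<odot> T x"
    and "T \<zero> = \<zero>"
    and "\<lbrakk>x \<in> carrier H; y \<in> carrier H\<rbrakk> \<Longrightarrow> T (x \<ominus> y) = T x \<ominus> T y"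
proof -
  have lin: "linear_map H H T" using assms by (simp add: bounded_operator_def)
  show "x \<in> carrier H \<Longrightarrow> T x \<in> carrier H"
    and "\<lbrakk>x \<in> carrier H; y \<in> carrier H\<rbrakk> \<Longrightarrow> T (x \<oplus> y) = T x \<oplus> T y"
    and "x \<in> carrier H \<Longrightarrow> T (c \<odot> x) = c \<odot> T x"
    using linear_mapD[OF lin] by auto
  show "T \<zero> = \<zero>" by (rule linear_map_zero[OF module_axioms module_axioms lin])
  show "T (x \<ominus> y) = T x \<ominus> T y" if "x \<in> carrier H" "y \<in> carrier H"
    by (rule linear_map_minus[OF module_axioms module_axioms lin that])
qed

lemma bounded_operator_bound:
  assumes "bounded_operator H T"
  obtains C where "0 \<le> C" "\<And>x. x \<in> carrier H \<Longrightarrow> hnorm H (T x) \<le> C * hnorm H x"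
proof -
  obtain C where C: "\<And>x. x \<in> carrier H \<Longrightarrow> hnorm H (T x) \<le> C * hnorm H x"
    using assms by (auto simp: bounded_operator_def)
  show ?thesis
  proof (rule that[of "\<bar>C\<bar>"])
    show "hnorm H (T x) \<le> \<bar>C\<bar> * hnorm H x" if "x \<in> carrier H" for x
      using C[OF that] mult_right_mono[OF abs_ge_self[of C], of "hnorm H x"] that by fastforce
  qed simp
qed

lemma bounded_operator_cong:
  "(\<And>x. x \<in> carrier H \<Longrightarrow> S x = T x) \<Longrightarrow> bounded_operator H S \<longleftrightarrow> bounded_operator H T"
  by (auto simp: bounded_operator_def linear_map_def Pi_def)

lemma operator_norm_upper:
  assumes T: "bounded_operator H T" and x: "x \<in> carrier H" "hnorm H x \<le> 1"
  shows "hnorm H (T x) \<le> operator_norm H T"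
proof -
  obtain C where C: "0 \<le> C" "\<And>x. x \<in> carrier H \<Longrightarrow> hnorm H (T x) \<le> C * hnorm H x"
    using bounded_operator_bound[OF T] by blast
  have "bdd_above {hnorm H (T x) |x. x \<in> carrier H \<and> hnorm H x \<le> 1}"
  proof (rule bdd_aboveI[of _ C])
    fix r assume "r \<in> {hnorm H (T x) |x. x \<in> carrier H \<and> hnorm H x \<le> 1}"
    then obtain x where "x \<in> carrier H" "hnorm H x \<le> 1" "r = hnorm H (T x)" by blast
    then show "r \<le> C" using C(2)[of x] mult_left_le[of "hnorm H x" C] C(1) by linarith
  qed
  moreover have "hnorm H (T x) \<in> {hnorm H (T x) |x. x \<in> carrier H \<and> hnorm H x \<le> 1}"
    using x by blast
  ultimately show ?thesis unfolding operator_norm_def by (intro cSup_upper)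
qed

lemma hnorm_le_operator_norm:
  assumes T: "bounded_operator H T" and x: "x \<in> carrier H"
  shows "hnorm H (T x) \<le> operator_norm H T * hnorm H x"
proof (cases "x = \<zero>")
  case True
  then show ?thesis using bounded_operatorD(4)[OF T] by simp
next
  case False
  have pos: "0 < hnorm H x" using False x N_eq_0_iff[of x] N_nonneg[of x] by linarith
  let ?y = "complex_of_real (1 / hnorm H x) \<odot> x"
  have y: "?y \<in> carrier H" "hnorm H ?y \<le> 1" using x pos by (simp_all add: norm_divide)
  then have "hnorm H (T ?y) \<le> operator_norm H T"
    by (rule operator_norm_upper[OF T])
  moreover have "hnorm H (T ?y) = hnorm H (T x) / hnorm H x"
    using bounded_operatorD(1,3)[OF T x] x pos by (simp add: norm_divide)
  ultimately show ?thesis using pos by (simp add: pos_divide_le_eq)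
qed

lemma operator_norm_le:
  assumes "0 \<le> C" "\<And>x. x \<in> carrier H \<Longrightarrow> hnorm H (T x) \<le> C * hnorm H x"
  shows "operator_norm H T \<le> C"
  unfolding operator_norm_def
proof (rule cSup_least)
  have "hnorm H \<zero> \<le> 1" "\<zero> \<in> carrier H" by simp_all
  then show "{hnorm H (T x) |x. x \<in> carrier H \<and> hnorm H x \<le> 1} \<noteq> {}" by blast
  fix r assume "r \<in> {hnorm H (T x) |x. x \<in> carrier H \<and> hnorm H x \<le> 1}"
  then obtain x where x: "x \<in> carrier H" "hnorm H x \<le> 1" and r: "r = hnorm H (T x)" by blast
  have "r \<le> C * hnorm H x" using assms(2)[OF x(1)] r by simp
  also have "\<dots> \<le> C" using mult_left_le[OF x(2) assms(1)] .
  finally show "r \<le> C" .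
qed

lemma operator_norm_nonneg: "bounded_operator H T \<Longrightarrow> 0 \<le> operator_norm H T"
  using operator_norm_upper[of T \<zero>] bounded_operatorD(4)[of T] by simp

lemma adjoint_op_eqI:
  assumes "S \<in> extensional (carrier H)" "bounded_operator H S"
    and "\<And>x y. \<lbrakk>x \<in> carrier H; y \<in> carrier H\<rbrakk> \<Longrightarrow> ip H (T x) y = ip H x (S y)"
  shows "adjoint_op H T = S"
  unfolding adjoint_op_def
proof (rule the_equality)
  fix S' assume S': "S' \<in> extensional (carrier H) \<and> bounded_operator H S' \<and>
     (\<forall>x\<in>carrier H. \<forall>y\<in>carrier H. ip H (T x) y = ip H x (S' y))"
  show "S' = S"
  proof (rule extensionalityI)
    fix y assume y: "y \<in> carrier H"
    show "S' y = S y"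
    proof (rule ip_right_cancel)
      fix z assume z: "z \<in> carrier H"
      show "ip H z (S' y) = ip H z (S y)" using S' assms(3)[OF z y] y z by auto
    qed (use S' assms y bounded_operatorD(1) in blast)+
  qed (use S' assms in auto)
qed (use assms in auto)

text \<open>Cauchy-Schwarz bounds the squared norm of \<open>S y\<close> by \<open>C\<close> times
  the norms of \<open>S y\<close> and \<open>y\<close>, and one factor cancels. Only the adjoint
  relation is required of \<open>S\<close>, so the bound is available while the adjoint is still
  being built, and later for the image of a starred element.\<close>

lemma adjoint_bound:
  assumes T: "bounded_operator H T" and C: "0 \<le> C" "\<And>x. x \<in> carrier H \<Longrightarrow> hnorm H (T x) \<le> C * hnorm H x"
    and S: "\<And>y. y \<in> carrier H \<Longrightarrow> S y \<in> carrier H"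
      "\<And>x y. \<lbrakk>x \<in> carrier H; y \<in> carrier H\<rbrakk> \<Longrightarrow> ip H (T x) y = ip H x (S y)"
    and y: "y \<in> carrier H"
  shows "hnorm H (S y) \<le> C * hnorm H y"
proof (cases "hnorm H (S y) = 0")
  case True then show ?thesis using C y by simp
next
  case False
  then have pos: "0 < hnorm H (S y)" using S(1)[OF y] N_nonneg[of "S y"] by linarith
  have "(hnorm H (S y))\<^sup>2 = Re (ip H (T (S y)) y)" using S y by (simp add: hnorm_sq)
  also have "\<dots> \<le> hnorm H (T (S y)) * hnorm H y"
    using Cauchy_Schwarz[of "T (S y)" y] complex_Re_le_cmod[of "ip H (T (S y)) y"]
      bounded_operatorD(1)[OF T] S(1) y by fastforce
  also have "\<dots> \<le> (C * hnorm H (S y)) * hnorm H y"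
    using C(2)[of "S y"] S(1) y by (intro mult_right_mono) auto
  finally have "hnorm H (S y) * hnorm H (S y) \<le> (C * hnorm H y) * hnorm H (S y)"
    by (simp add: power2_eq_square algebra_simps)
  then show ?thesis using pos by simp
qed

text \<open>Riesz representation of the functional that takes \<open>x\<close> to the inner product
  of \<open>T x\<close> with \<open>y\<close>. Linearity of the resulting map follows because inner
  products determine vectors.\<close>

lemma adjoint_exists:
  assumes T: "bounded_operator H T"
  shows "\<exists>S. S \<in> extensional (carrier H) \<and> bounded_operator H S \<and>
     (\<forall>x\<in>carrier H. \<forall>y\<in>carrier H. ip H (T x) y = ip H x (S y))"
proof -
  obtain C where C: "0 \<le> C" "\<And>x. x \<in> carrier H \<Longrightarrow> hnorm H (T x) \<le> C * hnorm H x"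
    using bounded_operator_bound[OF T] by blast
  note TD = bounded_operatorD[OF T]
  have "\<exists>z\<in>carrier H. \<forall>x\<in>carrier H. ip H (T x) y = ip H x z" if y: "y \<in> carrier H" for y
  proof -
    have "cmod (ip H (T x) y) \<le> (C * hnorm H y) * hnorm H x" if x: "x \<in> carrier H" for x
    proof -
      have "cmod (ip H (T x) y) \<le> hnorm H (T x) * hnorm H y" using Cauchy_Schwarz TD x y by simp
      also have "\<dots> \<le> (C * hnorm H x) * hnorm H y" using C x y by (intro mult_right_mono) auto
      finally show ?thesis by (simp add: algebra_simps)
    qed
    note bound = this
    obtain z where "z \<in> carrier H" "\<And>x. x \<in> carrier H \<Longrightarrow> ip H (T x) y = ip H x z"
      by (rule Riesz_representation[of "\<lambda>x. ip H (T x) y" "C * hnorm H y"])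
        (use TD y bound in \<open>simp_all add: ip_add ip_smult\<close>)
    then show ?thesis by blast
  qed
  then obtain S where S: "\<And>y. y \<in> carrier H \<Longrightarrow> S y \<in> carrier H"
      "\<And>x y. \<lbrakk>x \<in> carrier H; y \<in> carrier H\<rbrakk> \<Longrightarrow> ip H (T x) y = ip H x (S y)" by metis
  have "bounded_operator H S"
  proof (rule bounded_operatorI)
    show "S (x \<oplus> y) = S x \<oplus> S y" if "x \<in> carrier H" "y \<in> carrier H" for x y
      using that S TD(1) by (intro ip_right_cancel) (auto simp: ip_add_right simp flip: S(2))
    show "S (c \<odot> x) = c \<odot> S x" if "x \<in> carrier H" for c x
      using that S TD(1) by (intro ip_right_cancel) (auto simp: ip_smult_right simp flip: S(2))
    show "hnorm H (S y) \<le> C * hnorm H y" if "y \<in> carrier H" for y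
      using adjoint_bound[OF T C S that] .
  qed (use S in auto)
  then have "bounded_operator H (restrict S (carrier H))"
    by (subst bounded_operator_cong[of _ S]) auto
  then show ?thesis using S by (intro exI[of _ "restrict S (carrier H)"]) auto
qed

lemma adjoint_op:
  assumes "bounded_operator H T"
  shows "adjoint_op H T \<in> extensional (carrier H)" "bounded_operator H (adjoint_op H T)"
    and "\<lbrakk>x \<in> carrier H; y \<in> carrier H\<rbrakk> \<Longrightarrow> ip H (T x) y = ip H x (adjoint_op H T y)"
proof -
  obtain S where S: "S \<in> extensional (carrier H)" "bounded_operator H S"
     "\<And>x y. \<lbrakk>x \<in> carrier H; y \<in> carrier H\<rbrakk> \<Longrightarrow> ip H (T x) y = ip H x (S y)"
    using adjoint_exists[OF assms] by blast
  have "adjoint_op H T = S" by (rule adjoint_op_eqI[OF S])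
  then show "adjoint_op H T \<in> extensional (carrier H)" "bounded_operator H (adjoint_op H T)"
    and "\<lbrakk>x \<in> carrier H; y \<in> carrier H\<rbrakk> \<Longrightarrow> ip H (T x) y = ip H x (adjoint_op H T y)"
    using S by auto
qed

lemma adjoint_op_right:
  assumes "bounded_operator H T" "x \<in> carrier H" "y \<in> carrier H"
  shows "ip H x (T y) = ip H (adjoint_op H T x) y"
  using adjoint_op(3)[OF assms(1) assms(3) assms(2)] assms
    ip_commute[of "T y" x] ip_commute[of y "adjoint_op H T x"]
    bounded_operatorD(1)[OF assms(1)] bounded_operatorD(1)[OF adjoint_op(2)[OF assms(1)]]
  by simp

end

section \<open>The C*-algebra of bounded operators\<close>

lemma bounded_operators_carrier:
  "T \<in> carrier (bounded_operators H) \<longleftrightarrow> T \<in> extensional (carrier H) \<and> bounded_operator H T"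
  by (simp add: bounded_operators_def)

lemma bounded_operators_apply [simp]:
  assumes "x \<in> carrier H"
  shows "(S \<otimes>\<^bsub>bounded_operators H\<^esub> T) x = S (T x)"
    and "(S \<oplus>\<^bsub>bounded_operators H\<^esub> T) x = S x \<oplus>\<^bsub>H\<^esub> T x"
    and "\<zero>\<^bsub>bounded_operators H\<^esub> x = \<zero>\<^bsub>H\<^esub>"
    and "(c \<odot>\<^bsub>bounded_operators H\<^esub> T) x = c \<odot>\<^bsub>H\<^esub> T x"
  using assms by (simp_all add: bounded_operators_def compose_def)

lemma star_bounded_operators [simp]: "star (bounded_operators H) = adjoint_op H"
  and cnorm_bounded_operators [simp]: "cnorm (bounded_operators H) = operator_norm H"
  by (simp_all add: bounded_operators_def)

context hilbert_space
begin

abbreviation B where "B \<equiv> bounded_operators H"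

lemma operatorD:
  assumes "T \<in> carrier B"
  shows "bounded_operator H T" "T \<in> extensional (carrier H)"
    and "x \<in> carrier H \<Longrightarrow> T x \<in> carrier H"
    and "\<lbrakk>x \<in> carrier H; y \<in> carrier H\<rbrakk> \<Longrightarrow> T (x \<oplus> y) = T x \<oplus> T y"
    and "x \<in> carrier H \<Longrightarrow> T (c \<odot> x) = c \<odot> T x"
    and "T \<zero> = \<zero>"
    and "\<lbrakk>x \<in> carrier H; y \<in> carrier H\<rbrakk> \<Longrightarrow> T (x \<ominus> y) = T x \<ominus> T y"
  using assms bounded_operatorD[of T] by (simp_all add: bounded_operators_carrier)

lemma operatorI:
  "\<lbrakk>T \<in> extensional (carrier H); bounded_operator H T\<rbrakk> \<Longrightarrow> T \<in> carrier B"
  by (simp add: bounded_operators_carrier)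

lemma operator_bound:
  assumes "T \<in> carrier B"
  obtains C where "0 \<le> C" "\<And>x. x \<in> carrier H \<Longrightarrow> hnorm H (T x) \<le> C * hnorm H x"
  using bounded_operator_bound[of T] assms by (auto simp: bounded_operators_carrier)

lemma operator_eqI:
  "\<lbrakk>S \<in> carrier B; T \<in> carrier B; \<And>x. x \<in> carrier H \<Longrightarrow> S x = T x\<rbrakk> \<Longrightarrow> S = T"
  by (rule extensionalityI[of _ "carrier H"]) (auto simp: bounded_operators_carrier)

lemma operator_zero: "\<zero>\<^bsub>B\<^esub> \<in> carrier B"
  by (intro operatorI bounded_operatorI[of _ 0]) (simp_all add: bounded_operators_def)

lemma operator_add:
  assumes S: "S \<in> carrier B" and T: "T \<in> carrier B"
  shows "S \<oplus>\<^bsub>B\<^esub> T \<in> carrier B"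
proof -
  obtain C where C: "0 \<le> C" "\<And>x. x \<in> carrier H \<Longrightarrow> hnorm H (S x) \<le> C * hnorm H x"
    using operator_bound[OF S] by blast
  obtain D where D: "0 \<le> D" "\<And>x. x \<in> carrier H \<Longrightarrow> hnorm H (T x) \<le> D * hnorm H x"
    using operator_bound[OF T] by blast
  show ?thesis
  proof (intro operatorI bounded_operatorI[of _ "C + D"])
    show "S \<oplus>\<^bsub>B\<^esub> T \<in> extensional (carrier H)" by (simp add: bounded_operators_def)
    show "hnorm H ((S \<oplus>\<^bsub>B\<^esub> T) x) \<le> (C + D) * hnorm H x" if x: "x \<in> carrier H" for x
      using N_add[of "S x" "T x"] C(2)[OF x] D(2)[OF x] operatorD(3)[OF S x] operatorD(3)[OF T x] x
      by (simp add: algebra_simps)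
    show "(S \<oplus>\<^bsub>B\<^esub> T) (x \<oplus> y) = (S \<oplus>\<^bsub>B\<^esub> T) x \<oplus> (S \<oplus>\<^bsub>B\<^esub> T) y"
      if "x \<in> carrier H" "y \<in> carrier H" for x y
      using that by (simp add: operatorD[OF S] operatorD[OF T] M.a_ac)
  qed (simp_all add: operatorD[OF S] operatorD[OF T] smult_r_distr)
qed

lemma operator_smult:
  assumes T: "T \<in> carrier B"
  shows "c \<odot>\<^bsub>B\<^esub> T \<in> carrier B"
proof -
  obtain D where D: "0 \<le> D" "\<And>x. x \<in> carrier H \<Longrightarrow> hnorm H (T x) \<le> D * hnorm H x"
    using operator_bound[OF T] by blast
  show ?thesis
  proof (intro operatorI bounded_operatorI[of _ "cmod c * D"])
    show "c \<odot>\<^bsub>B\<^esub> T \<in> extensional (carrier H)" by (simp add: bounded_operators_def)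
    show "hnorm H ((c \<odot>\<^bsub>B\<^esub> T) x) \<le> cmod c * D * hnorm H x" if x: "x \<in> carrier H" for x
      using D(2)[OF x] x mult_left_mono[OF D(2)[OF x], of "cmod c"]
      by (simp add: operatorD[OF T] mult.assoc)
    show "(c \<odot>\<^bsub>B\<^esub> T) (d \<odot> x) = d \<odot> (c \<odot>\<^bsub>B\<^esub> T) x" if x: "x \<in> carrier H" for d x
      using x smult_assoc1[of c d "T x"] smult_assoc1[of d c "T x"]
      by (simp add: operatorD[OF T] mult.commute)
  qed (simp_all add: operatorD[OF T] smult_r_distr)
qed

lemma operator_mult:
  assumes S: "S \<in> carrier B" and T: "T \<in> carrier B"
  shows "S \<otimes>\<^bsub>B\<^esub> T \<in> carrier B"
proof -
  obtain C where C: "0 \<le> C" "\<And>x. x \<in> carrier H \<Longrightarrow> hnorm H (S x) \<le> C * hnorm H x"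
    using operator_bound[OF S] by blast
  obtain D where D: "0 \<le> D" "\<And>x. x \<in> carrier H \<Longrightarrow> hnorm H (T x) \<le> D * hnorm H x"
    using operator_bound[OF T] by blast
  show ?thesis
  proof (intro operatorI bounded_operatorI[of _ "C * D"])
    show "S \<otimes>\<^bsub>B\<^esub> T \<in> extensional (carrier H)" by (simp add: bounded_operators_def)
    show "hnorm H ((S \<otimes>\<^bsub>B\<^esub> T) x) \<le> C * D * hnorm H x" if x: "x \<in> carrier H" for x
      using C(2)[of "T x"] mult_left_mono[OF D(2)[OF x] C(1)] x
      by (simp add: operatorD[OF T] mult.assoc)
  qed (simp_all add: operatorD[OF S] operatorD[OF T])
qed

lemma operator_star: "T \<in> carrier B \<Longrightarrow> adjoint_op H T \<in> carrier B"
  using adjoint_op[of T] by (simp add: bounded_operators_carrier)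

lemma ip_adjoint:
  assumes "T \<in> carrier B" "x \<in> carrier H" "y \<in> carrier H"
  shows "ip H x (adjoint_op H T y) = ip H (T x) y" "ip H (adjoint_op H T x) y = ip H x (T y)"
  using adjoint_op(3)[of T x y] adjoint_op_right[of T x y] assms
  by (simp_all add: bounded_operators_carrier)

lemma adjointI:
  assumes "T \<in> carrier B" "S \<in> carrier B"
    and "\<And>x y. \<lbrakk>x \<in> carrier H; y \<in> carrier H\<rbrakk> \<Longrightarrow> ip H (T x) y = ip H x (S y)"
  shows "adjoint_op H T = S"
  by (rule adjoint_op_eqI) (use assms in \<open>auto simp: bounded_operators_carrier\<close>)

lemma operator_norm_bound:
  "\<lbrakk>T \<in> carrier B; x \<in> carrier H\<rbrakk> \<Longrightarrow> hnorm H (T x) \<le> operator_norm H T * hnorm H x"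
  by (rule hnorm_le_operator_norm) (simp_all add: bounded_operators_carrier)

lemma abelian_group_operators: "abelian_group B"
proof (rule abelian_groupI)
  show "S \<oplus>\<^bsub>B\<^esub> T \<in> carrier B" if "S \<in> carrier B" "T \<in> carrier B" for S T
    using that by (rule operator_add)
  show "\<zero>\<^bsub>B\<^esub> \<in> carrier B" by (rule operator_zero)
  show "(S \<oplus>\<^bsub>B\<^esub> T) \<oplus>\<^bsub>B\<^esub> U = S \<oplus>\<^bsub>B\<^esub> (T \<oplus>\<^bsub>B\<^esub> U)"
    if "S \<in> carrier B" "T \<in> carrier B" "U \<in> carrier B" for S T U
    by (rule operator_eqI) (simp_all add: operator_add that operatorD(3)[OF that(1)]
        operatorD(3)[OF that(2)] operatorD(3)[OF that(3)] M.a_assoc)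
  show "S \<oplus>\<^bsub>B\<^esub> T = T \<oplus>\<^bsub>B\<^esub> S" if "S \<in> carrier B" "T \<in> carrier B" for S T
    by (rule operator_eqI) (simp_all add: operator_add that operatorD(3)[OF that(1)]
        operatorD(3)[OF that(2)] M.a_comm)
  show "\<zero>\<^bsub>B\<^esub> \<oplus>\<^bsub>B\<^esub> T = T" if "T \<in> carrier B" for T
    by (rule operator_eqI) (simp_all add: operator_add operator_zero that operatorD(3)[OF that])
  show "\<exists>S\<in>carrier B. S \<oplus>\<^bsub>B\<^esub> T = \<zero>\<^bsub>B\<^esub>" if T: "T \<in> carrier B" for T
  proof (rule bexI[of _ "(-1) \<odot>\<^bsub>B\<^esub> T"])
    show "(-1) \<odot>\<^bsub>B\<^esub> T \<oplus>\<^bsub>B\<^esub> T = \<zero>\<^bsub>B\<^esub>"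
      by (rule operator_eqI)
        (simp_all add: operator_add operator_smult operator_zero T operatorD(3)[OF T] M.l_neg
          flip: uminus_eq_smult)
  qed (rule operator_smult[OF T])
qed

lemma module_operators: "module complex_field B"
proof (rule moduleI)
  show "cring complex_field" by (rule cring_complex_field)
  show "abelian_group B" by (rule abelian_group_operators)
  show "c \<odot>\<^bsub>B\<^esub> T \<in> carrier B" if "T \<in> carrier B" for c T
    using that by (rule operator_smult)
  show "(c \<oplus>\<^bsub>complex_field\<^esub> d) \<odot>\<^bsub>B\<^esub> T = c \<odot>\<^bsub>B\<^esub> T \<oplus>\<^bsub>B\<^esub> d \<odot>\<^bsub>B\<^esub> T" if T: "T \<in> carrier B" for c d T
    by (rule operator_eqI)
      (simp_all add: operator_add operator_smult T operatorD(3)[OF T] smult_l_distr[simplified])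
  show "c \<odot>\<^bsub>B\<^esub> (S \<oplus>\<^bsub>B\<^esub> T) = c \<odot>\<^bsub>B\<^esub> S \<oplus>\<^bsub>B\<^esub> c \<odot>\<^bsub>B\<^esub> T"
    if "S \<in> carrier B" "T \<in> carrier B" for c S T
    by (rule operator_eqI)
      (simp_all add: operator_add operator_smult that operatorD(3)[OF that(1)] operatorD(3)[OF that(2)]
        smult_r_distr)
  show "(c \<otimes>\<^bsub>complex_field\<^esub> d) \<odot>\<^bsub>B\<^esub> T = c \<odot>\<^bsub>B\<^esub> (d \<odot>\<^bsub>B\<^esub> T)" if T: "T \<in> carrier B" for c d T
    by (rule operator_eqI)
      (simp_all add: operator_smult T operatorD(3)[OF T] smult_assoc1[simplified])
  show "\<one>\<^bsub>complex_field\<^esub> \<odot>\<^bsub>B\<^esub> T = T" if T: "T \<in> carrier B" for T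
    using smult_one by (intro operator_eqI) (simp_all add: operator_smult T operatorD(3)[OF T])
qed

lemma normed_module_operators: "normed_module B (operator_norm H)"
proof (intro normed_module.intro normed_module_axioms.intro)
  show "module complex_field B" by (rule module_operators)
  show "0 \<le> operator_norm H T" if "T \<in> carrier B" for T
    using that operator_norm_nonneg by (simp add: bounded_operators_carrier)
  show "operator_norm H T = 0 \<longleftrightarrow> T = \<zero>\<^bsub>B\<^esub>" if T: "T \<in> carrier B" for T
  proof
    assume 0: "operator_norm H T = 0"
    have "hnorm H (T x) = 0" if x: "x \<in> carrier H" for x
      using operator_norm_bound[OF T x] 0 N_nonneg[OF operatorD(3)[OF T x]] by simp
    then show "T = \<zero>\<^bsub>B\<^esub>"
      by (intro operator_eqI) (simp_all add: T operator_zero operatorD(3)[OF T])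
  next
    assume "T = \<zero>\<^bsub>B\<^esub>"
    then have "operator_norm H T \<le> 0" by (intro operator_norm_le) simp_all
    then show "operator_norm H T = 0"
      using operatorD(1)[OF T] operator_norm_nonneg[of T] by simp
  qed
  have le: "operator_norm H (c \<odot>\<^bsub>B\<^esub> T) \<le> cmod c * operator_norm H T" if T: "T \<in> carrier B" for c T
    using operator_norm_nonneg[OF operatorD(1)[OF T]] mult_left_mono[OF operator_norm_bound[OF T],
      of _ "cmod c"]
    by (intro operator_norm_le) (simp_all add: operatorD(3)[OF T] mult.assoc)
  show "operator_norm H (c \<odot>\<^bsub>B\<^esub> T) = cmod c * operator_norm H T" if T: "T \<in> carrier B" for c T
  proof (cases "c = 0")
    case True
    then show ?thesis
      using le[OF T, of c] operator_norm_nonneg[OF operatorD(1)[OF operator_smult[OF T, of c]]] by simp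
  next
    case False
    have "(1 / c) \<odot>\<^bsub>B\<^esub> (c \<odot>\<^bsub>B\<^esub> T) = T"
      using False smult_assoc1[of "1 / c" c] smult_one
      by (intro operator_eqI) (simp_all add: operator_smult T operatorD(3)[OF T])
    then have "operator_norm H T \<le> cmod (1 / c) * operator_norm H (c \<odot>\<^bsub>B\<^esub> T)"
      using le[OF operator_smult[OF T, of c], of "1 / c"] by simp
    then have "cmod c * operator_norm H T \<le> operator_norm H (c \<odot>\<^bsub>B\<^esub> T)"
      using False by (simp add: norm_divide field_simps)
    then show ?thesis using le[OF T, of c] by simp
  qed
  show "operator_norm H (S \<oplus>\<^bsub>B\<^esub> T) \<le> operator_norm H S + operator_norm H T"
    if S: "S \<in> carrier B" and T: "T \<in> carrier B" for S T
  proof (rule operator_norm_le)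
    show "0 \<le> operator_norm H S + operator_norm H T"
      using operator_norm_nonneg operatorD(1)[OF S] operatorD(1)[OF T] by (simp add: add_nonneg_nonneg)
    show "hnorm H ((S \<oplus>\<^bsub>B\<^esub> T) x) \<le> (operator_norm H S + operator_norm H T) * hnorm H x"
      if x: "x \<in> carrier H" for x
      using N_add[OF operatorD(3)[OF S x] operatorD(3)[OF T x]]
        operator_norm_bound[OF S x] operator_norm_bound[OF T x] x
      by (simp add: algebra_simps)
  qed
qed

lemma operator_minus:
  assumes S: "S \<in> carrier B" and T: "T \<in> carrier B" and x: "x \<in> carrier H"
  shows "(S \<ominus>\<^bsub>B\<^esub> T) x = S x \<ominus> T x"
proof -
  interpret B: normed_module B "operator_norm H" by (rule normed_module_operators)
  show ?thesis
    using x operatorD(3)[OF T x]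
    by (simp add: B.minus_eq B.uminus_eq_smult T uminus_eq_smult M.minus_eq)
qed

text \<open>The Cauchy condition is uniform over the vectors of bounded norm, so the pointwise limit
  is approached at the same rate. That uniformity yields both boundedness of the limit and
  convergence in operator norm.\<close>

lemma norm_complete_operators: "norm_complete B (operator_norm H)"
proof -
  interpret B: normed_module B "operator_norm H" by (rule normed_module_operators)
  have "\<exists>l\<in>carrier B. \<forall>\<epsilon>>0. \<exists>M. \<forall>n\<ge>M. operator_norm H (f n \<ominus>\<^bsub>B\<^esub> l) < \<epsilon>"
    if f: "\<And>n. f n \<in> carrier B"
      and cauchy: "\<And>\<epsilon>. 0 < \<epsilon> \<Longrightarrow> \<exists>M. \<forall>m\<ge>M. \<forall>n\<ge>M. operator_norm H (f m \<ominus>\<^bsub>B\<^esub> f n) < \<epsilon>"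
    for f :: "nat \<Rightarrow> _"
  proof -
    have uniform: "\<exists>M. \<forall>m\<ge>M. \<forall>n\<ge>M. \<forall>x\<in>carrier H. hnorm H (f m x \<ominus> f n x) \<le> \<epsilon> * hnorm H x"
      if \<epsilon>: "0 < \<epsilon>" for \<epsilon>
    proof -
      obtain M where M: "\<And>m n. m \<ge> M \<Longrightarrow> n \<ge> M \<Longrightarrow> operator_norm H (f m \<ominus>\<^bsub>B\<^esub> f n) < \<epsilon>"
        using cauchy[OF \<epsilon>] by blast
      have "hnorm H (f m x \<ominus> f n x) \<le> \<epsilon> * hnorm H x"
        if mn: "m \<ge> M" "n \<ge> M" and x: "x \<in> carrier H" for m n x
      proof -
        have "hnorm H (f m x \<ominus> f n x) \<le> operator_norm H (f m \<ominus>\<^bsub>B\<^esub> f n) * hnorm H x"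
          using operator_norm_bound[OF B.M.minus_closed[OF f f] x, of m n]
            by (simp add: operator_minus f x)
        also have "\<dots> \<le> \<epsilon> * hnorm H x"
          using M[OF mn] x by (intro mult_right_mono) auto
        finally show ?thesis .
      qed
      then show ?thesis by blast
    qed
    have "\<exists>l\<in>carrier H. \<forall>\<epsilon>>0. \<exists>M. \<forall>n\<ge>M. hnorm H (f n x \<ominus> l) < \<epsilon>" if x: "x \<in> carrier H" for x
    proof -
      have "\<exists>M. \<forall>m\<ge>M. \<forall>n\<ge>M. hnorm H (f m x \<ominus> f n x) < \<epsilon>" if \<epsilon>: "0 < \<epsilon>" for \<epsilon>
      proof -
        have pos: "0 < \<epsilon> / (hnorm H x + 1)" using \<epsilon> x by (simp add: add_nonneg_pos)
        obtain M where M: "\<And>m n y. \<lbrakk>m \<ge> M; n \<ge> M; y \<in> carrier H\<rbrakk>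
            \<Longrightarrow> hnorm H (f m y \<ominus> f n y) \<le> \<epsilon> / (hnorm H x + 1) * hnorm H y"
          using uniform[OF pos] by blast
        have "\<epsilon> / (hnorm H x + 1) * hnorm H x < \<epsilon>"
          using \<epsilon> N_nonneg[OF x] by (simp add: field_simps)
        then have "hnorm H (f m x \<ominus> f n x) < \<epsilon>" if "m \<ge> M" "n \<ge> M" for m n
          using M[OF that x] by linarith
        then show ?thesis by blast
      qed
      then show ?thesis
        by (rule norm_complete_convergent[OF complete operatorD(3)[OF f x]])
    qed
    then obtain L where L: "\<And>x. x \<in> carrier H \<Longrightarrow> L x \<in> carrier H"
      and L_lim: "\<And>x \<epsilon>. \<lbrakk>x \<in> carrier H; 0 < \<epsilon>\<rbrakk> \<Longrightarrow> \<exists>M. \<forall>n\<ge>M. hnorm H (f n x \<ominus> L x) < \<epsilon>"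
      by metis
    have unif_L: "\<exists>M. \<forall>n\<ge>M. \<forall>x\<in>carrier H. hnorm H (f n x \<ominus> L x) \<le> \<epsilon> * hnorm H x"
      if \<epsilon>: "0 < \<epsilon>" for \<epsilon>
    proof -
      obtain M where M: "\<And>m n y. \<lbrakk>m \<ge> M; n \<ge> M; y \<in> carrier H\<rbrakk>
            \<Longrightarrow> hnorm H (f m y \<ominus> f n y) \<le> \<epsilon> * hnorm H y"
        using uniform[OF \<epsilon>] by blast
      have "hnorm H (f n x \<ominus> L x) \<le> \<epsilon> * hnorm H x" if n: "n \<ge> M" and x: "x \<in> carrier H" for n x
      proof (rule field_le_epsilon)
        fix d :: real assume "0 < d"
        then obtain M' where M': "\<And>n. n \<ge> M' \<Longrightarrow> hnorm H (f n x \<ominus> L x) < d"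
          using L_lim[OF x] by blast
        define k where "k = max M M'"
        have "hnorm H (f n x \<ominus> L x) \<le> hnorm H (f n x \<ominus> f k x) + hnorm H (f k x \<ominus> L x)"
          using N_minus_triangle operatorD(3)[OF f x] L[OF x] by simp
        then show "hnorm H (f n x \<ominus> L x) \<le> \<epsilon> * hnorm H x + d"
          using M[of n k x] M'[of k] n x by (simp add: k_def)
      qed
      then show ?thesis by blast
    qed
    define T where "T = restrict L (carrier H)"
    \<comment> \<open>To identify \<open>L x\<close> with \<open>y\<close> it suffices that
      \<open>f n x\<close> is within a fixed multiple of \<epsilon> of \<open>y\<close> whenever
      \<open>f n\<close> is uniformly \<epsilon>-close to \<open>L\<close>. Additivity and
      homogeneity of \<open>L\<close> are both reduced to this.\<close>
    have limit_eqI: "L x = y" if x: "x \<in> carrier H" and y: "y \<in> carrier H"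
      and le: "\<And>\<epsilon> n. \<lbrakk>0 < \<epsilon>; \<And>z. z \<in> carrier H \<Longrightarrow> hnorm H (f n z \<ominus> L z) \<le> \<epsilon> * hnorm H z\<rbrakk>
        \<Longrightarrow> hnorm H (f n x \<ominus> y) \<le> C * \<epsilon>" and C: "0 \<le> C" for x y C
    proof -
      have "hnorm H (L x \<ominus> y) \<le> 0 + (hnorm H x + C) * \<epsilon>" if \<epsilon>: "0 < \<epsilon>" for \<epsilon>
      proof -
        obtain n where n: "\<And>z. z \<in> carrier H \<Longrightarrow> hnorm H (f n z \<ominus> L z) \<le> \<epsilon> * hnorm H z"
          using unif_L[OF \<epsilon>] by blast
        have "hnorm H (L x \<ominus> y) \<le> hnorm H (L x \<ominus> f n x) + hnorm H (f n x \<ominus> y)"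
          using N_minus_triangle operatorD(3)[OF f x] L[OF x] y by simp
        then show ?thesis
          using n[OF x] le[OF \<epsilon> n] N_minus_commute[OF L[OF x] operatorD(3)[OF f x, of n]]
          by (simp add: algebra_simps)
      qed
      then have "hnorm H (L x \<ominus> y) \<le> 0"
        by (rule real_le_epsilonI) (use C x in simp_all)
      then show ?thesis
        using L[OF x] y by simp
    qed
    have T: "T \<in> carrier B"
    proof (rule operatorI)
      obtain M where M: "\<And>n x. \<lbrakk>n \<ge> M; x \<in> carrier H\<rbrakk> \<Longrightarrow> hnorm H (f n x \<ominus> L x) \<le> 1 * hnorm H x"
        using unif_L[of 1] by auto
      obtain C where C: "0 \<le> C" "\<And>x. x \<in> carrier H \<Longrightarrow> hnorm H (f M x) \<le> C * hnorm H x"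
        using operator_bound[OF f] by blast
      have "bounded_operator H L"
      proof (rule bounded_operatorI[of _ "C + 1"])
        show "hnorm H (L x) \<le> (C + 1) * hnorm H x" if x: "x \<in> carrier H" for x
          using N_le_add_minus[OF L[OF x] operatorD(3)[OF f x, of M]] M[OF order_refl x] C(2)[OF x]
            N_minus_commute[OF L[OF x] operatorD(3)[OF f x, of M]]
          by (simp add: algebra_simps)
        show "L (x \<oplus> y) = L x \<oplus> L y" if x: "x \<in> carrier H" and y: "y \<in> carrier H" for x y
        proof (rule limit_eqI)
          fix \<epsilon> :: real and n
          assume \<epsilon>: "0 < \<epsilon>" "\<And>z. z \<in> carrier H \<Longrightarrow> hnorm H (f n z \<ominus> L z) \<le> \<epsilon> * hnorm H z"
          have "f n (x \<oplus> y) \<ominus> (L x \<oplus> L y) = (f n x \<ominus> L x) \<oplus> (f n y \<ominus> L y)"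
            using x y L operatorD(3,4)[OF f] by (simp add: minus_add_add)
          then show "hnorm H (f n (x \<oplus> y) \<ominus> (L x \<oplus> L y)) \<le> (hnorm H x + hnorm H y) * \<epsilon>"
            using N_add[of "f n x \<ominus> L x" "f n y \<ominus> L y"] \<epsilon>(2)[OF x] \<epsilon>(2)[OF y] x y L operatorD(3)[OF f]
            by (simp add: algebra_simps)
        qed (use x y L in simp_all)
        show "L (c \<odot> x) = c \<odot> L x" if x: "x \<in> carrier H" for c x
        proof (rule limit_eqI)
          fix \<epsilon> :: real and n
          assume \<epsilon>: "0 < \<epsilon>" "\<And>z. z \<in> carrier H \<Longrightarrow> hnorm H (f n z \<ominus> L z) \<le> \<epsilon> * hnorm H z"
          have "f n (c \<odot> x) \<ominus> (c \<odot> L x) = c \<odot> (f n x \<ominus> L x)"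
            using x L operatorD(3,5)[OF f] by (simp add: smult_minus_right)
          then show "hnorm H (f n (c \<odot> x) \<ominus> (c \<odot> L x)) \<le> (cmod c * hnorm H x) * \<epsilon>"
            using mult_left_mono[OF \<epsilon>(2)[OF x], of "cmod c"] x L operatorD(3)[OF f]
            by (simp add: algebra_simps)
        qed (use x L in simp_all)
      qed (rule L)
      then show "bounded_operator H T"
        by (subst bounded_operator_cong[of _ L]) (auto simp: T_def)
    qed (simp add: T_def)
    have "\<exists>M. \<forall>n\<ge>M. operator_norm H (f n \<ominus>\<^bsub>B\<^esub> T) < \<epsilon>" if \<epsilon>: "0 < \<epsilon>" for \<epsilon>
    proof -
      obtain M where M: "\<And>n x. \<lbrakk>n \<ge> M; x \<in> carrier H\<rbrakk> \<Longrightarrow> hnorm H (f n x \<ominus> L x) \<le> \<epsilon> / 2 * hnorm H x"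
        using unif_L[of "\<epsilon> / 2"] \<epsilon> by auto
      have "operator_norm H (f n \<ominus>\<^bsub>B\<^esub> T) < \<epsilon>" if n: "n \<ge> M" for n
      proof -
        have "operator_norm H (f n \<ominus>\<^bsub>B\<^esub> T) \<le> \<epsilon> / 2"
          by (rule operator_norm_le) (use \<epsilon> M[OF n] in \<open>simp_all add: operator_minus f T, simp add:
            T_def\<close>)
        then show ?thesis using \<epsilon> by linarith
      qed
      then show ?thesis by blast
    qed
    then show ?thesis using T by blast
  qed
  then show ?thesis unfolding B.norm_complete_iff by blast
qed

text \<open>This makes the bounded operators an admissible target of the universal property, so that
  Cuntz-Krieger families of operators give representations.\<close>

theorem cstar_algebra_operators: "cstar_algebra B"
proof -
  interpret B: normed_module B "operator_norm H" by (rule normed_module_operators)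
  note simps = operator_add operator_mult operator_smult operator_star operatorD(3-5) 
  show ?thesis
  proof (intro cstar_algebra.intro module_operators cstar_algebra_axioms.intro, unfold
    star_bounded_operators cnorm_bounded_operators)
    show "S \<otimes>\<^bsub>B\<^esub> T \<in> carrier B" if "S \<in> carrier B" "T \<in> carrier B" for S T
      using that by (rule operator_mult)
    show "(S \<otimes>\<^bsub>B\<^esub> T) \<otimes>\<^bsub>B\<^esub> U = S \<otimes>\<^bsub>B\<^esub> (T \<otimes>\<^bsub>B\<^esub> U)"
      if "S \<in> carrier B" "T \<in> carrier B" "U \<in> carrier B" for S T U
      by (rule operator_eqI) (use that in \<open>simp_all add: simps\<close>)
    show "(S \<oplus>\<^bsub>B\<^esub> T) \<otimes>\<^bsub>B\<^esub> U = S \<otimes>\<^bsub>B\<^esub> U \<oplus>\<^bsub>B\<^esub> T \<otimes>\<^bsub>B\<^esub> U"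
      if "S \<in> carrier B" "T \<in> carrier B" "U \<in> carrier B" for S T U
      by (rule operator_eqI) (use that in \<open>simp_all add: simps\<close>)
    show "U \<otimes>\<^bsub>B\<^esub> (S \<oplus>\<^bsub>B\<^esub> T) = U \<otimes>\<^bsub>B\<^esub> S \<oplus>\<^bsub>B\<^esub> U \<otimes>\<^bsub>B\<^esub> T"
      if "S \<in> carrier B" "T \<in> carrier B" "U \<in> carrier B" for S T U
      by (rule operator_eqI) (use that in \<open>simp_all add: simps\<close>)
    show "(c \<odot>\<^bsub>B\<^esub> S) \<otimes>\<^bsub>B\<^esub> T = c \<odot>\<^bsub>B\<^esub> (S \<otimes>\<^bsub>B\<^esub> T)" if "S \<in> carrier B" "T \<in> carrier B" for S T c
      by (rule operator_eqI) (use that in \<open>simp_all add: simps\<close>)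
    show "S \<otimes>\<^bsub>B\<^esub> (c \<odot>\<^bsub>B\<^esub> T) = c \<odot>\<^bsub>B\<^esub> (S \<otimes>\<^bsub>B\<^esub> T)" if "S \<in> carrier B" "T \<in> carrier B" for S T c
      by (rule operator_eqI) (use that in \<open>simp_all add: simps\<close>)
    show "adjoint_op H T \<in> carrier B" if "T \<in> carrier B" for T
      using that by (rule operator_star)
    show "adjoint_op H (adjoint_op H T) = T" if "T \<in> carrier B" for T
      by (rule adjointI) (use that in \<open>simp_all add: simps ip_adjoint\<close>)
    show "adjoint_op H (S \<oplus>\<^bsub>B\<^esub> T) = adjoint_op H S \<oplus>\<^bsub>B\<^esub> adjoint_op H T"
      if "S \<in> carrier B" "T \<in> carrier B" for S T
      by (rule adjointI) (use that in \<open>simp_all add: simps ip_adjoint ip_add ip_add_right\<close>)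
    show "adjoint_op H (c \<odot>\<^bsub>B\<^esub> T) = cnj c \<odot>\<^bsub>B\<^esub> adjoint_op H T" if "T \<in> carrier B" for c T
      by (rule adjointI) (use that in \<open>simp_all add: simps ip_adjoint ip_smult ip_smult_right\<close>)
    show "adjoint_op H (S \<otimes>\<^bsub>B\<^esub> T) = adjoint_op H T \<otimes>\<^bsub>B\<^esub> adjoint_op H S"
      if "S \<in> carrier B" "T \<in> carrier B" for S T
      by (rule adjointI) (use that in \<open>simp_all add: simps ip_adjoint\<close>)
    show "norm_complete B (operator_norm H)" by (rule norm_complete_operators)
    show mult: "operator_norm H (S \<otimes>\<^bsub>B\<^esub> T) \<le> operator_norm H S * operator_norm H T"
      if S: "S \<in> carrier B" and T: "T \<in> carrier B" for S T
    proof (rule operator_norm_le)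
      show "hnorm H ((S \<otimes>\<^bsub>B\<^esub> T) x) \<le> operator_norm H S * operator_norm H T * hnorm H x"
        if x: "x \<in> carrier H" for x
        using operator_norm_bound[OF S operatorD(3)[OF T x]]
          mult_left_mono[OF operator_norm_bound[OF T x] B.N_nonneg[OF S]] x
        by (simp add: mult.assoc)
    qed (simp add: S T)
    show "operator_norm H (adjoint_op H T \<otimes>\<^bsub>B\<^esub> T) = (operator_norm H T)\<^sup>2" if T: "T \<in> carrier B" for T
    proof (rule antisym)
      have "hnorm H (adjoint_op H T y) \<le> operator_norm H T * hnorm H y" if y: "y \<in> carrier H" for y
        by (rule adjoint_bound[OF operatorD(1)[OF T] B.N_nonneg[OF T] operator_norm_bound[OF T] _ _ y])
          (simp_all add: T ip_adjoint operatorD(3)[OF operator_star[OF T]])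
      then have "operator_norm H (adjoint_op H T) \<le> operator_norm H T"
        by (intro operator_norm_le B.N_nonneg[OF T])
      then show "operator_norm H (adjoint_op H T \<otimes>\<^bsub>B\<^esub> T) \<le> (operator_norm H T)\<^sup>2"
        unfolding power2_eq_square
        by (intro order_trans[OF mult[OF operator_star[OF T] T]] mult_right_mono B.N_nonneg[OF T])
      let ?k = "operator_norm H (adjoint_op H T \<otimes>\<^bsub>B\<^esub> T)"
      have TT: "adjoint_op H T \<otimes>\<^bsub>B\<^esub> T \<in> carrier B" by (simp add: operator_mult operator_star T)
      have k: "0 \<le> ?k" using B.N_nonneg[OF TT] .
      \<comment> \<open>The harder half of the C*-identity: the squared norm of \<open>T x\<close>
        is the inner product of \<open>x\<close> with its image under the adjoint of
        \<open>T\<close> composed with \<open>T\<close>.\<close>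
      have "operator_norm H T \<le> sqrt ?k"
      proof (rule operator_norm_le)
        show "hnorm H (T x) \<le> sqrt ?k * hnorm H x" if x: "x \<in> carrier H" for x
        proof (rule power2_le_imp_le)
          have "(hnorm H (T x))\<^sup>2 = Re (ip H (adjoint_op H T (T x)) x)"
            using T x by (simp add: hnorm_sq operatorD(3) ip_adjoint)
          also have "\<dots> \<le> hnorm H (adjoint_op H T (T x)) * hnorm H x"
            using Cauchy_Schwarz[of "adjoint_op H T (T x)" x] complex_Re_le_cmod[of "ip H
              (adjoint_op H T (T x)) x"]
              T x operatorD(3)[OF operator_star[OF T] operatorD(3)[OF T x]] by simp
          also have "\<dots> \<le> ?k * hnorm H x * hnorm H x"
            using operator_norm_bound[OF TT x] x by (intro mult_right_mono) simp_all
          finally show "(hnorm H (T x))\<^sup>2 \<le> (sqrt ?k * hnorm H x)\<^sup>2"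
            using k by (simp add: power_mult_distrib power2_eq_square[of "hnorm H x"] mult.assoc)
        qed (simp add: k x)
      qed (simp add: k)
      then show "(operator_norm H T)\<^sup>2 \<le> ?k"
        using power_mono[of "operator_norm H T" "sqrt ?k" 2] B.N_nonneg[OF T] k by simp
    qed
  qed (simp_all add: B.N_add)
qed

end

section \<open>Unitary maps and homomorphisms\<close>

lemma unitary_mapD:
  assumes "unitary_map H K U"
  shows "linear_map H K U" "inj_on U (carrier H)" "U ` carrier H = carrier K"
    and "x \<in> carrier H \<Longrightarrow> U x \<in> carrier K"
    and "\<lbrakk>x \<in> carrier H; y \<in> carrier H\<rbrakk> \<Longrightarrow> ip K (U x) (U y) = ip H x y"
    and "x \<in> carrier H \<Longrightarrow> hnorm K (U x) = hnorm H x"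
    and "x \<in> carrier H \<Longrightarrow> inv_into (carrier H) U (U x) = x"
    and "z \<in> carrier K \<Longrightarrow> inv_into (carrier H) U z \<in> carrier H"
    and "z \<in> carrier K \<Longrightarrow> U (inv_into (carrier H) U z) = z"
  using assms
  by (auto simp: unitary_map_def bij_betw_def hnorm_def linear_map_def Pi_def
      inv_into_f_f inv_into_into f_inv_into_f)

definition conj_op :: "'h inner_space \<Rightarrow> 'k inner_space \<Rightarrow> ('h \<Rightarrow> 'k) \<Rightarrow> ('h \<Rightarrow> 'h) \<Rightarrow> 'k \<Rightarrow> 'k" where
  "conj_op H K U T = (\<lambda>y\<in>carrier K. U (T (inv_into (carrier H) U y)))"

locale unitary_equivalence = H: hilbert_space H + K: hilbert_space K
  for H :: "'h inner_space" and K :: "'k inner_space" +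
  fixes U :: "'h \<Rightarrow> 'k"
  assumes U: "unitary_map H K U"
begin

abbreviation V where "V \<equiv> inv_into (carrier H) U"

lemmas U_linear = linear_mapD[OF unitary_mapD(1)[OF U]]
lemmas U_simps = unitary_mapD(4-9)[OF U]

lemma V_eqI: "\<lbrakk>x \<in> carrier H; y = U x\<rbrakk> \<Longrightarrow> V y = x"
  using U_simps by simp

lemma V_add: "\<lbrakk>x \<in> carrier K; y \<in> carrier K\<rbrakk> \<Longrightarrow> V (x \<oplus>\<^bsub>K\<^esub> y) = V x \<oplus>\<^bsub>H\<^esub> V y"
  by (rule V_eqI) (simp_all add: U_linear U_simps)

lemma V_smult: "x \<in> carrier K \<Longrightarrow> V (c \<odot>\<^bsub>K\<^esub> x) = c \<odot>\<^bsub>H\<^esub> V x"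
  by (rule V_eqI) (simp_all add: U_linear U_simps)

lemma U_minus: "\<lbrakk>x \<in> carrier H; y \<in> carrier H\<rbrakk> \<Longrightarrow> U (x \<ominus>\<^bsub>H\<^esub> y) = U x \<ominus>\<^bsub>K\<^esub> U y"
  by (rule linear_map_minus[OF H.module_axioms K.module_axioms unitary_mapD(1)[OF U]])

lemma U_zero: "U \<zero>\<^bsub>H\<^esub> = \<zero>\<^bsub>K\<^esub>"
  by (rule linear_map_zero[OF H.module_axioms K.module_axioms unitary_mapD(1)[OF U]])

lemma U_eq_zero_iff: "x \<in> carrier H \<Longrightarrow> U x = \<zero>\<^bsub>K\<^esub> \<longleftrightarrow> x = \<zero>\<^bsub>H\<^esub>"
  using U_zero U_simps(4) H.M.zero_closed by metis

lemma ip_V: "\<lbrakk>x \<in> carrier K; y \<in> carrier K\<rbrakk> \<Longrightarrow> ip H (V x) (V y) = ip K x y"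
  using U_simps(2)[of "V x" "V y"] U_simps by simp

lemma hnorm_V: "x \<in> carrier K \<Longrightarrow> hnorm H (V x) = hnorm K x"
  using U_simps(3)[of "V x"] U_simps by simp

lemma unitary_V: "unitary_map K H V"
proof -
  have "bij_betw V (carrier K) (carrier H)"
    using U by (auto simp: unitary_map_def intro: bij_betw_inv_into)
  then show ?thesis by (simp add: unitary_map_def linear_map_def V_add V_smult ip_V U_simps)
qed

lemma conj_op_apply: "x \<in> carrier H \<Longrightarrow> conj_op H K U T (U x) = U (T x)"
  by (simp add: conj_op_def U_simps)

lemma conj_op_apply': "y \<in> carrier K \<Longrightarrow> conj_op H K U T y = U (T (V y))"
  by (simp add: conj_op_def)

lemma conj_op_carrier:
  assumes T: "T \<in> carrier (bounded_operators H)"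
  shows "conj_op H K U T \<in> carrier (bounded_operators K)"
proof -
  obtain C where C: "0 \<le> C" "\<And>x. x \<in> carrier H \<Longrightarrow> hnorm H (T x) \<le> C * hnorm H x"
    using H.operator_bound[OF T] by blast
  show ?thesis
  proof (intro K.operatorI K.bounded_operatorI[of _ C])
    show "conj_op H K U T \<in> extensional (carrier K)" by (simp add: conj_op_def)
    show "hnorm K (conj_op H K U T y) \<le> C * hnorm K y" if y: "y \<in> carrier K" for y
      using C(2)[of "V y"] y by (simp add: conj_op_apply' U_simps H.operatorD[OF T] hnorm_V)
  qed (simp_all add: conj_op_apply' U_simps U_linear H.operatorD[OF T] V_add V_smult)
qed

lemma star_hom_conj_op: "star_hom (bounded_operators H) (bounded_operators K) (conj_op H K U)"
  unfolding star_hom_def linear_map_def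
proof (intro conjI ballI allI)
  note simps = conj_op_carrier H.operator_add H.operator_smult H.operator_mult H.operator_star
    K.operator_add K.operator_smult K.operator_mult conj_op_apply' H.operatorD(3) K.operatorD(3)
      U_simps U_linear
  show "conj_op H K U \<in> carrier (bounded_operators H) \<rightarrow> carrier (bounded_operators K)"
    using conj_op_carrier by blast
  fix S assume S: "S \<in> carrier (bounded_operators H)"
  show "conj_op H K U (c \<odot>\<^bsub>bounded_operators H\<^esub> S) = c \<odot>\<^bsub>bounded_operators K\<^esub> conj_op H K U S" for c
    by (rule K.operator_eqI) (use S in \<open>simp_all add: simps\<close>)
  show "conj_op H K U (star (bounded_operators H) S) = star (bounded_operators K) (conj_op H K U S)"
    unfolding star_bounded_operators
    by (rule K.adjointI[symmetric])
      (use S in \<open>simp_all add: simps H.ip_adjoint flip: ip_V\<close>)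
  fix T assume T: "T \<in> carrier (bounded_operators H)"
  show "conj_op H K U (S \<oplus>\<^bsub>bounded_operators H\<^esub> T) = conj_op H K U S \<oplus>\<^bsub>bounded_operators K\<^esub> conj_op
    H K U T"
    by (rule K.operator_eqI) (use S T in \<open>simp_all add: simps\<close>)
  show "conj_op H K U (S \<otimes>\<^bsub>bounded_operators H\<^esub> T) = conj_op H K U S \<otimes>\<^bsub>bounded_operators K\<^esub> conj_op
    H K U T"
    by (rule K.operator_eqI) (use S T in \<open>simp_all add: simps\<close>)
qed

end

text \<open>The Hilbert space structure carried along an injection \<open>U\<close> to its image.
  This is how a space is moved to the type that the universal property or the uniqueness hypothesis
  prescribes. The fields \<open>monoid.mult\<close> and \<open>one\<close> are placeholders.\<close>

definition push_space :: "('h \<Rightarrow> 'k) \<Rightarrow> 'h inner_space \<Rightarrow> 'k inner_space" where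
  "push_space U H =
    (let V = inv_into (carrier H) U in
    \<lparr>carrier = U ` carrier H,
     monoid.mult = (\<lambda>x y. x),
     one = U \<zero>\<^bsub>H\<^esub>,
     ring.zero = U \<zero>\<^bsub>H\<^esub>,
     add = (\<lambda>x y. U (V x \<oplus>\<^bsub>H\<^esub> V y)),
     smult = (\<lambda>c x. U (c \<odot>\<^bsub>H\<^esub> V x)),
     ip = (\<lambda>x y. ip H (V x) (V y))\<rparr>)"

lemma (in hilbert_space) push_space:
  fixes U :: "'h \<Rightarrow> 'k"
  assumes inj: "inj_on U (carrier H)"
  shows hilbert_space_push_space: "hilbert_space (push_space U H)"
    and unitary_map_push_space: "unitary_map H (push_space U H) U"
proof -
  let ?K = "push_space U H"
  have V: "inv_into (carrier H) U (U x) = x" if "x \<in> carrier H" for x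
    using inj that by simp
  have carrier_K: "carrier ?K = U ` carrier H"
    and zero_K: "\<zero>\<^bsub>?K\<^esub> = U \<zero>"
    and add_K: "\<And>x y. \<lbrakk>x \<in> carrier H; y \<in> carrier H\<rbrakk> \<Longrightarrow> U x \<oplus>\<^bsub>?K\<^esub> U y = U (x \<oplus> y)"
    and smult_K: "\<And>c x. x \<in> carrier H \<Longrightarrow> c \<odot>\<^bsub>?K\<^esub> U x = U (c \<odot> x)"
    and ip_K: "\<And>x y. \<lbrakk>x \<in> carrier H; y \<in> carrier H\<rbrakk> \<Longrightarrow> ip ?K (U x) (U y) = ip H x y"
    by (simp_all add: push_space_def Let_def V)
  note simps = carrier_K zero_K add_K smult_K ip_K
  have hnorm_K: "hnorm ?K (U x) = hnorm H x" if "x \<in> carrier H" for x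
    by (simp add: hnorm_def ip_K that)
  have "abelian_group ?K"
  proof (rule abelian_groupI)
    show "\<exists>y\<in>carrier ?K. y \<oplus>\<^bsub>?K\<^esub> x = \<zero>\<^bsub>?K\<^esub>" if "x \<in> carrier ?K" for x
    proof -
      from that obtain x' where x': "x = U x'" "x' \<in> carrier H" by (auto simp: carrier_K)
      show ?thesis
        by (rule bexI[of _ "U (\<ominus> x')"]) (use x' in \<open>simp_all add: simps M.l_neg\<close>)
    qed
  qed (auto simp: simps M.a_assoc intro!: arg_cong[of _ _ U] M.a_comm)
  moreover have "module_axioms complex_field ?K"
    by (rule module_axioms.intro)
      (auto simp: simps smult_l_distr[simplified] smult_r_distr smult_assoc1[simplified]
        smult_one[simplified])
  ultimately have mod: "module complex_field ?K"
    by (intro module.intro cring_complex_field)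
  have lin: "linear_map H ?K U"
    by (auto simp: linear_map_def simps)
  have U_eq: "U x = U y \<longleftrightarrow> x = y" if "x \<in> carrier H" "y \<in> carrier H" for x y
    using inj that by (auto dest: inj_onD)
  have "normed_module ?K (hnorm ?K)"
    by (intro normed_module.intro mod normed_module_axioms.intro)
      (auto simp: simps hnorm_K U_eq N_add)
  then interpret K: normed_module ?K "hnorm ?K" .
  have "norm_complete ?K (hnorm ?K)"
    unfolding K.norm_complete_iff
  proof (intro allI impI)
    fix f :: "nat \<Rightarrow> 'k"
    assume "(\<forall>n. f n \<in> carrier ?K) \<and> (\<forall>\<epsilon>>0. \<exists>M. \<forall>m\<ge>M. \<forall>n\<ge>M. hnorm ?K (f m \<ominus>\<^bsub>?K\<^esub> f n) < \<epsilon>)"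
    then have f: "\<forall>n. \<exists>x\<in>carrier H. f n = U x"
      and cauchy: "\<And>\<epsilon>. 0 < \<epsilon> \<Longrightarrow> \<exists>M. \<forall>m\<ge>M. \<forall>n\<ge>M. hnorm ?K (f m \<ominus>\<^bsub>?K\<^esub> f n) < \<epsilon>"
      by (auto simp: carrier_K image_iff)
    obtain g where g: "\<And>n. g n \<in> carrier H" "\<And>n. f n = U (g n)"
      using f by metis
    have minus: "hnorm ?K (U x \<ominus>\<^bsub>?K\<^esub> U y) = hnorm H (x \<ominus> y)" if "x \<in> carrier H" "y \<in> carrier H" for x y
      using linear_map_minus[OF module_axioms mod lin that] hnorm_K[of "x \<ominus> y"] that by simp
    have "\<exists>l\<in>carrier H. \<forall>\<epsilon>>0. \<exists>M. \<forall>n\<ge>M. hnorm H (g n \<ominus> l) < \<epsilon>"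
      by (rule norm_complete_convergent[OF complete g(1)])
        (use cauchy in \<open>simp add: g minus\<close>)
    then obtain l where "l \<in> carrier H" "\<forall>\<epsilon>>0. \<exists>M. \<forall>n\<ge>M. hnorm H (g n \<ominus> l) < \<epsilon>" by blast
    then show "\<exists>l\<in>carrier ?K. \<forall>\<epsilon>>0. \<exists>M. \<forall>n\<ge>M. hnorm ?K (f n \<ominus>\<^bsub>?K\<^esub> l) < \<epsilon>"
      by (intro bexI[of _ "U l"]) (simp_all add: g minus carrier_K)
  qed
  then show "hilbert_space ?K"
    by (intro hilbert_space.intro mod hilbert_space_axioms.intro)
      (auto simp: simps ip_add ip_smult U_eq ip_pos intro: ip_commute)
  show "unitary_map H ?K U"
    using inj by (auto simp: unitary_map_def lin bij_betw_def carrier_K ip_K)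
qed

section \<open>Star homomorphisms and images of Cuntz-Krieger families\<close>

lemma star_hom_comp:
  assumes "star_hom A B \<phi>" "star_hom B C \<psi>"
  shows "star_hom A C (\<lambda>a. \<psi> (\<phi> a))"
  using assms by (simp add: star_hom_def linear_map_def Pi_def)

lemma star_homD:
  assumes "star_hom A B \<phi>"
  shows "x \<in> carrier A \<Longrightarrow> \<phi> x \<in> carrier B"
    and "\<lbrakk>x \<in> carrier A; y \<in> carrier A\<rbrakk> \<Longrightarrow> \<phi> (x \<oplus>\<^bsub>A\<^esub> y) = \<phi> x \<oplus>\<^bsub>B\<^esub> \<phi> y"
    and "x \<in> carrier A \<Longrightarrow> \<phi> (c \<odot>\<^bsub>A\<^esub> x) = c \<odot>\<^bsub>B\<^esub> \<phi> x"
    and "\<lbrakk>x \<in> carrier A; y \<in> carrier A\<rbrakk> \<Longrightarrow> \<phi> (x \<otimes>\<^bsub>A\<^esub> y) = \<phi> x \<otimes>\<^bsub>B\<^esub> \<phi> y"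
    and "x \<in> carrier A \<Longrightarrow> \<phi> (star A x) = star B (\<phi> x)"
  using assms by (auto simp: star_hom_def linear_map_def)

lemma star_hom_module:
  assumes \<phi>: "star_hom A B \<phi>" and A: "module complex_field A" and B: "module complex_field B"
  shows star_hom_zero: "\<phi> \<zero>\<^bsub>A\<^esub> = \<zero>\<^bsub>B\<^esub>"
    and star_hom_minus: "\<lbrakk>x \<in> carrier A; y \<in> carrier A\<rbrakk> \<Longrightarrow> \<phi> (x \<ominus>\<^bsub>A\<^esub> y) = \<phi> x \<ominus>\<^bsub>B\<^esub> \<phi> y"
    and star_hom_finsum: "\<lbrakk>finite F; f \<in> F \<rightarrow> carrier A\<rbrakk>
      \<Longrightarrow> \<phi> (\<Oplus>\<^bsub>A\<^esub>i\<in>F. f i) = (\<Oplus>\<^bsub>B\<^esub>i\<in>F. \<phi> (f i))"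
proof -
  interpret A: module complex_field A by (rule A)
  interpret B: module complex_field B by (rule B)
  have lin: "linear_map A B \<phi>" using \<phi> by (simp add: star_hom_def)
  show zero: "\<phi> \<zero>\<^bsub>A\<^esub> = \<zero>\<^bsub>B\<^esub>" by (rule linear_map_zero[OF A B lin])
  show "\<phi> (x \<ominus>\<^bsub>A\<^esub> y) = \<phi> x \<ominus>\<^bsub>B\<^esub> \<phi> y" if "x \<in> carrier A" "y \<in> carrier A"
    by (rule linear_map_minus[OF A B lin that])
  show "\<phi> (\<Oplus>\<^bsub>A\<^esub>i\<in>F. f i) = (\<Oplus>\<^bsub>B\<^esub>i\<in>F. \<phi> (f i))" if "finite F" "f \<in> F \<rightarrow> carrier A"
    using that
  proof (induction F rule: finite_induct)
    case empty
    then show ?case by (simp add: zero)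
  next
    case (insert i F)
    then show ?case
      by (simp add: Pi_def star_homD[OF \<phi>])
  qed
qed

text \<open>The relations are algebraic, and the order is too: it is witnessed by an element
  \<open>z\<close> times its adjoint, and the homomorphism carries the witness along.\<close>

lemma (in wf_digraph) star_hom_cuntz_krieger_family:
  assumes ck: "cuntz_krieger_family G A p s" and \<phi>: "star_hom A B \<phi>"
    and A: "module complex_field A" and B: "module complex_field B"
    and mult: "\<And>x y. \<lbrakk>x \<in> carrier A; y \<in> carrier A\<rbrakk> \<Longrightarrow> x \<otimes>\<^bsub>A\<^esub> y \<in> carrier A"
    and star: "\<And>x. x \<in> carrier A \<Longrightarrow> star A x \<in> carrier A"
  shows "cuntz_krieger_family G B (\<lambda>v. \<phi> (p v)) (\<lambda>e. \<phi> (s e))"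
proof -
  note hom = star_homD[OF \<phi>]
  have p: "p v \<in> carrier A" "star A (p v) = p v" "p v \<otimes>\<^bsub>A\<^esub> p v = p v" if "v \<in> verts G" for v
    using ck that by (auto simp: cuntz_krieger_family_def projection_def)
  have s: "s e \<in> carrier A" "s e \<otimes>\<^bsub>A\<^esub> star A (s e) \<otimes>\<^bsub>A\<^esub> s e = s e"
    "star A (s e) \<otimes>\<^bsub>A\<^esub> s e = p (head G e)" "cstar_le A (s e \<otimes>\<^bsub>A\<^esub> star A (s e)) (p (tail G e))"
    if "e \<in> arcs G" for e
    using ck that by (auto simp: cuntz_krieger_family_def partial_isometry_def)
  have le: "cstar_le B (\<phi> x) (\<phi> y)" if "cstar_le A x y" "x \<in> carrier A" "y \<in> carrier A" for x y
    using that star_hom_minus[OF \<phi> A B, of y x] hom star unfolding cstar_le_def by metis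
  show ?thesis
    unfolding cuntz_krieger_family_def
  proof (intro conjI ballI allI impI)
    show "projection B (\<phi> (p v))" if "v \<in> verts G" for v
      using p[OF that] hom(1) hom(4)[of "p v" "p v"] hom(5)[of "p v"] by (simp add: projection_def)
    show "\<phi> (p v) \<otimes>\<^bsub>B\<^esub> \<phi> (p w) = \<zero>\<^bsub>B\<^esub>" if "v \<in> verts G" "w \<in> verts G" "v \<noteq> w" for v w
      using that ck p(1) star_hom_zero[OF \<phi> A B] hom(4)[of "p v" "p w"]
        by (simp add: cuntz_krieger_family_def)
    show "partial_isometry B (\<phi> (s e))" if "e \<in> arcs G" for e
      using s(1,2)[OF that] hom(1) hom(4)[of "s e \<otimes>\<^bsub>A\<^esub> star A (s e)" "s e"] hom(4)[of "s e" "star A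
        (s e)"]
        hom(5)[of "s e"] mult star by (simp add: partial_isometry_def)
    show "(\<phi> (s e) \<otimes>\<^bsub>B\<^esub> star B (\<phi> (s e))) \<otimes>\<^bsub>B\<^esub> (\<phi> (s f) \<otimes>\<^bsub>B\<^esub> star B (\<phi> (s f))) = \<zero>\<^bsub>B\<^esub>"
      if "e \<in> arcs G" "f \<in> arcs G" "e \<noteq> f" for e f
    proof -
      have "(s e \<otimes>\<^bsub>A\<^esub> star A (s e)) \<otimes>\<^bsub>A\<^esub> (s f \<otimes>\<^bsub>A\<^esub> star A (s f)) = \<zero>\<^bsub>A\<^esub>"
        using ck that by (simp add: cuntz_krieger_family_def)
      from arg_cong[OF this, of \<phi>] show ?thesis
        using s(1)[OF that(1)] s(1)[OF that(2)] by (simp add: hom mult star star_hom_zero[OF \<phi> A B])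
    qed
    show "star B (\<phi> (s e)) \<otimes>\<^bsub>B\<^esub> \<phi> (s e) = \<phi> (p (head G e))" if "e \<in> arcs G" for e
      using s(1)[OF that] arg_cong[OF s(3)[OF that], of \<phi>] by (simp add: hom star)
    show "cstar_le B (\<phi> (s e) \<otimes>\<^bsub>B\<^esub> star B (\<phi> (s e))) (\<phi> (p (tail G e)))" if "e \<in> arcs G" for e
    proof -
      have "p (tail G e) \<in> carrier A"
        using p(1) tail_in_verts[OF that] by simp
      then show ?thesis using le[OF s(4)[OF that]] s(1)[OF that] by (simp add: hom mult star)
    qed
    show "\<phi> (p v) = (\<Oplus>\<^bsub>B\<^esub>e\<in>out_arcs G v. \<phi> (s e) \<otimes>\<^bsub>B\<^esub> star B (\<phi> (s e)))" if "regular_vertex G v" for v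
    proof -
      have arcs: "e \<in> arcs G" if "e \<in> out_arcs G v" for e using that by simp
      interpret B: module complex_field B by (rule B)
      have "\<phi> (p v) = \<phi> (\<Oplus>\<^bsub>A\<^esub>e\<in>out_arcs G v. s e \<otimes>\<^bsub>A\<^esub> star A (s e))"
        using ck that by (simp add: cuntz_krieger_family_def)
      also have "\<dots> = (\<Oplus>\<^bsub>B\<^esub>e\<in>out_arcs G v. \<phi> (s e \<otimes>\<^bsub>A\<^esub> star A (s e)))"
        by (rule star_hom_finsum[OF \<phi> A B])
          (use that s(1) in \<open>auto simp: regular_vertex_def intro!: mult star\<close>)
      also have "\<dots> = (\<Oplus>\<^bsub>B\<^esub>e\<in>out_arcs G v. \<phi> (s e) \<otimes>\<^bsub>B\<^esub> star B (\<phi> (s e)))"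
      proof (rule B.finsum_cong')
        have eq: "\<phi> (s e \<otimes>\<^bsub>A\<^esub> star A (s e)) = \<phi> (s e) \<otimes>\<^bsub>B\<^esub> star B (\<phi> (s e))"
          if "e \<in> out_arcs G v" for e
          using s(1)[OF arcs[OF that]] by (simp add: hom mult star)
        then show "\<phi> (s e \<otimes>\<^bsub>A\<^esub> star A (s e)) = \<phi> (s e) \<otimes>\<^bsub>B\<^esub> star B (\<phi> (s e))"
          if "e \<in> out_arcs G v" for e
          using that .
        show "(\<lambda>e. \<phi> (s e) \<otimes>\<^bsub>B\<^esub> star B (\<phi> (s e))) \<in> out_arcs G v \<rightarrow> carrier B"
        proof
          fix e assume e: "e \<in> out_arcs G v"
          show "\<phi> (s e) \<otimes>\<^bsub>B\<^esub> star B (\<phi> (s e)) \<in> carrier B"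
            unfolding eq[OF e, symmetric] using s(1)[OF arcs[OF e]] by (intro hom(1) mult star)
        qed
      qed simp
      finally show ?thesis .
    qed
  qed
qed

lemma (in unitary_equivalence) conj_op_inverse:
  assumes T: "T \<in> carrier (bounded_operators H)"
  shows "conj_op K H V (conj_op H K U T) = T"
proof -
  interpret inv: unitary_equivalence K H V
    by unfold_locales (rule unitary_V)
  show ?thesis
  proof (rule H.operator_eqI)
    show "conj_op K H V (conj_op H K U T) \<in> carrier (bounded_operators H)"
      by (intro inv.conj_op_carrier conj_op_carrier T)
    show "conj_op K H V (conj_op H K U T) x = T x" if x: "x \<in> carrier H" for x
      using inv.conj_op_apply[of "U x" "conj_op H K U T"] x
      by (simp add: U_simps conj_op_apply H.operatorD(3)[OF T])
  qed (rule T)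
qed

text \<open>Operators on a space of functions on words over \<open>'a + 'b\<close> have exactly the
  type over which the universal property quantifies. The family is moved there along
  \<open>j\<close>, and the homomorphism obtained is moved back.\<close>

lemma (in wf_digraph) graph_cstar_algebra_universal:
  fixes A :: "'c star_algebra" and H :: "'h inner_space" and j :: "'h \<Rightarrow> ('a + 'b) list \<Rightarrow> complex"
  assumes univ: "graph_cstar_algebra G A p s" and H: "hilbert_space H" and j: "inj_on j (carrier H)"
    and ck: "cuntz_krieger_family G (bounded_operators H) P S"
  shows "\<exists>\<phi>. star_hom A (bounded_operators H) \<phi> \<and>
    (\<forall>v\<in>verts G. \<phi> (p v) = P v) \<and> (\<forall>e\<in>arcs G. \<phi> (s e) = S e)"
proof -
  interpret H: hilbert_space H by (rule H)
  let ?K = "push_space j H"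
  interpret K: hilbert_space ?K by (rule H.hilbert_space_push_space[OF j])
  interpret unitary_equivalence H ?K j
    by unfold_locales (rule H.unitary_map_push_space[OF j])
  interpret inv: unitary_equivalence ?K H V
    by unfold_locales (rule unitary_V)
  have "cuntz_krieger_family G (bounded_operators ?K) (\<lambda>v. conj_op H ?K j (P v)) (\<lambda>e. conj_op H ?K j
    (S e))"
    by (rule star_hom_cuntz_krieger_family[OF ck star_hom_conj_op H.module_operators
      K.module_operators])
      (simp_all add: H.operator_mult H.operator_star)
  then obtain \<phi> where \<phi>: "star_hom A (bounded_operators ?K) \<phi>"
      "\<forall>v\<in>verts G. \<phi> (p v) = conj_op H ?K j (P v)" "\<forall>e\<in>arcs G. \<phi> (s e) = conj_op H ?K j (S e)"
    using univ K.cstar_algebra_operators unfolding graph_cstar_algebra_def by blast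
  have "P v \<in> carrier (bounded_operators H)" if "v \<in> verts G" for v
    using ck that by (simp add: cuntz_krieger_family_def projection_def)
  moreover have "S e \<in> carrier (bounded_operators H)" if "e \<in> arcs G" for e
    using ck that by (simp add: cuntz_krieger_family_def partial_isometry_def)
  ultimately show ?thesis
    using \<phi> star_hom_comp[OF \<phi>(1) inv.star_hom_conj_op]
    by (intro exI[of _ "\<lambda>a. conj_op ?K H V (\<phi> a)"]) (simp add: conj_op_inverse)
qed

section \<open>Irreducible representations\<close>

lemma irreducible_representationD:
  assumes "irreducible_representation A H \<pi>"
  shows "hilbert_space H" "star_hom A (bounded_operators H) \<pi>"
    and "\<exists>a\<in>carrier A. \<pi> a \<noteq> \<zero>\<^bsub>bounded_operators H\<^esub>"
    and "\<lbrakk>submodule K complex_field H; closedin (norm_topology H (hnorm H)) K;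
      \<And>a x. \<lbrakk>a \<in> carrier A; x \<in> K\<rbrakk> \<Longrightarrow> \<pi> a x \<in> K\<rbrakk> \<Longrightarrow> K = {\<zero>\<^bsub>H\<^esub>} \<or> K = carrier H"
  using assms by (simp_all add: irreducible_representation_def representation_def)

lemma submodule_zero: "submodule N R M \<Longrightarrow> \<zero>\<^bsub>M\<^esub> \<in> N"
  using subgroup.one_closed[OF submodule.axioms(1)] by fastforce

lemma (in unitary_equivalence) irreducible_representation_conj_op:
  assumes \<pi>: "irreducible_representation A H \<pi>"
  shows "irreducible_representation A K (\<lambda>a. conj_op H K U (\<pi> a))"
  unfolding irreducible_representation_def representation_def
proof (intro conjI allI impI)
  note \<pi>_hom = irreducible_representationD(2)[OF \<pi>]
  show "hilbert_space K" by (rule K.hilbert_space_axioms)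
  show "star_hom A (bounded_operators K) (\<lambda>a. conj_op H K U (\<pi> a))"
    by (rule star_hom_comp[OF \<pi>_hom star_hom_conj_op])
  obtain a where a: "a \<in> carrier A" "\<pi> a \<noteq> \<zero>\<^bsub>bounded_operators H\<^esub>"
    using irreducible_representationD(3)[OF \<pi>] by blast
  have "\<pi> a \<in> carrier (bounded_operators H)" using star_homD(1)[OF \<pi>_hom a(1)] .
  then obtain x where x: "x \<in> carrier H" "\<pi> a x \<noteq> \<zero>\<^bsub>H\<^esub>"
    using a(2) H.operator_eqI[OF _ H.operator_zero, of "\<pi> a"] by auto
  have "conj_op H K U (\<pi> a) (U x) \<noteq> \<zero>\<^bsub>bounded_operators K\<^esub> (U x)"
    using x H.operatorD(3)[OF \<open>\<pi> a \<in> carrier (bounded_operators H)\<close> x(1)]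
    by (simp add: conj_op_apply U_simps U_eq_zero_iff)
  then show "\<exists>a\<in>carrier A. conj_op H K U (\<pi> a) \<noteq> \<zero>\<^bsub>bounded_operators K\<^esub>"
    using a(1) by (intro bexI[of _ a]) auto
  fix L assume L: "submodule L complex_field K \<and> closedin (norm_topology K (hnorm K)) L \<and>
    (\<forall>a\<in>carrier A. \<forall>x\<in>L. conj_op H K U (\<pi> a) x \<in> L)"
  then have sub: "submodule L complex_field K" by simp
  note subD = K.submoduleE[OF sub]
  define N where "N = {x \<in> carrier H. U x \<in> L}"
  have "N = {\<zero>\<^bsub>H\<^esub>} \<or> N = carrier H"
  proof (rule irreducible_representationD(4)[OF \<pi>])
    show "submodule N complex_field H"
    proof (rule H.submoduleI)
      show "\<zero>\<^bsub>H\<^esub> \<in> N"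
        using submodule_zero[OF sub] by (simp add: N_def U_zero)
      show "\<ominus>\<^bsub>H\<^esub> x \<in> N" if "x \<in> N" for x
        using that subD(4)[of "-1" "U x"] by (simp add: N_def H.uminus_eq_smult U_linear)
    qed (auto simp: N_def U_linear subD)
    show "closedin (norm_topology H (hnorm H)) N"
      unfolding H.closedin_norm_topology_iff
    proof (intro conjI ballI impI)
      fix x assume x: "x \<in> carrier H" and approx: "\<forall>\<epsilon>>0. \<exists>k\<in>N. hnorm H (x \<ominus>\<^bsub>H\<^esub> k) < \<epsilon>"
      have "\<exists>k\<in>L. hnorm K (U x \<ominus>\<^bsub>K\<^esub> k) < \<epsilon>" if "0 < \<epsilon>" for \<epsilon>
      proof -
        from approx that obtain k where "k \<in> N" "hnorm H (x \<ominus>\<^bsub>H\<^esub> k) < \<epsilon>" by blast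
        then show ?thesis
          using x U_simps(3)[of "x \<ominus>\<^bsub>H\<^esub> k"] by (intro bexI[of _ "U k"]) (simp_all add: N_def U_minus)
      qed
      then show "x \<in> N"
        using L x U_simps(1)[OF x] unfolding K.closedin_norm_topology_iff N_def by blast
    qed (auto simp: N_def)
    show "\<pi> a x \<in> N" if "a \<in> carrier A" "x \<in> N" for a x
    proof -
      have "conj_op H K U (\<pi> a) (U x) \<in> L" using L that by (simp add: N_def)
      then show ?thesis
        using that H.operatorD(3)[OF star_homD(1)[OF \<pi>_hom that(1)], of x]
        by (simp add: N_def conj_op_apply)
    qed
  qed
  moreover have L_eq: "L = U ` N"
  proof
    show "L \<subseteq> U ` N"
    proof
      fix y assume "y \<in> L"
      then show "y \<in> U ` N"
        using subD(1) U_simps(5,6)[of y] by (intro image_eqI[of _ _ "V y"]) (auto simp: N_def)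
    qed
  qed (auto simp: N_def)
  ultimately show "L = {\<zero>\<^bsub>K\<^esub>} \<or> L = carrier K"
    using unitary_mapD(3)[OF U] by (auto simp: U_zero)
qed

text \<open>The vector \<open>\<xi>\<close> is cyclic, so \<open>\<eta>\<close> is determined by its inner products with the vectors \<open>\<pi> a \<xi>\<close>.\<close>

lemma (in cstar_algebra) irreducible_representation_embed:
  fixes H :: "'h inner_space"
  assumes \<pi>: "irreducible_representation A H \<pi>"
  shows "\<exists>j :: 'h \<Rightarrow> 'a \<Rightarrow> complex. inj_on j (carrier H)"
proof -
  interpret H: hilbert_space H by (rule irreducible_representationD(1)[OF \<pi>])
  note hom = star_homD[OF irreducible_representationD(2)[OF \<pi>]]
  note op = H.operatorD[OF hom(1)]
  obtain a where a: "a \<in> carrier A" "\<pi> a \<noteq> \<zero>\<^bsub>bounded_operators H\<^esub>"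
    using irreducible_representationD(3)[OF \<pi>] by blast
  obtain \<xi> where \<xi>: "\<xi> \<in> carrier H" "\<pi> a \<xi> \<noteq> \<zero>\<^bsub>H\<^esub>"
    using a(2) H.operator_eqI[OF hom(1)[OF a(1)] H.operator_zero] by auto
  \<comment> \<open>The orthogonal complement of the orbit of \<xi>. It is closed and invariant but
    does not contain \<open>\<pi> a \<xi>\<close>, so irreducibility makes it zero; this is the
    cyclicity of \<xi>.\<close>
  define N where "N = {\<eta> \<in> carrier H. \<forall>b\<in>carrier A. ip H \<eta> (\<pi> b \<xi>) = 0}"
  have "N = {\<zero>\<^bsub>H\<^esub>} \<or> N = carrier H"
  proof (rule irreducible_representationD(4)[OF \<pi>])
    show "submodule N complex_field H"
      by (rule H.submoduleI)
        (auto simp: N_def H.ip_zero_left H.ip_uminus H.ip_add H.ip_smult op(3) \<xi>)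
    show "closedin (norm_topology H (hnorm H)) N"
      unfolding H.closedin_norm_topology_iff
    proof (intro conjI ballI impI)
      fix x assume x: "x \<in> carrier H" and approx: "\<forall>\<epsilon>>0. \<exists>k\<in>N. hnorm H (x \<ominus>\<^bsub>H\<^esub> k) < \<epsilon>"
      have "ip H x (\<pi> b \<xi>) = 0" if b: "b \<in> carrier A" for b
      proof -
        have \<zeta>: "\<pi> b \<xi> \<in> carrier H" using op(3)[OF b \<xi>(1)] .
        have "cmod (ip H x (\<pi> b \<xi>)) \<le> 0 + hnorm H (\<pi> b \<xi>) * \<epsilon>" if \<epsilon>: "0 < \<epsilon>" for \<epsilon>
        proof -
          from approx \<epsilon> obtain k where k: "k \<in> N" "hnorm H (x \<ominus>\<^bsub>H\<^esub> k) < \<epsilon>" by blast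
          then have k': "k \<in> carrier H" "ip H k (\<pi> b \<xi>) = 0" using b by (auto simp: N_def)
          then have "cmod (ip H x (\<pi> b \<xi>)) = cmod (ip H (x \<ominus>\<^bsub>H\<^esub> k) (\<pi> b \<xi>))"
            using x \<zeta> by (simp add: H.ip_minus)
          also have "\<dots> \<le> hnorm H (x \<ominus>\<^bsub>H\<^esub> k) * hnorm H (\<pi> b \<xi>)"
            using H.Cauchy_Schwarz x k' \<zeta> by simp
          also have "\<dots> \<le> \<epsilon> * hnorm H (\<pi> b \<xi>)"
            using k \<zeta> by (intro mult_right_mono) auto
          finally show ?thesis by (simp add: mult.commute)
        qed
        then have "cmod (ip H x (\<pi> b \<xi>)) \<le> 0" by (rule real_le_epsilonI) (use \<zeta> in auto)
        then show ?thesis by simp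
      qed
      then show "x \<in> N" using x by (simp add: N_def)
    qed (auto simp: N_def)
    show "\<pi> c x \<in> N" if c: "c \<in> carrier A" and x: "x \<in> N" for c x
    proof -
      have "ip H (\<pi> c x) (\<pi> b \<xi>) = 0" if b: "b \<in> carrier A" for b
      proof -
        have "ip H (\<pi> c x) (\<pi> b \<xi>) = ip H x (adjoint_op H (\<pi> c) (\<pi> b \<xi>))"
          using H.ip_adjoint(1)[OF hom(1)[OF c], of x "\<pi> b \<xi>"] x op(3)[OF b \<xi>(1)] by (simp add: N_def)
        also have "adjoint_op H (\<pi> c) (\<pi> b \<xi>) = \<pi> (star A c \<otimes> b) \<xi>"
          using b c \<xi> by (simp add: hom star_closed)
        finally show ?thesis using x b c by (simp add: N_def star_closed mult_closed)
      qed
      then show ?thesis using x op(3)[OF c] by (simp add: N_def)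
    qed
  qed
  moreover have "\<pi> a \<xi> \<notin> N"
    using \<xi> a(1) H.ip_pos[OF op(3)[OF a(1) \<xi>(1)]] by (auto simp: N_def intro!: bexI[of _ a])
  ultimately have N: "N = {\<zero>\<^bsub>H\<^esub>}" using op(3)[OF a(1) \<xi>(1)] by auto
  have "inj_on (\<lambda>\<eta> b. if b \<in> carrier A then ip H \<eta> (\<pi> b \<xi>) else 0) (carrier H)"
  proof (rule inj_onI)
    fix x y assume xy: "x \<in> carrier H" "y \<in> carrier H"
      and eq: "(\<lambda>b. if b \<in> carrier A then ip H x (\<pi> b \<xi>) else 0) = (\<lambda>b.
        if b \<in> carrier A then ip H y (\<pi> b \<xi>) else 0)"
    have "ip H x (\<pi> b \<xi>) = ip H y (\<pi> b \<xi>)" if "b \<in> carrier A" for b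
      using fun_cong[OF eq, of b] that by simp
    then have "x \<ominus>\<^bsub>H\<^esub> y \<in> N"
      using xy op(3)[OF _ \<xi>(1)] by (simp add: N_def H.ip_minus)
    then show "x = y" using N xy by simp
  qed
  then show ?thesis by blast
qed

section \<open>Moving irreducible representations between types\<close>

lemma (in cstar_algebra) irreducible_representation_transport:
  fixes H :: "'h inner_space"
  assumes \<pi>: "irreducible_representation A H \<pi>"
  shows "\<exists>(K :: ('a \<Rightarrow> complex) inner_space) U. unitary_equivalence H K U"
proof -
  interpret H: hilbert_space H by (rule irreducible_representationD(1)[OF \<pi>])
  obtain j :: "'h \<Rightarrow> 'a \<Rightarrow> complex" where j: "inj_on j (carrier H)"
    using irreducible_representation_embed[OF \<pi>] by blast
  have "unitary_equivalence H (push_space j H) j"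
    by (intro unitary_equivalence.intro unitary_equivalence_axioms.intro H.hilbert_space_axioms
        H.hilbert_space_push_space[OF j] H.unitary_map_push_space[OF j])
  then show ?thesis by blast
qed

text \<open>Both representations are moved to functions on the algebra, where the hypothesis
  applies, and the three unitaries are composed. The intertwining relation is stated without an
  inverse, which is how it is applied to generators later.\<close>

lemma (in cstar_algebra) unique_irreducible_representation_any_type:
  fixes H :: "'h inner_space" and K :: "'k inner_space"
  assumes uniq: "unique_irreducible_representation A"
    and \<pi>: "irreducible_representation A H \<pi>" and \<rho>: "irreducible_representation A K \<rho>"
  shows "\<exists>W. unitary_equivalence H K W \<and> (\<forall>a\<in>carrier A. \<forall>x\<in>carrier H. W (\<pi> a x) = \<rho> a (W x))"
proof -
  obtain H' :: "('a \<Rightarrow> complex) inner_space" and U where "unitary_equivalence H H' U"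
    using irreducible_representation_transport[OF \<pi>] by blast
  then interpret U: unitary_equivalence H H' U .
  obtain K' :: "('a \<Rightarrow> complex) inner_space" and T where "unitary_equivalence K K' T"
    using irreducible_representation_transport[OF \<rho>] by blast
  then interpret T: unitary_equivalence K K' T .
  note \<pi>_op = U.H.operatorD[OF star_homD(1)[OF irreducible_representationD(2)[OF \<pi>]]]
  note \<rho>_op = T.H.operatorD[OF star_homD(1)[OF irreducible_representationD(2)[OF \<rho>]]]
  obtain X where X: "unitary_map H' K' X"
    and X_eq: "\<And>a y. \<lbrakk>a \<in> carrier A; y \<in> carrier H'\<rbrakk>
      \<Longrightarrow> conj_op H H' U (\<pi> a) y = inv_into (carrier H') X (conj_op K K' T (\<rho> a) (X y))"
    using uniq U.irreducible_representation_conj_op[OF \<pi>] T.irreducible_representation_conj_op[OF \<rho>]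
    unfolding unique_irreducible_representation_def unitarily_equivalent_def by blast
  interpret X: unitary_equivalence H' K' X by unfold_locales (rule X)
  define W where "W x = T.V (X (U x))" for x
  have W_carrier: "W x \<in> carrier K" if "x \<in> carrier H" for x
    by (simp add: W_def that U.U_simps X.U_simps T.U_simps)
  have "unitary_map H K W"
    unfolding unitary_map_def linear_map_def
  proof (intro conjI ballI allI)
    have "bij_betw (T.V \<circ> (X \<circ> U)) (carrier H) (carrier K)"
      using U.U X T.unitary_V by (intro bij_betw_trans) (auto simp: unitary_map_def)
    then show "bij_betw W (carrier H) (carrier K)" by (simp add: W_def comp_def bij_betw_def
      inj_on_def image_def)
  qed (simp_all add: W_def U.U_simps X.U_simps T.U_simps U.U_linear X.U_linear T.V_add T.V_smult T.ip_V)
  then have "unitary_equivalence H K W" by unfold_locales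
  moreover have "W (\<pi> a x) = \<rho> a (W x)" if a: "a \<in> carrier A" and x: "x \<in> carrier H" for a x
  proof -
    have "U (\<pi> a x) = inv_into (carrier H') X (conj_op K K' T (\<rho> a) (X (U x)))"
      using X_eq[OF a U.U_simps(1)[OF x]] x by (simp add: U.conj_op_apply)
    also have "conj_op K K' T (\<rho> a) (X (U x)) = T (\<rho> a (W x))"
      using T.conj_op_apply[OF W_carrier[OF x], of "\<rho> a"] x
      by (simp add: W_def U.U_simps X.U_simps T.U_simps)
    finally have "X (U (\<pi> a x)) = T (\<rho> a (W x))"
      using W_carrier[OF x] \<rho>_op(3)[OF a] by (simp add: X.U_simps T.U_simps)
    then show ?thesis
      using W_carrier[OF x] \<rho>_op(3)[OF a] by (simp add: W_def T.U_simps)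
  qed
  ultimately show ?thesis by blast
qed

section \<open>The Hilbert space of square-summable functions\<close>

text \<open>Members vanish off \<open>X\<close>, so equality of vectors is plain equality of
  functions. The fields \<open>monoid.mult\<close> and \<open>one\<close> are placeholders.\<close>

definition ell2 :: "'i set \<Rightarrow> ('i \<Rightarrow> complex) inner_space" where
  "ell2 X =
    \<lparr>carrier = {f. (\<forall>i. i \<notin> X \<longrightarrow> f i = 0) \<and> (\<lambda>i. (cmod (f i))\<^sup>2) summable_on X},
     monoid.mult = (\<lambda>f g. f),
     one = (\<lambda>i. 0),
     ring.zero = (\<lambda>i. 0),
     add = (\<lambda>f g i. f i + g i),
     smult = (\<lambda>c f i. c * f i),
     ip = (\<lambda>f g. \<Sum>\<^sub>\<infinity>i\<in>X. f i * cnj (g i))\<rparr>"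

lemma ell2_simps [simp]:
  "\<zero>\<^bsub>ell2 X\<^esub> = (\<lambda>i. 0)"
  "f \<oplus>\<^bsub>ell2 X\<^esub> g = (\<lambda>i. f i + g i)"
  "c \<odot>\<^bsub>ell2 X\<^esub> f = (\<lambda>i. c * f i)"
  by (simp_all add: ell2_def)

lemma ell2_carrier:
  "f \<in> carrier (ell2 X) \<longleftrightarrow> (\<forall>i. i \<notin> X \<longrightarrow> f i = 0) \<and> (\<lambda>i. (cmod (f i))\<^sup>2) summable_on X"
  by (simp add: ell2_def)

lemma ell2_ip: "ip (ell2 X) f g = (\<Sum>\<^sub>\<infinity>i\<in>X. f i * cnj (g i))"
  by (simp add: ell2_def)

lemma ell2_outside: "f \<in> carrier (ell2 X) \<Longrightarrow> i \<notin> X \<Longrightarrow> f i = 0"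
  by (simp add: ell2_carrier)

lemma ell2_carrierI:
  assumes "\<And>i. i \<notin> X \<Longrightarrow> f i = 0"
    and "\<And>F. \<lbrakk>finite F; F \<subseteq> X\<rbrakk> \<Longrightarrow> (\<Sum>i\<in>F. (cmod (f i))\<^sup>2) \<le> C"
  shows "f \<in> carrier (ell2 X)"
proof -
  have "bdd_above (sum (\<lambda>i. (cmod (f i))\<^sup>2) ` {F. F \<subseteq> X \<and> finite F})"
    using assms(2) by (intro bdd_aboveI[of _ C]) auto
  then have "(\<lambda>i. (cmod (f i))\<^sup>2) summable_on X"
    by (intro nonneg_bdd_above_summable_on) auto
  then show ?thesis using assms(1) by (simp add: ell2_carrier)
qed

lemma ell2_comparison:
  assumes "g \<in> carrier (ell2 X)" "\<And>i. i \<notin> X \<Longrightarrow> f i = 0" "\<And>i. i \<in> X \<Longrightarrow> cmod (f i) \<le> C * cmod (g i)"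
  shows "f \<in> carrier (ell2 X)"
proof -
  have "(\<lambda>i. (cmod (f i))\<^sup>2) summable_on X"
  proof (rule summable_on_comparison_test)
    show "(\<lambda>i. C\<^sup>2 * (cmod (g i))\<^sup>2) summable_on X"
      using assms(1) by (intro summable_on_cmult_right) (simp add: ell2_carrier)
    show "(cmod (f i))\<^sup>2 \<le> C\<^sup>2 * (cmod (g i))\<^sup>2" if "i \<in> X" for i
      using power_mono[OF assms(3)[OF that], of 2] by (simp add: power_mult_distrib)
  qed simp
  then show ?thesis using assms(2) by (simp add: ell2_carrier)
qed

lemma ell2_add:
  assumes f: "f \<in> carrier (ell2 X)" and g: "g \<in> carrier (ell2 X)"
  shows "(\<lambda>i. f i + g i) \<in> carrier (ell2 X)"
proof -
  have "(\<lambda>i. (cmod (f i + g i))\<^sup>2) summable_on X"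
  proof (rule summable_on_comparison_test)
    show "(\<lambda>i. 2 * (cmod (f i))\<^sup>2 + 2 * (cmod (g i))\<^sup>2) summable_on X"
      using f g by (intro summable_on_add summable_on_cmult_right) (simp_all add: ell2_carrier)
    show "(cmod (f i + g i))\<^sup>2 \<le> 2 * (cmod (f i))\<^sup>2 + 2 * (cmod (g i))\<^sup>2" for i
    proof -
      have "(cmod (f i + g i))\<^sup>2 \<le> (cmod (f i) + cmod (g i))\<^sup>2"
        by (intro power_mono norm_triangle_ineq) simp
      also have "\<dots> \<le> 2 * (cmod (f i))\<^sup>2 + 2 * (cmod (g i))\<^sup>2"
        using sum_squares_bound[of "cmod (f i)" "cmod (g i)"] by (simp add: power2_sum)
      finally show ?thesis .
    qed
  qed simp
  then show ?thesis using f g by (simp add: ell2_carrier)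
qed

lemma ell2_smult: "f \<in> carrier (ell2 X) \<Longrightarrow> (\<lambda>i. c * f i) \<in> carrier (ell2 X)"
  by (rule ell2_comparison[of f _ _ "cmod c"]) (auto simp: ell2_outside norm_mult)

lemma ell2_ip_summable:
  assumes f: "f \<in> carrier (ell2 X)" and g: "g \<in> carrier (ell2 X)"
  shows "(\<lambda>i. f i * cnj (g i)) summable_on X"
proof -
  have "(\<lambda>i. norm (f i * cnj (g i))) summable_on X"
  proof (rule summable_on_comparison_test)
    show "(\<lambda>i. (cmod (f i))\<^sup>2 + (cmod (g i))\<^sup>2) summable_on X"
      using f g by (intro summable_on_add) (simp_all add: ell2_carrier)
    show "norm (f i * cnj (g i)) \<le> (cmod (f i))\<^sup>2 + (cmod (g i))\<^sup>2" for i
      using sum_squares_bound[of "cmod (f i)" "cmod (g i)"]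
        mult_nonneg_nonneg[OF norm_ge_zero norm_ge_zero, of "f i" "g i"]
      unfolding norm_mult complex_mod_cnj by linarith
  qed simp
  then show ?thesis by (rule abs_summable_summable)
qed

lemma infsum_complex_of_real: "(\<Sum>\<^sub>\<infinity>i\<in>X. complex_of_real (f i)) = of_real (infsum f X)"
proof (rule infsum_bounded_linear_strong)
  show "(\<lambda>i. complex_of_real (f i)) summable_on X \<longleftrightarrow> f summable_on X"
    using summable_on_of_real[of f X] summable_on_Re[of "\<lambda>i. complex_of_real (f i)" X] by auto
qed (rule bounded_linear_of_real)

lemma ell2_ip_self: "ip (ell2 X) f f = of_real (\<Sum>\<^sub>\<infinity>i\<in>X. (cmod (f i))\<^sup>2)"
proof -
  have "f i * cnj (f i) = of_real ((cmod (f i))\<^sup>2)" for i by (rule complex_norm_square[symmetric])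
  then show ?thesis by (simp add: ell2_ip infsum_complex_of_real del: of_real_power)
qed

lemma ell2_hnorm: "hnorm (ell2 X) f = sqrt (\<Sum>\<^sub>\<infinity>i\<in>X. (cmod (f i))\<^sup>2)"
  by (simp add: hnorm_def ell2_ip_self)

lemma ell2_hnorm_sq: "(hnorm (ell2 X) f)\<^sup>2 = (\<Sum>\<^sub>\<infinity>i\<in>X. (cmod (f i))\<^sup>2)"
  by (simp add: ell2_hnorm infsum_nonneg)

lemma ell2_sum_le:
  assumes "f \<in> carrier (ell2 X)" "finite F"
  shows "(\<Sum>i\<in>F. (cmod (f i))\<^sup>2) \<le> (hnorm (ell2 X) f)\<^sup>2"
proof -
  have "(\<Sum>i\<in>F. (cmod (f i))\<^sup>2) = (\<Sum>i\<in>F \<inter> X. (cmod (f i))\<^sup>2)"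
    using assms by (intro sum.mono_neutral_right) (auto simp: ell2_outside)
  also have "\<dots> \<le> (\<Sum>\<^sub>\<infinity>i\<in>X. (cmod (f i))\<^sup>2)"
    using assms by (intro finite_sum_le_infsum) (auto simp: ell2_carrier)
  finally show ?thesis by (simp add: ell2_hnorm_sq)
qed

lemma ell2_cmod_le:
  assumes "f \<in> carrier (ell2 X)"
  shows "cmod (f i) \<le> hnorm (ell2 X) f"
  using ell2_sum_le[OF assms, of "{i}"] by (auto intro: power2_le_imp_le simp: ell2_hnorm infsum_nonneg)

lemma ell2_hnorm_le:
  assumes f: "f \<in> carrier (ell2 X)" and C: "0 \<le> C"
    and le: "\<And>F. \<lbrakk>finite F; F \<subseteq> X\<rbrakk> \<Longrightarrow> (\<Sum>i\<in>F. (cmod (f i))\<^sup>2) \<le> C\<^sup>2"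
  shows "hnorm (ell2 X) f \<le> C"
proof (rule power2_le_imp_le[OF _ C])
  show "(hnorm (ell2 X) f)\<^sup>2 \<le> C\<^sup>2"
    unfolding ell2_hnorm_sq using f le by (intro infsum_le_finite_sums) (simp_all add: ell2_carrier)
qed

lemma ell2_eq_zero: 
  assumes "f \<in> carrier (ell2 X)" "hnorm (ell2 X) f = 0"
  shows "f = (\<lambda>i. 0)"
  using ell2_cmod_le[OF assms(1)] assms(2) by auto

lemma module_ell2: "module complex_field (ell2 X)"
proof (rule moduleI)
  show "cring complex_field" by (rule cring_complex_field)
  show "abelian_group (ell2 X)"
  proof (rule abelian_groupI)
    show "\<exists>g\<in>carrier (ell2 X). g \<oplus>\<^bsub>ell2 X\<^esub> f = \<zero>\<^bsub>ell2 X\<^esub>" if "f \<in> carrier (ell2 X)" for f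
      using ell2_smult[OF that, of "-1"] by (intro bexI[of _ "\<lambda>i. - f i"]) auto
    show "\<zero>\<^bsub>ell2 X\<^esub> \<in> carrier (ell2 X)" by (simp add: ell2_carrier)
  qed (auto simp: ell2_add ac_simps)
qed (auto simp: ell2_smult algebra_simps)

lemma hilbert_space_axioms_ell2:
  assumes x: "x \<in> carrier (ell2 X)" and y: "y \<in> carrier (ell2 X)"
  shows ell2_ip_add: "z \<in> carrier (ell2 X) \<Longrightarrow> ip (ell2 X) (x \<oplus>\<^bsub>ell2 X\<^esub> y) z
    = ip (ell2 X) x z + ip (ell2 X) y z"
    and ell2_ip_smult: "ip (ell2 X) (c \<odot>\<^bsub>ell2 X\<^esub> x) y = c * ip (ell2 X) x y"
    and ell2_ip_commute: "ip (ell2 X) y x = cnj (ip (ell2 X) x y)"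
    and ell2_ip_pos: "x \<noteq> \<zero>\<^bsub>ell2 X\<^esub> \<Longrightarrow> 0 < Re (ip (ell2 X) x x)"
proof -
  show "ip (ell2 X) (x \<oplus>\<^bsub>ell2 X\<^esub> y) z = ip (ell2 X) x z + ip (ell2 X) y z" if "z \<in> carrier (ell2 X)"
    using ell2_ip_summable[OF x that] ell2_ip_summable[OF y that]
    by (simp add: ell2_ip distrib_right infsum_add)
  show "ip (ell2 X) (c \<odot>\<^bsub>ell2 X\<^esub> x) y = c * ip (ell2 X) x y"
    by (simp add: ell2_ip infsum_cmult_right' mult.assoc)
  show "ip (ell2 X) y x = cnj (ip (ell2 X) x y)"
    by (simp add: ell2_ip mult.commute flip: infsum_cnj)
  have "0 \<le> Re (ip (ell2 X) x x)" by (simp add: ell2_ip_self infsum_nonneg)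
  then show "0 < Re (ip (ell2 X) x x)" if "x \<noteq> \<zero>\<^bsub>ell2 X\<^esub>"
    using that ell2_eq_zero[OF x] by (fastforce simp: hnorm_def)
qed

lemma normed_module_ell2: "normed_module (ell2 X) (hnorm (ell2 X))"
proof (intro normed_module.intro module_ell2 normed_module_axioms.intro)
  show "0 \<le> hnorm (ell2 X) f" for f by (simp add: ell2_hnorm infsum_nonneg)
  show "hnorm (ell2 X) f = 0 \<longleftrightarrow> f = \<zero>\<^bsub>ell2 X\<^esub>" if "f \<in> carrier (ell2 X)" for f
    using ell2_eq_zero[OF that] by (auto simp: ell2_hnorm)
  show "hnorm (ell2 X) (c \<odot>\<^bsub>ell2 X\<^esub> f) = cmod c * hnorm (ell2 X) f" for c f
    by (simp add: ell2_hnorm norm_mult power_mult_distrib infsum_cmult_right' real_sqrt_mult)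
  show "hnorm (ell2 X) (f \<oplus>\<^bsub>ell2 X\<^esub> g) \<le> hnorm (ell2 X) f + hnorm (ell2 X) g"
    if f: "f \<in> carrier (ell2 X)" and g: "g \<in> carrier (ell2 X)" for f g
  proof (rule ell2_hnorm_le)
    show "f \<oplus>\<^bsub>ell2 X\<^esub> g \<in> carrier (ell2 X)" using ell2_add[OF f g] by simp
    show "0 \<le> hnorm (ell2 X) f + hnorm (ell2 X) g" by (simp add: ell2_hnorm infsum_nonneg)
    fix F assume "finite F" "F \<subseteq> X"
    have L2: "L2_set (\<lambda>i. cmod (h i)) F \<le> hnorm (ell2 X) h" if "h \<in> carrier (ell2 X)" for h
      unfolding L2_set_def using ell2_sum_le[OF that \<open>finite F\<close>]
      by (intro real_le_lsqrt sum_nonneg) (simp_all add: ell2_hnorm infsum_nonneg)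
    have "L2_set (\<lambda>i. cmod (f i + g i)) F \<le> L2_set (\<lambda>i. cmod (f i) + cmod (g i)) F"
      by (intro L2_set_mono norm_triangle_ineq) simp
    also have "\<dots> \<le> L2_set (\<lambda>i. cmod (f i)) F + L2_set (\<lambda>i. cmod (g i)) F" by (rule L2_set_triangle_ineq)
    also have "\<dots> \<le> hnorm (ell2 X) f + hnorm (ell2 X) g" using L2 f g by (intro add_mono)
    finally have "(L2_set (\<lambda>i. cmod (f i + g i)) F)\<^sup>2 \<le> (hnorm (ell2 X) f + hnorm (ell2 X) g)\<^sup>2"
      by (intro power_mono) (simp_all add: L2_set_nonneg)
    then show "(\<Sum>i\<in>F. (cmod ((f \<oplus>\<^bsub>ell2 X\<^esub> g) i))\<^sup>2) \<le> (hnorm (ell2 X) f + hnorm (ell2 X) g)\<^sup>2"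
      by (simp add: L2_set_def sum_nonneg)
  qed
qed

lemma ell2_minus:
  assumes f: "f \<in> carrier (ell2 X)" and g: "g \<in> carrier (ell2 X)"
  shows "f \<ominus>\<^bsub>ell2 X\<^esub> g = (\<lambda>i. f i - g i)"
proof -
  interpret normed_module "ell2 X" "hnorm (ell2 X)" by (rule normed_module_ell2)
  show ?thesis using uminus_eq_smult[OF g] by (simp add: minus_eq)
qed

text \<open>Coordinates of a Cauchy sequence converge. Bounds on finite partial sums survive the
  coordinatewise limit, and finite partial sums determine both membership and the norm.\<close>

theorem hilbert_space_ell2: "hilbert_space (ell2 X)"
proof -
  interpret E: normed_module "ell2 X" "hnorm (ell2 X)" by (rule normed_module_ell2)
  have "norm_complete (ell2 X) (hnorm (ell2 X))"
    unfolding E.norm_complete_iff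
  proof (intro allI impI)
    fix f :: "nat \<Rightarrow> 'a \<Rightarrow> complex"
    assume A: "(\<forall>n. f n \<in> carrier (ell2 X)) \<and>
      (\<forall>\<epsilon>>0. \<exists>M. \<forall>m\<ge>M. \<forall>n\<ge>M. hnorm (ell2 X) (f m \<ominus>\<^bsub>ell2 X\<^esub> f n) < \<epsilon>)"
    then have f: "f n \<in> carrier (ell2 X)" for n by simp
    have minus: "(\<lambda>i. f m i - f n i) \<in> carrier (ell2 X)" for m n
      using E.M.minus_closed[OF f[of m] f[of n]] by (simp add: ell2_minus f)
    have cauchy: "\<exists>M. \<forall>m\<ge>M. \<forall>n\<ge>M. hnorm (ell2 X) (\<lambda>i. f m i - f n i) < \<epsilon>" if "0 < \<epsilon>" for \<epsilon>
      using A that by (simp add: ell2_minus f)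
    have "convergent (\<lambda>n. f n i)" for i
    proof -
      have "Cauchy (\<lambda>n. f n i)"
      proof (rule metric_CauchyI)
        fix e :: real assume "0 < e"
        then obtain M where M: "\<forall>m\<ge>M. \<forall>n\<ge>M. hnorm (ell2 X) (\<lambda>i. f m i - f n i) < e"
          using cauchy by blast
        have "dist (f m i) (f n i) < e" if mn: "m \<ge> M" "n \<ge> M" for m n
          using ell2_cmod_le[OF minus[of m n], of i] M mn by (fastforce simp: dist_norm)
        then show "\<exists>M. \<forall>m\<ge>M. \<forall>n\<ge>M. dist (f m i) (f n i) < e" by blast
      qed
      then show ?thesis by (simp add: Cauchy_convergent_iff)
    qed
    then obtain l where l: "\<And>i. (\<lambda>n. f n i) \<longlonglongrightarrow> l i" unfolding convergent_def by metis
    have l_out: "l i = 0" if "i \<notin> X" for i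
      using l[of i] ell2_outside[OF f that] LIMSEQ_unique[OF _ tendsto_const, of "0::complex"] by simp
    have lim: "\<exists>M. \<forall>m\<ge>M. (\<lambda>i. f m i - l i) \<in> carrier (ell2 X) \<and> hnorm (ell2 X) (\<lambda>i. f m i - l i) \<le> \<epsilon>"
      if \<epsilon>: "0 < \<epsilon>" for \<epsilon>
    proof -
      obtain M where M: "\<And>m n. m \<ge> M \<Longrightarrow> n \<ge> M \<Longrightarrow> hnorm (ell2 X) (\<lambda>i. f m i - f n i) < \<epsilon>"
        using cauchy[OF \<epsilon>] by blast
      have le: "(\<Sum>i\<in>F. (cmod (f m i - l i))\<^sup>2) \<le> \<epsilon>\<^sup>2" if m: "m \<ge> M" and F: "finite F" for m F
      proof (rule LIMSEQ_le_const2)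
        show "(\<lambda>n. \<Sum>i\<in>F. (cmod (f m i - f n i))\<^sup>2) \<longlonglongrightarrow> (\<Sum>i\<in>F. (cmod (f m i - l i))\<^sup>2)"
          by (intro tendsto_intros l)
        have "(\<Sum>i\<in>F. (cmod (f m i - f n i))\<^sup>2) \<le> \<epsilon>\<^sup>2" if n: "n \<ge> M" for n
        proof -
          have "(\<Sum>i\<in>F. (cmod (f m i - f n i))\<^sup>2) \<le> (hnorm (ell2 X) (\<lambda>i. f m i - f n i))\<^sup>2"
            by (rule ell2_sum_le[OF minus F])
          also have "\<dots> \<le> \<epsilon>\<^sup>2" using M[OF m n] E.N_nonneg[OF minus]
            by (intro power_mono) (auto intro: less_imp_le)
          finally show ?thesis .
        qed
        then show "\<exists>N. \<forall>n\<ge>N. (\<Sum>i\<in>F. (cmod (f m i - f n i))\<^sup>2) \<le> \<epsilon>\<^sup>2" by blast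
      qed
      have "(\<lambda>i. f m i - l i) \<in> carrier (ell2 X)" if m: "m \<ge> M" for m
        using le[OF m] by (intro ell2_carrierI[of _ _ "\<epsilon>\<^sup>2"]) (simp_all add: l_out ell2_outside[OF f])
      then show ?thesis
        using le \<epsilon> by (intro exI[of _ M]) (auto intro!: ell2_hnorm_le)
    qed
    obtain m where m: "(\<lambda>i. f m i - l i) \<in> carrier (ell2 X)" using lim[of 1] by auto
    \<comment> \<open>The limit is \<open>f m\<close> minus the square-summable difference of
      \<open>f m\<close> and the limit.\<close>
    have "l = (\<lambda>i. f m i + (-1) * (f m i - l i))" by auto
    then have l_in: "l \<in> carrier (ell2 X)"
      using ell2_add[OF f[of m] ell2_smult[OF m, of "-1"]] by simp
    show "\<exists>l\<in>carrier (ell2 X). \<forall>\<epsilon>>0. \<exists>M. \<forall>n\<ge>M. hnorm (ell2 X) (f n \<ominus>\<^bsub>ell2 X\<^esub> l) < \<epsilon>"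
    proof (intro bexI[of _ l] allI impI l_in)
      fix \<epsilon> :: real assume \<epsilon>: "0 < \<epsilon>"
      obtain M where M: "\<And>m. m \<ge> M \<Longrightarrow> hnorm (ell2 X) (\<lambda>i. f m i - l i) \<le> \<epsilon> / 2"
        using lim[of "\<epsilon> / 2"] \<epsilon> by auto
      have "hnorm (ell2 X) (f n \<ominus>\<^bsub>ell2 X\<^esub> l) < \<epsilon>" if "n \<ge> M" for n
        using M[OF that] \<epsilon> by (simp add: ell2_minus f l_in)
      then show "\<exists>M. \<forall>n\<ge>M. hnorm (ell2 X) (f n \<ominus>\<^bsub>ell2 X\<^esub> l) < \<epsilon>" by blast
    qed
  qed
  then show ?thesis
    by (intro hilbert_space.intro module_ell2 hilbert_space_axioms.intro)
      (auto intro: ell2_ip_add ell2_ip_smult ell2_ip_commute ell2_ip_pos simp del: ell2_simps)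
qed

text \<open>The set \<open>F\<close> carries all but a small part of the total sum, so the estimate
  is uniform in the sets \<open>Z\<close> that avoid it. This turns agreement on finite sets into
  norm approximation.\<close>

lemma ell2_tail:
  assumes f: "f \<in> carrier (ell2 X)" and \<epsilon>: "0 < \<epsilon>"
  shows "\<exists>F. finite F \<and> F \<subseteq> X \<and> (\<forall>Z. Z \<inter> F = {} \<longrightarrow> hnorm (ell2 X) (\<lambda>i. if i \<in> Z then f i else 0) < \<epsilon>)"
proof -
  let ?s = "\<lambda>i. (cmod (f i))\<^sup>2"
  have sum: "?s summable_on X" using f by (simp add: ell2_carrier)
  have "0 < (\<epsilon> / 2)\<^sup>2" using \<epsilon> by simp
  then obtain F where F: "finite F" "F \<subseteq> X" "dist (sum ?s F) (infsum ?s X) \<le> (\<epsilon> / 2)\<^sup>2"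
    using infsum_finite_approximation[OF sum] by blast
  have "hnorm (ell2 X) (\<lambda>i. if i \<in> Z then f i else 0) < \<epsilon>" if Z: "Z \<inter> F = {}" for Z
  proof -
    have "hnorm (ell2 X) (\<lambda>i. if i \<in> Z then f i else 0) \<le> \<epsilon> / 2"
    proof (rule ell2_hnorm_le)
      show "(\<lambda>i. if i \<in> Z then f i else 0) \<in> carrier (ell2 X)"
        by (rule ell2_comparison[OF f, of _ 1]) (auto simp: ell2_outside[OF f])
      show "(\<Sum>i\<in>G. (cmod (if i \<in> Z then f i else 0))\<^sup>2) \<le> (\<epsilon> / 2)\<^sup>2" if G: "finite G" "G \<subseteq> X" for G
      proof -
        have "(\<Sum>i\<in>G. (cmod (if i \<in> Z then f i else 0))\<^sup>2) = sum ?s (G \<inter> Z)"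
          using G by (auto simp: sum.inter_restrict intro!: sum.cong)
        also have "\<dots> = sum ?s (F \<union> (G \<inter> Z)) - sum ?s F"
          using F G Z by (subst sum.union_disjoint) auto
        also have "\<dots> \<le> infsum ?s X - sum ?s F"
          using F G sum by (intro diff_right_mono finite_sum_le_infsum) auto
        also have "\<dots> \<le> (\<epsilon> / 2)\<^sup>2" using F(3) by (simp add: dist_real_def)
        finally show ?thesis .
      qed
    qed (use \<epsilon> in simp)
    then show ?thesis using \<epsilon> by linarith
  qed
  then show ?thesis using F by blast
qed

text \<open>Weighted composition operators; multiplication by an indicator function is the case \<open>\<phi> = id\<close>.\<close>

definition comp_op :: "'i set \<Rightarrow> 'i set \<Rightarrow> ('i \<Rightarrow> 'i) \<Rightarrow> complex \<Rightarrow> ('i \<Rightarrow> complex) \<Rightarrow> 'i \<Rightarrow> complex" where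
  "comp_op X R \<phi> \<tau> = (\<lambda>f\<in>carrier (ell2 X). \<lambda>i. if i \<in> R then \<tau> * f (\<phi> i) else 0)"

text \<open>Injectivity of \<phi> turns a finite sum of squares of the image into a finite sum of
  squares of \<open>f\<close> times the squared modulus of \<tau>.\<close>

lemma comp_op_operator:
  assumes R: "R \<subseteq> X" "inj_on \<phi> R" "\<phi> ` R \<subseteq> X"
  shows "comp_op X R \<phi> \<tau> \<in> carrier (bounded_operators (ell2 X))"
proof -
  interpret E: hilbert_space "ell2 X" by (rule hilbert_space_ell2)
  have le: "(\<Sum>i\<in>F. (cmod (if i \<in> R then \<tau> * f (\<phi> i) else 0))\<^sup>2) \<le> (cmod \<tau> * hnorm (ell2 X) f)\<^sup>2"
    if f: "f \<in> carrier (ell2 X)" and F: "finite F" for f F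
  proof -
    have "(\<Sum>i\<in>F. (cmod (if i \<in> R then \<tau> * f (\<phi> i) else 0))\<^sup>2)
      = (\<Sum>i\<in>F \<inter> R. (cmod \<tau>)\<^sup>2 * (cmod (f (\<phi> i)))\<^sup>2)"
      using F by (auto simp: sum.inter_restrict norm_mult power_mult_distrib intro!: sum.cong)
    also have "\<dots> = (cmod \<tau>)\<^sup>2 * (\<Sum>i\<in>\<phi> ` (F \<inter> R). (cmod (f i))\<^sup>2)"
      using R(2) by (subst sum.reindex) (auto simp: sum_distrib_left inj_on_def)
    also have "\<dots> \<le> (cmod \<tau>)\<^sup>2 * (hnorm (ell2 X) f)\<^sup>2"
      using F by (intro mult_left_mono ell2_sum_le[OF f]) auto
    finally show ?thesis by (simp add: power_mult_distrib)
  qed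
  have carrier: "(\<lambda>i. if i \<in> R then \<tau> * f (\<phi> i) else 0) \<in> carrier (ell2 X)"
    if f: "f \<in> carrier (ell2 X)" for f
    using R(1) le[OF f] by (intro ell2_carrierI[of _ _ "(cmod \<tau> * hnorm (ell2 X) f)\<^sup>2"]) auto
  show ?thesis
  proof (intro E.operatorI E.bounded_operatorI[of _ "cmod \<tau>"])
    show "comp_op X R \<phi> \<tau> \<in> extensional (carrier (ell2 X))" by (simp add: comp_op_def)
    fix f assume f: "f \<in> carrier (ell2 X)"
    show "comp_op X R \<phi> \<tau> f \<in> carrier (ell2 X)" using f carrier by (simp add: comp_op_def)
    show "hnorm (ell2 X) (comp_op X R \<phi> \<tau> f) \<le> cmod \<tau> * hnorm (ell2 X) f"
      using f le[OF f] carrier[OF f] by (simp add: comp_op_def ell2_hnorm_le)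
    show "comp_op X R \<phi> \<tau> (c \<odot>\<^bsub>ell2 X\<^esub> f) = c \<odot>\<^bsub>ell2 X\<^esub> comp_op X R \<phi> \<tau> f" for c
      using f by (auto simp: comp_op_def ell2_smult)
    fix g assume g: "g \<in> carrier (ell2 X)"
    show "comp_op X R \<phi> \<tau> (f \<oplus>\<^bsub>ell2 X\<^esub> g) = comp_op X R \<phi> \<tau> f \<oplus>\<^bsub>ell2 X\<^esub> comp_op X R \<phi> \<tau> g"
      using f g by (auto simp: comp_op_def ell2_add distrib_left)
  qed
qed

text \<open>The inner product is a sum over \<open>R\<close>, which \<phi> reindexes as a sum over
  \<open>R'\<close>.\<close>

lemma comp_op_adjoint:
  assumes R: "R \<subseteq> X" "R' \<subseteq> X" and \<phi>: "bij_betw \<phi> R R'" and \<psi>: "\<And>i. i \<in> R' \<Longrightarrow> \<psi> i \<in> R \<and> \<phi> (\<psi> i) = i"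
  shows "adjoint_op (ell2 X) (comp_op X R \<phi> \<tau>) = comp_op X R' \<psi> (cnj \<tau>)"
proof -
  interpret E: hilbert_space "ell2 X" by (rule hilbert_space_ell2)
  have \<psi>': "\<psi> (\<phi> i) = i" if "i \<in> R" for i
    using \<psi>[of "\<phi> i"] \<phi> that by (auto simp: bij_betw_def inj_on_def)
  show ?thesis
  proof (rule E.adjointI)
    show "comp_op X R \<phi> \<tau> \<in> carrier (bounded_operators (ell2 X))"
      using R \<phi> by (intro comp_op_operator) (auto simp: bij_betw_def)
    show "comp_op X R' \<psi> (cnj \<tau>) \<in> carrier (bounded_operators (ell2 X))"
    proof (rule comp_op_operator[OF R(2)])
      show "inj_on \<psi> R'" by (rule inj_onI) (metis \<psi>)
      show "\<psi> ` R' \<subseteq> X" using R \<psi> by auto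
    qed
    fix f g assume f: "f \<in> carrier (ell2 X)" and g: "g \<in> carrier (ell2 X)"
    have "ip (ell2 X) (comp_op X R \<phi> \<tau> f) g = (\<Sum>\<^sub>\<infinity>i\<in>R. \<tau> * f (\<phi> i) * cnj (g i))"
      unfolding ell2_ip using R f by (intro infsum_cong_neutral) (auto simp: comp_op_def)
    also have "\<dots> = (\<Sum>\<^sub>\<infinity>i\<in>R. \<tau> * f (\<phi> i) * cnj (g (\<psi> (\<phi> i))))"
      using \<psi>' by (intro infsum_cong) simp
    also have "\<dots> = (\<Sum>\<^sub>\<infinity>i\<in>R'. \<tau> * f i * cnj (g (\<psi> i)))"
      by (rule infsum_reindex_bij_betw[OF \<phi>])
    also have "\<dots> = ip (ell2 X) f (comp_op X R' \<psi> (cnj \<tau>) g)"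
      unfolding ell2_ip using R g by (intro infsum_cong_neutral) (auto simp: comp_op_def)
    finally show "ip (ell2 X) (comp_op X R \<phi> \<tau> f) g = ip (ell2 X) f (comp_op X R' \<psi> (cnj \<tau>) g)" .
  qed
qed

section \<open>Boundary paths\<close>

definition shift :: "nat \<Rightarrow> (nat \<Rightarrow> 'c) \<Rightarrow> nat \<Rightarrow> 'c" where
  "shift n z = (\<lambda>k. z (n + k))"

lemma shift_apply [simp]: "shift n z k = z (n + k)"
  by (simp add: shift_def)

lemma shift_0 [simp]: "shift 0 z = z"
  by (simp add: shift_def)

lemma shift_shift [simp]: "shift m (shift n z) = shift (n + m) z"
  by (simp add: shift_def add.assoc)

lemma shift_case_nat [simp]: "shift (Suc 0) (case_nat a z) = z"
  by (simp add: shift_def)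

lemma case_nat_shift: "z 0 = a \<Longrightarrow> case_nat a (shift (Suc 0) z) = z"
  by (auto split: nat.split)

lemma case_nat_eq_iff: "case_nat a y = z \<longleftrightarrow> z 0 = a \<and> y = shift (Suc 0) z"
  by (auto simp: case_nat_shift)

text \<open>The two shifts are independent: the paths may agree with a lag, as prepending an edge to
  a path requires.\<close>

definition tail_equivalent :: "(nat \<Rightarrow> 'c) \<Rightarrow> (nat \<Rightarrow> 'c) \<Rightarrow> bool" where
  "tail_equivalent x z \<longleftrightarrow> (\<exists>m n. shift m x = shift n z)"

lemma tail_equivalent_refl [simp]: "tail_equivalent x x"
  by (auto simp: tail_equivalent_def)

lemma tail_equivalent_sym: "tail_equivalent x z \<Longrightarrow> tail_equivalent z x"
  by (auto simp: tail_equivalent_def dest: sym)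

lemma tail_equivalent_trans:
  assumes "tail_equivalent x y" "tail_equivalent y z"
  shows "tail_equivalent x z"
proof -
  obtain m n where 1: "shift m x = shift n y" using assms by (auto simp: tail_equivalent_def)
  obtain k l where 2: "shift k y = shift l z" using assms by (auto simp: tail_equivalent_def)
  have "shift (m + k) x = shift (n + k) y" using arg_cong[OF 1, of "shift k"] by simp
  also have "\<dots> = shift (l + n) z" using arg_cong[OF 2, of "shift n"] by (simp add: add.commute)
  finally show ?thesis by (auto simp: tail_equivalent_def)
qed

lemma tail_equivalent_shift: "tail_equivalent z (shift n z)"
  unfolding tail_equivalent_def by (rule exI[of _ n], rule exI[of _ 0]) simp

context wf_digraph
begin

fun node :: "'a + 'b \<Rightarrow> 'a" where
  "node (Inl w) = w"
| "node (Inr e) = tail G e"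

text \<open>A boundary path is an infinite path or a finite path ending in a singular vertex \<open>w\<close>; the latter
  is padded with \<open>Inl w\<close>.\<close>

definition boundary_paths :: "(nat \<Rightarrow> 'a + 'b) set" where
  "boundary_paths = {z. \<forall>n. case z n of
     Inl w \<Rightarrow> w \<in> verts G \<and> \<not> regular_vertex G w \<and> z (Suc n) = Inl w
   | Inr e \<Rightarrow> e \<in> arcs G \<and> node (z (Suc n)) = head G e}"

lemma boundary_path_Inl:
  assumes "z \<in> boundary_paths" "z n = Inl w"
  shows "w \<in> verts G" "\<not> regular_vertex G w" "z (Suc n) = Inl w"
  using assms by (auto simp: boundary_paths_def dest!: spec[of _ n])

lemma boundary_path_Inr:
  assumes "z \<in> boundary_paths" "z n = Inr e"
  shows "e \<in> arcs G" "node (z (Suc n)) = head G e"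
  using assms by (auto simp: boundary_paths_def dest!: spec[of _ n])

lemma boundary_pathI:
  assumes "\<And>n w. z n = Inl w \<Longrightarrow> w \<in> verts G \<and> \<not> regular_vertex G w \<and> z (Suc n) = Inl w"
    and "\<And>n e. z n = Inr e \<Longrightarrow> e \<in> arcs G \<and> node (z (Suc n)) = head G e"
  shows "z \<in> boundary_paths"
  using assms by (auto simp: boundary_paths_def split: sum.split)

lemma boundary_path_node: "z \<in> boundary_paths \<Longrightarrow> node (z n) \<in> verts G"
  by (cases "z n") (auto dest: boundary_path_Inl boundary_path_Inr)

lemma boundary_path_shift: "z \<in> boundary_paths \<Longrightarrow> shift n z \<in> boundary_paths"
  by (rule boundary_pathI) (auto dest: boundary_path_Inl boundary_path_Inr)

lemma boundary_path_cons:
  "\<lbrakk>z \<in> boundary_paths; e \<in> arcs G; node (z 0) = head G e\<rbrakk> \<Longrightarrow> case_nat (Inr e) z \<in> boundary_paths"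
  by (rule boundary_pathI) (auto split: nat.splits dest: boundary_path_Inl boundary_path_Inr)

lemma boundary_path_const:
  "\<lbrakk>w \<in> verts G; \<not> regular_vertex G w\<rbrakk> \<Longrightarrow> (\<lambda>_. Inl w) \<in> boundary_paths"
  by (rule boundary_pathI) auto

lemma boundary_path_Inl_const:
  assumes z: "z \<in> boundary_paths" "z n = Inl w"
  shows "shift n z = (\<lambda>_. Inl w)"
proof
  show "shift n z k = Inl w" for k
    by (induction k) (use z boundary_path_Inl(3)[OF z(1)] in auto)
qed

definition tail_class :: "(nat \<Rightarrow> 'a + 'b) \<Rightarrow> (nat \<Rightarrow> 'a + 'b) set" where
  "tail_class x = {z \<in> boundary_paths. tail_equivalent x z}"

section \<open>Representations on boundary paths\<close>

definition path_proj :: "(nat \<Rightarrow> 'a + 'b) set \<Rightarrow> 'a \<Rightarrow> ((nat \<Rightarrow> 'a + 'b) \<Rightarrow> complex) \<Rightarrow> (nat \<Rightarrow> 'a + 'b) \<Rightarrow>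
  complex" where
  "path_proj X v = comp_op X {z \<in> X. node (z 0) = v} (\<lambda>z. z) 1"

text \<open>The scalar \<open>\<tau>\<close> is the gauge twist.\<close>

definition path_isom ::
    "(nat \<Rightarrow> 'a + 'b) set \<Rightarrow> complex \<Rightarrow> 'b \<Rightarrow> ((nat \<Rightarrow> 'a + 'b) \<Rightarrow> complex) \<Rightarrow> (nat \<Rightarrow> 'a + 'b) \<Rightarrow> complex" where
  "path_isom X \<tau> e = comp_op X {z \<in> X. z 0 = Inr e} (shift (Suc 0)) \<tau>"

text \<open>Explicit form of the adjoint of \<open>path_isom\<close>. Up to the scalar, it deletes
  the leading edge \<open>e\<close> from a basis path and kills the basis paths that do not begin
  with \<open>e\<close>.\<close>

definition path_isom_star ::
    "(nat \<Rightarrow> 'a + 'b) set \<Rightarrow> complex \<Rightarrow> 'b \<Rightarrow> ((nat \<Rightarrow> 'a + 'b) \<Rightarrow> complex) \<Rightarrow> (nat \<Rightarrow> 'a + 'b) \<Rightarrow> complex" where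
  "path_isom_star X \<tau> e = comp_op X {z \<in> X. node (z 0) = head G e} (case_nat (Inr e)) (cnj \<tau>)"

end

lemma (in hilbert_space) finsum_operators_apply:
  assumes "finite F" "T \<in> F \<rightarrow> carrier B" "x \<in> carrier H"
  shows "(\<Oplus>\<^bsub>B\<^esub>i\<in>F. T i) x = (\<Oplus>i\<in>F. T i x)"
  using assms
proof (induction F rule: finite_induct)
  case empty
  interpret B: abelian_group B by (rule abelian_group_operators)
  show ?case using empty by simp
next
  case (insert i F)
  interpret B: abelian_group B by (rule abelian_group_operators)
  have "T j x \<in> carrier H" if "j \<in> insert i F" for j
    using insert.prems that by (intro operatorD(3)[of "T j"]) auto
  then show ?case using insert by (simp add: Pi_def)
qed

lemma ell2_finsum:
  assumes "finite F" "f \<in> F \<rightarrow> carrier (ell2 X)"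
  shows "(\<Oplus>\<^bsub>ell2 X\<^esub>i\<in>F. f i) = (\<lambda>z. \<Sum>i\<in>F. f i z)"
  using assms
proof (induction F rule: finite_induct)
  case empty
  interpret module complex_field "ell2 X" by (rule module_ell2)
  show ?case by simp
next
  case (insert i F)
  interpret module complex_field "ell2 X" by (rule module_ell2)
  show ?case using insert by (simp add: Pi_def)
qed

text \<open>Closure under deleting and prepending edges keeps the operators within
  \<open>ell2 X\<close>. The tail classes are the instances of interest.\<close>

locale invariant_paths = wf_digraph G for G :: "('a, 'b) pre_digraph" +
  fixes X :: "(nat \<Rightarrow> 'a + 'b) set" and \<tau> :: complex
  assumes X_boundary: "X \<subseteq> boundary_paths"
    and X_shift: "z \<in> X \<Longrightarrow> shift (Suc 0) z \<in> X"
    and X_cons: "\<lbrakk>z \<in> X; e \<in> arcs G; node (z 0) = head G e\<rbrakk> \<Longrightarrow> case_nat (Inr e) z \<in> X"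
    and \<tau>: "cmod \<tau> = 1"
begin

sublocale E: hilbert_space "ell2 X" by (rule hilbert_space_ell2)

abbreviation "P \<equiv> path_proj X"
abbreviation "S \<equiv> path_isom X \<tau>"
abbreviation "S' \<equiv> path_isom_star X \<tau>"

lemma \<tau>_cnj [simp]: "\<tau> * cnj \<tau> = 1" "cnj \<tau> * \<tau> = 1" "\<tau> * (cnj \<tau> * a) = a" "cnj \<tau> * (\<tau> * a) = a"
proof -
  show "\<tau> * cnj \<tau> = 1" using complex_norm_square[of \<tau>] \<tau> by simp
  then show "cnj \<tau> * \<tau> = 1" "\<tau> * (cnj \<tau> * a) = a" "cnj \<tau> * (\<tau> * a) = a"
    by (simp_all add: mult.commute flip: mult.assoc)
qed

lemma X_node: "\<lbrakk>z \<in> X; z 0 = Inr e\<rbrakk> \<Longrightarrow> e \<in> arcs G \<and> node (z (Suc 0)) = head G e"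
  using X_boundary boundary_path_Inr by blast

lemma path_op_carrier:
  shows P_carrier: "P v \<in> carrier E.B"
    and S_carrier: "S e \<in> carrier E.B"
    and S'_carrier: "e \<in> arcs G \<Longrightarrow> S' e \<in> carrier E.B"
proof -
  show "P v \<in> carrier E.B" unfolding path_proj_def by (rule comp_op_operator) auto
  show "S e \<in> carrier E.B" unfolding path_isom_def
  proof (rule comp_op_operator)
    show "inj_on (shift (Suc 0)) {z \<in> X. z 0 = Inr e}"
      by (rule inj_onI) (metis (mono_tags, lifting) case_nat_shift mem_Collect_eq)
  qed (auto simp: X_shift)
  show "S' e \<in> carrier E.B" if "e \<in> arcs G" unfolding path_isom_star_def
  proof (rule comp_op_operator)
    show "inj_on (case_nat (Inr e)) {z \<in> X. node (z 0) = head G e}"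
      by (rule inj_onI) (metis shift_case_nat)
  qed (auto simp: X_cons that)
qed

lemma P_apply: "f \<in> carrier (ell2 X) \<Longrightarrow> P v f z = (if node (z 0) = v then f z else 0)"
  by (simp add: path_proj_def comp_op_def ell2_outside)

lemma S_apply: "f \<in> carrier (ell2 X) \<Longrightarrow> S e f z = (if z \<in> X \<and> z 0
  = Inr e then \<tau> * f (shift (Suc 0) z) else 0)"
  by (simp add: path_isom_def comp_op_def)

lemma S_outside: "f \<in> carrier (ell2 X) \<Longrightarrow> z 0 \<noteq> Inr e \<Longrightarrow> S e f z = 0"
  by (simp add: S_apply)

lemma S'_apply: "f \<in> carrier (ell2 X) \<Longrightarrow>
    S' e f z = (if z \<in> X \<and> node (z 0) = head G e then cnj \<tau> * f (case_nat (Inr e) z) else 0)"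
  by (simp add: path_isom_star_def comp_op_def)

lemma adjoint_P: "adjoint_op (ell2 X) (P v) = P v"
  unfolding path_proj_def by (subst comp_op_adjoint[where \<psi> = "\<lambda>z. z"]) (auto simp: bij_betw_def)

lemma adjoint_S: assumes e: "e \<in> arcs G" shows "adjoint_op (ell2 X) (S e) = S' e"
  unfolding path_isom_def path_isom_star_def
proof (rule comp_op_adjoint)
  show "bij_betw (shift (Suc 0)) {z \<in> X. z 0 = Inr e} {z \<in> X. node (z 0) = head G e}"
    by (rule bij_betwI[where g = "case_nat (Inr e)"])
      (auto simp: X_shift X_cons e case_nat_shift dest: X_node)
qed (auto simp: X_cons e)

lemmas path_op_closed =
  E.operatorD(3)[OF P_carrier] E.operatorD(3)[OF S_carrier] E.operatorD(3)[OF S'_carrier]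

text \<open>The range projection of \<open>S e\<close> is restriction to the paths that begin with
  \<open>e\<close>; the twist cancels since \<tau> has modulus one.\<close>

lemma SS'_apply:
  assumes e: "e \<in> arcs G" and f: "f \<in> carrier (ell2 X)"
  shows "S e (S' e f) z = (if z 0 = Inr e then f z else 0)"
  using f X_node[of z e] ell2_outside[OF f, of z]
  by (auto simp: S_apply S'_apply path_op_closed e X_shift case_nat_shift)

text \<open>All relations describe the partition of \<open>X\<close> by first letters. The relation
  at a regular vertex holds because a boundary path cannot stop there, so it begins with one of the
  finitely many edges emitted.\<close>

lemma cuntz_krieger_family_paths: "cuntz_krieger_family G E.B P S"
  unfolding cuntz_krieger_family_def
proof (intro conjI ballI allI impI)
  note closed = E.operator_mult E.operator_zero P_carrier S_carrier S'_carrier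
  show "projection E.B (P v)" for v
    unfolding projection_def
    by (intro conjI E.operator_eqI)
      (auto simp: closed adjoint_P path_op_closed P_apply intro!: ext)
  show "P v \<otimes>\<^bsub>E.B\<^esub> P w = \<zero>\<^bsub>E.B\<^esub>" if "v \<noteq> w" for v w
    by (rule E.operator_eqI) (use that in \<open>auto simp: closed path_op_closed P_apply intro!: ext\<close>)
  show "partial_isometry E.B (S e)" if e: "e \<in> arcs G" for e
    unfolding partial_isometry_def star_bounded_operators adjoint_S[OF e]
    by (intro conjI E.operator_eqI)
      (auto simp: e closed path_op_closed SS'_apply S_outside intro!: ext)
  show "(S e \<otimes>\<^bsub>E.B\<^esub> star E.B (S e)) \<otimes>\<^bsub>E.B\<^esub> (S f \<otimes>\<^bsub>E.B\<^esub> star E.B (S f)) = \<zero>\<^bsub>E.B\<^esub>"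
    if "e \<in> arcs G" "f \<in> arcs G" "e \<noteq> f" for e f
    unfolding star_bounded_operators adjoint_S[OF that(1)] adjoint_S[OF that(2)]
    by (rule E.operator_eqI) (use that in \<open>auto simp: closed path_op_closed SS'_apply intro!: ext\<close>)
  show "star E.B (S e) \<otimes>\<^bsub>E.B\<^esub> S e = P (head G e)" if e: "e \<in> arcs G" for e
    unfolding star_bounded_operators adjoint_S[OF e]
    by (rule E.operator_eqI)
      (auto simp: e closed path_op_closed S'_apply S_apply P_apply X_cons ell2_outside intro!: ext)
  show "cstar_le E.B (S e \<otimes>\<^bsub>E.B\<^esub> star E.B (S e)) (P (tail G e))" if e: "e \<in> arcs G" for e
  proof -
    \<comment> \<open>The projection onto the paths that start at the source of \<open>e\<close> but
      not with \<open>e\<close>. As a projection it is its own adjoint times itself, so it witnesses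
      the order relation.\<close>
    define D where "D = comp_op X {z \<in> X. node (z 0) = tail G e \<and> z 0 \<noteq> Inr e} (\<lambda>z. z) 1"
    have D: "D \<in> carrier E.B" unfolding D_def by (rule comp_op_operator) auto
    have D_apply: "D f z = (if node (z 0) = tail G e \<and> z 0 \<noteq> Inr e then f z else 0)"
      if "f \<in> carrier (ell2 X)" for f z
      using that by (simp add: D_def comp_op_def ell2_outside)
    have "adjoint_op (ell2 X) D = D"
      unfolding D_def by (subst comp_op_adjoint[where \<psi> = "\<lambda>z. z"]) (auto simp: bij_betw_def)
    moreover interpret B: module complex_field E.B by (rule E.module_operators)
    have "P (tail G e) \<ominus>\<^bsub>E.B\<^esub> (S e \<otimes>\<^bsub>E.B\<^esub> S' e) = D \<otimes>\<^bsub>E.B\<^esub> D"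
      by (rule E.operator_eqI)
        (auto simp: e D closed path_op_closed E.operatorD(3)[OF D] E.operator_minus ell2_minus
          SS'_apply P_apply D_apply intro!: ext)
    ultimately show ?thesis
      unfolding cstar_le_def star_bounded_operators adjoint_S[OF e] using D
        by (intro bexI[of _ D]) simp_all
  qed
  show "P v = (\<Oplus>\<^bsub>E.B\<^esub>e\<in>out_arcs G v. S e \<otimes>\<^bsub>E.B\<^esub> star E.B (S e))" if v: "regular_vertex G v" for v
  proof -
    interpret B: module complex_field E.B by (rule E.module_operators)
    have fin: "finite (out_arcs G v)" using v by (simp add: regular_vertex_def)
    have SS: "S e \<otimes>\<^bsub>E.B\<^esub> star E.B (S e) \<in> carrier E.B" for e
      by (simp add: closed E.operator_star)
    show ?thesis
    proof (rule E.operator_eqI)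
      show "(\<Oplus>\<^bsub>E.B\<^esub>e\<in>out_arcs G v. S e \<otimes>\<^bsub>E.B\<^esub> star E.B (S e)) \<in> carrier E.B"
        using SS by (intro B.finsum_closed) simp
      fix f assume f: "f \<in> carrier (ell2 X)"
      have "(\<Oplus>\<^bsub>E.B\<^esub>e\<in>out_arcs G v. S e \<otimes>\<^bsub>E.B\<^esub> star E.B (S e)) f
          = (\<Oplus>\<^bsub>ell2 X\<^esub>e\<in>out_arcs G v. (S e \<otimes>\<^bsub>E.B\<^esub> star E.B (S e)) f)"
        using SS f by (intro E.finsum_operators_apply fin) simp_all
      also have "\<dots> = (\<lambda>z. \<Sum>e\<in>out_arcs G v. (S e \<otimes>\<^bsub>E.B\<^esub> star E.B (S e)) f z)"
        using E.operatorD(3)[OF SS f] by (intro ell2_finsum fin) blast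
      also have "\<dots> = P v f"
      proof
        fix z
        have "(\<Sum>e\<in>out_arcs G v. (S e \<otimes>\<^bsub>E.B\<^esub> star E.B (S e)) f z) = (\<Sum>e\<in>out_arcs G v. if z 0
          = Inr e then f z else 0)"
          using f by (intro sum.cong) (simp_all add: adjoint_S SS'_apply)
        also have "\<dots> = P v f z"
        proof (cases "z \<in> X")
          case True
          then have z: "z \<in> boundary_paths" using X_boundary by blast
          show ?thesis
          proof (cases "z 0")
            case (Inl w)
            \<comment> \<open>Padding occurs only at singular vertices, whereas \<open>v\<close> is
              regular.\<close>
            then have "w \<noteq> v" using boundary_path_Inl(2)[OF z] v by auto
            then show ?thesis using f Inl by (simp add: P_apply)
          next
            case (Inr e)
            then show ?thesis using f fin boundary_path_Inr(1)[OF z] by (auto simp: P_apply)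
          qed
        next
          case False
          then have "f z = 0" using f by (simp add: ell2_outside)
          then show ?thesis using f by (auto simp: P_apply intro!: sum.neutral)
        qed
        finally show "(\<Sum>e\<in>out_arcs G v. (S e \<otimes>\<^bsub>E.B\<^esub> star E.B (S e)) f z) = P v f z" .
      qed
      finally show "P v f = (\<Oplus>\<^bsub>E.B\<^esub>e\<in>out_arcs G v. S e \<otimes>\<^bsub>E.B\<^esub> star E.B (S e)) f" by simp
    qed (rule P_carrier)
  qed
qed

end

section \<open>Irreducibility on a tail equivalence class, through closed invariant
  subspaces\<close>

definition point :: "'i \<Rightarrow> 'i \<Rightarrow> complex" where
  "point z = (\<lambda>y. if y = z then 1 else 0)"

lemma point_apply: "point z y = (if y = z then 1 else 0)"
  by (simp add: point_def)

lemma point_carrier: "z \<in> X \<Longrightarrow> point z \<in> carrier (ell2 X)"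
  by (rule ell2_carrierI[of _ _ 1]) (auto simp: point_def if_distrib if_distribR sum.delta cong:
    if_cong)

lemma ell2_restrict: "f \<in> carrier (ell2 X) \<Longrightarrow> (\<lambda>y. if y \<in> Z then f y else 0) \<in> carrier (ell2 X)"
  by (rule ell2_comparison[of f _ _ 1]) (auto simp: ell2_outside)

lemma (in invariant_paths) X_shifts: "z \<in> X \<Longrightarrow> shift n z \<in> X"
proof (induction n)
  case (Suc n)
  have "shift (Suc 0) (shift n z) \<in> X" by (rule X_shift[OF Suc.IH[OF Suc.prems]])
  then show ?case by (simp del: shift_apply)
qed simp

locale path_representation = invariant_paths G X \<tau> + A: cstar_algebra A
  for G :: "('a, 'b) pre_digraph" and X \<tau> and A :: "'c star_algebra" +
  fixes p :: "'a \<Rightarrow> 'c" and s :: "'b \<Rightarrow> 'c" and \<pi> :: "'c \<Rightarrow> ((nat \<Rightarrow> 'a + 'b) \<Rightarrow> complex) \<Rightarrow> (nat \<Rightarrow> 'a +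
    'b) \<Rightarrow> complex"
  assumes \<pi>_hom: "star_hom A E.B \<pi>"
    and p_closed: "v \<in> verts G \<Longrightarrow> p v \<in> carrier A"
    and s_closed: "e \<in> arcs G \<Longrightarrow> s e \<in> carrier A"
    and \<pi>_p: "v \<in> verts G \<Longrightarrow> \<pi> (p v) = P v"
    and \<pi>_s: "e \<in> arcs G \<Longrightarrow> \<pi> (s e) = S e"
begin

lemma \<pi>_s_star: "e \<in> arcs G \<Longrightarrow> \<pi> (star A (s e)) = S' e"
  using star_homD(5)[OF \<pi>_hom s_closed] by (simp add: \<pi>_s adjoint_S)

context
  fixes K
  assumes sub: "submodule K complex_field (ell2 X)"
    and closed: "closedin (norm_topology (ell2 X) (hnorm (ell2 X))) K"
    and inv: "\<And>a x. \<lbrakk>a \<in> carrier A; x \<in> K\<rbrakk> \<Longrightarrow> \<pi> a x \<in> K"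
begin

lemma K_carrier: "f \<in> K \<Longrightarrow> f \<in> carrier (ell2 X)"
  using E.submoduleE(1)[OF sub] by blast

lemma K_add: "\<lbrakk>f \<in> K; g \<in> K\<rbrakk> \<Longrightarrow> (\<lambda>z. f z + g z) \<in> K"
  using E.submoduleE(5)[OF sub, of f g] by simp

lemma K_smult: "f \<in> K \<Longrightarrow> (\<lambda>z. c * f z) \<in> K"
  using E.submoduleE(4)[OF sub, of c f] by simp

lemma K_minus: "\<lbrakk>f \<in> K; g \<in> K\<rbrakk> \<Longrightarrow> (\<lambda>z. f z - g z) \<in> K"
  using K_add[of f "\<lambda>z. - 1 * g z"] K_smult[of g "-1"] by simp

lemma K_P: "\<lbrakk>f \<in> K; v \<in> verts G\<rbrakk> \<Longrightarrow> P v f \<in> K"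
  using inv[of "p v" f] by (simp add: p_closed \<pi>_p)

lemma K_S: "\<lbrakk>f \<in> K; e \<in> arcs G\<rbrakk> \<Longrightarrow> S e f \<in> K"
  using inv[of "s e" f] by (simp add: s_closed \<pi>_s)

lemma K_S': "\<lbrakk>f \<in> K; e \<in> arcs G\<rbrakk> \<Longrightarrow> S' e f \<in> K"
  using inv[of "star A (s e)" f] by (simp add: s_closed A.star_closed \<pi>_s_star)

text \<open>The approximation error is \<open>h\<close> cut down to a set that avoids a prescribed
  finite set, hence arbitrarily small. Membership in \<open>K\<close> thus becomes a question about
  finitely many paths at a time.\<close>

lemma K_closedI:
  assumes f: "f \<in> carrier (ell2 X)" and h: "h \<in> carrier (ell2 X)"
    and approx: "\<And>F. \<lbrakk>finite F; F \<subseteq> X\<rbrakk> \<Longrightarrow> \<exists>k\<in>K. \<exists>Z. Z \<inter> F = {} \<and> (\<lambda>z. k z - f z) = (\<lambda>z.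
      if z \<in> Z then h z else 0)"
  shows "f \<in> K"
proof -
  have "\<exists>k\<in>K. hnorm (ell2 X) (f \<ominus>\<^bsub>ell2 X\<^esub> k) < \<epsilon>" if \<epsilon>: "0 < \<epsilon>" for \<epsilon>
  proof -
    obtain F where F: "finite F" "F \<subseteq> X"
      "\<And>Z. Z \<inter> F = {} \<Longrightarrow> hnorm (ell2 X) (\<lambda>z. if z \<in> Z then h z else 0) < \<epsilon>"
      using ell2_tail[OF h \<epsilon>] by blast
    obtain k Z where k: "k \<in> K" "Z \<inter> F = {}" "(\<lambda>z. k z - f z) = (\<lambda>z. if z \<in> Z then h z else 0)"
      using approx[OF F(1,2)] by blast
    have "hnorm (ell2 X) (f \<ominus>\<^bsub>ell2 X\<^esub> k) = hnorm (ell2 X) (k \<ominus>\<^bsub>ell2 X\<^esub> f)"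
      by (rule E.N_minus_commute[OF f K_carrier[OF k(1)]])
    then show ?thesis
      using F(3)[OF k(2)] k by (intro bexI[of _ k]) (simp_all add: ell2_minus f K_carrier)
  qed
  then show ?thesis
    using closed f unfolding E.closedin_norm_topology_iff by blast
qed

text \<open>Restriction to the paths beginning with \<open>e\<close> is \<open>S e\<close> after its
  adjoint and preserves \<open>K\<close>; it is subtracted for one edge after another.\<close>

lemma K_remove_edges:
  assumes "finite F" "F \<subseteq> arcs G" "f \<in> K"
  shows "(\<lambda>z. if \<forall>e\<in>F. z 0 \<noteq> Inr e then f z else 0) \<in> K"
  using assms(1,2)
proof (induction F rule: finite_induct)
  case empty
  show ?case using assms(3) by simp
next
  case (insert e F)
  let ?g = "\<lambda>z. if \<forall>e\<in>F. z 0 \<noteq> Inr e then f z else 0"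
  have g: "?g \<in> K" using insert by simp
  have e: "e \<in> arcs G" using insert by simp
  have "(\<lambda>z. ?g z - S e (S' e ?g) z) \<in> K" using K_minus[OF g K_S[OF K_S'[OF g e] e]] .
  also have "(\<lambda>z. ?g z - S e (S' e ?g) z) = (\<lambda>z. if \<forall>e\<in>insert e F. z 0 \<noteq> Inr e then f z else 0)"
    by (auto simp: SS'_apply[OF e K_carrier[OF g]])
  finally show ?case .
qed

text \<open>Induction on the length of the prescribed prefix: the adjoint of \<open>S e\<close>
  strips the first edge, the remainder is restricted, and \<open>S e\<close> puts the edge back. A
  path that stops at once offers no edge to strip. Its vertex may emit infinitely many edges, of
  which only finitely many can be removed algebraically; closedness of \<open>K\<close> supplies the
  limit.\<close>

lemma K_restrict_cylinder:
  assumes "f \<in> K" "z \<in> X"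
  shows "(\<lambda>y. if \<forall>k<n. y k = z k then f y else 0) \<in> K"
  using assms
proof (induction n arbitrary: f z)
  case 0
  then show ?case by simp
next
  case (Suc n)
  have z: "z \<in> boundary_paths" using Suc.prems X_boundary by blast
  have f: "f \<in> carrier (ell2 X)" using K_carrier Suc.prems by blast
  have agree: "(\<forall>k<Suc n. y k = z k) \<longleftrightarrow> y 0 = z 0 \<and> (\<forall>k<n. shift (Suc 0) y k = shift (Suc 0) z k)" for y
    by (auto simp: less_Suc_eq_0_disj)
  show ?case
  proof (cases "z 0")
    case (Inr e)
    have e: "e \<in> arcs G" using boundary_path_Inr[OF z Inr] by simp
    let ?g = "\<lambda>y. if \<forall>k<n. y k = shift (Suc 0) z k then S' e f y else 0"
    have g: "?g \<in> K" using Suc.IH[OF K_S'[OF Suc.prems(1) e] X_shift[OF Suc.prems(2)]] .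
    have "S e ?g y = (if \<forall>k<Suc n. y k = z k then f y else 0)" for y
    proof (cases "y \<in> X \<and> y 0 = Inr e")
      case True
      then have "S e ?g y = (if \<forall>k<n. shift (Suc 0) y k = shift (Suc 0) z k then S e (S' e f) y else 0)"
        using K_carrier[OF g] path_op_closed(3)[OF e f] by (auto simp: S_apply)
      then show ?thesis using True Inr by (auto simp: agree SS'_apply[OF e f])
    next
      case False
      then show ?thesis using Inr K_carrier[OF g] ell2_outside[OF f] by (auto simp: agree S_apply)
    qed
    then have "S e ?g = (\<lambda>y. if \<forall>k<Suc n. y k = z k then f y else 0)" by blast
    then show ?thesis using K_S[OF g e] by simp
  next
    case (Inl w)
    have w: "w \<in> verts G" using boundary_path_Inl[OF z Inl] by simp
    have zw: "z = (\<lambda>_. Inl w)" using boundary_path_Inl_const[OF z Inl] by simp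
    \<comment> \<open>Padding persists, so a path with first letter \<open>Inl w\<close> is the
      constant one.\<close>
    have only: "y = z" if "y \<in> X" "y 0 = Inl w" for y
      using boundary_path_Inl_const[of y 0 w] that X_boundary zw by auto
    have eq: "(\<lambda>y. if \<forall>k<Suc n. y k = z k then f y else 0) = (\<lambda>y. if y \<in> {z} then f y else 0)"
      using only Inl ell2_outside[OF f] by (fastforce simp: agree)
    show ?thesis unfolding eq
    proof (rule K_closedI[OF ell2_restrict[OF f] f])
      fix F :: "(nat \<Rightarrow> 'a + 'b) set" assume F: "finite F" "F \<subseteq> X"
      \<comment> \<open>The finitely many edges with which the members of \<open>F\<close> begin;
        removing them makes the error vanish on \<open>F\<close>.\<close>
      let ?F = "{e \<in> arcs G. \<exists>y\<in>F. y 0 = Inr e}"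
      have "?F \<subseteq> (\<lambda>y. projr (y 0)) ` F" by force
      then have fin: "finite ?F" using F(1) finite_surj by blast
      let ?k = "\<lambda>y. if \<forall>e\<in>?F. y 0 \<noteq> Inr e then P w f y else 0"
      have k: "?k \<in> K" by (rule K_remove_edges[OF fin _ K_P[OF Suc.prems(1) w]]) blast
      let ?Z = "{y \<in> X. node (y 0) = w \<and> y \<noteq> z \<and> (\<forall>e\<in>?F. y 0 \<noteq> Inr e)}"
      have disj: "?Z \<inter> F = {}"
      proof -
        have False if y: "y \<in> ?Z" "y \<in> F" for y
        proof (cases "y 0")
          case (Inl u)
          then show False using y only[of y] by auto
        next
          case (Inr e)
          then have "e \<in> arcs G" using X_node y by blast
          then show False using y Inr by blast
        qed
        then show ?thesis by blast
      qed
      have eq: "(\<lambda>y. ?k y - (if y \<in> {z} then f y else 0)) = (\<lambda>y. if y \<in> ?Z then f y else 0)"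
      proof
        fix y
        have Pf: "P w f y = (if node (y 0) = w then f y else 0)" by (rule P_apply[OF f])
        have "\<forall>e\<in>?F. z 0 \<noteq> Inr e" "node (z 0) = w" using Inl by simp_all
        then show "?k y - (if y \<in> {z} then f y else 0) = (if y \<in> ?Z then f y else 0)"
          unfolding Pf using ell2_outside[OF f, of y] by (cases "y = z"; cases "y \<in> X") auto
      qed
      show "\<exists>k\<in>K. \<exists>Z. Z \<inter> F = {} \<and> (\<lambda>y. k y - (if y \<in> {z} then f y else 0)) = (\<lambda>y.
        if y \<in> Z then f y else 0)"
        by (rule bexI[OF _ k], rule exI[of _ ?Z], rule conjI[OF disj eq])
    qed
  qed
qed

text \<open>Restrictions of \<open>f\<close> to ever longer cylinders around \<open>z\<close>
  converge to \<open>f z\<close> times the basis vector. For a finite set of paths, the cylinder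
  need only be long enough to separate \<open>z\<close> from its other members.\<close>

lemma K_point:
  assumes f: "f \<in> K" and z: "f z \<noteq> 0"
  shows "point z \<in> K"
proof -
  have zX: "z \<in> X" using ell2_outside[OF K_carrier[OF f]] z by blast
  have "(\<lambda>y. if y \<in> {z} then f y else 0) \<in> K"
  proof (rule K_closedI[OF ell2_restrict[OF K_carrier[OF f]] K_carrier[OF f]])
    fix F :: "(nat \<Rightarrow> 'a + 'b) set" assume F: "finite F" "F \<subseteq> X"
    have "\<exists>d. y d \<noteq> z d" if "y \<noteq> z" for y using that by auto
    then obtain d where d: "\<And>y. y \<noteq> z \<Longrightarrow> y (d y) \<noteq> z (d y)" by metis
    define n where "n = Suc (Max (insert 0 (d ` F)))"
    have n: "d y < n" if "y \<in> F" for y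
      using F that by (auto simp: n_def less_Suc_eq_le)
    let ?Z = "{y. (\<forall>k<n. y k = z k) \<and> y \<noteq> z}"
    have disj: "?Z \<inter> F = {}" using n d by blast
    have eq: "(\<lambda>y. (if \<forall>k<n. y k = z k then f y else 0) - (if y \<in> {z} then f y else 0)) = (\<lambda>y.
      if y \<in> ?Z then f y else 0)"
    proof
      show "(if \<forall>k<n. y k = z k then f y else 0) - (if y \<in> {z} then f y else 0)
        = (if y \<in> ?Z then f y else 0)" for y
        by (cases "y = z") auto
    qed
    show "\<exists>k\<in>K. \<exists>Z. Z \<inter> F = {} \<and> (\<lambda>y. k y - (if y \<in> {z} then f y else 0)) = (\<lambda>y.
      if y \<in> Z then f y else 0)"
      by (rule bexI[OF _ K_restrict_cylinder[OF f zX, of n]], rule exI[of _ ?Z], rule conjI[OF disj eq])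
  qed
  from K_smult[OF this, of "1 / f z"] have "(\<lambda>y. 1 / f z * (if y \<in> {z} then f y else 0)) \<in> K" .
  also have "(\<lambda>y. 1 / f z * (if y \<in> {z} then f y else 0)) = point z"
    using z by (auto simp: point_def)
  finally show ?thesis .
qed

lemma K_point_shift:
  assumes "point z \<in> K" "z \<in> X"
  shows "point (shift (Suc 0) z) \<in> K"
proof (cases "z 0")
  case (Inl w)
  have "shift (Suc 0) z = z"
    using boundary_path_Inl_const[of z 0 w] assms X_boundary Inl by (auto simp: shift_def)
  then show ?thesis using assms by simp
next
  case (Inr e)
  have e: "e \<in> arcs G" "node (z (Suc 0)) = head G e" using X_node[OF assms(2) Inr] by auto
  have "S' e (point z) (shift (Suc 0) z) \<noteq> 0"
    using \<tau> e K_carrier[OF assms(1)] X_shift[OF assms(2)]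
    by (auto simp: S'_apply case_nat_shift[of z, OF Inr] point_def)
  then show ?thesis using K_point[OF K_S'[OF assms(1) e(1)]] by blast
qed

lemma K_point_unshift:
  assumes "point (shift (Suc 0) z) \<in> K" "z \<in> X"
  shows "point z \<in> K"
proof (cases "z 0")
  case (Inl w)
  have "shift (Suc 0) z = z"
    using boundary_path_Inl_const[of z 0 w] assms X_boundary Inl by (auto simp: shift_def)
  then show ?thesis using assms by simp
next
  case (Inr e)
  have e: "e \<in> arcs G" using X_node[OF assms(2) Inr] by auto
  have "S e (point (shift (Suc 0) z)) z \<noteq> 0"
    using \<tau> K_carrier[OF assms(1)] assms(2) Inr by (auto simp: S_apply point_def)
  then show ?thesis using K_point[OF K_S[OF assms(1) e]] by blast
qed

lemma K_point_tail_equivalent: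
  assumes z: "point z \<in> K" "z \<in> X" and y: "y \<in> X" and eq: "tail_equivalent z y"
  shows "point y \<in> K"
proof -
  obtain m n where mn: "shift m z = shift n y" using eq by (auto simp: tail_equivalent_def)
  have "point (shift k z) \<in> K" for k
  proof (induction k)
    case (Suc k)
    have "point (shift (Suc 0) (shift k z)) \<in> K" by (rule K_point_shift[OF Suc X_shifts[OF z(2)]])
    then show ?case by (simp del: shift_apply)
  qed (use z in simp)
  then have "point (shift n y) \<in> K" using mn by metis
  then show ?thesis
  proof (induction n)
    case (Suc n)
    have "point (shift (Suc 0) (shift n y)) \<in> K" using Suc.prems by (simp del: shift_apply)
    then show ?case by (rule Suc.IH[OF K_point_unshift[OF _ X_shifts[OF y]]])
  qed (simp del: shift_apply)
qed

text \<open>Finite truncations are combinations of basis vectors and approximate every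
  square-summable function.\<close>

lemma K_everything:
  assumes all: "\<And>z. z \<in> X \<Longrightarrow> point z \<in> K"
  shows "K = carrier (ell2 X)"
proof
  show "K \<subseteq> carrier (ell2 X)" using K_carrier by blast
  show "carrier (ell2 X) \<subseteq> K"
  proof
    fix f assume f: "f \<in> carrier (ell2 X)"
    have finite_part: "(\<lambda>z. if z \<in> F then f z else 0) \<in> K" if "finite F" "F \<subseteq> X" for F
      using that
    proof (induction F rule: finite_induct)
      case empty
      then show ?case using submodule_zero[OF sub] by simp
    next
      case (insert y F)
      then have "(\<lambda>z. (if z \<in> F then f z else 0) + f y * point y z) \<in> K"
        using all by (intro K_add K_smult) auto
      also have "(\<lambda>z. (if z \<in> F then f z else 0) + f y * point y z) = (\<lambda>z.
        if z \<in> insert y F then f z else 0)"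
        using insert.hyps by (auto simp: point_def)
      finally show ?case .
    qed
    show "f \<in> K"
    proof (rule K_closedI[OF f ell2_smult[OF f, of "-1"]])
      fix F assume F: "finite F" "F \<subseteq> X"
      have eq: "(\<lambda>z. (if z \<in> F then f z else 0) - f z) = (\<lambda>z. if z \<in> - F then -1 * f z else 0)" by auto
      show "\<exists>k\<in>K. \<exists>Z. Z \<inter> F = {} \<and> (\<lambda>z. k z - f z) = (\<lambda>z. if z \<in> Z then -1 * f z else 0)"
        by (rule bexI[OF _ finite_part[OF F]], rule exI[of _ "- F"], rule conjI[OF _ eq]) blast
    qed
  qed
qed

end

text \<open>A nonzero closed invariant subspace contains the basis vector of any path at which one
  of its members is nonzero. Deleting and prepending edges then spreads this over the whole tail
  class.\<close>

lemma irreducible_path_representation: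
  assumes x: "x \<in> X" and conn: "\<And>z. z \<in> X \<Longrightarrow> tail_equivalent x z"
  shows "irreducible_representation A (ell2 X) \<pi>"
  unfolding irreducible_representation_def representation_def
proof (intro conjI allI impI)
  show "hilbert_space (ell2 X)" by (rule hilbert_space_ell2)
  show "star_hom A E.B \<pi>" by (rule \<pi>_hom)
  have v: "node (x 0) \<in> verts G" using boundary_path_node X_boundary x by blast
  have "P (node (x 0)) (point x) x \<noteq> \<zero>\<^bsub>E.B\<^esub> (point x) x"
    using point_carrier[OF x] by (simp add: P_apply) (simp add: point_def)
  then have "\<pi> (p (node (x 0))) \<noteq> \<zero>\<^bsub>E.B\<^esub>" using v by (auto simp: \<pi>_p)
  then show "\<exists>a\<in>carrier A. \<pi> a \<noteq> \<zero>\<^bsub>E.B\<^esub>" using p_closed[OF v] by blast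
  fix K assume K: "submodule K complex_field (ell2 X) \<and> closedin (norm_topology (ell2 X) (hnorm
    (ell2 X))) K \<and>
    (\<forall>a\<in>carrier A. \<forall>x\<in>K. \<pi> a x \<in> K)"
  then have sub: "submodule K complex_field (ell2 X)"
    and closed: "closedin (norm_topology (ell2 X) (hnorm (ell2 X))) K"
    and inv: "\<And>a x. \<lbrakk>a \<in> carrier A; x \<in> K\<rbrakk> \<Longrightarrow> \<pi> a x \<in> K" by auto
  show "K = {\<zero>\<^bsub>ell2 X\<^esub>} \<or> K = carrier (ell2 X)"
  proof (cases "K \<subseteq> {\<zero>\<^bsub>ell2 X\<^esub>}")
    case True
    then show ?thesis using submodule_zero[OF sub] by auto
  next
    case False
    then obtain f z where f: "f \<in> K" and z: "f z \<noteq> 0" by (auto simp: fun_eq_iff)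
    have zX: "z \<in> X" using ell2_outside[OF K_carrier[OF sub closed inv f]] z by blast
    have "point y \<in> K" if "y \<in> X" for y
      using K_point_tail_equivalent[OF sub closed inv K_point[OF sub closed inv f z] zX that]
        tail_equivalent_trans[OF tail_equivalent_sym[OF conn[OF zX]] conn[OF that]] by blast
    then show ?thesis using K_everything[OF sub closed inv] by blast
  qed
qed

end

text \<open>For all \<open>k\<close> together: \<open>W (point z)\<close> is supported at \<open>z\<close>.\<close>

lemma intertwiner_point:
  assumes 1: "path_representation G X \<tau> A p s \<pi>" and 2: "path_representation G Y \<sigma> A p s \<rho>"
    and W: "unitary_equivalence (ell2 X) (ell2 Y) W"
    and W_eq: "\<And>a f. \<lbrakk>a \<in> carrier A; f \<in> carrier (ell2 X)\<rbrakk> \<Longrightarrow> W (\<pi> a f) = \<rho> a (W f)"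
  shows "\<lbrakk>z \<in> X; z k \<noteq> u k\<rbrakk> \<Longrightarrow> W (point z) u = 0"
proof (induction k arbitrary: z u)
  interpret X: path_representation G X \<tau> A p s \<pi> by (rule 1)
  interpret Y: path_representation G Y \<sigma> A p s \<rho> by (rule 2)
  interpret W: unitary_equivalence "ell2 X" "ell2 Y" W by (rule W)
  note Wc = W.U_simps(1)[OF point_carrier]
  have W_P: "W (X.P v f) = Y.P v (W f)" if "v \<in> verts G" "f \<in> carrier (ell2 X)" for v f
    using W_eq[OF X.p_closed that(2)] that by (simp add: X.\<pi>_p Y.\<pi>_p)
  have W_S: "W (X.S e f) = Y.S e (W f)" if "e \<in> arcs G" "f \<in> carrier (ell2 X)" for e f
    using W_eq[OF X.s_closed that(2)] that by (simp add: X.\<pi>_s Y.\<pi>_s)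
  have W_S': "W (X.S' e f) = Y.S' e (W f)" if "e \<in> arcs G" "f \<in> carrier (ell2 X)" for e f
    using W_eq[OF X.A.star_closed[OF X.s_closed] that(2)] that by (simp add: X.\<pi>_s_star Y.\<pi>_s_star)
  \<comment> \<open>First letters are visible to the generators. If \<open>z\<close> begins with an
    edge \<open>e\<close>, its basis vector lies in the range of \<open>S e\<close>, and
    \<open>W\<close> respects that. If \<open>z\<close> is padding, vertex projections separate it
    from other padding.\<close>
  have first: "W (point z) u = 0" if z: "z \<in> X" and neq: "z 0 \<noteq> u 0" for z u
  proof (cases "u \<in> Y")
    case False
    then show ?thesis using ell2_outside[OF Wc[OF z]] by blast
  next
    case True
    have zb: "z \<in> X.boundary_paths" and ub: "u \<in> X.boundary_paths"
      using z True X.X_boundary Y.X_boundary by auto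
    show ?thesis
    proof (cases "z 0")
      case (Inr e)
      have e: "e \<in> arcs G" using X.boundary_path_Inr[OF zb Inr] by simp
      have "X.S e (X.S' e (point z)) = point z"
        using Inr by (intro ext) (auto simp: X.SS'_apply[OF e point_carrier[OF z]] point_apply)
      then have "W (point z) = Y.S e (Y.S' e (W (point z)))"
        using W_S[OF e X.path_op_closed(3)[OF e point_carrier[OF z]]] W_S'[OF e point_carrier[OF z]]
          by simp
      then have "W (point z) u = Y.S e (Y.S' e (W (point z))) u" by simp
      also have "\<dots> = 0" using neq Inr by (simp add: Y.SS'_apply[OF e Wc[OF z]])
      finally show ?thesis .
    next
      case (Inl w)
      have w: "w \<in> verts G" using X.boundary_path_Inl[OF zb Inl] by simp
      show ?thesis
      proof (cases "u 0")
        case (Inl w')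
        have "X.P w (point z) = point z"
          using \<open>z 0 = Inl w\<close> by (intro ext) (auto simp: X.P_apply[OF point_carrier[OF z]] point_apply)
        then have "W (point z) u = Y.P w (W (point z)) u" using W_P[OF w point_carrier[OF z]] by simp
        also have "\<dots> = 0" using neq Inl \<open>z 0 = Inl w\<close> by (simp add: Y.P_apply[OF Wc[OF z]])
        finally show ?thesis .
      next
        case (Inr f)
        have f: "f \<in> arcs G" "X.node (u (Suc 0)) = head G f" using X.boundary_path_Inr[OF ub Inr]
          by auto
        \<comment> \<open>No edge can be stripped from padding, so the image of the basis vector
          vanishes on all paths that begin with \<open>f\<close>.\<close>
        have "X.S' f (point z) = \<zero>\<^bsub>ell2 X\<^esub>"
          using \<open>z 0 = Inl w\<close> by (intro ext, simp) (auto simp: X.S'_apply[OF point_carrier[OF z]]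
            point_apply)
        then have "Y.S' f (W (point z)) = (\<lambda>_. 0)"
          using W_S'[OF f(1) point_carrier[OF z]] W.U_zero by simp
        then have "Y.S f (Y.S' f (W (point z))) u = 0"
          using Y.path_op_closed(2)[of "\<lambda>_. 0"] Y.E.M.zero_closed by (simp add: Y.S_apply)
        then show ?thesis using Inr by (simp add: Y.SS'_apply[OF f(1) Wc[OF z]])
      qed
    qed
  qed
  {
    case 0
    then show ?case using first by simp
  next
    case (Suc k)
    show ?case
    proof (cases "z 0 = u 0 \<and> u \<in> Y")
      case False
      then show ?thesis using first[OF Suc.prems(1)] ell2_outside[OF Wc[OF Suc.prems(1)]] by blast
    next
      case True
      have zb: "z \<in> X.boundary_paths" and ub: "u \<in> X.boundary_paths"
        using Suc.prems True X.X_boundary Y.X_boundary by auto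
      show ?thesis
      proof (cases "z 0")
        case (Inl w)
        then have "z = u"
          using X.boundary_path_Inl_const[OF zb Inl] X.boundary_path_Inl_const[OF ub, of 0 w] True
            by simp
        then show ?thesis using Suc.prems by simp
      next
        case (Inr e)
        have e: "e \<in> arcs G" "X.node (z (Suc 0)) = head G e" using X.boundary_path_Inr[OF zb Inr]
          by auto
        note zc = point_carrier[OF Suc.prems(1)]
        \<comment> \<open>Stripping the common first edge reduces a discrepancy at position
          \<open>Suc k\<close> to one at position \<open>k\<close>.\<close>
        have "X.S' e (point z) = (\<lambda>y. cnj \<tau> * point (shift (Suc 0) z) y)"
          using Inr e X.X_shift[OF Suc.prems(1)]
          by (intro ext) (auto simp: X.S'_apply[OF zc] point_apply case_nat_eq_iff)
        then have "Y.S' e (W (point z)) = (\<lambda>y. cnj \<tau> * W (point (shift (Suc 0) z)) y)"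
          using W_S'[OF e(1) zc] W.U_linear(3)[OF point_carrier[OF X.X_shift[OF Suc.prems(1)]], of
            "cnj \<tau>"] by simp
        moreover have "W (point (shift (Suc 0) z)) (shift (Suc 0) u) = 0"
          by (rule Suc.IH[OF X.X_shift[OF Suc.prems(1)]]) (use Suc.prems in simp)
        ultimately have "Y.S e (Y.S' e (W (point z))) u = 0"
          using Y.path_op_closed(3)[OF e(1) Wc[OF Suc.prems(1)]] by (simp add: Y.S_apply)
        then show ?thesis using Inr True by (simp add: Y.SS'_apply[OF e(1) Wc[OF Suc.prems(1)]])
      qed
    qed
  }
qed

lemma (in invariant_paths) S'_point:
  assumes "z \<in> X" "z 0 = Inr e"
  shows "S' e (point z) = (\<lambda>y. cnj \<tau> * point (shift (Suc 0) z) y)"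
  using assms X_node[OF assms] X_shift[OF assms(1)]
  by (intro ext) (auto simp: S'_apply[OF point_carrier[OF assms(1)]] point_apply case_nat_eq_iff)

text \<open>A path tail equivalent to \<open>x\<close> is determined by a word and a shift of \<open>x\<close>, and a word together with
  a number can be coded by a word.\<close>

lemma ell2_tail_equivalent_embed:
  fixes x :: "nat \<Rightarrow> 'c" and X :: "(nat \<Rightarrow> 'c) set"
  assumes X: "\<And>z. z \<in> X \<Longrightarrow> tail_equivalent x z" and neq: "c0 \<noteq> (c1 :: 'c)"
  shows "\<exists>j :: ((nat \<Rightarrow> 'c) \<Rightarrow> complex) \<Rightarrow> 'c list \<Rightarrow> complex. inj_on j (carrier (ell2 X))"
proof -
  \<comment> \<open>Decoder: the leading copies of \<open>c0\<close> count the shift of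
    \<open>x\<close>, the following letter is a separator, and the remaining letters are the prefix
    of the path.\<close>
  define g where "g w = (let m = length (takeWhile (\<lambda>c. c = c0) w); l = drop (Suc m) w
    in (\<lambda>k. if k < length l then l ! k else x (m + (k - length l))))" for w :: "'c list"
  have "X \<subseteq> range g"
  proof
    fix z assume "z \<in> X"
    from X[OF this] obtain m n where mn: "shift m x = shift n z" by (auto simp: tail_equivalent_def)
    have "g (replicate m c0 @ c1 # map z [0..<n]) = z"
    proof
      fix k
      have "takeWhile (\<lambda>c. c = c0) (replicate m c0 @ c1 # map z [0..<n]) = replicate m c0"
        using neq by (simp add: takeWhile_append)
      moreover have "x (m + (k - n)) = z k" if "n \<le> k"
        using fun_cong[OF mn, of "k - n"] that by simp
      ultimately show "g (replicate m c0 @ c1 # map z [0..<n]) k = z k"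
        by (simp add: g_def Let_def)
    qed
    then show "z \<in> range g" by (metis rangeI)
  qed
  then have inj: "inj_on (inv_into UNIV g) X" by (rule inj_on_inv_into)
  define j where "j f w = (if w \<in> inv_into UNIV g ` X then f (inv_into X (inv_into UNIV g) w) else 0)"
    for f :: "(nat \<Rightarrow> 'c) \<Rightarrow> complex" and w
  have "inj_on j (carrier (ell2 X))"
  proof (intro inj_onI ext)
    fix f h z assume f: "f \<in> carrier (ell2 X)" and h: "h \<in> carrier (ell2 X)" and eq: "j f = j h"
    show "f z = h z"
    proof (cases "z \<in> X")
      case True
      then show ?thesis using fun_cong[OF eq, of "inv_into UNIV g z"] inj by (simp add: j_def)
    qed (simp add: ell2_outside[OF f] ell2_outside[OF h])
  qed
  then show ?thesis by blast
qed

context wf_digraph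
begin

lemma invariant_paths_tail_class:
  assumes "cmod \<tau> = 1"
  shows "invariant_paths G (tail_class x) \<tau>"
proof (unfold_locales)
  fix z assume z: "z \<in> tail_class x"
  show "shift (Suc 0) z \<in> tail_class x"
    using z tail_equivalent_trans[OF _ tail_equivalent_shift[of z "Suc 0"]]
    by (simp add: tail_class_def boundary_path_shift)
  show "case_nat (Inr e) z \<in> tail_class x" if "e \<in> arcs G" "node (z 0) = head G e" for e
  proof -
    have "tail_equivalent z (case_nat (Inr e) z)"
      using tail_equivalent_sym[OF tail_equivalent_shift[of "case_nat (Inr e) z" "Suc 0"]] by simp
    then show ?thesis
      using z that tail_equivalent_trans boundary_path_cons by (auto simp: tail_class_def)
  qed
qed (auto simp: tail_class_def assms)

text \<open>A tail class is coded by words over letters \<open>Inl\<close> and \<open>Inr\<close>,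
  so its \<open>ell2\<close> space embeds into the functions on words and the universal property
  applies to the path operators.\<close>

lemma path_representation_exists:
  fixes A :: "'c star_algebra"
  assumes A: "graph_cstar_algebra G A p s" and \<tau>: "cmod \<tau> = 1"
  shows "\<exists>\<pi>. path_representation G (tail_class x) \<tau> A p s \<pi>"
proof -
  interpret invariant_paths G "tail_class x" \<tau> by (rule invariant_paths_tail_class[OF \<tau>])
  interpret A: cstar_algebra A using A by (simp add: graph_cstar_algebra_def)
  have ck: "cuntz_krieger_family G A p s" using A by (simp add: graph_cstar_algebra_def)
  obtain j :: "((nat \<Rightarrow> 'a + 'b) \<Rightarrow> complex) \<Rightarrow> ('a + 'b) list \<Rightarrow> complex"
    where "inj_on j (carrier (ell2 (tail_class x)))"
    using ell2_tail_equivalent_embed[of "tail_class x" x "Inl undefined" "Inr undefined"]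
    by (auto simp: tail_class_def)
  then obtain \<pi> where "star_hom A E.B \<pi>" "\<forall>v\<in>verts G. \<pi> (p v) = P v" "\<forall>e\<in>arcs G. \<pi> (s e) = S e"
    using graph_cstar_algebra_universal[OF A E.hilbert_space_axioms _ cuntz_krieger_family_paths]
      by blast
  then have "path_representation G (tail_class x) \<tau> A p s \<pi>"
    using ck by unfold_locales (auto simp: cuntz_krieger_family_def projection_def partial_isometry_def)
  then show ?thesis by blast
qed

lemma tail_class_refl: "x \<in> boundary_paths \<Longrightarrow> x \<in> tail_class x"
  by (simp add: tail_class_def)

lemma irreducible_tail_class:
  assumes "path_representation G (tail_class x) \<tau> A p s \<pi>" "x \<in> boundary_paths"
  shows "irreducible_representation A (ell2 (tail_class x)) \<pi>"
  using path_representation.irreducible_path_representation[OF assms(1) tail_class_refl[OF assms(2)]]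
  by (simp add: tail_class_def)

section \<open>Consequences of uniqueness for boundary paths\<close>

context
  fixes A :: "'c star_algebra" and p s
  assumes A: "graph_cstar_algebra G A p s" and uniq: "unique_irreducible_representation A"
begin

text \<open>The intertwiner sends the basis vector of \<open>x\<close> to a nonzero vector supported
  at \<open>x\<close> alone. That vector lives on the tail class of \<open>z\<close>, which must
  therefore contain \<open>x\<close>.\<close>

lemma boundary_paths_tail_equivalent:
  assumes x: "x \<in> boundary_paths" and z: "z \<in> boundary_paths"
  shows "tail_equivalent z x"
proof -
  have cstar: "cstar_algebra A" using A by (simp add: graph_cstar_algebra_def)
  obtain \<pi> where \<pi>: "path_representation G (tail_class x) 1 A p s \<pi>"
    using path_representation_exists[OF A, of 1] by auto
  obtain \<rho> where \<rho>: "path_representation G (tail_class z) 1 A p s \<rho>"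
    using path_representation_exists[OF A, of 1] by auto
  obtain W where W: "unitary_equivalence (ell2 (tail_class x)) (ell2 (tail_class z)) W"
    and W_eq: "\<And>a f. \<lbrakk>a \<in> carrier A; f \<in> carrier (ell2 (tail_class x))\<rbrakk> \<Longrightarrow> W (\<pi> a f) = \<rho> a (W f)"
    using cstar_algebra.unique_irreducible_representation_any_type[OF cstar uniq
        irreducible_tail_class[OF \<pi> x] irreducible_tail_class[OF \<rho> z]] by blast
  interpret W: unitary_equivalence "ell2 (tail_class x)" "ell2 (tail_class z)" W by (rule W)
  have pt: "point x \<in> carrier (ell2 (tail_class x))" by (rule point_carrier[OF tail_class_refl[OF x]])
  have "point x \<noteq> (\<lambda>_. 0)" by (auto simp: point_def fun_eq_iff)
  then have "W (point x) \<noteq> (\<lambda>_. 0)" using W.U_eq_zero_iff[OF pt] by simp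
  then obtain u where u: "W (point x) u \<noteq> 0" by auto
  have "x k = u k" for k
    using intertwiner_point[OF \<pi> \<rho> W W_eq tail_class_refl[OF x]] u by blast
  then have "u = x" by auto
  then have "x \<in> tail_class z" using u ell2_outside[OF W.U_simps(1)[OF pt]] by blast
  then show ?thesis by (simp add: tail_class_def)
qed

text \<open>Twisting by a scalar \<open>\<sigma>\<close> with \<open>\<sigma>\<^sup>n = -1\<close> would change the action of the cycle on the basis
  vector of \<open>x\<close>.\<close>

lemma boundary_path_not_periodic:
  assumes x: "x \<in> boundary_paths" "shift n x = x" "0 < n"
  shows "x 0 = Inl (node (x 0))"
proof (rule ccontr)
  assume "x 0 \<noteq> Inl (node (x 0))"
  then obtain e0 where e0: "x 0 = Inr e0" by (cases "x 0") auto
  have x_period: "x (i * n) = x 0" for i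
  proof (induction i)
    case (Suc i)
    have "x (Suc i * n) = shift n x (i * n)" by simp
    then show ?case using Suc x(2) by simp
  qed simp
  \<comment> \<open>Padding at position \<open>k\<close> would persist up to position
    \<open>k * n\<close>, where periodicity shows the edge \<open>e0\<close> again.\<close>
  have x_Inr: "\<exists>e. x k = Inr e" for k
  proof (cases "x k")
    case (Inl w)
    have "x (k * n) = shift k x (k * n - k)" using x(3) by simp
    also have "\<dots> = Inl w" by (simp only: boundary_path_Inl_const[OF x(1) Inl])
    finally show ?thesis using x_period[of k] e0 by simp
  qed simp
  \<comment> \<open>An n-th root of -1, so that one turn around the cycle changes the sign.\<close>
  define \<sigma> where "\<sigma> = cis (pi / real n)"
  have cstar: "cstar_algebra A" using A by (simp add: graph_cstar_algebra_def)
  obtain \<pi> where \<pi>: "path_representation G (tail_class x) 1 A p s \<pi>"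
    using path_representation_exists[OF A, of 1] by auto
  obtain \<rho> where \<rho>: "path_representation G (tail_class x) \<sigma> A p s \<rho>"
    using path_representation_exists[OF A, of \<sigma>] by (auto simp: \<sigma>_def)
  obtain W where W: "unitary_equivalence (ell2 (tail_class x)) (ell2 (tail_class x)) W"
    and W_eq: "\<And>a f. \<lbrakk>a \<in> carrier A; f \<in> carrier (ell2 (tail_class x))\<rbrakk> \<Longrightarrow> W (\<pi> a f) = \<rho> a (W f)"
    using cstar_algebra.unique_irreducible_representation_any_type[OF cstar uniq
        irreducible_tail_class[OF \<pi> x(1)] irreducible_tail_class[OF \<rho> x(1)]] by blast
  interpret W: unitary_equivalence "ell2 (tail_class x)" "ell2 (tail_class x)" W by (rule W)
  interpret \<pi>: path_representation G "tail_class x" 1 A p s \<pi> by (rule \<pi>)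
  interpret \<rho>: path_representation G "tail_class x" \<sigma> A p s \<rho> by (rule \<rho>)
  have x_in: "shift k x \<in> tail_class x" for k
    by (rule \<pi>.X_shifts[OF tail_class_refl[OF x(1)]])
  \<comment> \<open>The diagonal coefficient of \<open>W\<close> along the shifts of
    \<open>x\<close>. Comparing the untwisted and the twisted adjoints multiplies it by
    \<open>cnj \<sigma>\<close> at each step. After \<open>n\<close> steps the path is
    \<open>x\<close> again, so \<open>c 0 = - c 0\<close>, and the image of the basis vector of
    \<open>x\<close> is zero.\<close>
  define c where "c k = W (point (shift k x)) (shift k x)" for k
  have step: "c (Suc k) = cnj \<sigma> * c k" for k
  proof -
    obtain e where e: "shift k x 0 = Inr e" using x_Inr[of k] by auto
    have arc: "e \<in> arcs G" "node (shift k x (Suc 0)) = head G e" using \<pi>.X_node[OF x_in e] by auto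
    note pt = point_carrier[OF x_in]
    have "\<pi>.S' e (point (shift k x)) = point (shift (Suc k) x)"
      using \<pi>.S'_point[OF x_in e] by (simp del: shift_apply)
    then have "W (point (shift (Suc k) x)) = \<rho>.S' e (W (point (shift k x)))"
      using W_eq[OF \<pi>.A.star_closed[OF \<pi>.s_closed[OF arc(1)]] pt, of k] arc(1)
      by (simp add: \<pi>.\<pi>_s_star \<rho>.\<pi>_s_star)
    then have "c (Suc k) = \<rho>.S' e (W (point (shift k x))) (shift (Suc k) x)" by (simp add: c_def)
    also have "\<dots> = cnj \<sigma> * W (point (shift k x)) (case_nat (Inr e) (shift (Suc k) x))"
      using arc(2) x_in[of "Suc k"] by (simp add: \<rho>.S'_apply[OF W.U_simps(1)[OF pt]])
    also have "case_nat (Inr e) (shift (Suc k) x) = shift k x"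
      using case_nat_shift[of "shift k x" "Inr e"] e by simp
    finally show ?thesis by (simp only: c_def)
  qed
  have "c k = cnj \<sigma> ^ k * c 0" for k
    by (induction k) (simp_all add: step)
  then have "c n = cnj \<sigma> ^ n * c 0" .
  also have "cnj \<sigma> ^ n = -1"
  proof -
    have "\<sigma> ^ n = -1" using x(3) by (simp add: \<sigma>_def Complex.DeMoivre)
    then show ?thesis by (simp flip: complex_cnj_power)
  qed
  finally have "c 0 = 0" using x(2) by (simp add: c_def)
  moreover have "W (point x) u = 0" if "u \<noteq> x" for u
  proof -
    from that obtain k where "x k \<noteq> u k" by fastforce
    then show ?thesis using intertwiner_point[OF \<pi> \<rho> W W_eq tail_class_refl[OF x(1)]] by blast
  qed
  ultimately have "W (point x) u = 0" for u by (cases "u = x") (simp_all add: c_def)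
  then have "W (point x) = (\<lambda>_. 0)" by blast
  moreover have "point x \<noteq> (\<lambda>_. 0)" by (auto simp: point_def fun_eq_iff)
  ultimately show False
    using W.U_eq_zero_iff[OF point_carrier[OF tail_class_refl[OF x(1)]]] by simp
qed

end

section \<open>Vertices emitting a single boundary path\<close>

text \<open>Follow a chosen edge into \<open>W\<close> at regular vertices and stop at singular
  ones. Taking \<open>W\<close> to be all vertices gives a boundary path from every vertex; a
  smaller \<open>W\<close> gives one that avoids prescribed vertices.\<close>

lemma boundary_path_within:
  assumes W: "W \<subseteq> verts G" and succ: "\<And>u. \<lbrakk>u \<in> W; regular_vertex G u\<rbrakk> \<Longrightarrow> \<exists>e\<in>out_arcs G u. head G e \<in> W"
    and u: "u \<in> W"
  shows "\<exists>z\<in>boundary_paths. node (z 0) = u \<and> (\<forall>n. node (z n) \<in> W)"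
proof -
  obtain nx where nx: "\<And>u. \<lbrakk>u \<in> W; regular_vertex G u\<rbrakk> \<Longrightarrow> nx u \<in> out_arcs G u \<and> head G (nx u) \<in> W"
    using succ by metis
  define a where "a u = (if regular_vertex G u then Inr (nx u) else Inl u)" for u
  define t where "t u = (if regular_vertex G u then head G (nx u) else u)" for u
  define y where "y n = (t ^^ n) u" for n
  have y: "y n \<in> W" for n
    by (induction n) (use u nx in \<open>auto simp: y_def t_def\<close>)
  have node_a: "node (a w) = w" if "w \<in> W" for w
    using nx[OF that] by (auto simp: a_def)
  have "(\<lambda>n. a (y n)) \<in> boundary_paths"
  proof (rule boundary_pathI)
    fix n w assume "a (y n) = Inl w"
    then have "\<not> regular_vertex G (y n)" "w = y n" by (auto simp: a_def split: if_splits)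
    then show "w \<in> verts G \<and> \<not> regular_vertex G w \<and> a (y (Suc n)) = Inl w"
      using y[of n] W by (auto simp: y_def t_def a_def)
  next
    fix n e assume "a (y n) = Inr e"
    then have "regular_vertex G (y n)" "e = nx (y n)" by (auto simp: a_def split: if_splits)
    then show "e \<in> arcs G \<and> node (a (y (Suc n))) = head G e"
      using nx[OF y] node_a[OF y[of "Suc n"]] by (auto simp: y_def t_def)
  qed
  then show ?thesis
    using node_a y y[of 0] by (intro bexI[of _ "\<lambda>n. a (y n)"]) (auto simp: y_def)
qed

definition paths_from :: "'a \<Rightarrow> (nat \<Rightarrow> 'a + 'b) set" where
  "paths_from v = {z \<in> boundary_paths. node (z 0) = v}"

lemma paths_from_nonempty:
  assumes "v \<in> verts G"
  shows "\<exists>z. z \<in> paths_from v"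
proof -
  have "\<exists>e\<in>out_arcs G u. head G e \<in> verts G" if "regular_vertex G u" for u
    using that by (auto simp: regular_vertex_def)
  then show ?thesis
    using boundary_path_within[of "verts G" v] assms by (auto simp: paths_from_def)
qed

text \<open>By induction on the position, only countably many letters occur at each place of a path
  from \<open>u\<close>, since every vertex emits countably many edges. Such a path is determined by
  a finite word over these letters and a shift of \<open>x\<close>.\<close>

lemma countable_paths_from:
  assumes row: "row_countable G" and u: "u \<in> verts G" and eq: "\<And>z. z \<in> paths_from u
    \<Longrightarrow> tail_equivalent x z"
  shows "countable (paths_from u)"
proof -
  define C where "C w = insert (Inl w) (Inr ` out_arcs G w)" for w
  have countable_C: "countable (C w)" if "w \<in> verts G" for w
    using row that by (simp add: C_def row_countable_def)
  have C: "z n \<in> C (node (z n))" if "z \<in> boundary_paths" for z n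
    using boundary_path_Inr(1)[OF that, of n] by (cases "z n") (simp_all add: C_def)
  define Sy where "Sy n = {z n |z. z \<in> paths_from u}" for n
  have countable_Sy: "countable (Sy n)" for n
  proof (induction n)
    case 0
    have "Sy 0 \<subseteq> C u" using C by (force simp: Sy_def paths_from_def)
    then show ?case using countable_C[OF u] by (rule countable_subset)
  next
    case (Suc n)
    \<comment> \<open>The letters that can follow \<open>c\<close>.\<close>
    define D where "D c = (case c of Inl w \<Rightarrow> {Inl w} | Inr e \<Rightarrow>
      if e \<in> arcs G then C (head G e) else {})" for c
    have "Sy (Suc n) \<subseteq> (\<Union>c\<in>Sy n. D c)"
    proof
      fix c assume "c \<in> Sy (Suc n)"
      then obtain z where z: "z \<in> boundary_paths" "z \<in> paths_from u" "c = z (Suc n)"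
        by (auto simp: Sy_def paths_from_def)
      have "z n \<in> Sy n" using z by (auto simp: Sy_def)
      moreover have "c \<in> D (z n)"
        using boundary_path_Inl(3)[OF z(1), of n] boundary_path_Inr[OF z(1), of n] C[OF z(1), of
          "Suc n"] z(3)
        by (cases "z n") (auto simp: D_def)
      ultimately show "c \<in> (\<Union>c\<in>Sy n. D c)" by blast
    qed
    moreover have "countable (D c)" for c
      using countable_C by (cases c) (auto simp: D_def)
    then have "countable (\<Union>c\<in>Sy n. D c)" using Suc by (intro countable_UN) auto
    ultimately show ?case by (rule countable_subset)
  qed
  define L where "L = lists (\<Union>n. Sy n)"
  define g where "g = (\<lambda>(l, m). (\<lambda>k. if k < length l then l ! k else x (m + (k - length l))))"
  have "paths_from u \<subseteq> g ` (L \<times> (UNIV :: nat set))"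
  proof
    fix z assume z: "z \<in> paths_from u"
    obtain m n where mn: "shift m x = shift n z" using eq[OF z] by (auto simp: tail_equivalent_def)
    have "z k \<in> (\<Union>n. Sy n)" for k using z by (intro UN_I[of k]) (auto simp: Sy_def)
    then have "map z [0..<n] \<in> L" by (auto simp: L_def simp del: UN_iff)
    moreover have "z = g (map z [0..<n], m)"
    proof
      fix k
      have "x (m + (k - n)) = z k" if "n \<le> k"
        using fun_cong[OF mn, of "k - n"] that by simp
      then show "z k = g (map z [0..<n], m) k" by (simp add: g_def)
    qed
    ultimately show "z \<in> g ` (L \<times> UNIV)" by blast
  qed
  moreover have "countable (g ` (L \<times> (UNIV :: nat set)))"
    unfolding L_def using countable_Sy by (intro countable_image countable_SIGMA countable_lists
      countable_UN) auto
  ultimately show ?thesis by (rule countable_subset)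
qed

lemma boundary_path_splice:
  assumes z: "z \<in> boundary_paths" and y: "y \<in> boundary_paths" and eq: "node (y 0) = node (z n)"
    and Inr: "\<And>k. k < n \<Longrightarrow> \<exists>e. z k = Inr e"
  shows "(\<lambda>k. if k < n then z k else y (k - n)) \<in> boundary_paths"
proof (rule boundary_pathI)
  fix k w assume k: "(if k < n then z k else y (k - n)) = Inl w"
  then have "\<not> k < n" using Inr[of k] by auto
  then show "w \<in> verts G \<and> \<not> regular_vertex G w \<and> (if Suc k < n then z (Suc k) else y (Suc k - n))
    = Inl w"
    using k boundary_path_Inl[OF y, of "k - n" w] by (simp add: Suc_diff_le)
next
  fix k e assume k: "(if k < n then z k else y (k - n)) = Inr e"
  consider "Suc k < n" | "Suc k = n" | "n \<le> k" by linarith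
  then show "e \<in> arcs G \<and> node (if Suc k < n then z (Suc k) else y (Suc k - n)) = head G e"
    using k eq boundary_path_Inr[OF z, of k e] boundary_path_Inr[OF y, of "k - n" e]
    by cases (auto simp: Suc_diff_le)
qed

text \<open>Where two boundary paths with the same source first differ, a vertex emits two edges:
  if one of the
  paths ends there, then the vertex is an infinite emitter.\<close>

lemma branching_vertex:
  assumes "v \<in> verts G" and not_single: "\<And>y. paths_from v \<noteq> {y}"
  shows "\<exists>y\<in>paths_from v. \<exists>d e f. (\<forall>k<d. \<exists>g. y k = Inr g) \<and> e \<noteq> f \<and> e \<in> out_arcs G (node (y d))
    \<and> f \<in> out_arcs G (node (y d))"
proof -
  obtain y where y: "y \<in> paths_from v" using paths_from_nonempty assms by blast
  then obtain z where z: "z \<in> paths_from v" "z \<noteq> y" using not_single[of y] by blast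
  have yb: "y \<in> boundary_paths" and zb: "z \<in> boundary_paths" using y z by (auto simp: paths_from_def)
  define d where "d = (LEAST k. y k \<noteq> z k)"
  have "\<exists>k. y k \<noteq> z k" using z(2) by fastforce
  from LeastI_ex[OF this] have d: "y d \<noteq> z d" "\<And>k. k < d \<Longrightarrow> y k = z k"
    unfolding d_def by (auto dest: not_less_Least)
  \<comment> \<open>Before the first difference both paths consist of edges: common padding would
    make them agree from there on.\<close>
  have Inr: "\<exists>g. y k = Inr g" if k: "k < d" for k
  proof (cases "y k")
    case (Inl w)
    have Inl': "z k = Inl w" using d(2)[OF k] Inl by simp
    have "y d = shift k y (d - k)" "z d = shift k z (d - k)" using k by auto
    then have "y d = z d"
      by (simp only: boundary_path_Inl_const[OF yb Inl] boundary_path_Inl_const[OF zb Inl'])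
    then show ?thesis using d(1) by simp
  qed simp
  have node: "node (z d) = node (y d)"
  proof (cases d)
    case 0
    then show ?thesis using y z by (auto simp: paths_from_def)
  next
    case (Suc k)
    then obtain g where "y k = Inr g" using Inr[of k] by auto
    then show ?thesis using boundary_path_Inr(2)[OF yb, of k g] boundary_path_Inr(2)[OF zb, of k g]
      d(2)[of k] Suc by simp
  qed
  have arc_y: "e \<in> out_arcs G (node (y d))" if "y d = Inr e" for e
    using boundary_path_Inr(1)[OF yb that] that by simp
  have arc_z: "e \<in> out_arcs G (node (y d))" if "z d = Inr e" for e
    using boundary_path_Inr(1)[OF zb that] that by (simp flip: node)
  \<comment> \<open>A singular vertex that emits an edge emits infinitely many.\<close>
  have another: "\<exists>f. f \<noteq> e \<and> f \<in> out_arcs G w" if "\<not> regular_vertex G w" "w \<in> verts G" "e \<in> out_arcs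
    G w" for e w
  proof -
    have "infinite (out_arcs G w)" using that by (auto simp: regular_vertex_def)
    then have "out_arcs G w - {e} \<noteq> {}" by (metis finite.emptyI infinite_remove)
    then show ?thesis by blast
  qed
  have "\<exists>e f. e \<noteq> f \<and> e \<in> out_arcs G (node (y d)) \<and> f \<in> out_arcs G (node (y d))"
  proof (cases "y d")
    case yI: (Inl w)
    show ?thesis
    proof (cases "z d")
      case (Inl w')
      then show ?thesis using d(1) node yI by simp
    next
      case (Inr e)
      then show ?thesis using another[OF _ _ arc_z[OF Inr]] boundary_path_Inl(1,2)[OF yb yI]
        arc_z[OF Inr] yI by auto
    qed
  next
    case yR: (Inr e)
    show ?thesis
    proof (cases "z d")
      case (Inl w)
      then have "node (y d) = w" using node by simp
      then show ?thesis using another[OF _ _ arc_y[OF yR]] boundary_path_Inl(1,2)[OF zb Inl]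
        arc_y[OF yR] by blast
    next
      case (Inr f)
      then show ?thesis using d(1) arc_y[OF yR] arc_z[OF Inr] yR by auto
    qed
  qed
  then show ?thesis using y Inr by blast
qed

end

context wf_digraph
begin

lemma paths_from_splice:
  assumes z: "z \<in> paths_from u" and y: "y \<in> paths_from (node (z n))"
    and Inr: "\<And>k. k < n \<Longrightarrow> \<exists>e. z k = Inr e"
  shows "(\<lambda>k. if k < n then z k else y (k - n)) \<in> paths_from u"
  using boundary_path_splice[of z y n] assms by (cases n) (auto simp: paths_from_def)

lemma paths_from_cons:
  assumes "z \<in> paths_from (head G e)" "e \<in> arcs G"
  shows "case_nat (Inr e) z \<in> paths_from (tail G e)"
  using assms boundary_path_cons by (auto simp: paths_from_def)

text \<open>Diagonalization: if every vertex emitted several boundary paths, then a boundary path could be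
  built that avoids all members of a given sequence.\<close>

lemma single_boundary_path_exists:
  assumes u: "u \<in> verts G" and countable: "countable (paths_from u)"
  shows "\<exists>v\<in>verts G. \<exists>y. paths_from v = {y}"
proof (rule ccontr)
  assume none: "\<not> ?thesis"
  define f where "f = from_nat_into (paths_from u)"
  have range_f: "range f = paths_from u"
    unfolding f_def using paths_from_nonempty[OF u] countable by (intro range_from_nat_into) auto
  \<comment> \<open>A state is a path with the length of a frozen prefix. The prefix consists of
    edges, since nothing can be spliced in after padding.\<close>
  define ok where "ok zn \<longleftrightarrow> fst zn \<in> paths_from u \<and> (\<forall>k<snd zn. \<exists>e. fst zn k = Inr e)" for zn
  define ext where "ext i zn zn' \<longleftrightarrow> (\<forall>k<snd zn. fst zn' k = fst zn k) \<and> snd zn < snd zn' \<and>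
    (\<exists>k<snd zn'. fst zn' k \<noteq> f i k)" for i zn zn'
  have extend: "\<exists>zn'. ok zn' \<and> ext i zn zn'" if ok: "ok zn" for i zn
  proof -
    obtain z n where zn: "zn = (z, n)" by (cases zn)
    have z: "z \<in> paths_from u" "\<And>k. k < n \<Longrightarrow> \<exists>e. z k = Inr e" using ok by (auto simp: ok_def zn)
    have nv: "node (z n) \<in> verts G" using z(1) boundary_path_node by (auto simp: paths_from_def)
    have "paths_from (node (z n)) \<noteq> {y}" for y using none nv by blast
    from branching_vertex[OF nv this] obtain y d e1 e2 where y: "y \<in> paths_from (node (z n))" "\<And>k. k
      < d \<Longrightarrow> \<exists>g. y k = Inr g"
      and e: "e1 \<noteq> e2" "e1 \<in> out_arcs G (node (y d))" "e2 \<in> out_arcs G (node (y d))"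
      by blast
    \<comment> \<open>Of the two edges at the branching vertex, at least one differs from the letter
      of \<open>f i\<close> at that position.\<close>
    obtain e where e: "e \<in> out_arcs G (node (y d))" "Inr e \<noteq> f i (n + d)"
    proof (cases "f i (n + d) = Inr e1")
      case True
      then show ?thesis using e by (intro that[of e2]) auto
    next
      case False
      then show ?thesis using e by (intro that[of e1]) auto
    qed
    have arc: "e \<in> arcs G" "tail G e = node (y d)" using e by auto
    then obtain x where "x \<in> paths_from (head G e)"
      using paths_from_nonempty[OF head_in_verts] by blast
    then have x: "case_nat (Inr e) x \<in> paths_from (node (y d))"
      using paths_from_cons[of x e] arc by simp
    let ?y = "\<lambda>k. if k < d then y k else case_nat (Inr e) x (k - d)"
    have y': "?y \<in> paths_from (node (z n))" by (rule paths_from_splice[OF y(1) x y(2)])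
    let ?z = "\<lambda>k. if k < n then z k else ?y (k - n)"
    have "?z \<in> paths_from u" by (rule paths_from_splice[OF z(1) y' z(2)])
    moreover have "\<exists>g. ?z k = Inr g" if "k < Suc (n + d)" for k
      using z(2)[of k] y(2)[of "k - n"] that by (cases "k < n"; cases "k = n + d") auto
    moreover have "?z (n + d) = Inr e" by simp
    ultimately show ?thesis
      using e(2) by (intro exI[of _ "(?z, Suc (n + d))"]) (auto simp: ok_def ext_def zn)
  qed
  obtain z0 where "z0 \<in> paths_from u" using paths_from_nonempty[OF u] by blast
  then have "ok (z0, 0)" by (simp add: ok_def)
  then obtain t where t: "\<And>i. ok (t i)" "\<And>i. ext i (t i) (t (Suc i))"
    using dependent_nat_choice[of "\<lambda>_. ok" ext] extend by blast
  define Z where "Z i = fst (t i)" for i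
  define N where "N i = snd (t i)" for i
  have Z: "Z i \<in> paths_from u" for i
    using t(1)[of i] by (simp add: ok_def Z_def)
  have agree: "Z (Suc i) k = Z i k" if "k < N i" for i k
    using t(2)[of i] that by (simp add: ext_def Z_def N_def)
  have N_Suc: "N i < N (Suc i)" for i
    using t(2)[of i] by (simp add: ext_def N_def)
  have differ: "\<exists>k<N (Suc i). Z (Suc i) k \<noteq> f i k" for i
    using t(2)[of i] by (simp add: ext_def Z_def N_def)
  have N_mono: "N i \<le> N j" if "i \<le> j" for i j
    by (rule lift_Suc_mono_le[of N, OF less_imp_le[OF N_Suc] that])
  have N_ge: "i \<le> N i" for i
  proof (induction i)
    case (Suc i)
    then show ?case using N_Suc[of i] by linarith
  qed simp
  have agree': "Z j k = Z i k" if "k < N i" "i \<le> j" for i j k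
    using that(2)
  proof (induction j rule: dec_induct)
    case (step j)
    then show ?case using agree[of k j] N_mono[of i j] that(1) by simp
  qed simp
  \<comment> \<open>Stage \<open>Suc k\<close> has frozen at least \<open>Suc k\<close> letters,
    hence position \<open>k\<close>.\<close>
  define l where "l k = Z (Suc k) k" for k
  have l: "l k = Z i k" if "k < N i" for i k
    using agree'[of k i "max i (Suc k)"] agree'[of k "Suc k" "max i (Suc k)"] that N_ge[of "Suc k"]
    by (simp add: l_def)
  have "l \<in> boundary_paths"
  proof (rule boundary_pathI)
    fix n
    \<comment> \<open>The path condition relates consecutive letters, so both are read off from one
      stage that has frozen them.\<close>
    have n: "n < N (Suc (Suc n))" "Suc n < N (Suc (Suc n))" using N_ge[of "Suc (Suc n)"] by auto
    have b: "Z (Suc (Suc n)) \<in> boundary_paths" using Z by (simp add: paths_from_def)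
    show "w \<in> verts G \<and> \<not> regular_vertex G w \<and> l (Suc n) = Inl w" if "l n = Inl w" for w
      using boundary_path_Inl[OF b, of n w] that by (simp add: l[OF n(1)] l[OF n(2)])
    show "e \<in> arcs G \<and> node (l (Suc n)) = head G e" if "l n = Inr e" for e
      using boundary_path_Inr[OF b, of n e] that by (simp add: l[OF n(1)] l[OF n(2)])
  qed
  moreover have "node (l 0) = u"
    using Z[of 1] by (simp add: l_def paths_from_def)
  ultimately have "l \<in> paths_from u" by (simp add: paths_from_def)
  then obtain i where i: "l = f i" using range_f by auto
  obtain k where "k < N (Suc i)" "Z (Suc i) k \<noteq> f i k" using differ by blast
  then show False using l[of k "Suc i"] i by simp
qed

text \<open>A second path from a later vertex of \<open>y\<close> would, with the preceding edge
  prepended, give a second path from the vertex before it.\<close>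

lemma paths_from_along_single:
  assumes single: "paths_from v = {y}"
  shows "paths_from (node (y n)) = {shift n y}"
proof -
  have y: "y \<in> boundary_paths" "node (y 0) = v" using single by (auto simp: paths_from_def)
  show ?thesis
  proof (induction n)
    case 0
    then show ?case using single y by simp
  next
    case (Suc n)
    have self: "shift (Suc n) y \<in> paths_from (node (y (Suc n)))"
      using boundary_path_shift[OF y(1), of "Suc n"] by (simp add: paths_from_def)
    have only: "z = shift (Suc n) y" if z: "z \<in> paths_from (node (y (Suc n)))" for z
    proof (cases "y n")
      case (Inl w)
      have "y (Suc n) = y n" using boundary_path_Inl(3)[OF y(1) Inl] Inl by simp
      then have "z = shift n y" and "shift (Suc n) y = shift n y"
        using Suc z self by (auto simp del: shift_apply)
      then show ?thesis by (simp only:)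
    next
      case (Inr e)
      have e: "e \<in> arcs G" "node (y (Suc n)) = head G e" using boundary_path_Inr[OF y(1) Inr] by auto
      have "case_nat (Inr e) z \<in> paths_from (tail G e)" using paths_from_cons[of z e] z e by simp
      then have "case_nat (Inr e) z = shift n y" using Suc Inr by (simp del: shift_apply)
      then have "z = shift (Suc 0) (shift n y)" by (simp only: case_nat_eq_iff)
      then show ?thesis by (simp del: shift_apply)
    qed
    show ?case using only self by blast
  qed
qed

text \<open>Every edge emitted along \<open>y\<close> continues to some boundary path, so
  single-path vertices emit only the next letter of \<open>y\<close>. If a vertex occurs twice, the
  two tails of \<open>y\<close> coincide and are periodic, which is possible only for
  padding.\<close>

lemma unbranched_path_exists:
  fixes A :: "'c star_algebra"
  assumes A: "graph_cstar_algebra G A p s" and uniq: "unique_irreducible_representation A"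
    and row: "row_countable G" and ne: "verts G \<noteq> {}"
  shows "\<exists>y\<in>boundary_paths. (\<forall>n. \<forall>e\<in>out_arcs G (node (y n)). y n = Inr e) \<and>
    (\<forall>m n. m < n \<and> node (y m) = node (y n) \<longrightarrow> (\<exists>w. shift m y = (\<lambda>_. Inl w)))"
proof -
  obtain u where u: "u \<in> verts G" using ne by blast
  obtain x where x: "x \<in> paths_from u" using paths_from_nonempty[OF u] by blast
  have "tail_equivalent x z" if "z \<in> paths_from u" for z
    using boundary_paths_tail_equivalent[OF A uniq, of z x] that x by (simp add: paths_from_def)
  then have "countable (paths_from u)" by (rule countable_paths_from[OF row u])
  then obtain v y where single: "paths_from v = {y}"
    using single_boundary_path_exists[OF u] by blast
  then have y: "y \<in> boundary_paths" by (auto simp: paths_from_def)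
  have "y n = Inr e" if e: "e \<in> out_arcs G (node (y n))" for n e
  proof -
    obtain z where "z \<in> paths_from (head G e)" using paths_from_nonempty[OF head_in_verts] e
      by fastforce
    then have "case_nat (Inr e) z \<in> paths_from (node (y n))" using paths_from_cons[of z e] e by simp
    then have "case_nat (Inr e) z = shift n y" using paths_from_along_single[OF single]
      by (simp del: shift_apply)
    then show ?thesis by (simp add: case_nat_eq_iff del: shift_apply) simp
  qed
  moreover have "\<exists>w. shift m y = (\<lambda>_. Inl w)" if mn: "m < n" "node (y m) = node (y n)" for m n
  proof -
    have "{shift m y} = {shift n y}" using paths_from_along_single[OF single] mn(2) by metis
    then have "shift n y = shift m y" by (simp del: shift_apply)
    then have "shift (n - m) (shift m y) = shift m y" using mn(1) by (simp del: shift_apply)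
    from boundary_path_not_periodic[OF A uniq boundary_path_shift[OF y] this]
    have "shift m y 0 = Inl (node (shift m y 0))" using mn(1) by simp
    then have "y m = Inl (node (y m))" by simp
    then show ?thesis using boundary_path_Inl_const[OF y] by blast
  qed
  ultimately show ?thesis using y by blast
qed

end

section \<open>Generators and density in C*-algebras\<close>

context cstar_algebra
begin

lemma mult_zero_left [simp]: "x \<in> carrier A \<Longrightarrow> \<zero> \<otimes> x = \<zero>"
  using smult_mult_left[of \<zero> x 0] mult_closed[of \<zero> x] smult_l_null[of "\<zero> \<otimes> x"] smult_l_null[of \<zero>]
  by simp

lemma mult_zero_right [simp]: "x \<in> carrier A \<Longrightarrow> x \<otimes> \<zero> = \<zero>"
  using smult_mult_right[of x \<zero> 0] mult_closed[of x \<zero>] smult_l_null[of "x \<otimes> \<zero>"] smult_l_null[of \<zero>]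
  by simp

lemma star_zero [simp]: "star A \<zero> = \<zero>"
  using star_smult[of \<zero> 0] star_closed[of \<zero>] smult_l_null[of "star A \<zero>"] smult_l_null[of \<zero>] by simp

lemma star_minus: "\<lbrakk>x \<in> carrier A; y \<in> carrier A\<rbrakk> \<Longrightarrow> star A (x \<ominus> y) = star A x \<ominus> star A y"
  by (simp add: M.minus_eq uminus_eq_smult star_add star_smult star_closed)

lemma mult_minus_left: "\<lbrakk>x \<in> carrier A; y \<in> carrier A; z \<in> carrier A\<rbrakk> \<Longrightarrow> (x \<ominus> y) \<otimes> z = x \<otimes> z \<ominus> y \<otimes> z"
  by (simp add: M.minus_eq uminus_eq_smult mult_distrib_right smult_mult_left mult_closed)

lemma mult_minus_right: "\<lbrakk>x \<in> carrier A; y \<in> carrier A; z \<in> carrier A\<rbrakk> \<Longrightarrow> z \<otimes> (x \<ominus> y) = z \<otimes> x \<ominus> z \<otimes> y"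
  by (simp add: M.minus_eq uminus_eq_smult mult_distrib_left smult_mult_right mult_closed)

lemma cnorm_star [simp]:
  assumes x: "x \<in> carrier A"
  shows "cnorm A (star A x) = cnorm A x"
proof -
  have le: "cnorm A x \<le> cnorm A (star A x)" if x: "x \<in> carrier A" for x
  proof (cases "x = \<zero>")
    case False
    then have pos: "0 < cnorm A x" using x N_nonneg[of x] N_eq_0_iff[of x] by linarith
    have "cnorm A x * cnorm A x \<le> cnorm A (star A x) * cnorm A x"
      using cstar_identity[OF x] cnorm_mult[of "star A x" x] x
        by (simp add: star_closed power2_eq_square)
    then show ?thesis using pos by simp
  qed simp
  show ?thesis using le[OF x] le[OF star_closed[OF x]] x by (simp add: star_star)
qed

lemma finsum_mult:
  assumes "finite F" "f \<in> F \<rightarrow> carrier A" "x \<in> carrier A"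
  shows finsum_mult_right: "(\<Oplus>i\<in>F. f i) \<otimes> x = (\<Oplus>i\<in>F. f i \<otimes> x)"
    and finsum_mult_left: "x \<otimes> (\<Oplus>i\<in>F. f i) = (\<Oplus>i\<in>F. x \<otimes> f i)"
  using assms
  by (induction F rule: finite_induct)
    (simp_all add: Pi_def mult_closed mult_distrib_left mult_distrib_right)

lemma finsum_star:
  "\<lbrakk>finite F; f \<in> F \<rightarrow> carrier A\<rbrakk> \<Longrightarrow> star A (\<Oplus>i\<in>F. f i) = (\<Oplus>i\<in>F. star A (f i))"
  by (induction F rule: finite_induct) (simp_all add: Pi_def star_closed star_add)

text \<open>The norm closure of \<open>C\<close> is a closed star subalgebra containing the
  generators, hence everything. Later arguments check a property on generators, show that it defines
  a star subalgebra, and approximate.\<close>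

lemma generates_dense:
  assumes gen: "generates A G" and C: "star_subalgebra A C" "G \<subseteq> C" and a: "a \<in> carrier A" "0 < \<epsilon>"
  shows "\<exists>c\<in>C. cnorm A (a \<ominus> c) < \<epsilon>"
proof -
  have sub: "submodule C complex_field A" and C_mult: "\<And>x y. \<lbrakk>x \<in> C; y \<in> C\<rbrakk> \<Longrightarrow> x \<otimes> y \<in> C"
    and C_star: "\<And>x. x \<in> C \<Longrightarrow> star A x \<in> C"
    using C(1) by (auto simp: star_subalgebra_def)
  note subD = submoduleE[OF sub]
  have CA: "c \<in> carrier A" if "c \<in> C" for c using subD(1) that by blast
  define D where "D = {x \<in> carrier A. \<forall>\<epsilon>>0. \<exists>c\<in>C. cnorm A (x \<ominus> c) < \<epsilon>}"
  \<comment> \<open>Any fixed multiple of \<epsilon> suffices as error. The restriction to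
    \<epsilon> below 1 bounds the norm of an approximant of \<open>x\<close> by that of
    \<open>x\<close> plus 1, as products require.\<close>
  have D_I: "x \<in> D" if x: "x \<in> carrier A" and K: "0 \<le> K" and le: "\<And>\<epsilon>. \<lbrakk>0 < \<epsilon>; \<epsilon> < 1\<rbrakk>
    \<Longrightarrow> \<exists>c\<in>C. cnorm A (x \<ominus> c) \<le> K * \<epsilon>" for x K
    unfolding D_def
  proof (intro CollectI conjI x allI impI)
    fix \<epsilon> :: real assume \<epsilon>: "0 < \<epsilon>"
    define d where "d = min (1 / 2) (\<epsilon> / (2 * (K + 1)))"
    have d: "0 < d" "d < 1" "d \<le> \<epsilon> / (2 * (K + 1))" using \<epsilon> K by (auto simp: d_def)
    have "K * d \<le> K * (\<epsilon> / (2 * (K + 1)))" using d K by (intro mult_left_mono)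
    also have "\<dots> < \<epsilon>" using K \<epsilon> by (simp add: field_simps add_nonneg_pos)
    finally show "\<exists>c\<in>C. cnorm A (x \<ominus> c) < \<epsilon>" using le[OF d(1,2)] by (meson le_less_trans)
  qed
  have D_D: "\<exists>c\<in>C. c \<in> carrier A \<and> cnorm A (x \<ominus> c) < \<epsilon>" if "x \<in> D" "0 < \<epsilon>" for x \<epsilon>
    using that CA unfolding D_def by blast
  have DA: "x \<in> carrier A" if "x \<in> D" for x using that by (simp add: D_def)
  have CD: "C \<subseteq> D"
  proof
    fix c assume c: "c \<in> C"
    have "\<exists>c'\<in>C. cnorm A (c \<ominus> c') \<le> 0 * \<epsilon>" for \<epsilon>
      using c CA by (intro bexI[of _ c]) simp_all
    then show "c \<in> D" using CA[OF c] by (intro D_I[of c 0]) auto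
  qed
  have D_smult: "c \<odot> x \<in> D" if x: "x \<in> D" for c x
  proof (rule D_I[of _ "cmod c"])
    fix \<epsilon> :: real assume "0 < \<epsilon>"
    then obtain d where d: "d \<in> C" "d \<in> carrier A" "cnorm A (x \<ominus> d) < \<epsilon>" using D_D[OF x] by blast
    then show "\<exists>d\<in>C. cnorm A (c \<odot> x \<ominus> d) \<le> cmod c * \<epsilon>"
      using DA[OF x] subD(4)[of c d] by (intro bexI[of _ "c \<odot> d"]) (simp_all add: mult_left_mono
        flip: smult_minus_right)
  qed (use DA[OF x] in simp_all)
  have "star_subalgebra A D"
    unfolding star_subalgebra_def
  proof (intro conjI ballI submoduleI)
    show "D \<subseteq> carrier A" using DA by blast
    show "\<zero> \<in> D" using submodule_zero[OF sub] CD by blast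
    show "c \<odot> x \<in> D" if "x \<in> D" for c x using D_smult[OF that] .
    show "\<ominus> x \<in> D" if "x \<in> D" for x using D_smult[OF that] DA[OF that] by (simp add: uminus_eq_smult)
    show "x \<oplus> y \<in> D" if x: "x \<in> D" and y: "y \<in> D" for x y
    proof (rule D_I[of _ 2])
      fix \<epsilon> :: real assume \<epsilon>: "0 < \<epsilon>"
      obtain c where c: "c \<in> C" "c \<in> carrier A" "cnorm A (x \<ominus> c) < \<epsilon>" using D_D[OF x \<epsilon>] by blast
      obtain d where d: "d \<in> C" "d \<in> carrier A" "cnorm A (y \<ominus> d) < \<epsilon>" using D_D[OF y \<epsilon>] by blast
      have "cnorm A ((x \<oplus> y) \<ominus> (c \<oplus> d)) \<le> 2 * \<epsilon>"
        using cnorm_add[of "x \<ominus> c" "y \<ominus> d"] c d DA[OF x] DA[OF y] by (simp add: minus_add_add)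
      then show "\<exists>c\<in>C. cnorm A ((x \<oplus> y) \<ominus> c) \<le> 2 * \<epsilon>" using subD(5)[OF c(1) d(1)] by blast
    qed (use DA[OF x] DA[OF y] in simp_all)
    show "x \<otimes> y \<in> D" if x: "x \<in> D" and y: "y \<in> D" for x y
    proof (rule D_I[of _ "cnorm A y + (cnorm A x + 1)"])
      fix \<epsilon> :: real assume \<epsilon>: "0 < \<epsilon>" "\<epsilon> < 1"
      obtain c where c: "c \<in> C" "c \<in> carrier A" "cnorm A (x \<ominus> c) < \<epsilon>" using D_D[OF x \<epsilon>(1)] by blast
      obtain d where d: "d \<in> C" "d \<in> carrier A" "cnorm A (y \<ominus> d) < \<epsilon>" using D_D[OF y \<epsilon>(1)] by blast
      note xy = DA[OF x] DA[OF y]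
      have "cnorm A c \<le> cnorm A x + 1"
        using N_le_add_minus[of c x] N_minus_commute[of c x] c \<epsilon> xy by simp
      have "x \<otimes> y \<ominus> c \<otimes> d = (x \<ominus> c) \<otimes> y \<oplus> c \<otimes> (y \<ominus> d)"
        using c d xy by (simp add: mult_minus_left mult_minus_right minus_minus_triangle mult_closed)
      then have "cnorm A (x \<otimes> y \<ominus> c \<otimes> d) \<le> cnorm A (x \<ominus> c) * cnorm A y + cnorm A c * cnorm A (y \<ominus> d)"
        using cnorm_add[of "(x \<ominus> c) \<otimes> y" "c \<otimes> (y \<ominus> d)"] cnorm_mult[of "x \<ominus> c" y] cnorm_mult[of c "y
          \<ominus> d"]
          c d xy by (simp add: mult_closed)
      also have "\<dots> \<le> \<epsilon> * cnorm A y + (cnorm A x + 1) * \<epsilon>"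
        using c d xy \<epsilon> \<open>cnorm A c \<le> cnorm A x + 1\<close> by (intro add_mono mult_mono) simp_all
      also have "\<dots> = (cnorm A y + (cnorm A x + 1)) * \<epsilon>" by (simp add: algebra_simps)
      finally show "\<exists>c\<in>C. cnorm A (x \<otimes> y \<ominus> c) \<le> (cnorm A y + (cnorm A x + 1)) * \<epsilon>"
        using C_mult[OF c(1) d(1)] by blast
    qed (use DA[OF x] DA[OF y] in \<open>simp_all add: mult_closed\<close>)
    show "star A x \<in> D" if x: "x \<in> D" for x
    proof (rule D_I[of _ 1])
      fix \<epsilon> :: real assume "0 < \<epsilon>"
      then obtain c where c: "c \<in> C" "c \<in> carrier A" "cnorm A (x \<ominus> c) < \<epsilon>" using D_D[OF x] by blast
      then show "\<exists>c\<in>C. cnorm A (star A x \<ominus> c) \<le> 1 * \<epsilon>"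
        using DA[OF x] C_star[OF c(1)] by (intro bexI[of _ "star A c"]) (simp_all flip: star_minus)
    qed (use DA[OF x] in \<open>simp_all add: star_closed\<close>)
  qed
  moreover have "closedin (norm_topology A (cnorm A)) D"
    unfolding closedin_norm_topology_iff
  proof (intro conjI ballI impI)
    fix x assume x: "x \<in> carrier A" and lim: "\<forall>\<epsilon>>0. \<exists>k\<in>D. cnorm A (x \<ominus> k) < \<epsilon>"
    show "x \<in> D"
    proof (rule D_I[of _ 2])
      fix \<epsilon> :: real assume \<epsilon>: "0 < \<epsilon>"
      obtain k where k: "k \<in> D" "cnorm A (x \<ominus> k) < \<epsilon>" using lim \<epsilon> by blast
      obtain c where c: "c \<in> C" "c \<in> carrier A" "cnorm A (k \<ominus> c) < \<epsilon>" using D_D[OF k(1) \<epsilon>] by blast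
      have "cnorm A (x \<ominus> c) \<le> 2 * \<epsilon>"
        using N_minus_triangle[OF x DA[OF k(1)] c(2)] k(2) c(3) by simp
      then show "\<exists>c\<in>C. cnorm A (x \<ominus> c) \<le> 2 * \<epsilon>" using c(1) by blast
    qed (use x in simp_all)
  qed (use DA in blast)
  ultimately have "D = carrier A" using gen C(2) CD unfolding generates_def by blast
  then show ?thesis using D_D a by blast
qed

end

text \<open>For nonzero \<open>q\<close>, coefficients of good approximations to \<open>x\<close>
  are close to each other, since their difference times the norm of \<open>q\<close> is bounded by
  the two errors; hence they converge.\<close>

lemma (in normed_module) line_closed:
  assumes x: "x \<in> carrier V" and q: "q \<in> carrier V" and approx: "\<And>\<epsilon>. 0 < \<epsilon> \<Longrightarrow> \<exists>c. N (x \<ominus> c \<odot> q) < \<epsilon>"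
  shows "\<exists>c. x = c \<odot> q"
proof (cases "q = \<zero>")
  case True
  have "\<not> 0 < N x"
  proof
    assume "0 < N x"
    then show False using approx[of "N x"] True x by simp
  qed
  then have "N x \<le> 0" by linarith
  then show ?thesis using x True by simp
next
  case False
  then have Nq: "0 < N q" using q N_nonneg[of q] N_eq_0_iff[of q] by linarith
  have "\<exists>c. N (x \<ominus> c \<odot> q) < inverse (real (Suc n))" for n by (rule approx) simp
  then obtain c where c: "\<And>n. N (x \<ominus> c n \<odot> q) < inverse (real (Suc n))" by metis
  have diff: "cmod (a - b) * N q \<le> N (x \<ominus> a \<odot> q) + N (x \<ominus> b \<odot> q)" for a b
  proof -
    have "a \<odot> q \<ominus> b \<odot> q = (a - b) \<odot> q"
      using q smult_l_distr[of a "-b" q] smult_l_minus[of b q]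
        by (simp add: M.minus_eq complex_field_uminus)
    then have "cmod (a - b) * N q = N (a \<odot> q \<ominus> b \<odot> q)" using q by simp
    also have "\<dots> \<le> N (a \<odot> q \<ominus> x) + N (x \<ominus> b \<odot> q)" using q x by (intro N_minus_triangle) simp_all
    finally show ?thesis using N_minus_commute[of x "a \<odot> q"] q x by simp
  qed
  have lim0: "(\<lambda>n. inverse (real (Suc n))) \<longlonglongrightarrow> 0" by (rule LIMSEQ_inverse_real_of_nat)
  have "Cauchy c"
  proof (rule metric_CauchyI)
    fix e :: real assume "0 < e"
    then have "0 < e * N q / 2" using Nq by simp
    from LIMSEQ_D[OF lim0 this] obtain M where M: "\<And>n. n \<ge> M \<Longrightarrow> inverse (real (Suc n)) < e * N q / 2"
      by auto
    have "dist (c m) (c n) < e" if mn: "m \<ge> M" "n \<ge> M" for m n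
    proof -
      have "cmod (c m - c n) * N q < e * N q"
        using diff[of "c m" "c n"] c[of m] c[of n] M[OF mn(1)] M[OF mn(2)] by linarith
      then show ?thesis using Nq by (simp add: dist_norm)
    qed
    then show "\<exists>M. \<forall>m\<ge>M. \<forall>n\<ge>M. dist (c m) (c n) < e" by blast
  qed
  then obtain l where l: "c \<longlonglongrightarrow> l" by (auto simp: Cauchy_convergent_iff convergent_def)
  have le: "N (x \<ominus> l \<odot> q) \<le> inverse (real (Suc n)) + cmod (c n - l) * N q" for n
  proof -
    have "c n \<odot> q \<ominus> l \<odot> q = (c n - l) \<odot> q"
      using q smult_l_distr[of "c n" "-l" q] smult_l_minus[of l q]
        by (simp add: M.minus_eq complex_field_uminus)
    then show ?thesis
      using N_minus_triangle[of x "c n \<odot> q" "l \<odot> q"] c[of n] x q by simp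
  qed
  have "(\<lambda>n. inverse (real (Suc n)) + cmod (c n - l) * N q) \<longlonglongrightarrow> 0 + cmod (l - l) * N q"
    by (intro tendsto_intros lim0 l)
  then have "N (x \<ominus> l \<odot> q) \<le> 0"
    using le by (intro LIMSEQ_le_const[of _ 0]) auto
  then show ?thesis using x q by auto
qed

context wf_digraph
begin

text \<open>At a singular vertex the constant path is a boundary path. A path that leaves through
  \<open>e\<close> is tail equivalent to it, hence returns to the vertex, and repeating the loop
  yields a periodic infinite path, which is excluded.\<close>

lemma regular_vertex_tail:
  fixes A :: "'c star_algebra"
  assumes A: "graph_cstar_algebra G A p s" and uniq: "unique_irreducible_representation A"
    and e: "e \<in> arcs G"
  shows "regular_vertex G (tail G e)"
proof (rule ccontr)
  assume sing: "\<not> regular_vertex G (tail G e)"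
  let ?w = "tail G e"
  obtain z where z: "z \<in> paths_from (head G e)" using paths_from_nonempty[OF head_in_verts[OF e]]
    by blast
  define y where "y = case_nat (Inr e) z"
  have y: "y \<in> boundary_paths" "y 0 = Inr e"
    using paths_from_cons[OF z e] by (auto simp: y_def paths_from_def)
  have "(\<lambda>_. Inl ?w) \<in> boundary_paths" using e sing by (intro boundary_path_const) auto
  then have "tail_equivalent y (\<lambda>_. Inl ?w)" using boundary_paths_tail_equivalent[OF A uniq _ y(1)]
    by blast
  then obtain m k where mk: "shift m y = shift k (\<lambda>_. Inl ?w)" by (auto simp: tail_equivalent_def)
  have "y m = Inl ?w" using fun_cong[OF mk, of 0] by simp
  then have ex: "\<exists>n. y n = Inl ?w" by blast
  \<comment> \<open>The first arrival at the padding: all earlier letters are edges.\<close>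
  define n where "n = (LEAST n. y n = Inl ?w)"
  have yn: "y n = Inl ?w" unfolding n_def by (rule LeastI_ex[OF ex])
  have n0: "0 < n" using yn y(2) by (cases n) auto
  have Inr: "\<exists>f. y k = Inr f" if k: "k < n" for k
  proof (cases "y k")
    case (Inl u)
    have "y n = shift k y (n - k)" using k by simp
    also have "\<dots> = Inl u" by (simp only: boundary_path_Inl_const[OF y(1) Inl])
    finally have "y k = Inl ?w" using Inl yn by simp
    then have "n \<le> k" unfolding n_def by (rule Least_le)
    then show ?thesis using k by simp
  qed simp
  \<comment> \<open>The loop repeated forever. It closes up because \<open>node (y n)\<close> is the
    source of \<open>e\<close>, the edge with which it begins.\<close>
  define x where "x k = y (k mod n)" for k
  have "x \<in> boundary_paths"
  proof (rule boundary_pathI)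
    fix k u assume "x k = Inl u"
    then show "u \<in> verts G \<and> \<not> regular_vertex G u \<and> x (Suc k) = Inl u"
      using Inr[of "k mod n"] n0 by (simp add: x_def)
  next
    fix k f assume k: "x k = Inr f"
    then have f: "f \<in> arcs G" "node (y (Suc (k mod n))) = head G f"
      using boundary_path_Inr[OF y(1), of "k mod n" f] by (auto simp: x_def)
    show "f \<in> arcs G \<and> node (x (Suc k)) = head G f"
    proof (cases "Suc (k mod n) = n")
      case True
      then have "Suc k mod n = 0" by (simp add: mod_Suc)
      then show ?thesis using f True yn y(2) by (simp add: x_def)
    next
      case False
      then show ?thesis using f by (simp add: x_def mod_Suc)
    qed
  qed
  moreover have "shift n x = x" by (auto simp: x_def shift_def)
  moreover have "x 0 = Inr e" using y(2) by (simp add: x_def)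
  ultimately show False using boundary_path_not_periodic[OF A uniq _ _ n0, of x] by simp
qed

end

section \<open>Matrix units from an unbranched path\<close>

text \<open>What uniqueness yields about the graph. The algebra below proceeds from these conditions
  and makes no further appeal to uniqueness.\<close>

locale unbranched_family = wf_digraph G + A: cstar_algebra A
  for G :: "('a, 'b) pre_digraph" and A :: "'c star_algebra" (structure) +
  fixes p :: "'a \<Rightarrow> 'c" and s :: "'b \<Rightarrow> 'c" and y :: "nat \<Rightarrow> 'a + 'b"
  assumes ck: "cuntz_krieger_family G A p s"
    and gen: "generates A (p ` verts G \<union> s ` arcs G)"
    and regular: "e \<in> arcs G \<Longrightarrow> regular_vertex G (tail G e)"
    and y: "y \<in> boundary_paths"
    and unbranched: "e \<in> out_arcs G (node (y n)) \<Longrightarrow> y n = Inr e"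
    and no_return: "\<lbrakk>m < n; node (y m) = node (y n)\<rbrakk> \<Longrightarrow> \<exists>w. shift m y = (\<lambda>_. Inl w)"
    and cofinal: "z \<in> boundary_paths \<Longrightarrow> tail_equivalent z y"
begin

section \<open>Cuntz-Krieger relations and partial isometries along the unbranched path\<close>

lemma p_simps [simp]:
  assumes "v \<in> verts G"
  shows "p v \<in> carrier A" "star A (p v) = p v" "p v \<otimes> p v = p v"
  using ck assms by (auto simp: cuntz_krieger_family_def projection_def)

lemma p_orth: "\<lbrakk>v \<in> verts G; w \<in> verts G; v \<noteq> w\<rbrakk> \<Longrightarrow> p v \<otimes> p w = \<zero>"
  using ck by (simp add: cuntz_krieger_family_def)

lemma s_closed [simp]: "e \<in> arcs G \<Longrightarrow> s e \<in> carrier A"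
  using ck by (simp add: cuntz_krieger_family_def partial_isometry_def)

lemma s_star_closed [simp]: "e \<in> arcs G \<Longrightarrow> star A (s e) \<in> carrier A"
  by (simp add: A.star_closed)

lemmas [simp] = A.mult_closed

lemma s_star_s: "e \<in> arcs G \<Longrightarrow> star A (s e) \<otimes> s e = p (head G e)"
  using ck by (simp add: cuntz_krieger_family_def)

lemma s_p: "e \<in> arcs G \<Longrightarrow> s e \<otimes> p (head G e) = s e"
  using ck by (simp add: cuntz_krieger_family_def partial_isometry_def A.mult_assoc flip: s_star_s)

lemma s_s_star_s: "e \<in> arcs G \<Longrightarrow> s e \<otimes> (star A (s e) \<otimes> s e) = s e"
  by (simp add: s_star_s s_p)

lemma s_star_s_orth:
  assumes e: "e \<in> arcs G" and f: "f \<in> arcs G" and neq: "e \<noteq> f"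
  shows "star A (s e) \<otimes> s f = \<zero>"
proof -
  have "star A (s e) = star A (s e) \<otimes> (s e \<otimes> star A (s e))"
    using arg_cong[OF s_s_star_s[OF e], of "star A"] e by (simp add: A.star_mult A.star_star
      A.mult_assoc)
  then have "star A (s e) \<otimes> s f = (star A (s e) \<otimes> (s e \<otimes> star A (s e))) \<otimes> (s f \<otimes> (star A (s f) \<otimes> s f))"
    by (simp only: s_s_star_s[OF f])
  also have "\<dots> = star A (s e) \<otimes> ((s e \<otimes> star A (s e)) \<otimes> (s f \<otimes> star A (s f))) \<otimes> s f"
    using e f by (simp add: A.mult_assoc)
  also have "(s e \<otimes> star A (s e)) \<otimes> (s f \<otimes> star A (s f)) = \<zero>"
    using ck e f neq by (simp add: cuntz_krieger_family_def)
  finally show ?thesis using e f by simp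
qed

lemma p_regular: "regular_vertex G v \<Longrightarrow> p v = (\<Oplus>e\<in>out_arcs G v. s e \<otimes> star A (s e))"
  using ck by (simp add: cuntz_krieger_family_def)

text \<open>The source of an edge is regular, so its projection is a finite sum of range
  projections, of which only the one of \<open>e\<close> survives multiplication by
  \<open>s e\<close>. This route avoids extracting the identity from the order relation.\<close>

lemma p_s:
  assumes e: "e \<in> arcs G"
  shows "p (tail G e) \<otimes> s e = s e"
proof -
  let ?O = "out_arcs G (tail G e)"
  have fin: "finite ?O" using regular[OF e] by (simp add: regular_vertex_def)
  have "p (tail G e) \<otimes> s e = (\<Oplus>f\<in>?O. (s f \<otimes> star A (s f)) \<otimes> s e)"
    using e by (subst p_regular[OF regular[OF e]], subst A.finsum_mult_right[OF fin]) auto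
  also have "\<dots> = (\<Oplus>f\<in>?O. if e = f then s f else \<zero>)"
  proof (rule A.M.finsum_cong')
    show "(s f \<otimes> star A (s f)) \<otimes> s e = (if e = f then s f else \<zero>)" if "f \<in> ?O" for f
      using that e s_star_s_orth[of f e] s_s_star_s[of f] by (auto simp: A.mult_assoc)
  qed auto
  also have "\<dots> = s e" using e fin by (intro A.M.add.finprod_singleton) auto
  finally show ?thesis .
qed

lemma s_star_p: "e \<in> arcs G \<Longrightarrow> star A (s e) \<otimes> p (tail G e) = star A (s e)"
  using arg_cong[OF p_s, of e "star A"] by (simp add: A.star_mult)

lemma p_s_star: "e \<in> arcs G \<Longrightarrow> p (head G e) \<otimes> star A (s e) = star A (s e)"
  using arg_cong[OF s_p, of e "star A"] by (simp add: A.star_mult)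

lemma y_node [simp]: "node (y n) \<in> verts G"
  by (rule boundary_path_node[OF y])

lemma y_arc: "y n = Inr e \<Longrightarrow> e \<in> arcs G \<and> tail G e = node (y n) \<and> node (y (Suc n)) = head G e"
  using boundary_path_Inr[OF y] by auto

text \<open>The sum in the relation at a regular vertex has a single term, as the vertex emits only
  the next edge of \<open>y\<close>.\<close>

lemma s_s_star_along: 
  assumes e: "y n = Inr e"
  shows "s e \<otimes> star A (s e) = p (node (y n))"
proof -
  note arc = y_arc[OF e]
  have "f = e" if "f \<in> out_arcs G (node (y n))" for f
    using unbranched[OF that] e by simp
  moreover have "e \<in> out_arcs G (node (y n))" using arc by simp
  ultimately have out: "out_arcs G (node (y n)) = {e}" by blast
  have "regular_vertex G (node (y n))" using regular[of e] arc by metis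
  from p_regular[OF this] show ?thesis using arc by (simp only: out) simp
qed

text \<open>The adjoint of the product of the first \<open>n\<close> edges of \<open>y\<close>, read
  from \<open>q\<close> to the vertex reached; it stays constant once \<open>y\<close> is
  padding.\<close>

primrec b :: "nat \<Rightarrow> 'c" where
  "b 0 = p (node (y 0))"
| "b (Suc n) = (case y n of Inl w \<Rightarrow> b n | Inr e \<Rightarrow> star A (s e) \<otimes> b n)"

abbreviation "q \<equiv> p (node (y 0))"

lemma q_simps [simp]: "q \<in> carrier A" "star A q = q" "q \<otimes> q = q"
  by simp_all

text \<open>Along \<open>y\<close> each \<open>s e\<close> has full range in the projection of its
  source, so multiplying by its adjoint preserves the initial projection \<open>q\<close> and moves
  the final projection to the next vertex.\<close>

lemma b_props:
  "b n \<in> carrier A \<and> p (node (y n)) \<otimes> b n = b n \<and> star A (b n) \<otimes> b n = q \<and> b n \<otimes> q = b n \<and>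
    b n \<otimes> star A (b n) = p (node (y n))"
proof (induction n)
  case 0
  then show ?case by simp
next
  case (Suc n)
  show ?case
  proof (cases "y n")
    case (Inl w)
    then show ?thesis using Suc boundary_path_Inl(3)[OF y Inl] by simp
  next
    case (Inr e)
    note arc = y_arc[OF Inr]
    have e: "e \<in> arcs G" "head G e \<in> verts G" using arc head_in_verts by auto
    have bn: "b n \<in> carrier A" "star A (b n) \<in> carrier A" using Suc by (auto simp: A.star_closed)
    have "star A (b n) \<otimes> s e \<otimes> (star A (s e) \<otimes> b n) = star A (b n) \<otimes> ((s e \<otimes> star A (s e)) \<otimes> b n)"
      using e bn by (simp add: A.mult_assoc)
    also have "\<dots> = q" using Suc s_s_star_along[OF Inr] by simp
    finally have 1: "star A (b n) \<otimes> s e \<otimes> (star A (s e) \<otimes> b n) = q" .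
    have "(star A (s e) \<otimes> b n) \<otimes> (star A (b n) \<otimes> s e) = star A (s e) \<otimes> (b n \<otimes> star A (b n)) \<otimes> s e"
      using e bn by (simp add: A.mult_assoc)
    also have "b n \<otimes> star A (b n) = p (tail G e)" using Suc arc by metis
    also have "star A (s e) \<otimes> p (tail G e) \<otimes> s e = p (head G e)"
      using e(1) by (simp add: s_star_p s_star_s)
    finally have 2: "(star A (s e) \<otimes> b n) \<otimes> (star A (b n) \<otimes> s e) = p (head G e)" .
    have 3: "p (head G e) \<otimes> (star A (s e) \<otimes> b n) = star A (s e) \<otimes> b n"
      using e bn p_s_star[of e] by (simp flip: A.mult_assoc)
    have 4: "star A (s e) \<otimes> b n \<otimes> q = star A (s e) \<otimes> b n"
      using e bn Suc by (simp add: A.mult_assoc)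
    show ?thesis using 1 2 3 4 Inr arc e bn by (simp add: A.star_mult A.star_star)
  qed
qed

text \<open>The products of a finite path leading to a vertex of \<open>y\<close> with the
  corresponding \<open>b n\<close>, each tagged with the source of the path. They are the matrix
  units of the column belonging to \<open>q\<close>: partial isometries with initial projection
  \<open>q\<close>.\<close>

inductive_set T :: "('a \<times> 'c) set" where
  base: "(node (y n), b n) \<in> T"
| step: "\<lbrakk>(head G e, t) \<in> T; e \<in> arcs G\<rbrakk> \<Longrightarrow> (tail G e, s e \<otimes> t) \<in> T"

lemma T_props:
  "(u, t) \<in> T \<Longrightarrow> u \<in> verts G \<and> t \<in> carrier A \<and> p u \<otimes> t = t \<and> star A t \<otimes> t = q \<and> t \<otimes> q = t"
proof (induction rule: T.induct)
  case (base n)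
  then show ?case using b_props[of n] by simp
next
  case (step e t)
  have ts: "star A t \<in> carrier A" "t \<in> carrier A" using step by (auto simp: A.star_closed)
  have "(star A t \<otimes> star A (s e)) \<otimes> (s e \<otimes> t) = star A t \<otimes> ((star A (s e) \<otimes> s e) \<otimes> t)"
    using step ts by (simp add: A.mult_assoc)
  also have "\<dots> = q" using step by (simp add: s_star_s)
  finally have 1: "star A (s e \<otimes> t) \<otimes> (s e \<otimes> t) = q" using step ts by (simp add: A.star_mult)
  have 2: "p (tail G e) \<otimes> (s e \<otimes> t) = s e \<otimes> t"
    using step ts p_s[of e] by (simp flip: A.mult_assoc)
  show ?case using 1 2 step ts by (simp add: A.mult_assoc)
qed

lemma T_closed: "(u, t) \<in> T \<Longrightarrow> t \<in> carrier A" "(u, t) \<in> T \<Longrightarrow> star A t \<in> carrier A"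
  using T_props by (auto simp: A.star_closed)

lemma T_p: "\<lbrakk>(u, t) \<in> T; w \<in> verts G\<rbrakk> \<Longrightarrow> p w \<otimes> t = (if w = u then t else \<zero>)"
proof -
  assume T: "(u, t) \<in> T" and w: "w \<in> verts G"
  note props = T_props[OF T]
  show ?thesis
  proof (cases "w = u")
    case False
    have "p w \<otimes> t = (p w \<otimes> p u) \<otimes> t" using props w by (simp add: A.mult_assoc)
    then show ?thesis using False props w p_orth[of w u] by simp
  qed (use props in simp)
qed

lemma T_s:
  assumes T: "(u, t) \<in> T" and e: "e \<in> arcs G"
  shows "s e \<otimes> t = \<zero> \<or> (tail G e, s e \<otimes> t) \<in> T"
proof (cases "head G e = u")
  case True
  then show ?thesis using T.step T e by blast
next
  case False
  have "s e \<otimes> t = s e \<otimes> (p (head G e) \<otimes> t)"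
    using T_closed[OF T] e s_p[OF e] by (simp flip: A.mult_assoc)
  also have "\<dots> = \<zero>" using T_p[OF T, of "head G e"] False e by simp
  finally show ?thesis by simp
qed

text \<open>Together with zero, \<open>T\<close> is stable under the generators and their adjoints.
  For a bare \<open>b n\<close>, an edge out of the vertex reached must be the next edge of
  \<open>y\<close>, and its adjoint produces \<open>b (Suc n)\<close>. Otherwise the adjoint meets
  the first edge and either cancels it or gives zero.\<close>

lemma T_s_star:
  assumes T: "(u, t) \<in> T" and e: "e \<in> arcs G"
  shows "star A (s e) \<otimes> t = \<zero> \<or> (\<exists>v. (v, star A (s e) \<otimes> t) \<in> T)"
  using T
proof (cases rule: T.cases)
  case (base n)
  show ?thesis
  proof (cases "tail G e = node (y n)")
    case True
    then have "y n = Inr e" using unbranched[of e n] e by simp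
    then have "star A (s e) \<otimes> t = b (Suc n)" using base by simp
    then show ?thesis using T.base[of "Suc n"] by metis
  next
    case False
    have "star A (s e) \<otimes> t = star A (s e) \<otimes> (p (tail G e) \<otimes> t)"
      using T_closed[OF T] e s_star_p[OF e] by (simp flip: A.mult_assoc)
    also have "\<dots> = \<zero>" using T_p[OF T, of "tail G e"] False e base by simp
    finally show ?thesis by simp
  qed
next
  case (step f t')
  have eq: "star A (s e) \<otimes> t = (star A (s e) \<otimes> s f) \<otimes> t'"
    using step e T_closed[OF step(3)] by (simp add: A.mult_assoc)
  show ?thesis
  proof (cases "e = f")
    case True
    then show ?thesis using eq step T_props[OF step(3)] by (auto simp: s_star_s)
  next
    case False
    then show ?thesis using eq step e T_closed[OF step(3)] by (simp add: s_star_s_orth)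
  qed
qed

text \<open>A vertex repeats along \<open>y\<close> only within the padding, where \<open>b\<close>
  no longer changes.\<close>

lemma b_eq: 
  assumes "node (y m) = node (y n)"
  shows "b m = b n"
proof -
  have less: "b m = b n" if mn: "m < n" "node (y m) = node (y n)" for m n
  proof -
    obtain w where w: "shift m y = (\<lambda>_. Inl w)" using no_return[OF mn] by blast
    have "b (m + k) = b m" for k
    proof (induction k)
      case (Suc k)
      have "y (m + k) = Inl w" using fun_cong[OF w, of k] by simp
      then show ?case using Suc by simp
    qed simp
    from this[of "n - m"] show ?thesis using mn by simp
  qed
  consider "m < n" | "m = n" | "n < m" by linarith
  then show ?thesis
  proof cases
    case 1 then show ?thesis using less assms by blast
  next
    case 3 then show ?thesis using less[OF 3 assms[symmetric]] by simp
  qed simp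
qed

text \<open>An edge out of a vertex of \<open>y\<close> is the next edge of \<open>y\<close>; the
  induction hypothesis puts its adjoint directly behind it, and the product of the two is the vertex
  projection. Hence detours along \<open>y\<close> cancel.\<close>

lemma T_unique: "(u, t) \<in> T \<Longrightarrow> u = node (y m) \<Longrightarrow> t = b m"
proof (induction arbitrary: m rule: T.induct)
  case (base n)
  then show ?case by (rule b_eq)
next
  case (step e t)
  have ym: "y m = Inr e" using unbranched[of e m] step.hyps(2) step.prems by simp
  have "head G e = node (y (Suc m))" using y_arc[OF ym] by metis
  then have t: "t = star A (s e) \<otimes> b m" using step.IH[of "Suc m"] ym by simp
  have "s e \<otimes> t = (s e \<otimes> star A (s e)) \<otimes> b m"
    unfolding t using step.hyps(2) b_props[of m] by (simp add: A.mult_assoc)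
  then show ?case unfolding s_s_star_along[OF ym] using b_props[of m] by simp
qed

section \<open>The span of the matrix column and the one-dimensional corner\<close>

inductive_set L :: "'c set" where
  zero: "\<zero> \<in> L"
| add: "\<lbrakk>l \<in> L; (u, t) \<in> T\<rbrakk> \<Longrightarrow> c \<odot> t \<oplus> l \<in> L"

lemma L_carrier: "l \<in> L \<Longrightarrow> l \<in> carrier A"
  by (induction rule: L.induct) (simp_all add: T_closed)

lemma L_add: "\<lbrakk>l \<in> L; k \<in> L\<rbrakk> \<Longrightarrow> l \<oplus> k \<in> L"
proof (induction rule: L.induct)
  case (add l u t c)
  then show ?case using L.add[of "l \<oplus> k" u t c] by (simp add: A.M.a_assoc T_closed L_carrier)
qed (simp add: L_carrier)

lemma L_smult: "l \<in> L \<Longrightarrow> d \<odot> l \<in> L"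
proof (induction rule: L.induct)
  case (add l u t c)
  have "d \<odot> (c \<odot> t \<oplus> l) = (d * c) \<odot> t \<oplus> d \<odot> l"
    using add A.smult_assoc1[of d c t] by (simp add: A.smult_r_distr T_closed L_carrier)
  then show ?case using L.add[OF add.IH add.hyps(2)] by simp
qed (simp add: L.zero)

lemma T_in_L:
  assumes "(u, t) \<in> T"
  shows "t \<in> L"
  using L.add[OF L.zero assms, of 1] A.smult_one[of t] T_closed[OF assms] by simp

text \<open>Elements that, together with their adjoints, preserve the span \<open>L\<close>. The
  condition on the adjoint is built in to make this a star subalgebra; it contains the generators
  and is therefore dense.\<close>

definition stab :: "'c set" where
  "stab = {a \<in> carrier A. (\<forall>(u, t)\<in>T. a \<otimes> t \<in> L) \<and> (\<forall>(u, t)\<in>T. star A a \<otimes> t \<in> L)}"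

lemma stabD:
  assumes "a \<in> stab"
  shows "a \<in> carrier A" "(u, t) \<in> T \<Longrightarrow> a \<otimes> t \<in> L" "(u, t) \<in> T \<Longrightarrow> star A a \<otimes> t \<in> L"
  using assms by (auto simp: stab_def)

lemma stabI:
  assumes "a \<in> carrier A" "\<And>u t. (u, t) \<in> T \<Longrightarrow> a \<otimes> t \<in> L" "\<And>u t. (u, t) \<in> T \<Longrightarrow> star A a \<otimes> t \<in> L"
  shows "a \<in> stab"
  using assms by (auto simp: stab_def)

lemma L_mult:
  assumes a: "a \<in> carrier A" "\<And>u t. (u, t) \<in> T \<Longrightarrow> a \<otimes> t \<in> L" and l: "l \<in> L"
  shows "a \<otimes> l \<in> L"
  using l
proof (induction rule: L.induct)
  case (add l u t c)
  have "a \<otimes> (c \<odot> t \<oplus> l) = c \<odot> (a \<otimes> t) \<oplus> a \<otimes> l"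
    using add a(1) by (simp add: A.mult_distrib_left A.smult_mult_right T_closed L_carrier)
  then show ?case using L_add[OF L_smult[OF a(2)[OF add.hyps(2)]] add.IH] by simp
qed (simp add: a L.zero)

lemma star_subalgebra_stab: "star_subalgebra A stab"
  unfolding star_subalgebra_def
proof (intro conjI ballI A.submoduleI)
  show "stab \<subseteq> carrier A" using stabD by blast
  show "\<zero> \<in> stab" by (rule stabI) (simp_all add: T_closed L.zero)
  have smult: "c \<odot> a \<in> stab" if a: "a \<in> stab" for c a
  proof (rule stabI)
    show "c \<odot> a \<in> carrier A" using stabD(1)[OF a] by simp
    show "c \<odot> a \<otimes> t \<in> L" if t: "(u, t) \<in> T" for u t
      using L_smult[OF stabD(2)[OF a t]] stabD(1)[OF a] by (simp add: A.smult_mult_left T_closed[OF t])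
    show "star A (c \<odot> a) \<otimes> t \<in> L" if t: "(u, t) \<in> T" for u t
      using L_smult[OF stabD(3)[OF a t]] stabD(1)[OF a]
      by (simp add: A.smult_mult_left A.star_smult A.star_closed T_closed[OF t])
  qed
  then show "c \<odot> a \<in> stab" if "a \<in> stab" for c a using that .
  show "\<ominus> a \<in> stab" if "a \<in> stab" for a
    using smult[OF that, of "-1"] stabD(1)[OF that] by (simp add: A.uminus_eq_smult)
  show "a \<oplus> c \<in> stab" if a: "a \<in> stab" and c: "c \<in> stab" for a c
  proof (rule stabI)
    show "a \<oplus> c \<in> carrier A" using stabD(1)[OF a] stabD(1)[OF c] by simp
    show "(a \<oplus> c) \<otimes> t \<in> L" if t: "(u, t) \<in> T" for u t
      using L_add[OF stabD(2)[OF a t] stabD(2)[OF c t]] stabD(1)[OF a] stabD(1)[OF c]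
      by (simp add: A.mult_distrib_right T_closed[OF t])
    show "star A (a \<oplus> c) \<otimes> t \<in> L" if t: "(u, t) \<in> T" for u t
      using L_add[OF stabD(3)[OF a t] stabD(3)[OF c t]] stabD(1)[OF a] stabD(1)[OF c]
      by (simp add: A.mult_distrib_right A.star_add A.star_closed T_closed[OF t])
  qed
  show "a \<otimes> c \<in> stab" if a: "a \<in> stab" and c: "c \<in> stab" for a c
  proof (rule stabI)
    show "a \<otimes> c \<in> carrier A" using stabD(1)[OF a] stabD(1)[OF c] by simp
    show "(a \<otimes> c) \<otimes> t \<in> L" if t: "(u, t) \<in> T" for u t
      using L_mult[OF stabD(1,2)[OF a] stabD(2)[OF c t]] stabD(1)[OF a] stabD(1)[OF c]
      by (simp add: A.mult_assoc T_closed[OF t])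
    show "star A (a \<otimes> c) \<otimes> t \<in> L" if t: "(u, t) \<in> T" for u t
      using L_mult[OF A.star_closed[OF stabD(1)[OF c]] stabD(3)[OF c] stabD(3)[OF a t]] stabD(1)[OF
        a] stabD(1)[OF c]
      by (simp add: A.mult_assoc A.star_mult A.star_closed T_closed[OF t])
  qed
  show "star A a \<in> stab" if a: "a \<in> stab" for a
    using stabD[OF a] by (intro stabI) (simp_all add: A.star_star A.star_closed)
qed

lemma generators_stab: "p ` verts G \<union> s ` arcs G \<subseteq> stab"
proof -
  have "p v \<in> stab" if v: "v \<in> verts G" for v
    using v T_p by (intro stabI) (auto intro: L.zero T_in_L)
  moreover have "s e \<in> stab" if e: "e \<in> arcs G" for e
  proof (rule stabI)
    show "s e \<otimes> t \<in> L" if "(u, t) \<in> T" for u t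
      using T_s[OF that e] by (auto intro: L.zero T_in_L)
    show "star A (s e) \<otimes> t \<in> L" if "(u, t) \<in> T" for u t
      using T_s_star[OF that e] by (auto intro: L.zero T_in_L)
  qed (use e in simp)
  ultimately show ?thesis by blast
qed

text \<open>For a member of \<open>T\<close>, multiplication by \<open>q\<close> gives zero unless
  the tag is the initial vertex of \<open>y\<close>, and then \<open>T_unique\<close> identifies the
  member with \<open>q\<close> itself.\<close>

lemma q_L: "l \<in> L \<Longrightarrow> \<exists>c. q \<otimes> l = c \<odot> q"
proof (induction rule: L.induct)
  case zero
  show ?case by (rule exI[of _ 0]) simp
next
  case (add l u t c)
  then obtain d where d: "q \<otimes> l = d \<odot> q" by blast
  have "\<exists>d'. q \<otimes> t = d' \<odot> q"
  proof (cases "u = node (y 0)")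
    case True
    then have "t = q" using T_unique[OF add.hyps(2), of 0] by simp
    then show ?thesis using A.smult_one[of q] by (intro exI[of _ 1]) simp
  next
    case False
    then show ?thesis using T_p[OF add.hyps(2), of "node (y 0)"] by (intro exI[of _ 0]) simp
  qed
  then obtain d' where d': "q \<otimes> t = d' \<odot> q" by blast
  have "q \<otimes> (c \<odot> t \<oplus> l) = (c * d') \<odot> q \<oplus> d \<odot> q"
    using add d d' A.smult_assoc1[of c d' q]
    by (simp add: A.mult_distrib_left A.smult_mult_right T_closed L_carrier)
  also have "\<dots> = (c * d' + d) \<odot> q" using A.smult_l_distr[of "c * d'" d q] by simp
  finally show ?case by blast
qed

text \<open>For \<open>d\<close> in the dense subalgebra \<open>stab\<close>, the element
  \<open>d \<otimes> q\<close> lies in the span, so \<open>q \<otimes> d \<otimes> q\<close> is a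
  multiple of \<open>q\<close>. Lines are closed, so the statement passes to limits.\<close>

lemma corner:
  assumes a: "a \<in> carrier A"
  shows "\<exists>c. q \<otimes> a \<otimes> q = c \<odot> q"
proof (rule A.line_closed)
  show "q \<otimes> a \<otimes> q \<in> carrier A" "q \<in> carrier A" using a by simp_all
  fix \<epsilon> :: real assume \<epsilon>: "0 < \<epsilon>"
  let ?K = "cnorm A q * cnorm A q"
  have K: "0 \<le> ?K" by simp
  obtain d where d: "d \<in> stab" "cnorm A (a \<ominus> d) < \<epsilon> / (?K + 1)"
    using A.generates_dense[OF gen star_subalgebra_stab generators_stab a, of "\<epsilon> / (?K + 1)"] \<epsilon> K
    by (auto simp: add_nonneg_pos)
  have dA: "d \<in> carrier A" using stabD[OF d(1)] by simp
  have "d \<otimes> q \<in> L" using stabD(2)[OF d(1) T.base[of 0]] by simp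
  then obtain c where c: "q \<otimes> (d \<otimes> q) = c \<odot> q" using q_L by blast
  have "q \<otimes> a \<otimes> q \<ominus> c \<odot> q = q \<otimes> (a \<ominus> d) \<otimes> q"
    using a dA c by (simp add: A.mult_minus_left A.mult_minus_right A.mult_assoc flip: c)
  then have "cnorm A (q \<otimes> a \<otimes> q \<ominus> c \<odot> q) \<le> cnorm A q * cnorm A (a \<ominus> d) * cnorm A q"
    using A.cnorm_mult[of "q \<otimes> (a \<ominus> d)" q] mult_right_mono[OF A.cnorm_mult[of q "a \<ominus> d"], of "cnorm
      A q"] a dA
    by simp
  also have "\<dots> = ?K * cnorm A (a \<ominus> d)" by simp
  also have "\<dots> \<le> ?K * (\<epsilon> / (?K + 1))" using d by (intro mult_left_mono) simp_all
  also have "\<dots> < \<epsilon>"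
  proof -
    have "0 < ?K + 1" using K by linarith
    then show ?thesis using \<epsilon> by (simp add: pos_divide_less_eq)
  qed
  finally show "\<exists>c. cnorm A (q \<otimes> a \<otimes> q \<ominus> c \<odot> q) < \<epsilon>" by blast
qed

text \<open>Finite sums of range projections of members of \<open>T\<close>. Orthogonality of the
  summands is not recorded: the later norm bound and the reduction to rank one operators work term
  by term.\<close>

inductive_set FS :: "'c set" where
  zero: "\<zero> \<in> FS"
| add: "\<lbrakk>g \<in> FS; (u, t) \<in> T\<rbrakk> \<Longrightarrow> t \<otimes> star A t \<oplus> g \<in> FS"

lemma FS_carrier: "g \<in> FS \<Longrightarrow> g \<in> carrier A"
  by (induction rule: FS.induct) (simp_all add: T_closed)

lemma FS_add: "\<lbrakk>g \<in> FS; h \<in> FS\<rbrakk> \<Longrightarrow> g \<oplus> h \<in> FS"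
proof (induction rule: FS.induct)
  case (add g u t)
  then show ?case using FS.add[of "g \<oplus> h" u t] by (simp add: A.M.a_assoc T_closed FS_carrier)
qed (simp add: FS_carrier)

lemma FS_finsum: "\<lbrakk>finite F; f \<in> F \<rightarrow> FS\<rbrakk> \<Longrightarrow> (\<Oplus>i\<in>F. f i) \<in> FS"
proof (induction F rule: finite_induct)
  case (insert i F)
  have "f \<in> F \<rightarrow> carrier A" "f i \<in> carrier A" using insert.prems FS_carrier by auto
  then show ?case using insert FS_add[of "f i"] by (simp add: Pi_def)
qed (simp add: FS.zero)

text \<open>Conjugation turns the range projection of \<open>t\<close> into that of
  \<open>s e \<otimes> t\<close>, which is zero or again comes from \<open>T\<close>.\<close>

lemma FS_conj:
  assumes e: "e \<in> arcs G"
  shows "g \<in> FS \<Longrightarrow> s e \<otimes> g \<otimes> star A (s e) \<in> FS"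
proof (induction rule: FS.induct)
  case zero
  then show ?case using e by (simp add: FS.zero)
next
  case (add g u t)
  note t = T_closed[OF add.hyps(2)]
  have eq: "s e \<otimes> (t \<otimes> star A t \<oplus> g) \<otimes> star A (s e) =
      (s e \<otimes> t) \<otimes> star A (s e \<otimes> t) \<oplus> s e \<otimes> g \<otimes> star A (s e)"
    using e t FS_carrier[OF add.hyps(1)]
    by (simp add: A.mult_distrib_left A.mult_distrib_right A.star_mult A.mult_assoc)
  from T_s[OF add.hyps(2) e] show ?case
  proof
    assume "s e \<otimes> t = \<zero>"
    then show ?thesis using eq add.IH FS_carrier[OF add.IH] by simp
  next
    assume "(tail G e, s e \<otimes> t) \<in> T"
    from FS.add[OF add.IH this] show ?thesis using eq by simp
  qed
qed

lemma p_along_FS: "p (node (y n)) \<in> FS"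
  using FS.add[OF FS.zero T.base[of n]] b_props[of n] by simp

lemma p_FS_regular:
  assumes v: "regular_vertex G v" and FS: "\<And>e. e \<in> out_arcs G v \<Longrightarrow> p (head G e) \<in> FS"
  shows "p v \<in> FS"
proof -
  have "s e \<otimes> star A (s e) \<in> FS" if e: "e \<in> out_arcs G v" for e
    using FS_conj[of e, OF _ FS[OF e]] e s_p[of e] by simp
  then show ?thesis
    unfolding p_regular[OF v] using v by (intro FS_finsum) (auto simp: regular_vertex_def)
qed

text \<open>A vertex projection outside \<open>FS\<close> would start a boundary path that never meets \<open>y\<close>.\<close>

lemma p_FS:
  assumes v: "v \<in> verts G"
  shows "p v \<in> FS"
proof (rule ccontr)
  assume nv: "p v \<notin> FS"
  define W where "W = {u \<in> verts G. p u \<notin> FS}"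
  have "\<exists>e\<in>out_arcs G u. head G e \<in> W" if "u \<in> W" "regular_vertex G u" for u
  proof (rule ccontr)
    assume "\<not> ?thesis"
    then have "p (head G e) \<in> FS" if "e \<in> out_arcs G u" for e
      using that head_in_verts by (auto simp: W_def)
    then show False using p_FS_regular[OF \<open>regular_vertex G u\<close>] \<open>u \<in> W\<close> by (simp add: W_def)
  qed
  then obtain z where z: "z \<in> boundary_paths" "\<And>n. node (z n) \<in> W"
    using boundary_path_within[of W v] v nv by (auto simp: W_def)
  obtain m n where mn: "shift m z = shift n y" using cofinal[OF z(1)]
    by (auto simp: tail_equivalent_def)
  have "z m = y n" using fun_cong[OF mn, of 0] by simp
  then show False using z(2)[of m] p_along_FS[of n] by (simp add: W_def)
qed

end

section \<open>Approximate units\<close>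

context unbranched_family
begin

definition unit_on :: "'a set \<Rightarrow> 'c" where
  "unit_on F = (\<Oplus>v\<in>F. p v)"

lemma unit_on_simps [simp]:
  assumes F: "finite F" "F \<subseteq> verts G"
  shows "unit_on F \<in> carrier A" "star A (unit_on F) = unit_on F"
proof -
  have p: "p v \<in> carrier A" "star A (p v) = p v" if "v \<in> F" for v
    using F that by auto
  show "unit_on F \<in> carrier A" unfolding unit_on_def using p by (intro A.M.finsum_closed) blast
  show "star A (unit_on F) = unit_on F"
    unfolding unit_on_def using p by (subst A.finsum_star[OF F(1)]) (auto intro!: A.M.finsum_cong')
qed

lemma unit_on_p:
  assumes F: "finite F" "F \<subseteq> verts G" "v \<in> F"
  shows "unit_on F \<otimes> p v = p v"
proof -
  have v: "v \<in> verts G" using F by blast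
  have "unit_on F \<otimes> p v = (\<Oplus>w\<in>F. p w \<otimes> p v)"
    unfolding unit_on_def using F v by (subst A.finsum_mult_right[OF F(1)]) auto
  also have "\<dots> = (\<Oplus>w\<in>F. if v = w then p w else \<zero>)"
    using F v p_orth[of _ v] by (intro A.M.finsum_cong') auto
  also have "\<dots> = p v" using F by (intro A.M.add.finprod_singleton) auto
  finally show ?thesis .
qed

lemma unit_on_mono:
  assumes F: "finite F'" "F' \<subseteq> verts G" "F \<subseteq> F'"
  shows "unit_on F' \<otimes> unit_on F = unit_on F" "unit_on F \<otimes> unit_on F' = unit_on F"
proof -
  have fin: "finite F" "F \<subseteq> verts G" using F finite_subset by auto
  have "unit_on F' \<otimes> (\<Oplus>v\<in>F. p v) = (\<Oplus>v\<in>F. unit_on F' \<otimes> p v)"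
    using F fin by (intro A.finsum_mult_left) auto
  also have "\<dots> = (\<Oplus>v\<in>F. p v)"
    using F fin by (intro A.M.finsum_cong') (auto simp: unit_on_p)
  finally show 1: "unit_on F' \<otimes> unit_on F = unit_on F" by (simp add: unit_on_def)
  show "unit_on F \<otimes> unit_on F' = unit_on F"
    using arg_cong[OF 1, of "star A"] F fin by (simp add: A.star_mult)
qed

lemma unit_on_FS: "\<lbrakk>finite F; F \<subseteq> verts G\<rbrakk> \<Longrightarrow> unit_on F \<in> FS"
  unfolding unit_on_def using p_FS by (intro FS_finsum) auto

lemma cnorm_unit_on:
  assumes F: "finite F" "F \<subseteq> verts G"
  shows "cnorm A (unit_on F) \<le> 1"
proof -
  have "cnorm A (unit_on F) = (cnorm A (unit_on F))\<^sup>2"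
    using A.cstar_identity[of "unit_on F"] unit_on_mono[OF F subset_refl] F by simp
  then have "cnorm A (unit_on F) = 0 \<or> cnorm A (unit_on F) = 1" by (auto simp: power2_eq_square)
  then show ?thesis by auto
qed

text \<open>Elements with a two-sided local unit. They form a star subalgebra containing the
  generators, so local units become an approximate unit by density.\<close>

definition supported :: "'c set" where
  "supported = {d \<in> carrier A. \<exists>F. finite F \<and> F \<subseteq> verts G \<and> unit_on F \<otimes> d = d \<and> d \<otimes> unit_on F = d}"

lemma supported_mono:
  assumes F: "finite F'" "F' \<subseteq> verts G" "F \<subseteq> F'" and d: "d \<in> carrier A" "unit_on F \<otimes> d
    = d" "d \<otimes> unit_on F = d"
  shows "unit_on F' \<otimes> d = d" "d \<otimes> unit_on F' = d"
proof -
  have fin: "finite F" "F \<subseteq> verts G" using F finite_subset by auto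
  have "unit_on F' \<otimes> (unit_on F \<otimes> d) = unit_on F \<otimes> d"
    using unit_on_mono(1)[OF F] F fin d(1) by (simp flip: A.mult_assoc)
  then show "unit_on F' \<otimes> d = d" by (simp only: d)
  have "(d \<otimes> unit_on F) \<otimes> unit_on F' = d \<otimes> unit_on F"
    using unit_on_mono(2)[OF F] F fin d(1) by (simp add: A.mult_assoc)
  then show "d \<otimes> unit_on F' = d" by (simp only: d)
qed

lemma supported_pair:
  assumes "d \<in> supported" "d' \<in> supported"
  shows "\<exists>F. finite F \<and> F \<subseteq> verts G \<and> unit_on F \<otimes> d = d \<and> d \<otimes> unit_on F = d \<and> unit_on F \<otimes> d' = d'
    \<and> d' \<otimes> unit_on F = d'"
proof -
  obtain F where F: "finite F" "F \<subseteq> verts G" "unit_on F \<otimes> d = d" "d \<otimes> unit_on F = d"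
    and d: "d \<in> carrier A"
    using assms by (auto simp: supported_def)
  obtain F' where F': "finite F'" "F' \<subseteq> verts G" "unit_on F' \<otimes> d' = d'" "d' \<otimes> unit_on F' = d'"
    and d': "d' \<in> carrier A"
    using assms by (auto simp: supported_def)
  show ?thesis
    using supported_mono[of "F \<union> F'" F d] supported_mono[of "F \<union> F'" F' d'] F F' d d'
    by (intro exI[of _ "F \<union> F'"]) simp
qed

lemma star_subalgebra_supported: "star_subalgebra A supported"
  unfolding star_subalgebra_def
proof (intro conjI ballI A.submoduleI)
  show "supported \<subseteq> carrier A" by (auto simp: supported_def)
  show "\<zero> \<in> supported" by (auto simp: supported_def intro!: exI[of _ "{}"])
  have smult: "c \<odot> d \<in> supported" if "d \<in> supported" for c d
    using that by (auto simp: supported_def A.smult_mult_left A.smult_mult_right)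
  then show "c \<odot> d \<in> supported" if "d \<in> supported" for c d using that .
  show "\<ominus> d \<in> supported" if "d \<in> supported" for d
    using smult[OF that, of "-1"] that by (simp add: supported_def A.uminus_eq_smult)
  fix d assume d: "d \<in> supported"
  then have dA: "d \<in> carrier A" by (simp add: supported_def)
  obtain F where F: "finite F" "F \<subseteq> verts G" "unit_on F \<otimes> d = d" "d \<otimes> unit_on F = d"
    using d by (auto simp: supported_def)
  have "unit_on F \<otimes> star A d = star A d" "star A d \<otimes> unit_on F = star A d"
    using A.star_mult[of d "unit_on F"] A.star_mult[of "unit_on F" d] F dA by simp_all
  then show "star A d \<in> supported" using F dA by (auto simp: supported_def A.star_closed)
  fix d' assume d': "d' \<in> supported"
  then have d'A: "d' \<in> carrier A" by (simp add: supported_def)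
  obtain E where E: "finite E" "E \<subseteq> verts G" "unit_on E \<otimes> d = d" "d \<otimes> unit_on E = d"
      "unit_on E \<otimes> d' = d'" "d' \<otimes> unit_on E = d'"
    using supported_pair[OF d d'] by blast
  show "d \<oplus> d' \<in> supported"
    unfolding supported_def using E dA d'A
    by (auto intro!: exI[of _ E] simp: A.mult_distrib_left A.mult_distrib_right)
  have "unit_on E \<otimes> (d \<otimes> d') = d \<otimes> d'" "(d \<otimes> d') \<otimes> unit_on E = d \<otimes> d'"
    using E dA d'A A.mult_assoc[of "unit_on E" d d'] A.mult_assoc[of d d' "unit_on E"] by simp_all
  then show "d \<otimes> d' \<in> supported" using E dA d'A by (auto simp: supported_def)
qed

lemma generators_supported: "p ` verts G \<union> s ` arcs G \<subseteq> supported"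
proof -
  have "p v \<in> supported" if v: "v \<in> verts G" for v
    using v by (auto simp: supported_def unit_on_def intro!: exI[of _ "{v}"])
  moreover have "s e \<in> supported" if e: "e \<in> arcs G" for e
  proof -
    let ?F = "{tail G e, head G e}"
    have F: "finite ?F" "?F \<subseteq> verts G" using e by auto
    have t: "unit_on ?F \<otimes> p (tail G e) = p (tail G e)" and h: "unit_on ?F \<otimes> p (head G e) = p (head G e)"
      using F by (intro unit_on_p; simp)+
    have "unit_on ?F \<otimes> s e = (unit_on ?F \<otimes> p (tail G e)) \<otimes> s e"
      using e F p_s[OF e] by (simp add: A.mult_assoc)
    then have 1: "unit_on ?F \<otimes> s e = s e" unfolding t using p_s[OF e] by simp
    have "p (head G e) \<otimes> unit_on ?F = p (head G e)"
      using arg_cong[OF h, of "star A"] F e by (simp add: A.star_mult)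
    then have 2: "s e \<otimes> unit_on ?F = s e"
      using A.mult_assoc[of "s e" "p (head G e)" "unit_on ?F"] s_p[OF e] e F by simp
    show ?thesis
      unfolding supported_def by (intro CollectI conjI exI[of _ ?F] F 1 2 s_closed e)
  qed
  ultimately show ?thesis by blast
qed

text \<open>Each member of \<open>Y\<close> is replaced by a nearby supported element, and one
  \<open>F\<close> serves them all. The error is counted twice, once directly and once after
  multiplication by a projection of norm at most one. Several elements are treated at once because a
  finite net of a compact operator must be nearly fixed.\<close>

lemma approximate_unit:
  assumes Y: "finite Y" "Y \<subseteq> carrier A" and \<epsilon>: "0 < \<epsilon>"
  shows "\<exists>F. finite F \<and> F \<subseteq> verts G \<and> (\<forall>a\<in>Y. cnorm A (a \<ominus> unit_on F \<otimes> a) < \<epsilon>)"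
proof -
  have "\<exists>d F. d \<in> carrier A \<and> finite F \<and> F \<subseteq> verts G \<and> unit_on F \<otimes> d = d \<and> d \<otimes> unit_on F = d
    \<and> cnorm A (a \<ominus> d) < \<epsilon> / 2"
    if "a \<in> Y" for a
  proof -
    have a: "a \<in> carrier A" using Y that by blast
    obtain d where d: "d \<in> supported" "cnorm A (a \<ominus> d) < \<epsilon> / 2"
      using A.generates_dense[OF gen star_subalgebra_supported generators_supported a, of "\<epsilon> / 2"] \<epsilon>
        by auto
    from d(1) obtain F where "d \<in> carrier A" "finite F" "F \<subseteq> verts G" "unit_on F \<otimes> d
      = d" "d \<otimes> unit_on F = d"
      unfolding supported_def by blast
    then show ?thesis using d(2) by blast
  qed
  then obtain d F where dF: "\<And>a. a \<in> Y \<Longrightarrow> d a \<in> carrier A \<and> finite (F a) \<and> F a \<subseteq> verts G \<and>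
      unit_on (F a) \<otimes> d a = d a \<and> d a \<otimes> unit_on (F a) = d a \<and> cnorm A (a \<ominus> d a) < \<epsilon> / 2"
    by metis
  define E where "E = (\<Union>a\<in>Y. F a)"
  have E: "finite E" "E \<subseteq> verts G" using Y dF by (auto simp: E_def)
  have "cnorm A (a \<ominus> unit_on E \<otimes> a) < \<epsilon>" if a: "a \<in> Y" for a
  proof -
    have aA: "a \<in> carrier A" using Y a by blast
    have d: "d a \<in> carrier A" "cnorm A (a \<ominus> d a) < \<epsilon> / 2" using dF[OF a] by auto
    have "F a \<subseteq> E" using a by (auto simp: E_def)
    then have ud: "unit_on E \<otimes> d a = d a" using supported_mono[OF E] dF[OF a] by blast
    have diff: "a \<ominus> d a \<in> carrier A" using aA d by simp
    have "unit_on E \<otimes> (a \<ominus> d a) = unit_on E \<otimes> a \<ominus> d a"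
      using aA d E by (simp add: A.mult_minus_right ud)
    then have "d a \<ominus> unit_on E \<otimes> a = \<ominus> (unit_on E \<otimes> (a \<ominus> d a))"
      using aA d E by (simp add: A.uminus_minus)
    then have "cnorm A (d a \<ominus> unit_on E \<otimes> a) = cnorm A (unit_on E \<otimes> (a \<ominus> d a))"
      using E diff by simp
    also have "\<dots> \<le> cnorm A (unit_on E) * cnorm A (a \<ominus> d a)" using E diff
      by (intro A.cnorm_mult) simp_all
    also have "\<dots> \<le> 1 * cnorm A (a \<ominus> d a)" using cnorm_unit_on[OF E] diff
      by (intro mult_right_mono) simp_all
    finally show ?thesis
      using A.N_minus_triangle[of a "d a" "unit_on E \<otimes> a"] aA d E by simp
  qed
  then show ?thesis using E by blast
qed

lemma approximate_unit_right:
  assumes a: "a \<in> carrier A" and \<epsilon>: "0 < \<epsilon>"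
  shows "\<exists>F. finite F \<and> F \<subseteq> verts G \<and> cnorm A (a \<ominus> a \<otimes> unit_on F) < \<epsilon>"
proof -
  obtain F where F: "finite F" "F \<subseteq> verts G" "cnorm A (star A a \<ominus> unit_on F \<otimes> star A a) < \<epsilon>"
    using approximate_unit[of "{star A a}", OF _ _ \<epsilon>] a by (auto simp: A.star_closed)
  have "star A (a \<ominus> a \<otimes> unit_on F) = star A a \<ominus> unit_on F \<otimes> star A a"
    using a F by (simp add: A.star_minus A.star_mult)
  then have "cnorm A (a \<ominus> a \<otimes> unit_on F) < \<epsilon>"
    using F A.cnorm_star[of "a \<ominus> a \<otimes> unit_on F"] a by simp
  then show ?thesis using F by blast
qed

end

section \<open>The representation by compact operators\<close>

lemma (in hilbert_space) operator_bound_from_ball: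
  assumes T: "bounded_operator H T" and le: "\<And>x. \<lbrakk>x \<in> carrier H; hnorm H x \<le> 1\<rbrakk> \<Longrightarrow> hnorm H (T x) \<le> C"
    and x: "x \<in> carrier H"
  shows "hnorm H (T x) \<le> C * hnorm H x"
proof (cases "x = \<zero>")
  case True
  then show ?thesis using bounded_operatorD(4)[OF T] by simp
next
  case False
  then have pos: "0 < hnorm H x" using x N_eq_0_iff[of x] N_nonneg[of x] by linarith
  let ?y = "complex_of_real (1 / hnorm H x) \<odot> x"
  have y: "?y \<in> carrier H" "hnorm H ?y \<le> 1" using x pos by (simp_all add: norm_divide)
  have "hnorm H (T ?y) = hnorm H (T x) / hnorm H x"
    using bounded_operatorD(1,3)[OF T x] x pos by (simp add: norm_divide)
  then show ?thesis using le[OF y] pos by (simp add: pos_divide_le_eq)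
qed

text \<open>The vector \<xi> is a unit vector in the range of the projection \<open>q\<close>; in
  the application it comes from the basis vector of the path \<open>y\<close>.\<close>

locale minimal_representation = unbranched_family G A p s y + H: hilbert_space H
  for G :: "('a, 'b) pre_digraph" and A :: "'c star_algebra" (structure) and p s y
    and H :: "'h inner_space" +
  fixes \<pi> :: "'c \<Rightarrow> 'h \<Rightarrow> 'h" and \<xi> :: 'h
  assumes irr: "irreducible_representation A H \<pi>"
    and \<xi>: "\<xi> \<in> carrier H" "hnorm H \<xi> = 1"
    and q_\<xi>: "\<pi> q \<xi> = \<xi>"
begin

section \<open>The left ideal generated by the corner as a copy of the Hilbert space\<close>

lemmas hom = star_homD[OF irreducible_representationD(2)[OF irr]]
lemmas op = H.operatorD[OF hom(1)]

lemma hom_apply: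
  assumes "a \<in> carrier A" "c \<in> carrier A" "f \<in> carrier H"
  shows "\<pi> (a \<otimes> c) f = \<pi> a (\<pi> c f)" "\<pi> (a \<oplus> c) f = \<pi> a f \<oplus>\<^bsub>H\<^esub> \<pi> c f"
    and "\<pi> (k \<odot> a) f = k \<odot>\<^bsub>H\<^esub> \<pi> a f" "\<pi> (a \<ominus> c) f = \<pi> a f \<ominus>\<^bsub>H\<^esub> \<pi> c f"
  using assms hom H.operator_minus[OF hom(1) hom(1)]
  by (simp_all add: star_hom_minus[OF irreducible_representationD(2)[OF irr] A.module_axioms
    H.module_operators])

lemma ip_star: "\<lbrakk>a \<in> carrier A; f \<in> carrier H; g \<in> carrier H\<rbrakk> \<Longrightarrow> ip H (\<pi> a f) g
  = ip H f (\<pi> (star A a) g)"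
  using H.ip_adjoint(1)[OF hom(1), of a f g] hom(5)[of a] by simp

text \<open>The left ideal of all elements \<open>a \<otimes> q\<close>, phrased as an equation so
  that limits stay inside.\<close>

definition Aq :: "'c set" where
  "Aq = {x \<in> carrier A. x \<otimes> q = x}"

abbreviation J :: "'c \<Rightarrow> 'h" where "J x \<equiv> \<pi> x \<xi>"

lemma AqD: "x \<in> Aq \<Longrightarrow> x \<in> carrier A" "x \<in> Aq \<Longrightarrow> x \<otimes> q = x"
  by (auto simp: Aq_def)

lemma Aq_mult: "\<lbrakk>a \<in> carrier A; x \<in> Aq\<rbrakk> \<Longrightarrow> a \<otimes> x \<in> Aq"
  by (auto simp: Aq_def A.mult_assoc)

lemma Aq_minus: "\<lbrakk>x \<in> Aq; z \<in> Aq\<rbrakk> \<Longrightarrow> x \<ominus> z \<in> Aq"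
  by (auto simp: Aq_def A.mult_minus_left)

lemma T_Aq: "(u, t) \<in> T \<Longrightarrow> t \<in> Aq"
  using T_props by (auto simp: Aq_def)

lemma J_carrier: "x \<in> Aq \<Longrightarrow> J x \<in> carrier H"
  using op(3)[OF _ \<xi>(1)] AqD by blast

lemma cnorm_q: "cnorm A q = 1"
proof -
  have "cnorm A q = (cnorm A q)\<^sup>2" using A.cstar_identity[of q] by simp
  moreover have "q \<noteq> \<zero>"
  proof
    assume "q = \<zero>"
    then have "\<xi> = \<zero>\<^bsub>H\<^esub>"
      using q_\<xi> \<xi>(1) star_hom_zero[OF irreducible_representationD(2)[OF irr] A.module_axioms
        H.module_operators]
      by simp
    then show False using \<xi>(2) by simp
  qed
  then have "cnorm A q \<noteq> 0" by simp
  ultimately show ?thesis by (simp add: power2_eq_square)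
qed

text \<open>The product is unchanged when compressed by \<open>q\<close> on both sides, so it lies
  in the one-dimensional corner. Letting it act on \<xi> and pairing with \<xi> reads off the
  scalar.\<close>

lemma star_mult_Aq:
  assumes x: "x \<in> Aq" and z: "z \<in> Aq"
  shows "star A z \<otimes> x = ip H (J x) (J z) \<odot> q"
proof -
  note xA = AqD[OF x] and zA = AqD[OF z]
  have star_z: "star A z \<in> carrier A" "q \<otimes> star A z = star A z"
    using zA A.star_mult[of z q] by (simp_all add: A.star_closed)
  have "star A z \<otimes> x = q \<otimes> (star A z \<otimes> x) \<otimes> q"
    using xA star_z by (simp add: A.mult_assoc) (simp flip: A.mult_assoc)
  then obtain c where c: "star A z \<otimes> x = c \<odot> q" using corner[of "star A z \<otimes> x"] xA star_z by auto
  have "ip H (J x) (J z) = ip H (\<pi> (star A z) (J x)) \<xi>"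
    using ip_star[of "star A z" "J x" \<xi>] star_z zA J_carrier[OF x] \<xi> by (simp add: A.star_star)
  also have "\<dots> = ip H (\<pi> (c \<odot> q) \<xi>) \<xi>"
    using star_z xA \<xi> by (simp add: hom_apply flip: c)
  also have "\<dots> = c"
    using \<xi> H.ip_self[OF \<xi>(1)] hom_apply(3)[of q q \<xi> c] q_\<xi> by (simp add: H.ip_smult)
  finally show ?thesis using c by simp
qed

text \<open>By the C*-identity the squared norm of \<open>x\<close> is the norm of a multiple of
  \<open>q\<close>, whose coefficient is the squared length of \<open>J x\<close>.\<close>

lemma hnorm_J:
  assumes x: "x \<in> Aq"
  shows "hnorm H (J x) = cnorm A x"
proof -
  have "(cnorm A x)\<^sup>2 = cnorm A (star A x \<otimes> x)" using A.cstar_identity AqD[OF x] by simp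
  also have "\<dots> = cmod (ip H (J x) (J x))" by (simp add: star_mult_Aq x cnorm_q)
  also have "\<dots> = (hnorm H (J x))\<^sup>2" using H.ip_self[OF J_carrier[OF x]] by (simp add: norm_power)
  finally show ?thesis using AqD[OF x] J_carrier[OF x] by simp
qed

lemma q_Aq: "q \<in> Aq" by (simp add: Aq_def)

lemma J_mult: "\<lbrakk>a \<in> carrier A; x \<in> Aq\<rbrakk> \<Longrightarrow> \<pi> a (J x) = J (a \<otimes> x)"
  using \<xi> AqD by (simp add: hom_apply)

text \<open>\<open>J\<close> is isometric, so preimages of a convergent sequence are Cauchy in the
  complete algebra.\<close>

lemma J_closed_range:
  assumes f: "f \<in> carrier H" and lim: "\<And>\<epsilon>. 0 < \<epsilon> \<Longrightarrow> \<exists>x\<in>Aq. hnorm H (f \<ominus>\<^bsub>H\<^esub> J x) < \<epsilon>"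
  shows "f \<in> J ` Aq"
proof -
  define \<delta> where "\<delta> n = inverse (real (Suc n))" for n
  have \<delta>: "0 < \<delta> n" for n by (simp add: \<delta>_def)
  have "\<exists>x\<in>Aq. hnorm H (f \<ominus>\<^bsub>H\<^esub> J x) < \<delta> n" for n by (rule lim[OF \<delta>])
  then obtain x where x: "\<And>n. x n \<in> Aq" "\<And>n. hnorm H (f \<ominus>\<^bsub>H\<^esub> J (x n)) < \<delta> n" by metis
  note xA = AqD[OF x(1)] and xJ = J_carrier[OF x(1)]
  have dist: "cnorm A (x m \<ominus> x n) \<le> \<delta> m + \<delta> n" for m n
  proof -
    have "cnorm A (x m \<ominus> x n) = hnorm H (J (x m) \<ominus>\<^bsub>H\<^esub> J (x n))"
      using hnorm_J[OF Aq_minus[OF x(1) x(1)], of m n] xA \<xi> by (simp add: hom_apply)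
    also have "\<dots> \<le> hnorm H (J (x m) \<ominus>\<^bsub>H\<^esub> f) + hnorm H (f \<ominus>\<^bsub>H\<^esub> J (x n))"
      using xJ f by (intro H.N_minus_triangle)
    also have "\<dots> \<le> \<delta> m + \<delta> n"
      using x(2)[of m] x(2)[of n] H.N_minus_commute[OF xJ[of m] f] by linarith
    finally show ?thesis .
  qed
  obtain l where l: "l \<in> carrier A"
    and near_l: "\<And>\<epsilon>. 0 < \<epsilon> \<Longrightarrow> \<exists>n. \<delta> n < \<epsilon> \<and> cnorm A (x n \<ominus> l) < \<epsilon>"
    using A.harmonic_Cauchy_convergent[OF A.complete, of x] xA(1) dist unfolding \<delta>_def by blast
  \<comment> \<open>The limit still satisfies \<open>l \<otimes> q = l\<close>, because right
    multiplication by \<open>q\<close> does not increase norms.\<close>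
  have "cnorm A (l \<otimes> q \<ominus> l) \<le> 0 + 2 * \<epsilon>" if \<epsilon>: "0 < \<epsilon>" for \<epsilon>
  proof -
    obtain n where n: "cnorm A (x n \<ominus> l) < \<epsilon>" using near_l[OF \<epsilon>] by blast
    have "x n \<ominus> l \<otimes> q = (x n \<ominus> l) \<otimes> q" using xA l by (simp add: A.mult_minus_left)
    then have "cnorm A (x n \<ominus> l \<otimes> q) \<le> cnorm A (x n \<ominus> l)"
      using A.cnorm_mult[of "x n \<ominus> l" q] xA l by (simp add: cnorm_q)
    then show ?thesis
      using A.N_minus_triangle[of "l \<otimes> q" "x n" l] A.N_minus_commute[of "l \<otimes> q" "x n"] xA l n by simp
  qed
  then have "cnorm A (l \<otimes> q \<ominus> l) \<le> 0" by (rule real_le_epsilonI) simp_all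
  then have lq: "l \<in> Aq" using l by (simp add: Aq_def)
  have "hnorm H (f \<ominus>\<^bsub>H\<^esub> J l) \<le> 0 + 2 * \<epsilon>" if \<epsilon>: "0 < \<epsilon>" for \<epsilon>
  proof -
    obtain n where n: "\<delta> n < \<epsilon>" "cnorm A (x n \<ominus> l) < \<epsilon>" using near_l[OF \<epsilon>] by blast
    have "hnorm H (J (x n) \<ominus>\<^bsub>H\<^esub> J l) = cnorm A (x n \<ominus> l)"
      using hnorm_J[OF Aq_minus[OF x(1) lq], of n] xA l \<xi> by (simp add: hom_apply)
    then show ?thesis
      using H.N_minus_triangle[OF f xJ J_carrier[OF lq], of n] x(2)[of n] n by linarith
  qed
  then have "hnorm H (f \<ominus>\<^bsub>H\<^esub> J l) \<le> 0" by (rule real_le_epsilonI) simp_all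
  then have "f = J l" using f J_carrier[OF lq] by simp
  then show ?thesis using lq by blast
qed

text \<open>The range is a closed invariant subspace that contains the nonzero vector \<xi>, so
  irreducibility makes it everything.\<close>

lemma J_surj: "J ` Aq = carrier H"
proof -
  have "J ` Aq = {\<zero>\<^bsub>H\<^esub>} \<or> J ` Aq = carrier H"
  proof (rule irreducible_representationD(4)[OF irr])
    show "submodule (J ` Aq) complex_field H"
    proof (rule H.submoduleI)
      have "\<zero> \<in> Aq" by (simp add: Aq_def)
      moreover have "J \<zero> = \<zero>\<^bsub>H\<^esub>"
        using \<xi> star_hom_zero[OF irreducible_representationD(2)[OF irr] A.module_axioms
          H.module_operators] by simp
      ultimately show "\<zero>\<^bsub>H\<^esub> \<in> J ` Aq" by (metis imageI)
      have smult: "c \<odot>\<^bsub>H\<^esub> f \<in> J ` Aq" if "f \<in> J ` Aq" for c f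
      proof -
        from that obtain x where x: "x \<in> Aq" "f = J x" by blast
        then have "c \<odot> x \<in> Aq" "c \<odot>\<^bsub>H\<^esub> f = J (c \<odot> x)"
          using AqD[OF x(1)] \<xi> hom_apply(3)[of x x \<xi> c] by (simp_all add: Aq_def A.smult_mult_left)
        then show ?thesis by blast
      qed
      then show "c \<odot>\<^bsub>H\<^esub> f \<in> J ` Aq" if "f \<in> J ` Aq" for c f using that .
      show "\<ominus>\<^bsub>H\<^esub> f \<in> J ` Aq" if "f \<in> J ` Aq" for f
        using smult[OF that, of "-1"] that J_carrier by (auto simp: H.uminus_eq_smult)
      show "f \<oplus>\<^bsub>H\<^esub> g \<in> J ` Aq" if "f \<in> J ` Aq" "g \<in> J ` Aq" for f g
      proof -
        from that obtain x z where x: "x \<in> Aq" "f = J x" and z: "z \<in> Aq" "g = J z" by blast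
        then have "x \<oplus> z \<in> Aq" "f \<oplus>\<^bsub>H\<^esub> g = J (x \<oplus> z)"
          using AqD[OF x(1)] AqD[OF z(1)] \<xi> by (simp_all add: Aq_def A.mult_distrib_right hom_apply)
        then show ?thesis by blast
      qed
    qed (use J_carrier in blast)
    show "closedin (norm_topology H (hnorm H)) (J ` Aq)"
      unfolding H.closedin_norm_topology_iff using J_carrier J_closed_range by blast
    show "\<pi> a f \<in> J ` Aq" if "a \<in> carrier A" "f \<in> J ` Aq" for a f
      using that J_mult Aq_mult by blast
  qed
  moreover have "\<xi> \<in> J ` Aq" using q_Aq q_\<xi> by (metis imageI)
  moreover have "\<xi> \<noteq> \<zero>\<^bsub>H\<^esub>" using \<xi> by auto
  ultimately show ?thesis by auto
qed

section \<open>Norm estimates for the representation\<close>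

lemma obtain_J:
  assumes "f \<in> carrier H"
  obtains x where "x \<in> Aq" "f = J x"
  using J_surj assms by blast

text \<open>Through \<open>J\<close> the representation is left multiplication on \<open>Aq\<close>,
  so submultiplicativity of the norm suffices.\<close>

lemma contractive:
  assumes a: "a \<in> carrier A" and f: "f \<in> carrier H"
  shows "hnorm H (\<pi> a f) \<le> cnorm A a * hnorm H f"
proof -
  obtain x where x: "x \<in> Aq" "f = J x" using obtain_J[OF f] .
  then show ?thesis
    using A.cnorm_mult[OF a AqD(1)[OF x(1)]] by (simp add: J_mult a hnorm_J Aq_mult)
qed

text \<open>A single term \<open>t\<close> with its adjoint, applied to \<open>a\<close>, has norm
  at most that of \<open>t\<close> times that of the adjoint of \<open>a\<close> applied to
  \<open>t\<close>; as \<open>t\<close> lies in \<open>Aq\<close>, this is controlled by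
  \<open>M\<close>. The point is that \<open>C\<close> depends on \<open>g\<close> alone.\<close>

lemma FS_bound:
  "g \<in> FS \<Longrightarrow> \<exists>C. \<forall>a M. a \<in> carrier A \<longrightarrow> 0 \<le> M \<longrightarrow> (\<forall>x\<in>Aq. cnorm A (star A a \<otimes> x) \<le> M * cnorm A x)
    \<longrightarrow> cnorm A (g \<otimes> a) \<le> C * M"
proof (induction rule: FS.induct)
  case zero
  show ?case by (rule exI[of _ 0]) simp
next
  case (add g u t)
  then obtain C where C: "\<And>a M. \<lbrakk>a \<in> carrier A; 0 \<le> M; \<forall>x\<in>Aq. cnorm A (star A a \<otimes> x) \<le> M * cnorm A x\<rbrakk>
    \<Longrightarrow> cnorm A (g \<otimes> a) \<le> C * M" by blast
  note t = T_closed[OF add.hyps(2)] and g = FS_carrier[OF add.hyps(1)]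
  show ?case
  proof (intro exI[of _ "cnorm A t * cnorm A t + C"] allI impI)
    fix a M assume a: "a \<in> carrier A" and M: "0 \<le> M" and le: "\<forall>x\<in>Aq. cnorm A (star A a \<otimes> x)
      \<le> M * cnorm A x"
    have "star A (star A t \<otimes> a) = star A a \<otimes> t" using a t by (simp add: A.star_mult A.star_star)
    then have "cnorm A (star A t \<otimes> a) = cnorm A (star A a \<otimes> t)"
      using A.cnorm_star[of "star A t \<otimes> a"] a t by simp
    then have "cnorm A (star A t \<otimes> a) \<le> M * cnorm A t" using le T_Aq[OF add.hyps(2)] by simp
    then have "cnorm A (t \<otimes> (star A t \<otimes> a)) \<le> cnorm A t * (M * cnorm A t)"
      using A.cnorm_mult[of t "star A t \<otimes> a"] mult_left_mono[of "cnorm A (star A t \<otimes> a)" "M * cnorm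
        A t" "cnorm A t"] a t
      by simp
    moreover have "(t \<otimes> star A t \<oplus> g) \<otimes> a = t \<otimes> (star A t \<otimes> a) \<oplus> g \<otimes> a"
      using a t g by (simp add: A.mult_distrib_right A.mult_assoc)
    ultimately show "cnorm A ((t \<otimes> star A t \<oplus> g) \<otimes> a) \<le> (cnorm A t * cnorm A t + C) * M"
      using A.cnorm_add[of "t \<otimes> (star A t \<otimes> a)" "g \<otimes> a"] C[OF a M le] a t g by (simp add: algebra_simps)
  qed
qed

text \<open>For self-adjoint \<open>a\<close> the norm is \<open>\<parallel>a\<^bsup>2^k\<^esup>\<parallel>\<^bsup>1/2^k\<^esup>\<close>, so that a bound up to a constant suffices.\<close>

lemma self_adjoint_bound:
  assumes a: "a \<in> carrier A" "star A a = a" and g: "g \<in> FS" "g \<otimes> a = a"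
    and M: "0 < M" and le: "\<And>x. x \<in> Aq \<Longrightarrow> cnorm A (a \<otimes> x) \<le> M * cnorm A x"
  shows "cnorm A a \<le> M"
proof (rule ccontr)
  assume "\<not> ?thesis"
  then have gt: "M < cnorm A a" by simp
  \<comment> \<open>Iterated squares. They stay self-adjoint, so the C*-identity squares the norm
    exactly, and \<open>g\<close> still fixes them on the left.\<close>
  define sq where "sq k = ((\<lambda>b. b \<otimes> b) ^^ k) a" for k
  have sq_Suc: "sq (Suc k) = sq k \<otimes> sq k" for k by (simp add: sq_def)
  have sq: "sq k \<in> carrier A \<and> star A (sq k) = sq k \<and> g \<otimes> sq k = sq k \<and> cnorm A (sq k)
    = cnorm A a ^ (2 ^ k) \<and>
    (\<forall>x\<in>Aq. cnorm A (sq k \<otimes> x) \<le> M ^ (2 ^ k) * cnorm A x)" for k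
  proof (induction k)
    case 0
    then show ?case using a g le by (simp add: sq_def)
  next
    case (Suc k)
    have cnorm_sq: "cnorm A (sq k \<otimes> sq k) = (cnorm A (sq k))\<^sup>2"
      using A.cstar_identity[of "sq k"] Suc by simp
    have bound: "cnorm A (sq k \<otimes> sq k \<otimes> x) \<le> M ^ (2 ^ Suc k) * cnorm A x" if x: "x \<in> Aq" for x
    proof -
      have "cnorm A (sq k \<otimes> (sq k \<otimes> x)) \<le> M ^ (2 ^ k) * cnorm A (sq k \<otimes> x)" using Suc Aq_mult x by blast
      also have "\<dots> \<le> M ^ (2 ^ k) * (M ^ (2 ^ k) * cnorm A x)" using Suc x M
        by (intro mult_left_mono) auto
      finally show ?thesis using Suc AqD[OF x] by (simp add: A.mult_assoc power_add mult_2)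
    qed
    have "g \<otimes> (sq k \<otimes> sq k) = sq k \<otimes> sq k"
      using Suc FS_carrier[OF g(1)] A.mult_assoc[of g "sq k" "sq k"] by simp
    then show ?case using Suc bound cnorm_sq
      by (simp add: sq_Suc A.star_mult power_even_eq flip: power_mult)
  qed
  obtain C where C: "\<And>a M. \<lbrakk>a \<in> carrier A; 0 \<le> M; \<forall>x\<in>Aq. cnorm A (star A a \<otimes> x) \<le> M * cnorm A x\<rbrakk>
    \<Longrightarrow> cnorm A (g \<otimes> a) \<le> C * M" using FS_bound[OF g(1)] by blast
  \<comment> \<open>One constant serves every \<open>k\<close>, since the same \<open>g\<close>
    fixes all iterated squares. If the norm of \<open>a\<close> exceeded \<open>M\<close>, powers of
    their ratio \<open>r\<close> would outgrow \<open>C\<close>.\<close>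
  have le: "cnorm A a ^ (2 ^ k) \<le> C * M ^ (2 ^ k)" for k
    using C[of "sq k" "M ^ (2 ^ k)"] sq[of k] M by simp
  define r where "r = cnorm A a / M"
  have r: "1 < r" using gt M by (simp add: r_def)
  obtain n where n: "C < r ^ n" using real_arch_pow[OF r] by blast
  have "r ^ n \<le> r ^ (2 ^ n)" using r by (intro power_increasing) (auto intro: less_imp_le)
  also have "\<dots> \<le> C" using le[of n] M by (simp add: r_def power_divide pos_divide_le_eq)
  finally show False using n by simp
qed

text \<open>For \<open>c\<close> with a right unit from \<open>FS\<close>, the product of its
  adjoint with \<open>c\<close> is self-adjoint and fixed by that unit, so the self-adjoint bound
  applies with \<open>M * M\<close>. The approximate unit reduces the general case to this
  one.\<close>

lemma isometric:
  assumes a: "a \<in> carrier A" and M: "0 \<le> M" and le: "\<And>f. f \<in> carrier H \<Longrightarrow> hnorm H (\<pi> a f)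
    \<le> M * hnorm H f"
  shows "cnorm A a \<le> M"
proof -
  have supp: "cnorm A c \<le> M" if c: "c \<in> carrier A" "c \<otimes> unit_on F = c" and F: "finite F" "F \<subseteq> verts G"
    and M: "0 < M" and le: "\<And>f. f \<in> carrier H \<Longrightarrow> hnorm H (\<pi> c f) \<le> M * hnorm H f" for c F M
  proof -
    have sc: "star A c \<in> carrier A" "unit_on F \<otimes> star A c = star A c"
      using c F A.star_mult[of c "unit_on F"] by (simp_all add: A.star_closed)
    have le_star: "hnorm H (\<pi> (star A c) f) \<le> M * hnorm H f" if f: "f \<in> carrier H" for f
      by (rule H.adjoint_bound[OF op(1)[OF c(1)] less_imp_le[OF M] le op(3)[OF sc(1)] _ f])
        (simp_all add: ip_star c)
    have "cnorm A (star A c \<otimes> c) \<le> M * M"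
    proof (rule self_adjoint_bound)
      show "star A c \<otimes> c \<in> carrier A" "star A (star A c \<otimes> c) = star A c \<otimes> c"
        using c sc by (simp_all add: A.star_mult A.star_star)
      show "unit_on F \<in> FS" by (rule unit_on_FS[OF F])
      show "unit_on F \<otimes> (star A c \<otimes> c) = star A c \<otimes> c"
        using c sc F by (simp flip: A.mult_assoc)
      show "0 < M * M" using M by simp
      fix x assume x: "x \<in> Aq"
      have "cnorm A ((star A c \<otimes> c) \<otimes> x) = hnorm H (J ((star A c \<otimes> c) \<otimes> x))"
        using hnorm_J[OF Aq_mult[OF _ x, of "star A c \<otimes> c"]] c sc by simp
      also have "J ((star A c \<otimes> c) \<otimes> x) = \<pi> (star A c) (\<pi> c (J x))"
        using c sc AqD[OF x] \<xi> op(3) by (simp add: hom_apply)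
      also have "hnorm H \<dots> \<le> M * hnorm H (\<pi> c (J x))" by (rule le_star[OF op(3)[OF c(1) J_carrier[OF
        x]]])
      also have "\<dots> \<le> M * (M * hnorm H (J x))" using le[OF J_carrier[OF x]] M
        by (intro mult_left_mono) auto
      finally show "cnorm A ((star A c \<otimes> c) \<otimes> x) \<le> M * M * cnorm A x"
        by (simp add: hnorm_J x mult.assoc)
    qed
    then have "(cnorm A c)\<^sup>2 \<le> M\<^sup>2" using A.cstar_identity[OF c(1)] by (simp add: power2_eq_square)
    then show ?thesis by (rule power2_le_imp_le) (use M in simp)
  qed
  have "cnorm A a \<le> M + 2 * \<epsilon>" if \<epsilon>: "0 < \<epsilon>" for \<epsilon>
  proof -
    obtain F where F: "finite F" "F \<subseteq> verts G" "cnorm A (a \<ominus> a \<otimes> unit_on F) < \<epsilon>"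
      using approximate_unit_right[OF a \<epsilon>] by blast
    have u: "unit_on F \<in> carrier A" using F by simp
    have "cnorm A (a \<otimes> unit_on F) \<le> M + \<epsilon>"
    proof (rule supp[OF _ _ F(1,2)])
      show "a \<otimes> unit_on F \<in> carrier A" "a \<otimes> unit_on F \<otimes> unit_on F = a \<otimes> unit_on F"
        using a u unit_on_mono[OF F(1,2) subset_refl] by (simp_all add: A.mult_assoc)
      \<comment> \<open>The supported case needs a strictly positive bound, while \<open>M\<close>
        may be zero, as in the proof of injectivity.\<close>
      show "0 < M + \<epsilon>" using M \<epsilon> by linarith
      fix f assume f: "f \<in> carrier H"
      have "hnorm H (\<pi> (a \<otimes> unit_on F) f) \<le> M * hnorm H (\<pi> (unit_on F) f)"
        using le[OF op(3)[OF u f]] a u f by (simp add: hom_apply)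
      also have "\<dots> \<le> M * (1 * hnorm H f)"
        using contractive[OF u f] mult_right_mono[OF cnorm_unit_on[OF F(1,2)], of "hnorm H f"] f M
        by (intro mult_left_mono) auto
      also have "\<dots> \<le> (M + \<epsilon>) * hnorm H f" using f \<epsilon> by (simp add: mult_right_mono)
      finally show "hnorm H (\<pi> (a \<otimes> unit_on F) f) \<le> (M + \<epsilon>) * hnorm H f" .
    qed
    then show ?thesis using A.N_le_add_minus[of a "a \<otimes> unit_on F"] a u F(3) by simp
  qed
  then show ?thesis by (rule real_le_epsilonI) simp_all
qed

end

text \<open>In a complete space relative compactness is total boundedness. The centres of the net
  may lie anywhere in \<open>H\<close>, which makes nets easy to build; moving them into the image
  costs a factor of two.\<close>

lemma (in hilbert_space) compact_operator_iff:
  "compact_operator H T \<longleftrightarrow> linear_map H H T \<and> (\<forall>\<epsilon>>0. \<exists>K. finite K \<and> K \<subseteq> carrier H \<and>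
    (\<forall>x\<in>carrier H. hnorm H x \<le> 1 \<longrightarrow> (\<exists>k\<in>K. hnorm H (T x \<ominus> k) < \<epsilon>)))"
proof (cases "linear_map H H T")
  case True
  define S where "S = T ` {x \<in> carrier H. hnorm H x \<le> 1}"
  have S: "S \<subseteq> carrier H" using linear_mapD(1)[OF True] by (auto simp: S_def)
  have "compact_operator H T \<longleftrightarrow> mtotally_bounded S"
    unfolding compact_operator_def Let_def mtotally_bounded_eq_compact_closure_of[OF complete]
    using True S by (simp add: S_def)
  also have "\<dots> \<longleftrightarrow> (\<forall>\<epsilon>>0. \<exists>K. finite K \<and> K \<subseteq> carrier H \<and> (\<forall>s\<in>S. \<exists>k\<in>K. hnorm H (s \<ominus> k) < \<epsilon>))"
  proof (intro iffI allI impI)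
    fix \<epsilon> :: real assume tb: "mtotally_bounded S" and \<epsilon>: "0 < \<epsilon>"
    from tb[unfolded mtotally_bounded_def, rule_format, OF \<epsilon>]
    obtain K where K: "finite K" "K \<subseteq> S" "S \<subseteq> (\<Union>x\<in>K. mball x \<epsilon>)" by blast
    have "\<exists>k\<in>K. hnorm H (s \<ominus> k) < \<epsilon>" if s: "s \<in> S" for s
    proof -
      from subsetD[OF K(3) s] obtain k where k: "k \<in> K" "s \<in> mball k \<epsilon>" by blast
      have "k \<in> carrier H" "s \<in> carrier H" using k s K(2) S by blast+
      then have "hnorm H (s \<ominus> k) < \<epsilon>" using k(2) N_minus_commute[of s k] by (simp add: in_mball)
      then show ?thesis using k(1) by blast
    qed
    then show "\<exists>K. finite K \<and> K \<subseteq> carrier H \<and> (\<forall>s\<in>S. \<exists>k\<in>K. hnorm H (s \<ominus> k) < \<epsilon>)"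
      using K S by (intro exI[of _ K] conjI ballI) auto
  next
    assume nets: "\<forall>\<epsilon>>0. \<exists>K. finite K \<and> K \<subseteq> carrier H \<and> (\<forall>s\<in>S. \<exists>k\<in>K. hnorm H (s \<ominus> k) < \<epsilon>)"
    show "mtotally_bounded S"
      unfolding mtotally_bounded_def
    proof (intro allI impI)
      fix \<epsilon> :: real assume "0 < \<epsilon>"
      then have "0 < \<epsilon> / 2" by simp
      from nets[rule_format, OF this]
      obtain K where K: "finite K" "K \<subseteq> carrier H" "\<And>s. s \<in> S \<Longrightarrow> \<exists>k\<in>K. hnorm H (s \<ominus> k) < \<epsilon> / 2"
        by blast
      \<comment> \<open>The centres that are actually close to a point of \<open>S\<close>; each is
        replaced by such a point.\<close>
      define K1 where "K1 = {k \<in> K. \<exists>s\<in>S. hnorm H (s \<ominus> k) < \<epsilon> / 2}"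
      have "\<exists>s\<in>S. hnorm H (s \<ominus> k) < \<epsilon> / 2" if "k \<in> K1" for k using that by (simp add: K1_def)
      then obtain c where c: "\<And>k. k \<in> K1 \<Longrightarrow> c k \<in> S" "\<And>k. k \<in> K1 \<Longrightarrow> hnorm H (c k \<ominus> k) < \<epsilon> / 2" by metis
      have cover: "S \<subseteq> (\<Union>x\<in>c ` K1. mball x \<epsilon>)"
      proof
        fix s assume s: "s \<in> S"
        obtain k where k: "k \<in> K" "hnorm H (s \<ominus> k) < \<epsilon> / 2" using K(3)[OF s] by blast
        then have k1: "k \<in> K1" using s by (auto simp: K1_def)
        have mem: "s \<in> carrier H" "k \<in> carrier H" "c k \<in> carrier H" using s k c(1)[OF k1] K S by auto
        have "hnorm H (c k \<ominus> s) < \<epsilon>"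
          using N_minus_triangle[of "c k" k s] N_minus_commute[of k s] mem k(2) c(2)[OF k1] by simp
        then have "s \<in> mball (c k) \<epsilon>" using mem by (simp add: in_mball)
        then show "s \<in> (\<Union>x\<in>c ` K1. mball x \<epsilon>)" using k1 by blast
      qed
      have fin: "finite (c ` K1)" using K(1) by (simp add: K1_def)
      have sub: "c ` K1 \<subseteq> S" using c(1) by blast
      show "\<exists>K. finite K \<and> K \<subseteq> S \<and> S \<subseteq> (\<Union>x\<in>K. mball x \<epsilon>)"
        by (intro exI[of _ "c ` K1"] conjI fin sub cover)
    qed
  qed
  finally have "compact_operator H T \<longleftrightarrow>
      (\<forall>\<epsilon>>0. \<exists>K. finite K \<and> K \<subseteq> carrier H \<and> (\<forall>s\<in>S. \<exists>k\<in>K. hnorm H (s \<ominus> k) < \<epsilon>))" .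
  moreover have "(\<forall>s\<in>S. Q s) \<longleftrightarrow> (\<forall>x\<in>carrier H. hnorm H x \<le> 1 \<longrightarrow> Q (T x))" for Q
    by (auto simp: S_def)
  ultimately show ?thesis using True by simp
qed (simp add: compact_operator_def)

context minimal_representation
begin

text \<open>Compactness of the image phrased through finite nets, so that sums, left multiples and
  norm limits are plain estimates.\<close>

definition cpt :: "'c set" where
  "cpt = {a \<in> carrier A. \<forall>\<epsilon>>0. \<exists>K. finite K \<and> K \<subseteq> carrier H \<and>
    (\<forall>f\<in>carrier H. hnorm H f \<le> 1 \<longrightarrow> (\<exists>k\<in>K. hnorm H (\<pi> a f \<ominus>\<^bsub>H\<^esub> k) < \<epsilon>))}"

lemma cptD:
  assumes "a \<in> cpt" "0 < \<epsilon>"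
  obtains K where "finite K" "K \<subseteq> carrier H"
    "\<And>f. \<lbrakk>f \<in> carrier H; hnorm H f \<le> 1\<rbrakk> \<Longrightarrow> \<exists>k\<in>K. hnorm H (\<pi> a f \<ominus>\<^bsub>H\<^esub> k) < \<epsilon>"
proof -
  have "\<exists>K. finite K \<and> K \<subseteq> carrier H \<and>
    (\<forall>f\<in>carrier H. hnorm H f \<le> 1 \<longrightarrow> (\<exists>k\<in>K. hnorm H (\<pi> a f \<ominus>\<^bsub>H\<^esub> k) < \<epsilon>))"
    using assms by (simp add: cpt_def)
  then show ?thesis by (elim exE conjE) (rule that, auto)
qed

lemma cptI:
  assumes "a \<in> carrier A" "\<And>\<epsilon>. 0 < \<epsilon> \<Longrightarrow> \<exists>K. finite K \<and> K \<subseteq> carrier H \<and>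
    (\<forall>f\<in>carrier H. hnorm H f \<le> 1 \<longrightarrow> (\<exists>k\<in>K. hnorm H (\<pi> a f \<ominus>\<^bsub>H\<^esub> k) < \<epsilon>))"
  shows "a \<in> cpt"
  using assms by (simp add: cpt_def)

lemma cpt_carrier: "a \<in> cpt \<Longrightarrow> a \<in> carrier A"
  by (simp add: cpt_def)

lemma cpt_add:
  assumes a: "a \<in> cpt" and c: "c \<in> cpt"
  shows "a \<oplus> c \<in> cpt"
proof (rule cptI)
  note mem = cpt_carrier[OF a] cpt_carrier[OF c]
  show "a \<oplus> c \<in> carrier A" using mem by simp
  fix \<epsilon> :: real assume "0 < \<epsilon>"
  then have \<epsilon>: "0 < \<epsilon> / 2" by simp
  obtain K where K: "finite K" "K \<subseteq> carrier H"
    "\<And>f. \<lbrakk>f \<in> carrier H; hnorm H f \<le> 1\<rbrakk> \<Longrightarrow> \<exists>k\<in>K. hnorm H (\<pi> a f \<ominus>\<^bsub>H\<^esub> k) < \<epsilon> / 2"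
      by (rule cptD[OF a \<epsilon>]) (rule that)
  obtain K' where K': "finite K'" "K' \<subseteq> carrier H"
    "\<And>f. \<lbrakk>f \<in> carrier H; hnorm H f \<le> 1\<rbrakk> \<Longrightarrow> \<exists>k\<in>K'. hnorm H (\<pi> c f \<ominus>\<^bsub>H\<^esub> k) < \<epsilon> / 2"
      by (rule cptD[OF c \<epsilon>]) (rule that)
  let ?K = "(\<lambda>(k, k'). k \<oplus>\<^bsub>H\<^esub> k') ` (K \<times> K')"
  have "\<exists>k\<in>?K. hnorm H (\<pi> (a \<oplus> c) f \<ominus>\<^bsub>H\<^esub> k) < \<epsilon>" if f: "f \<in> carrier H" "hnorm H f \<le> 1" for f
  proof -
    obtain k where k: "k \<in> K" "hnorm H (\<pi> a f \<ominus>\<^bsub>H\<^esub> k) < \<epsilon> / 2" using K(3)[OF f] by blast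
    obtain k' where k': "k' \<in> K'" "hnorm H (\<pi> c f \<ominus>\<^bsub>H\<^esub> k') < \<epsilon> / 2" using K'(3)[OF f] by blast
    have kk: "k \<in> carrier H" "k' \<in> carrier H" "\<pi> a f \<in> carrier H" "\<pi> c f \<in> carrier H"
      using k k' K K' op(3) mem f by auto
    have "hnorm H (\<pi> (a \<oplus> c) f \<ominus>\<^bsub>H\<^esub> (k \<oplus>\<^bsub>H\<^esub> k')) < \<epsilon>"
      using H.N_add[of "\<pi> a f \<ominus>\<^bsub>H\<^esub> k" "\<pi> c f \<ominus>\<^bsub>H\<^esub> k'"] kk k(2) k'(2) mem f
      by (simp add: hom_apply H.minus_add_add)
    then show ?thesis using k(1) k'(1) by force
  qed
  moreover have "finite ?K" "?K \<subseteq> carrier H" using K K' by auto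
  ultimately show "\<exists>K. finite K \<and> K \<subseteq> carrier H \<and>
    (\<forall>f\<in>carrier H. hnorm H f \<le> 1 \<longrightarrow> (\<exists>k\<in>K. hnorm H (\<pi> (a \<oplus> c) f \<ominus>\<^bsub>H\<^esub> k) < \<epsilon>))"
      by (intro exI[of _ ?K]) blast
qed

lemma cpt_mult:
  assumes a: "a \<in> cpt" and c: "c \<in> carrier A"
  shows "c \<otimes> a \<in> cpt"
proof (rule cptI)
  note mem = cpt_carrier[OF a]
  show "c \<otimes> a \<in> carrier A" using mem c by simp
  fix \<epsilon> :: real assume \<epsilon>: "0 < \<epsilon>"
  have pos: "0 < cnorm A c + 1" using c by (simp add: add_nonneg_pos)
  then have \<epsilon>': "0 < \<epsilon> / (cnorm A c + 1)" using \<epsilon> by simp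
  obtain K where K: "finite K" "K \<subseteq> carrier H"
    "\<And>f. \<lbrakk>f \<in> carrier H; hnorm H f \<le> 1\<rbrakk> \<Longrightarrow> \<exists>k\<in>K. hnorm H (\<pi> a f \<ominus>\<^bsub>H\<^esub> k) < \<epsilon> / (cnorm A c + 1)"
    by (rule cptD[OF a \<epsilon>']) (rule that)
  have "\<exists>k\<in>\<pi> c ` K. hnorm H (\<pi> (c \<otimes> a) f \<ominus>\<^bsub>H\<^esub> k) < \<epsilon>" if f: "f \<in> carrier H" "hnorm H f \<le> 1" for f
  proof -
    obtain k where k: "k \<in> K" "hnorm H (\<pi> a f \<ominus>\<^bsub>H\<^esub> k) < \<epsilon> / (cnorm A c + 1)" using K(3)[OF f] by blast
    have kk: "k \<in> carrier H" "\<pi> a f \<in> carrier H" using k K op(3)[OF mem f(1)] by auto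
    have "hnorm H (\<pi> (c \<otimes> a) f \<ominus>\<^bsub>H\<^esub> \<pi> c k) = hnorm H (\<pi> c (\<pi> a f \<ominus>\<^bsub>H\<^esub> k))"
      using kk mem c f by (simp add: hom_apply op(7))
    also have "\<dots> \<le> cnorm A c * hnorm H (\<pi> a f \<ominus>\<^bsub>H\<^esub> k)" using kk by (intro contractive[OF c]) simp
    also have "\<dots> \<le> (cnorm A c + 1) * hnorm H (\<pi> a f \<ominus>\<^bsub>H\<^esub> k)" using kk
      by (intro mult_right_mono) simp_all
    also have "\<dots> < \<epsilon>" using k(2) pos by (simp add: pos_less_divide_eq mult.commute)
    finally show ?thesis using k(1) by blast
  qed
  moreover have "finite (\<pi> c ` K)" "\<pi> c ` K \<subseteq> carrier H" using K op(3)[OF c] by auto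
  ultimately show "\<exists>K. finite K \<and> K \<subseteq> carrier H \<and>
    (\<forall>f\<in>carrier H. hnorm H f \<le> 1 \<longrightarrow> (\<exists>k\<in>K. hnorm H (\<pi> (c \<otimes> a) f \<ominus>\<^bsub>H\<^esub> k) < \<epsilon>))"
      by (intro exI[of _ "\<pi> c ` K"]) blast
qed

lemma cpt_limit:
  assumes a: "a \<in> carrier A" and lim: "\<And>\<epsilon>. 0 < \<epsilon> \<Longrightarrow> \<exists>c\<in>cpt. cnorm A (a \<ominus> c) < \<epsilon>"
  shows "a \<in> cpt"
proof (rule cptI[OF a])
  fix \<epsilon> :: real assume "0 < \<epsilon>"
  then have \<epsilon>: "0 < \<epsilon> / 2" by simp
  obtain c where c: "c \<in> cpt" "cnorm A (a \<ominus> c) < \<epsilon> / 2" using lim[OF \<epsilon>] by blast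
  note mem = cpt_carrier[OF c(1)]
  obtain K where K: "finite K" "K \<subseteq> carrier H"
    "\<And>f. \<lbrakk>f \<in> carrier H; hnorm H f \<le> 1\<rbrakk> \<Longrightarrow> \<exists>k\<in>K. hnorm H (\<pi> c f \<ominus>\<^bsub>H\<^esub> k) < \<epsilon> / 2"
      by (rule cptD[OF c(1) \<epsilon>]) (rule that)
  have "\<exists>k\<in>K. hnorm H (\<pi> a f \<ominus>\<^bsub>H\<^esub> k) < \<epsilon>" if f: "f \<in> carrier H" "hnorm H f \<le> 1" for f
  proof -
    obtain k where k: "k \<in> K" "hnorm H (\<pi> c f \<ominus>\<^bsub>H\<^esub> k) < \<epsilon> / 2" using K(3)[OF f] by blast
    have kk: "k \<in> carrier H" "\<pi> a f \<in> carrier H" "\<pi> c f \<in> carrier H" using k K op(3) mem a f by auto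
    have "hnorm H (\<pi> a f \<ominus>\<^bsub>H\<^esub> \<pi> c f) \<le> cnorm A (a \<ominus> c) * hnorm H f"
      using contractive[of "a \<ominus> c" f] a mem f by (simp add: hom_apply)
    also have "\<dots> \<le> cnorm A (a \<ominus> c) * 1" using a mem f by (intro mult_left_mono) simp_all
    finally have "hnorm H (\<pi> a f \<ominus>\<^bsub>H\<^esub> k) < \<epsilon>"
      using H.N_minus_triangle[of "\<pi> a f" "\<pi> c f" k] kk k(2) c(2) by simp
    then show ?thesis using k(1) by blast
  qed
  then show "\<exists>K. finite K \<and> K \<subseteq> carrier H \<and>
    (\<forall>f\<in>carrier H. hnorm H f \<le> 1 \<longrightarrow> (\<exists>k\<in>K. hnorm H (\<pi> a f \<ominus>\<^bsub>H\<^esub> k) < \<epsilon>))" using K(1,2)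
      by (intro exI[of _ K]) blast
qed

text \<open>Writing \<open>f\<close> as \<open>J x\<close>, the product of the adjoint of
  \<open>z\<close> with \<open>x\<close> is a scalar multiple of \<open>q\<close>, and the scalar is
  the inner product.\<close>

lemma hom_rank_one:
  assumes t: "t \<in> Aq" and z: "z \<in> Aq" and f: "f \<in> carrier H"
  shows "\<pi> (t \<otimes> star A z) f = ip H f (J z) \<odot>\<^bsub>H\<^esub> J t"
proof -
  obtain x where x: "x \<in> Aq" "f = J x" using obtain_J[OF f] .
  note tA = AqD[OF t] and zA = AqD[OF z] and xA = AqD[OF x(1)]
  have "\<pi> (t \<otimes> star A z) f = J (t \<otimes> (star A z \<otimes> x))"
    using x tA zA xA by (simp add: J_mult A.mult_assoc A.star_closed)
  also have "t \<otimes> (star A z \<otimes> x) = ip H f (J z) \<odot> t"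
    using tA x by (simp add: star_mult_Aq[OF x(1) z] A.smult_mult_right)
  also have "J \<dots> = ip H f (J z) \<odot>\<^bsub>H\<^esub> J t" using hom_apply(3)[of t t \<xi>] tA \<xi> by simp
  finally show ?thesis .
qed

text \<open>The image of the unit ball consists of multiples of \<open>J t\<close> with coefficients
  in a compact disc, so a finite net of the disc suffices.\<close>

lemma cpt_rank_one:
  assumes t: "t \<in> Aq"
  shows "t \<otimes> star A t \<in> cpt"
proof (rule cptI)
  note tA = AqD[OF t] and tJ = J_carrier[OF t]
  show "t \<otimes> star A t \<in> carrier A" using tA by (simp add: A.star_closed)
  fix \<epsilon> :: real assume \<epsilon>: "0 < \<epsilon>"
  define r where "r = hnorm H (J t)"
  have r: "0 \<le> r" using tJ by (simp add: r_def)
  define e where "e = \<epsilon> / (r + 1)"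
  have e: "0 < e" using \<epsilon> r by (simp add: e_def)
  have "compact (cball (0::complex) r)" by (rule compact_cball)
  then obtain K where K: "finite K" "cball (0::complex) r \<subseteq> (\<Union>x\<in>K. ball x e)"
    using e unfolding compact_eq_totally_bounded by blast
  let ?K = "(\<lambda>c. c \<odot>\<^bsub>H\<^esub> J t) ` K"
  have "\<exists>k\<in>?K. hnorm H (\<pi> (t \<otimes> star A t) f \<ominus>\<^bsub>H\<^esub> k) < \<epsilon>" if f: "f \<in> carrier H" "hnorm H f \<le> 1" for f
  proof -
    let ?c = "ip H f (J t)"
    have "cmod ?c \<le> hnorm H f * r" unfolding r_def by (rule H.Cauchy_Schwarz[OF f(1) tJ])
    also have "\<dots> \<le> 1 * r" using f r by (intro mult_right_mono)
    finally have "?c \<in> cball 0 r" by (simp add: dist_norm)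
    then obtain d where d: "d \<in> K" "cmod (d - ?c) < e" using K(2) by (auto simp: dist_norm)
    have "?c \<odot>\<^bsub>H\<^esub> J t \<ominus>\<^bsub>H\<^esub> d \<odot>\<^bsub>H\<^esub> J t = (?c - d) \<odot>\<^bsub>H\<^esub> J t"
      using tJ H.smult_l_distr[of ?c "-d" "J t"] H.smult_l_minus[of d "J t"]
      by (simp add: H.minus_eq complex_field_uminus)
    then have "hnorm H (\<pi> (t \<otimes> star A t) f \<ominus>\<^bsub>H\<^esub> d \<odot>\<^bsub>H\<^esub> J t) = cmod (d - ?c) * r"
      using tJ by (simp add: hom_rank_one t f r_def norm_minus_commute)
    also have "\<dots> \<le> cmod (d - ?c) * (r + 1)" by (intro mult_left_mono) simp_all
    also have "\<dots> < \<epsilon>" using d(2) r by (simp add: e_def pos_less_divide_eq add_nonneg_pos)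
    finally show ?thesis using d(1) by blast
  qed
  moreover have "finite ?K" "?K \<subseteq> carrier H" using K tJ by auto
  ultimately show "\<exists>K. finite K \<and> K \<subseteq> carrier H \<and>
    (\<forall>f\<in>carrier H. hnorm H f \<le> 1 \<longrightarrow> (\<exists>k\<in>K. hnorm H (\<pi> (t \<otimes> star A t) f \<ominus>\<^bsub>H\<^esub> k) < \<epsilon>))"
      by (intro exI[of _ ?K]) blast
qed

lemma cpt_FS: "g \<in> FS \<Longrightarrow> g \<in> cpt"
proof (induction rule: FS.induct)
  case zero
  have "\<pi> \<zero> f = \<zero>\<^bsub>H\<^esub>" if "f \<in> carrier H" for f
    using that star_hom_zero[OF irreducible_representationD(2)[OF irr] A.module_axioms
      H.module_operators] by simp
  then show ?case by (intro cptI) (auto intro!: exI[of _ "{\<zero>\<^bsub>H\<^esub>}"])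
next
  case (add g u t)
  then show ?case using cpt_add cpt_rank_one T_Aq by blast
qed

text \<open>Each \<open>a\<close> is a limit of left multiples of local units, and local units are
  finite sums of rank one projections.\<close>

lemma all_cpt: "a \<in> carrier A \<Longrightarrow> a \<in> cpt"
proof (rule cpt_limit)
  fix \<epsilon> :: real assume a: "a \<in> carrier A" and \<epsilon>: "0 < \<epsilon>"
  obtain F where "finite F" "F \<subseteq> verts G" "cnorm A (a \<ominus> a \<otimes> unit_on F) < \<epsilon>"
    using approximate_unit_right[OF a \<epsilon>] by blast
  then show "\<exists>c\<in>cpt. cnorm A (a \<ominus> c) < \<epsilon>"
    using cpt_mult[OF cpt_FS[OF unit_on_FS] a] by blast
qed

lemma hom_compact:
  assumes a: "a \<in> carrier A"
  shows "\<pi> a \<in> carrier (compact_operators H)"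
proof -
  have "linear_map H H (\<pi> a)" using op(1)[OF a] by (simp add: bounded_operator_def)
  then show ?thesis
    using all_cpt[OF a] op(2)[OF a] by (simp add: compact_operators_def H.compact_operator_iff cpt_def)
qed

text \<open>A rank one operator followed after any bounded \<open>X\<close> is again rank one:
  \<open>X\<close> is absorbed by its adjoint into the second vector, and that vector equals
  \<open>J z\<close> for some \<open>z\<close>. Hence the range of the representation contains the
  composition of a local unit with any bounded operator.\<close>

lemma FS_mult_operator:
  assumes T: "X \<in> carrier H.B"
  shows "g \<in> FS \<Longrightarrow> \<exists>a\<in>carrier A. \<forall>f\<in>carrier H. \<pi> g (X f) = \<pi> a f"
proof (induction rule: FS.induct)
  case zero
  have "\<pi> \<zero> f = \<zero>\<^bsub>H\<^esub>" if "f \<in> carrier H" for f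
    using that star_hom_zero[OF irreducible_representationD(2)[OF irr] A.module_axioms
      H.module_operators] by simp
  then show ?case using H.operatorD(3)[OF T] by (intro bexI[of _ \<zero>]) simp_all
next
  case (add g u t)
  note t = T_Aq[OF add.hyps(2)] and gA = FS_carrier[OF add.hyps(1)]
  note tA = AqD(1)[OF t] and Xc = H.operatorD(3)[OF T]
  obtain a where a: "a \<in> carrier A" "\<And>f. f \<in> carrier H \<Longrightarrow> \<pi> g (X f) = \<pi> a f" using add.IH by blast
  have "adjoint_op H X (J t) \<in> carrier H"
    using H.operatorD(3)[OF H.operator_star[OF T] J_carrier[OF t]] .
  then obtain z where z: "z \<in> Aq" "adjoint_op H X (J t) = J z" using obtain_J by blast
  note zA = AqD(1)[OF z(1)]
  have "\<pi> (t \<otimes> star A t \<oplus> g) (X f) = \<pi> (t \<otimes> star A z \<oplus> a) f" if f: "f \<in> carrier H" for f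
  proof -
    have "\<pi> (t \<otimes> star A t) (X f) = ip H (X f) (J t) \<odot>\<^bsub>H\<^esub> J t" using hom_rank_one[OF t t Xc[OF f]] .
    also have "ip H (X f) (J t) = ip H f (J z)"
      using H.ip_adjoint(1)[OF T f J_carrier[OF t]] z(2) by simp
    also have "ip H f (J z) \<odot>\<^bsub>H\<^esub> J t = \<pi> (t \<otimes> star A z) f" using hom_rank_one[OF t z(1) f] by simp
    finally show ?thesis
      using a f tA zA gA Xc[OF f] by (simp add: hom_apply A.star_closed)
  qed
  then show ?case using a(1) tA zA by (intro bexI[of _ "t \<otimes> star A z \<oplus> a"]) (simp_all add:
    A.star_closed)
qed

lemma compact_bounded:
  assumes "X \<in> carrier (compact_operators H)"
  shows "X \<in> carrier H.B"
proof (rule H.operatorI)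
  have X: "X \<in> extensional (carrier H)" "compact_operator H X"
    using assms by (auto simp: compact_operators_def)
  show "X \<in> extensional (carrier H)" by (rule X(1))
  have lin: "linear_map H H X" using X(2) by (simp add: compact_operator_def)
  obtain K where K: "finite K" "K \<subseteq> carrier H"
    "\<And>f. \<lbrakk>f \<in> carrier H; hnorm H f \<le> 1\<rbrakk> \<Longrightarrow> \<exists>k\<in>K. hnorm H (X f \<ominus>\<^bsub>H\<^esub> k) < 1"
    using X(2) unfolding H.compact_operator_iff by (metis zero_less_one)
  \<comment> \<open>The image of the unit ball lies within distance 1 of the finite set
    \<open>K\<close>.\<close>
  define C where "C = 1 + (\<Sum>k\<in>K. hnorm H k)"
  have C: "hnorm H (X f) \<le> C" if f: "f \<in> carrier H" "hnorm H f \<le> 1" for f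
  proof -
    obtain k where k: "k \<in> K" "hnorm H (X f \<ominus>\<^bsub>H\<^esub> k) < 1" using K(3)[OF f] by blast
    have "hnorm H k \<le> (\<Sum>k\<in>K. hnorm H k)" using K k by (intro member_le_sum) auto
    then show ?thesis
      using H.N_le_add_minus[of "X f" k] linear_mapD(1)[OF lin f(1)] k K(2) unfolding C_def by fastforce
  qed
  have "hnorm H (X f) \<le> C * hnorm H f" if f: "f \<in> carrier H" for f
  proof (cases "f = \<zero>\<^bsub>H\<^esub>")
    case True
    then show ?thesis using linear_map_zero[OF H.module_axioms H.module_axioms lin] by simp
  next
    case False
    then have pos: "0 < hnorm H f" using f H.N_eq_0_iff[of f] H.N_nonneg[of f] by linarith
    let ?y = "complex_of_real (1 / hnorm H f) \<odot>\<^bsub>H\<^esub> f"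
    have y: "?y \<in> carrier H" "hnorm H ?y \<le> 1" using f pos by (simp_all add: norm_divide)
    have "hnorm H (X ?y) = hnorm H (X f) / hnorm H f"
      using linear_mapD(1,3)[OF lin f] f pos by (simp add: norm_divide)
    then show ?thesis using C[OF y] pos by (simp add: pos_divide_le_eq)
  qed
  then show "bounded_operator H X" using lin by (auto simp: bounded_operator_def)
qed

text \<open>A finite net of the image of the unit ball is pulled back to \<open>Aq\<close>, and a
  local unit is chosen that nearly fixes it. Then \<open>X\<close> is close to the local unit
  composed with \<open>X\<close>, which lies in the range. The three errors are: to the net, moving
  the net point, and back.\<close>

lemma compact_approx:
  assumes X: "X \<in> carrier (compact_operators H)" and \<epsilon>: "0 < \<epsilon>"
  shows "\<exists>a\<in>carrier A. \<forall>f\<in>carrier H. hnorm H (X f \<ominus>\<^bsub>H\<^esub> \<pi> a f) \<le> 3 * \<epsilon> * hnorm H f"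
proof -
  have XB: "X \<in> carrier H.B" by (rule compact_bounded[OF X])
  note Xc = H.operatorD(3)[OF XB]
  have "compact_operator H X" using X by (simp add: compact_operators_def)
  then obtain K where K: "finite K" "K \<subseteq> carrier H"
    "\<And>f. \<lbrakk>f \<in> carrier H; hnorm H f \<le> 1\<rbrakk> \<Longrightarrow> \<exists>k\<in>K. hnorm H (X f \<ominus>\<^bsub>H\<^esub> k) < \<epsilon>"
    using \<epsilon> unfolding H.compact_operator_iff by metis
  have "\<exists>x. x \<in> Aq \<and> k = J x" if "k \<in> K" for k using obtain_J[of k] K(2) that by blast
  then obtain x where x: "\<And>k. k \<in> K \<Longrightarrow> x k \<in> Aq \<and> k = J (x k)" by metis
  have xK: "finite (x ` K)" "x ` K \<subseteq> carrier A" using K x AqD by auto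
  obtain F where F: "finite F" "F \<subseteq> verts G" "\<forall>a\<in>x ` K. cnorm A (a \<ominus> unit_on F \<otimes> a) < \<epsilon>"
    using approximate_unit[OF xK \<epsilon>] by metis
  have u: "unit_on F \<in> carrier A" using F by simp
  obtain a where a: "a \<in> carrier A" "\<And>f. f \<in> carrier H \<Longrightarrow> \<pi> (unit_on F) (X f) = \<pi> a f"
    using FS_mult_operator[OF XB unit_on_FS[OF F(1,2)]] by blast
  have ball: "hnorm H ((X \<ominus>\<^bsub>H.B\<^esub> \<pi> a) f) \<le> 3 * \<epsilon>" if f: "f \<in> carrier H" "hnorm H f \<le> 1" for f
  proof -
    obtain k where k: "k \<in> K" "hnorm H (X f \<ominus>\<^bsub>H\<^esub> k) < \<epsilon>" using K(3)[OF f] by blast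
    have xk: "x k \<in> Aq" "k = J (x k)" using x[OF k(1)] by auto
    have kc: "k \<in> carrier H" using K k by blast
    let ?u = "\<pi> (unit_on F)"
    have uk: "?u k \<in> carrier H" "?u (X f) \<in> carrier H" using op(3)[OF u] kc Xc f by auto
    have "k \<ominus>\<^bsub>H\<^esub> ?u k = J (x k \<ominus> unit_on F \<otimes> x k)"
      using J_mult[OF u xk(1)] xk AqD[OF xk(1)] u \<xi> hom_apply(4)[of "x k" "unit_on F \<otimes> x k" \<xi>] by simp
    then have "hnorm H (k \<ominus>\<^bsub>H\<^esub> ?u k) = cnorm A (x k \<ominus> unit_on F \<otimes> x k)"
      using hnorm_J[OF Aq_minus[OF xk(1) Aq_mult[OF u xk(1)]]] by simp
    then have 1: "hnorm H (k \<ominus>\<^bsub>H\<^esub> ?u k) < \<epsilon>" using F(3) k(1) by simp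
    have "hnorm H (?u k \<ominus>\<^bsub>H\<^esub> ?u (X f)) = hnorm H (?u (k \<ominus>\<^bsub>H\<^esub> X f))"
      using op(7)[OF u kc Xc[OF f(1)]] by simp
    also have "\<dots> \<le> cnorm A (unit_on F) * hnorm H (k \<ominus>\<^bsub>H\<^esub> X f)" using kc Xc f
      by (intro contractive[OF u]) simp
    also have "\<dots> \<le> 1 * hnorm H (k \<ominus>\<^bsub>H\<^esub> X f)"
      using cnorm_unit_on[OF F(1,2)] kc Xc f by (intro mult_right_mono) simp_all
    also have "\<dots> < \<epsilon>" using k(2) H.N_minus_commute[OF kc Xc[OF f(1)]] by simp
    finally have 2: "hnorm H (?u k \<ominus>\<^bsub>H\<^esub> ?u (X f)) < \<epsilon>" .
    have "hnorm H (X f \<ominus>\<^bsub>H\<^esub> ?u (X f)) \<le> hnorm H (X f \<ominus>\<^bsub>H\<^esub> k) + (hnorm H (k \<ominus>\<^bsub>H\<^esub> ?u k) + hnorm H (?u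
      k \<ominus>\<^bsub>H\<^esub> ?u (X f)))"
      using H.N_minus_triangle[OF Xc[OF f(1)] kc uk(2)] H.N_minus_triangle[OF kc uk(1) uk(2)]
        by linarith
    also have "\<dots> \<le> 3 * \<epsilon>" using k(2) 1 2 by linarith
    finally show ?thesis using a f by (simp add: H.operator_minus[OF XB hom(1)])
  qed
  interpret B: module complex_field H.B by (rule H.module_operators)
  have D: "X \<ominus>\<^bsub>H.B\<^esub> \<pi> a \<in> carrier H.B" using XB hom(1)[OF a(1)] by simp
  have "hnorm H ((X \<ominus>\<^bsub>H.B\<^esub> \<pi> a) f) \<le> 3 * \<epsilon> * hnorm H f" if "f \<in> carrier H" for f
    by (rule H.operator_bound_from_ball[OF H.operatorD(1)[OF D] ball that])
  then show ?thesis using a(1) by (intro bexI[of _ a]) (simp_all add: H.operator_minus[OF XB hom(1)])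
qed

text \<open>Preimages of approximations to \<open>X\<close> form a Cauchy sequence because the
  representation is norm-reflecting; its limit is a preimage of \<open>X\<close>.\<close>

lemma compact_in_range:
  assumes X: "X \<in> carrier (compact_operators H)"
  shows "\<exists>a\<in>carrier A. \<pi> a = X"
proof -
  have XB: "X \<in> carrier H.B" by (rule compact_bounded[OF X])
  note Xc = H.operatorD(3)[OF XB]
  define \<delta> where "\<delta> n = inverse (real (Suc n))" for n
  have \<delta>: "0 < \<delta> n" for n by (simp add: \<delta>_def)
  have "\<exists>a\<in>carrier A. \<forall>f\<in>carrier H. hnorm H (X f \<ominus>\<^bsub>H\<^esub> \<pi> a f) \<le> \<delta> n * hnorm H f" for n
    using compact_approx[OF X, of "\<delta> n / 3"] \<delta>[of n] by simp
  then obtain a where a: "\<And>n. a n \<in> carrier A"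
    and le: "\<And>n f. f \<in> carrier H \<Longrightarrow> hnorm H (X f \<ominus>\<^bsub>H\<^esub> \<pi> (a n) f) \<le> \<delta> n * hnorm H f" by metis
  have dist: "cnorm A (a m \<ominus> a n) \<le> \<delta> m + \<delta> n" for m n
  proof (rule isometric)
    show "a m \<ominus> a n \<in> carrier A" using a by simp
    show "0 \<le> \<delta> m + \<delta> n" using \<delta>[of m] \<delta>[of n] by linarith
    fix f assume f: "f \<in> carrier H"
    have "hnorm H (\<pi> (a m) f \<ominus>\<^bsub>H\<^esub> \<pi> (a n) f) \<le> hnorm H (\<pi> (a m) f \<ominus>\<^bsub>H\<^esub> X f) + hnorm H (X f \<ominus>\<^bsub>H\<^esub> \<pi> (a
      n) f)"
      using op(3)[OF a f] Xc[OF f] by (intro H.N_minus_triangle)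
    also have "\<dots> \<le> (\<delta> m + \<delta> n) * hnorm H f"
      using le[OF f, of m] le[OF f, of n] H.N_minus_commute[OF op(3)[OF a f, of m] Xc[OF f]]
      by (simp add: algebra_simps)
    finally show "hnorm H (\<pi> (a m \<ominus> a n) f) \<le> (\<delta> m + \<delta> n) * hnorm H f" by (simp add: hom_apply a f)
  qed
  obtain l where l: "l \<in> carrier A"
    and near_l: "\<And>\<epsilon>. 0 < \<epsilon> \<Longrightarrow> \<exists>n. \<delta> n < \<epsilon> \<and> cnorm A (a n \<ominus> l) < \<epsilon>"
    using A.harmonic_Cauchy_convergent[OF A.complete, of a] a dist unfolding \<delta>_def by blast
  have "X f = \<pi> l f" if f: "f \<in> carrier H" for f
  proof -
    have "hnorm H (X f \<ominus>\<^bsub>H\<^esub> \<pi> l f) \<le> 0 + 2 * hnorm H f * \<epsilon>" if \<epsilon>: "0 < \<epsilon>" for \<epsilon>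
    proof -
      obtain n where n: "\<delta> n < \<epsilon>" "cnorm A (a n \<ominus> l) < \<epsilon>" using near_l[OF \<epsilon>] by blast
      have "hnorm H (\<pi> (a n) f \<ominus>\<^bsub>H\<^esub> \<pi> l f) \<le> cnorm A (a n \<ominus> l) * hnorm H f"
        using contractive[of "a n \<ominus> l" f] a l f by (simp add: hom_apply)
      also have "\<dots> \<le> \<epsilon> * hnorm H f" using n f by (intro mult_right_mono) simp_all
      finally have 1: "hnorm H (\<pi> (a n) f \<ominus>\<^bsub>H\<^esub> \<pi> l f) \<le> \<epsilon> * hnorm H f" .
      have "\<delta> n * hnorm H f \<le> \<epsilon> * hnorm H f" using n f by (intro mult_right_mono) simp_all
      then have 2: "hnorm H (X f \<ominus>\<^bsub>H\<^esub> \<pi> (a n) f) \<le> \<epsilon> * hnorm H f" using le[OF f, of n] by linarith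
      show ?thesis
        using H.N_minus_triangle[OF Xc[OF f] op(3)[OF a f] op(3)[OF l f], of n] 1 2
        by (simp add: algebra_simps)
    qed
    then have "hnorm H (X f \<ominus>\<^bsub>H\<^esub> \<pi> l f) \<le> 0" by (rule real_le_epsilonI) (use f in simp_all)
    then show ?thesis using Xc[OF f] op(3)[OF l f] by simp
  qed
  then have "\<pi> l = X" by (intro H.operator_eqI[OF hom(1)[OF l] XB]) simp
  then show ?thesis using l by blast
qed

theorem star_isomorphic_compact_operators: "star_isomorphic A (compact_operators H)"
proof -
  have "inj_on \<pi> (carrier A)"
  proof (rule inj_onI)
    fix a c assume a: "a \<in> carrier A" and c: "c \<in> carrier A" and eq: "\<pi> a = \<pi> c"
    have "cnorm A (a \<ominus> c) \<le> 0"
      by (rule isometric) (use a c op(3)[OF c] in \<open>simp_all add: hom_apply eq\<close>)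
    then show "a = c" using a c by simp
  qed
  moreover have "\<pi> ` carrier A = carrier (compact_operators H)"
    using hom_compact compact_in_range by blast
  ultimately have "bij_betw \<pi> (carrier A) (carrier (compact_operators H))" by (simp add: bij_betw_def)
  moreover have "star_hom A (compact_operators H) \<pi>"
    using hom hom_compact by (simp add: star_hom_def linear_map_def compact_operators_def)
  ultimately show ?thesis unfolding star_isomorphic_def by blast
qed

end

lemma hnorm_point:
  assumes "z \<in> X"
  shows "hnorm (ell2 X) (point z) = 1"
proof -
  have "(\<Sum>\<^sub>\<infinity>i\<in>X. (cmod (point z i))\<^sup>2) = (\<Sum>\<^sub>\<infinity>i\<in>{z}. (cmod (point z i))\<^sup>2)"
    using assms by (intro infsum_cong_neutral) (auto simp: point_apply)
  then show ?thesis by (simp add: ell2_hnorm point_apply)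
qed

theorem theorem4p2:
  fixes E :: "('v, 'e) pre_digraph"
    and A :: "'a star_algebra" and p :: "'v \<Rightarrow> 'a" and s :: "'e \<Rightarrow> 'a"
  assumes "wf_digraph E" and "verts E \<noteq> {}"
    and "row_countable E"
    and "graph_cstar_algebra E A p s"
    and "unique_irreducible_representation A"
  shows "\<exists>H :: ('a \<Rightarrow> complex) inner_space.
           hilbert_space H \<and> star_isomorphic A (compact_operators H)"
proof -
  interpret wf_digraph E by fact
  note uniq = \<open>unique_irreducible_representation A\<close> and univ = \<open>graph_cstar_algebra E A p s\<close>
  interpret A: cstar_algebra A using univ by (simp add: graph_cstar_algebra_def)
  obtain y where y: "y \<in> boundary_paths"
    and unbranched: "\<And>n e. e \<in> out_arcs E (node (y n)) \<Longrightarrow> y n = Inr e"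
    and no_return: "\<And>m n. \<lbrakk>m < n; node (y m) = node (y n)\<rbrakk> \<Longrightarrow> \<exists>w. shift m y = (\<lambda>_. Inl w)"
    using unbranched_path_exists[OF univ uniq \<open>row_countable E\<close> \<open>verts E \<noteq> {}\<close>] by blast
  have "unbranched_family E A p s y"
  proof (intro unbranched_family.intro unbranched_family_axioms.intro wf_digraph_axioms
    A.cstar_algebra_axioms)
    show "cuntz_krieger_family E A p s" "generates A (p ` verts E \<union> s ` arcs E)"
      using univ by (auto simp: graph_cstar_algebra_def)
    show "regular_vertex E (tail E e)" if "e \<in> arcs E" for e
      by (rule regular_vertex_tail[OF univ uniq that])
    show "tail_equivalent z y" if "z \<in> boundary_paths" for z
      by (rule boundary_paths_tail_equivalent[OF univ uniq y that])
  qed (fact y unbranched no_return)+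
  then interpret unbranched_family E A p s y .
  obtain \<rho> where \<rho>: "path_representation E (tail_class y) 1 A p s \<rho>"
    using path_representation_exists[OF univ, of 1] by auto
  then interpret \<rho>: path_representation E "tail_class y" 1 A p s \<rho> .
  note irr = irreducible_tail_class[OF \<rho> y]
  \<comment> \<open>The path space has the wrong type for the conclusion; the embedding of
    irreducible representations moves it to functions on the algebra.\<close>
  obtain H :: "('a \<Rightarrow> complex) inner_space" and U where "unitary_equivalence (ell2 (tail_class y)) H U"
    using A.irreducible_representation_transport[OF irr] by blast
  then interpret U: unitary_equivalence "ell2 (tail_class y)" H U .
  have pt: "point y \<in> carrier (ell2 (tail_class y))" by (rule point_carrier[OF tail_class_refl[OF y]])
  \<comment> \<open>The path \<open>y\<close> starts at the vertex whose projection is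
    \<open>q\<close>, so its image under \<open>U\<close> serves as the unit vector \<xi>.\<close>
  have "\<rho> q (point y) = point y"
    by (intro ext) (simp add: \<rho>.\<pi>_p \<rho>.P_apply[OF pt], simp add: point_apply)
  then have "minimal_representation E A p s y H (\<lambda>a. conj_op (ell2 (tail_class y)) H U (\<rho> a)) (U
    (point y))"
    by (intro minimal_representation.intro minimal_representation_axioms.intro unbranched_family_axioms
        U.K.hilbert_space_axioms U.irreducible_representation_conj_op irr)
      (simp_all add: U.U_simps pt U.conj_op_apply hnorm_point tail_class_refl y)
  then have "star_isomorphic A (compact_operators H)"
    by (rule minimal_representation.star_isomorphic_compact_operators)
  then show ?thesis using U.K.hilbert_space_axioms by (intro exI[of _ H] conjI)
qed

end
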